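(* Let $I=(0,1)$, let $b,c,f$ be analytic functions on $\overline I$ for which there are constants $\gamma_f,\gamma_c,\gamma_b,C_0>0$ with $$\|f^{(n)}\|_{\infty,I}\le C_0\, n!\,\gamma_f^n,\quad \|c^{(n)}\|_{\infty,I}\le C_0\, n!\,\gamma_c^n,\quad \|b^{(n)}\|_{\infty,I}\le C_0\, n!\,\gamma_b^n\qquad\text{for all } n=0,1,2,\dots,$$ and let $\beta,\gamma,\rho>0$ and $\kappa>0$ be constants. Then there exist constants $C>0$ and $\sigma>0$, independent of $\varepsilon_1$, $\varepsilon_2$ and $p$, such that the following holds for all $p\in\mathbb{N}$ and all $0<\varepsilon_1<\varepsilon_2\le 1$ such that, for all $x\in\overline I$, $$b(x)\ge\beta,\qquad c(x)\ge\gamma,\qquad c(x)-\tfrac{\varepsilon_2}{2}b'(x)\ge\rho,$$ and such that the Spectral Boundary Layer mesh $\Delta_{BL}(\kappa,p)$ is defined. If $u$ is the solution of $$-\varepsilon_1u''(x)+\varepsilon_2 b(x)u'(x)+c(x)u(x)=f(x)\ \ (x\in I),\qquad u(0)=u(1)=0,$$ and $u_{FEM}\in S_0(\kappa,p)$ is its finite element approximation based on the Spectral Boundary Layer mesh, then $$\|u-u_{FEM}\|_{E,I}\le C e^{-\sigma p}.$$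
   Context: Notation: $\|\cdot\|_{\infty,I}$ is the $L^\infty(I)$ norm, $\langle\cdot,\cdot\rangle_I$ the $L^2(I)$ inner product, $\|\cdot\|_{0,I}$ the $L^2(I)$ norm, $|v|_{1,I}=\|v'\|_{0,I}$, and $H^1_0(I)$ is the usual Sobolev space of $H^1(I)$ functions vanishing at $0$ and $1$. Energy norm (for given $\varepsilon_1$): $\|v\|_{E,I}^2:=\varepsilon_1|v|_{1,I}^2+\|v\|_{0,I}^2$. Layer parameters: let $\lambda_0(x)<0<\lambda_1(x)$ be the solutions of the characteristic equation $-\varepsilon_1\lambda^2+\varepsilon_2 b(x)\lambda+c(x)=0$, and set $\mu_0=-\max_{x\in[0,1]}\lambda_0(x)$, $\mu_1=\min_{x\in[0,1]}\lambda_1(x)$; equivalently $$\mu_0=\min_{x\in[0,1]}\frac{-\varepsilon_2b(x)+\sqrt{\varepsilon_2^2b(x)^2+4\varepsilon_1c(x)}}{2\varepsilon_1},\qquad \mu_1=\min_{x\in[0,1]}\frac{\varepsilon_2b(x)+\sqrt{\varepsilon_2^2b(x)^2+4\varepsilon_1c(x)}}{2\varepsilon_1}.$$ One has $\mu_0\le\mu_1$. Spectral Boundary Layer mesh: for $\kappa>0$, $p\in\mathbb{N}$ and $0<\varepsilon_1,\varepsilon_2\le1$, $$\Delta_{BL}(\kappa,p):=\begin{cases}\{0,1\} & \text{if }\kappa p\mu_1^{-1}\ge 1/2,\\ \{0,\ \kappa p\mu_0^{-1},\ 1-\kappa p\mu_1^{-1},\ 1\} & \text{if }\kappa p\mu_0^{-1}<1/2.\end{cases}$$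 The mesh is defined when one of these two (mutually exclusive) conditions holds. Finite element space: $S_0(\kappa,p)$ is the space of functions in $H_0^1(I)$ whose restriction to each subinterval of the mesh $\Delta_{BL}(\kappa,p)$ is a polynomial of degree at most $p$. Finite element approximation: $u_{FEM}\in S_0(\kappa,p)$ is the (unique) function satisfying $\mathcal{B}(u_{FEM},v)=\langle f,v\rangle_I$ for all $v\in S_0(\kappa,p)$, where $$\mathcal{B}(w,v)=\varepsilon_1\langle w',v'\rangle_I+\varepsilon_2\langle bw',v\rangle_I+\langle cw,v\rangle_I.$$ The constants $C$ and $\sigma$ may depend on $b,c,f$, on $\kappa$, and on the constants in the assumptions, but not on $\varepsilon_1,\varepsilon_2,p$. *)

theory Defs
  imports
    "HOL-Analysis.Analysis"
    "HOL-Computational_Algebra.Polynomial"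
    "HOL-Probability.Essential_Supremum"
begin

abbreviation I01 :: "real set" where
  "I01 \<equiv> {0<..<1}"

text \<open>Power series expansions relative to \<open>S\<close>: no condition is put on the values of
  the function outside \<open>S\<close>. For a nondegenerate interval this means that
  \<open>f\<close> restricted to \<open>S\<close> extends analytically to a neighbourhood of \<open>S\<close>.\<close>

definition real_analytic_on :: "(real \<Rightarrow> real) \<Rightarrow> real set \<Rightarrow> bool" where
  "real_analytic_on f S \<longleftrightarrow>
     (\<forall>x\<in>S. \<exists>r>0. \<exists>a. \<forall>y\<in>S. \<bar>y - x\<bar> < r \<longrightarrow> (\<lambda>n. a n * (y - x) ^ n) sums f y)"

text \<open>Derivative on the closed unit interval, one-sided at the endpoints.\<close>

definition deriv01 :: "(real \<Rightarrow> real) \<Rightarrow> real \<Rightarrow> real" where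
  "deriv01 f x = vector_derivative f (at x within {0..1})"

definition Linf_norm :: "(real \<Rightarrow> real) \<Rightarrow> ereal" where
  "Linf_norm g = esssup (lebesgue_on I01) (\<lambda>x. ereal \<bar>g x\<bar>)"

definition L2 :: "(real \<Rightarrow> real) set" where
  "L2 = {v. v \<in> borel_measurable (lebesgue_on I01) \<and> integrable (lebesgue_on I01) (\<lambda>x. (v x)\<^sup>2)}"

definition L2_inner :: "(real \<Rightarrow> real) \<Rightarrow> (real \<Rightarrow> real) \<Rightarrow> real" where
  "L2_inner w v = integral\<^sup>L (lebesgue_on I01) (\<lambda>x. w x * v x)"

definition L2_norm :: "(real \<Rightarrow> real) \<Rightarrow> real" where
  "L2_norm v = sqrt (L2_inner v v)"

definition test_functions :: "(real \<Rightarrow> real) set" where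
  "test_functions =
     {\<phi>. (\<forall>n x. (deriv ^^ n) \<phi> differentiable (at x)) \<and>
         (\<exists>K. compact K \<and> K \<subseteq> I01 \<and> (\<forall>x. x \<notin> K \<longrightarrow> \<phi> x = 0))}"

definition is_weak_deriv :: "(real \<Rightarrow> real) \<Rightarrow> (real \<Rightarrow> real) \<Rightarrow> bool" where
  "is_weak_deriv v g \<longleftrightarrow> (\<forall>\<phi>\<in>test_functions. L2_inner v (deriv \<phi>) = - L2_inner g \<phi>)"

definition H1 :: "(real \<Rightarrow> real) set" where
  "H1 = {v \<in> L2. \<exists>g\<in>L2. is_weak_deriv v g}"

text \<open>For \<open>v \<in> H1\<close>, the weak derivative is unique up to null sets, so quantities
  defined by integration do not depend on the choice.\<close>

definition weak_deriv :: "(real \<Rightarrow> real) \<Rightarrow> real \<Rightarrow> real" where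
  "weak_deriv v = (SOME g. g \<in> L2 \<and> is_weak_deriv v g)"

text \<open>Elements are functions rather than classes modulo null sets; continuity on
  \<open>[0,1]\<close> selects the representative for which boundary values make sense.\<close>

definition H1_0 :: "(real \<Rightarrow> real) set" where
  "H1_0 = {v \<in> H1. continuous_on {0..1} v \<and> v 0 = 0 \<and> v 1 = 0}"

definition energy_norm :: "real \<Rightarrow> (real \<Rightarrow> real) \<Rightarrow> real" where
  "energy_norm \<epsilon>1 v = sqrt (\<epsilon>1 * (L2_norm (weak_deriv v))\<^sup>2 + (L2_norm v)\<^sup>2)"

definition char_eq :: "real \<Rightarrow> real \<Rightarrow> (real \<Rightarrow> real) \<Rightarrow> (real \<Rightarrow> real) \<Rightarrow> real \<Rightarrow> real \<Rightarrow> bool" where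
  "char_eq \<epsilon>1 \<epsilon>2 b c x l \<longleftrightarrow> - \<epsilon>1 * l\<^sup>2 + \<epsilon>2 * b x * l + c x = 0"

definition lambda0 :: "real \<Rightarrow> real \<Rightarrow> (real \<Rightarrow> real) \<Rightarrow> (real \<Rightarrow> real) \<Rightarrow> real \<Rightarrow> real" where
  "lambda0 \<epsilon>1 \<epsilon>2 b c x = (THE l. l < 0 \<and> char_eq \<epsilon>1 \<epsilon>2 b c x l)"

definition lambda1 :: "real \<Rightarrow> real \<Rightarrow> (real \<Rightarrow> real) \<Rightarrow> (real \<Rightarrow> real) \<Rightarrow> real \<Rightarrow> real" where
  "lambda1 \<epsilon>1 \<epsilon>2 b c x = (THE l. 0 < l \<and> char_eq \<epsilon>1 \<epsilon>2 b c x l)"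

text \<open>For \<open>\<epsilon>1 > 0\<close> and continuous \<open>b\<close> and \<open>c > 0\<close> the two roots exist, are unique and
  depend continuously on \<open>x\<close>, so the supremum and infimum below are a maximum and a minimum.\<close>

definition mu0 :: "real \<Rightarrow> real \<Rightarrow> (real \<Rightarrow> real) \<Rightarrow> (real \<Rightarrow> real) \<Rightarrow> real" where
  "mu0 \<epsilon>1 \<epsilon>2 b c = - (SUP x\<in>{0..1}. lambda0 \<epsilon>1 \<epsilon>2 b c x)"

definition mu1 :: "real \<Rightarrow> real \<Rightarrow> (real \<Rightarrow> real) \<Rightarrow> (real \<Rightarrow> real) \<Rightarrow> real" where
  "mu1 \<epsilon>1 \<epsilon>2 b c = (INF x\<in>{0..1}. lambda1 \<epsilon>1 \<epsilon>2 b c x)"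

text \<open>The spectral boundary layer mesh; \<open>None\<close> if neither condition holds. The order of
  the two tests is immaterial, since \<open>mu0 \<le> mu1\<close> makes the conditions exclusive.\<close>

definition SBL_mesh ::
  "real \<Rightarrow> real \<Rightarrow> (real \<Rightarrow> real) \<Rightarrow> (real \<Rightarrow> real) \<Rightarrow> real \<Rightarrow> nat \<Rightarrow> real set option" where
  "SBL_mesh \<epsilon>1 \<epsilon>2 b c \<kappa> p =
     (if \<kappa> * real p * inverse (mu1 \<epsilon>1 \<epsilon>2 b c) \<ge> 1 / 2 then Some {0, 1}
      else if \<kappa> * real p * inverse (mu0 \<epsilon>1 \<epsilon>2 b c) < 1 / 2
      then Some {0, \<kappa> * real p * inverse (mu0 \<epsilon>1 \<epsilon>2 b c),
                 1 - \<kappa> * real p * inverse (mu1 \<epsilon>1 \<epsilon>2 b c), 1}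
      else None)"

definition subintervals :: "real set \<Rightarrow> real set set" where
  "subintervals \<Delta> = {{x..y} |x y. x \<in> \<Delta> \<and> y \<in> \<Delta> \<and> x < y \<and> {x<..<y} \<inter> \<Delta> = {}}"

definition FE_space :: "real set \<Rightarrow> nat \<Rightarrow> (real \<Rightarrow> real) set" where
  "FE_space \<Delta> p =
     {v \<in> H1_0. \<forall>K\<in>subintervals \<Delta>. \<exists>q::real poly. degree q \<le> p \<and> (\<forall>x\<in>K. v x = poly q x)}"

definition bilinear_form ::
  "real \<Rightarrow> real \<Rightarrow> (real \<Rightarrow> real) \<Rightarrow> (real \<Rightarrow> real) \<Rightarrow> (real \<Rightarrow> real) \<Rightarrow> (real \<Rightarrow> real) \<Rightarrow> real" where
  "bilinear_form \<epsilon>1 \<epsilon>2 b c w v =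
     \<epsilon>1 * L2_inner (weak_deriv w) (weak_deriv v)
     + \<epsilon>2 * L2_inner (\<lambda>x. b x * weak_deriv w x) v
     + L2_inner (\<lambda>x. c x * w x) v"

definition is_FE_approx ::
  "real \<Rightarrow> real \<Rightarrow> (real \<Rightarrow> real) \<Rightarrow> (real \<Rightarrow> real) \<Rightarrow> (real \<Rightarrow> real) \<Rightarrow> real set \<Rightarrow> nat
    \<Rightarrow> (real \<Rightarrow> real) \<Rightarrow> bool" where
  "is_FE_approx \<epsilon>1 \<epsilon>2 b c f \<Delta> p w \<longleftrightarrow>
     w \<in> FE_space \<Delta> p \<and> (\<forall>v\<in>FE_space \<Delta> p. bilinear_form \<epsilon>1 \<epsilon>2 b c w v = L2_inner f v)"

text \<open>Classical solutions of the boundary value problem.\<close>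

definition is_BVP_solution ::
  "real \<Rightarrow> real \<Rightarrow> (real \<Rightarrow> real) \<Rightarrow> (real \<Rightarrow> real) \<Rightarrow> (real \<Rightarrow> real) \<Rightarrow> (real \<Rightarrow> real) \<Rightarrow> bool" where
  "is_BVP_solution \<epsilon>1 \<epsilon>2 b c f u \<longleftrightarrow>
     continuous_on {0..1} u \<and>
     (\<forall>x\<in>I01. u differentiable (at x) \<and> deriv u differentiable (at x) \<and>
        - \<epsilon>1 * deriv (deriv u) x + \<epsilon>2 * b x * deriv u x + c x * u x = f x) \<and>
     u 0 = 0 \<and> u 1 = 0"

end

theory Submission
  imports Defs "HOL-Complex_Analysis.Complex_Analysis"
begin

text \<open>The exponential rate comes from an exact splitting of the solution rather than from an asymptotic
  expansion. With \<open>s = \<epsilon>2 + sqrt \<epsilon>1\<close> the two characteristic rates are comparable to \<open>1 / s\<close>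
  (left layer) and \<open>s / \<epsilon>1\<close> (right layer), uniformly in both parameters. The theorem
  \<open>solution_decomposition\<close> says that on one fixed complex neighbourhood \<open>W\<close> of \<open>[0,1]\<close>
  \<open>u x = Re (S x + \<alpha>0 * exp (- M0 x) + \<alpha>1 * exp (- M1 (1 - x)))\<close>,
  where \<open>S\<close> is holomorphic and bounded on \<open>W\<close> and \<open>M0' \<sim> 1 / s\<close>, \<open>M1' \<sim> s / \<epsilon>1\<close> on \<open>W\<close>, all
  with constants that do not depend on \<open>\<epsilon>1\<close>, \<open>\<epsilon>2\<close>. The logarithmic derivatives \<open>M0'\<close>, \<open>M1'\<close> solve Riccati
  equations, up to sign; the solutions are perturbations of the roots of the characteristic equation and are
  found by a contraction argument, in which the linear coefficient points into a fixed cone of the complex plane and is large compared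
  with the forcing (\<open>riccati_solution\<close>, \<open>singular_decomposition\<close>). When \<open>\<epsilon>1\<close> is bounded below the
  equation is regular and there is no layer to split off (\<open>regular_decomposition\<close>).

  A bounded holomorphic function is approximated by polynomials at an exponential rate, by Bernstein's
  theorem (\<open>Bernstein_approximation\<close>, proved with Chebyshev polynomials of the second kind). For a layer function on its own
  element the length \<open>h\<close> satisfies \<open>\<mu> h \<le> K p\<close>, where \<open>\<mu>\<close> is the rate. On an ellipse of parameter
  \<open>1 + \<rho>\<close> around \<open>[0,h]\<close> the layer grows only like \<open>exp (O(p \<rho>\<^sup>2))\<close>, whereas Bernstein's
  theorem gains \<open>exp (- p \<rho> / 4)\<close>; a small \<open>\<rho>\<close> wins (\<open>layer_polynomial\<close>). Outside its element the layer
  is exponentially small in \<open>p\<close>, because \<open>\<mu> h \<ge> K' p\<close> whenever its element is not all of \<open>[0,1]\<close> (\<open>layer_approximation\<close>).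

  The energy norm does not control \<open>\<epsilon>2 b u'\<close>, so quasi-optimality in that norm with uniform constants is not available. The
  interpolation error is therefore split into \<open>ea\<close> (smooth part and left layer), whose derivative
  costs only \<open>1 / s\<close> and is compensated by \<open>\<epsilon>2\<close>, and \<open>eb\<close> (right layer), for which the convection term is integrated by
  parts and \<open>\<epsilon>2\<^sup>2 / \<epsilon>1\<close> times its square is integrable thanks to the exponential weight
  (\<open>energy_estimate\<close>, \<open>weighted_error_integral\<close>). Together with Galerkin orthogonality
  this gives \<open>FEM_error_bound\<close>; for \<open>p = 0\<close> the discrete space is trivial and stability of the continuous problem
  suffices.\<close>

section \<open>Test functions and the fundamental lemma of the calculus of variations\<close>

text \<open>The family is closed under differentiation up to linear combinations, which is how smoothness
  of the bump functions below is obtained without computing any derivative of higher order.\<close>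

definition flat :: "nat \<Rightarrow> real \<Rightarrow> real" where
  "flat k y = (if y > 0 then inverse y ^ k * exp (- inverse y) else 0)"

text \<open>One term of the series of \<open>exp (1 / y)\<close> already beats \<open>y ^ (- k - 2)\<close>. The extra factor
  \<open>y\<^sup>2\<close> makes the difference quotient at \<open>0\<close> vanish.\<close>

lemma flat_bound: "\<bar>flat k y\<bar> \<le> fact (k + 2) * y^2"
proof (cases "y > 0")
  case True
  define t where "t = inverse y"
  define c :: real where "c = fact (k + 2)"
  have c: "c > 0" unfolding c_def by (rule fact_gt_zero)
  have t: "t > 0" using True by (simp add: t_def)
  have "t ^ (k + 2) /\<^sub>R fact (k + 2) \<le> (\<Sum>n<Suc (k+2). t ^ n /\<^sub>R fact n)"
    by (rule member_le_sum) (use t in auto)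
  also have "\<dots> \<le> exp t"
    using t unfolding exp_def by (intro sum_le_suminf summable_exp_generic) auto
  finally have "t ^ (k+2) \<le> c * exp t" unfolding c_def[symmetric] using c by (simp add: field_simps)
  then have "t ^ k * t^2 * exp (- t) \<le> c * exp t * exp (- t)"
    unfolding power_add by (intro mult_right_mono) auto
  then have "t ^ k * t^2 * exp (- t) \<le> c * (exp t * exp (- t))" by (simp only: mult.assoc)
  then have "t ^ k * t^2 * exp (- t) \<le> c" by (simp flip: exp_add)
  then have "t ^ k * exp (- t) * t^2 * y^2 \<le> c * y^2" by (intro mult_right_mono) (simp_all add: mult_ac)
  moreover have "t^2 * y^2 = 1" using True by (simp add: t_def flip: power_mult_distrib)
  ultimately have "t ^ k * exp (- t) \<le> c * y^2" by (simp add: mult.assoc)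
  then show ?thesis using True unfolding c_def[symmetric] by (simp add: flat_def t_def)
qed (simp add: flat_def)

lemma flat_deriv: "(flat k has_real_derivative (flat (k + 2) y - real k * flat (k + 1) y)) (at y)"
proof -
  consider "y > 0" | "y < 0" | "y = 0" by linarith
  then show ?thesis
  proof cases
    case 1
    have "((\<lambda>y. inverse y ^ k * exp (- inverse y)) has_real_derivative
      (flat (k + 2) y - real k * flat (k + 1) y)) (at y)"
    proof -
      have "((\<lambda>y. inverse y ^ k) has_real_derivative real k * inverse y ^ (k - 1) * - (inverse y ^ 2)) (at y)"
        using 1 by (auto intro!: derivative_eq_intros simp: power2_eq_square)
      moreover have "real k * inverse y ^ (k - 1) * - (inverse y ^ 2) = - real k * inverse y ^ (k + 1)"
        by (cases k) (auto simp: power2_eq_square algebra_simps)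
      ultimately have "((\<lambda>y. inverse y ^ k) has_real_derivative - real k * inverse y ^ (k + 1)) (at y)"
        by (simp only:)
      note [derivative_intros] = this
      show ?thesis using 1
        by (auto intro!: derivative_eq_intros simp: flat_def power2_eq_square algebra_simps)
    qed
    then show ?thesis
      by (rule has_field_derivative_transform_within_open[of _ _ _ "{0<..}"]) (use 1 in \<open>auto simp: flat_def\<close>)
  next
    case 2
    have "((\<lambda>y. 0) has_real_derivative (flat (k + 2) y - real k * flat (k + 1) y)) (at y)"
      using 2 by (simp add: flat_def)
    then show ?thesis
      by (rule has_field_derivative_transform_within_open[of _ _ _ "{..<0}"]) (use 2 in \<open>auto simp: flat_def\<close>)
  next
    case 3
    have "(\<lambda>h. flat k h / h) \<midarrow>0\<rightarrow> 0"
    proof (rule Lim_null_comparison)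
      show "\<forall>\<^sub>F h in at 0. norm (flat k h / h) \<le> fact (k + 2) * \<bar>h\<bar>"
      proof (rule eventuallyI)
        fix h :: real
        have "\<bar>flat k h\<bar> \<le> fact (k + 2) * \<bar>h\<bar> * \<bar>h\<bar>"
          using flat_bound[of k h] by (simp add: power2_eq_square mult.assoc flip: abs_mult)
        then show "norm (flat k h / h) \<le> fact (k + 2) * \<bar>h\<bar>"
          by (cases "h = 0") (simp_all add: divide_le_eq)
      qed
      show "(\<lambda>h::real. fact (k + 2) * \<bar>h\<bar>) \<midarrow>0\<rightarrow> 0"
        by (rule tendsto_eq_intros tendsto_rabs_zero | simp)+
    qed
    then show ?thesis using 3 by (simp add: DERIV_def flat_def)
  qed
qed

inductive_set flat_algebra :: "(real \<Rightarrow> real) set" where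
  flat: "(\<lambda>x. flat k (\<alpha> * x + \<beta>)) \<in> flat_algebra"
| const: "(\<lambda>x. c) \<in> flat_algebra"
| add: "f \<in> flat_algebra \<Longrightarrow> g \<in> flat_algebra \<Longrightarrow> (\<lambda>x. f x + g x) \<in> flat_algebra"
| mult: "f \<in> flat_algebra \<Longrightarrow> g \<in> flat_algebra \<Longrightarrow> (\<lambda>x. f x * g x) \<in> flat_algebra"

lemma flat_algebra_deriv:
  "f \<in> flat_algebra \<Longrightarrow> \<exists>f'\<in>flat_algebra. \<forall>x. (f has_real_derivative f' x) (at x)"
proof (induction rule: flat_algebra.induct)
  case (flat k \<alpha> \<beta>)
  have "((\<lambda>x. flat k (\<alpha> * x + \<beta>)) has_real_derivative
      \<alpha> * (flat (k + 2) (\<alpha> * x + \<beta>) + (- real k) * flat (k + 1) (\<alpha> * x + \<beta>))) (at x)" for x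
  proof -
    have "((\<lambda>x. \<alpha> * x + \<beta>) has_real_derivative \<alpha>) (at x)" by (auto intro!: derivative_eq_intros)
    from DERIV_chain2[where f = "flat k", OF flat_deriv this]
    show ?thesis by (simp add: mult.commute)
  qed
  moreover have "(\<lambda>x. \<alpha> * (flat (k + 2) (\<alpha> * x + \<beta>) + (- real k) * flat (k + 1) (\<alpha> * x + \<beta>))) \<in> flat_algebra"
    by (intro flat_algebra.intros)
  ultimately show ?case by (intro bexI allI)
next
  case (const c)
  then show ?case by (intro bexI[of _ "\<lambda>x. 0"]) (auto intro: flat_algebra.intros)
next
  case (add f g)
  then obtain f' g' where "f' \<in> flat_algebra" "g' \<in> flat_algebra"
    "\<And>x. (f has_real_derivative f' x) (at x)" "\<And>x. (g has_real_derivative g' x) (at x)" by blast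
  then show ?case
    by (intro bexI[of _ "\<lambda>x. f' x + g' x"]) (auto intro: flat_algebra.intros derivative_intros)
next
  case (mult f g)
  then obtain f' g' where *: "f' \<in> flat_algebra" "g' \<in> flat_algebra"
    "\<And>x. (f has_real_derivative f' x) (at x)" "\<And>x. (g has_real_derivative g' x) (at x)" by blast
  show ?case
    by (intro bexI[of _ "\<lambda>x. f x * g' x + f' x * g x"])
       (auto intro!: flat_algebra.intros mult derivative_eq_intros * simp: algebra_simps)
qed

lemma flat_algebra_smooth:
  assumes "f \<in> flat_algebra"
  shows "(deriv ^^ n) f differentiable (at x)"
proof -
  have d: "deriv g \<in> flat_algebra" if "g \<in> flat_algebra" for g
  proof -
    obtain g' where g': "g' \<in> flat_algebra" "\<And>x. (g has_real_derivative g' x) (at x)"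
      using flat_algebra_deriv[OF \<open>g \<in> flat_algebra\<close>] by blast
    then have "deriv g = g'" by (intro ext DERIV_imp_deriv) auto
    then show ?thesis using g' by simp
  qed
  have "(deriv ^^ n) f \<in> flat_algebra" by (induction n) (use assms d in auto)
  then show ?thesis using flat_algebra_deriv real_differentiable_def by blast
qed

text \<open>The two factors cut off at distance \<open>1 / n\<close> from \<open>a\<close> and from \<open>1\<close>, so the support is a compact
  subset of the open unit interval; as \<open>n\<close> grows the product tends to the indicator of \<open>(a,1)\<close>,
  since \<open>flat 0\<close> tends to \<open>1\<close> at infinity.\<close>

definition bump :: "real \<Rightarrow> nat \<Rightarrow> real \<Rightarrow> real" where
  "bump a n x = flat 0 (real n * (x - a) - 1) * flat 0 (real n * (1 - x) - 1)"

lemma bump_test_function: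
  assumes "0 \<le> a" "n > 0"
  shows "bump a n \<in> test_functions"
proof -
  have eq: "bump a n = (\<lambda>x. flat 0 (real n * x + (- real n * a - 1)) * flat 0 ((- real n) * x + (real n - 1)))"
    unfolding bump_def by (intro ext arg_cong2[where f = "(*)"] arg_cong[where f = "flat 0"]) (auto simp: algebra_simps)
  have "bump a n \<in> flat_algebra" unfolding eq by (intro flat_algebra.intros)
  moreover have "bump a n x = 0" if "x \<notin> {a + 1 / n .. 1 - 1 / n}" for x
    using that assms by (auto simp: bump_def flat_def field_simps)
  moreover have "{a + 1 / n .. 1 - 1 / n} \<subseteq> I01"
  proof
    fix x assume "x \<in> {a + 1 / n .. 1 - 1 / n}"
    moreover have "1 / real n > 0" using assms by simp
    ultimately show "x \<in> I01" using assms(1)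
      unfolding atLeastAtMost_iff greaterThanLessThan_iff by linarith
  qed
  ultimately show ?thesis unfolding test_functions_def using flat_algebra_smooth
    by (auto intro!: exI[of _ "{a + 1 / n .. 1 - 1 / n}"])
qed

lemma bump_bounds: "\<bar>bump a n x\<bar> \<le> 1"
proof -
  have "\<bar>flat 0 y\<bar> \<le> 1" for y by (simp add: flat_def)
  then show ?thesis unfolding bump_def abs_mult by (intro mult_le_one) auto
qed

lemma bump_limit: "(\<lambda>n. bump a n x) \<longlonglongrightarrow> indicator {a<..<1} x"
proof -
  have f: "(\<lambda>n. flat 0 (real n * d - 1)) \<longlonglongrightarrow> (if d > 0 then 1 else 0)" for d
  proof (cases "d > 0")
    case True
    have "filterlim (\<lambda>n. real n * d - 1) at_top sequentially"
      using True by real_asymp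
    then have "(\<lambda>n. exp (- inverse (real n * d - 1))) \<longlonglongrightarrow> exp (- 0)"
      by (intro tendsto_intros tendsto_inverse_0_at_top)
    moreover have "\<forall>\<^sub>F n in sequentially. real n * d - 1 > 0" using True by real_asymp
    ultimately show ?thesis
      by (auto simp: True flat_def elim!: Lim_transform_eventually elim: eventually_mono)
  next
    case False
    have "flat 0 (real n * d - 1) = 0" for n
      using mult_nonneg_nonpos[of "real n" d] False by (simp add: flat_def not_less)
    then show ?thesis using False by simp
  qed
  have "(\<lambda>n. bump a n x) \<longlonglongrightarrow> (if x - a > 0 then 1 else 0) * (if 1 - x > 0 then 1 else 0)"
    unfolding bump_def by (intro tendsto_mult f)
  then show ?thesis by (auto simp: indicator_def)
qed

text \<open>The measures with densities \<open>max g 0\<close> and \<open>max (-g) 0\<close> agree on the half lines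
  \<open>{a<..}\<close>, a generating system closed under intersection, hence they are equal.\<close>

lemma ae_zero_if_tail_integrals_zero:
  fixes g :: "real \<Rightarrow> real"
  assumes g: "integrable lborel g" and tail: "\<And>a. (\<integral>t. g t * indicator {a<..} t \<partial>lborel) = 0"
  shows "AE t in lborel. g t = 0"
proof -
  have [measurable]: "g \<in> borel_measurable borel" using borel_measurable_integrable[OF g] by simp
  have eq: "(\<integral>\<^sup>+t. ennreal (g t) * indicator {a<..} t \<partial>lborel) = (\<integral>\<^sup>+t. ennreal (- g t) * indicator {a<..} t \<partial>lborel)
    \<and> (\<integral>\<^sup>+t. ennreal (g t) * indicator {a<..} t \<partial>lborel) < \<infinity>" for a
  proof -
    have int: "integrable lborel (\<lambda>t. g t * indicator {a<..} t)"
      using g by (rule integrable_real_mult_indicator[rotated]) simp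
    have e: "ennreal (g t) * indicator {a<..} t = ennreal (g t * indicator {a<..} t)"
      "ennreal (- g t) * indicator {a<..} t = ennreal (- (g t * indicator {a<..} t))" for t
      by (auto simp: indicator_def)
    have fin: "(\<integral>\<^sup>+t. ennreal (g t * indicator {a<..} t) \<partial>lborel) < \<infinity>"
      "(\<integral>\<^sup>+t. ennreal (- (g t * indicator {a<..} t)) \<partial>lborel) < \<infinity>"
      using int by (auto simp: real_integrable_def less_top)
    have "enn2real (\<integral>\<^sup>+t. ennreal (g t * indicator {a<..} t) \<partial>lborel)
       = enn2real (\<integral>\<^sup>+t. ennreal (- (g t * indicator {a<..} t)) \<partial>lborel)"
      using real_lebesgue_integral_def[OF int] tail[of a] by simp
    then show ?thesis unfolding e using fin
      by (metis ennreal_enn2real infinity_ennreal_def)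
  qed
  have "density lborel (\<lambda>t. ennreal (g t)) = density lborel (\<lambda>t. ennreal (- g t))"
  proof (rule measure_eqI_lessThan)
    show "emeasure (density lborel (\<lambda>t. ennreal (g t))) {x<..} < \<infinity>" for x
      using eq[of x, THEN conjunct2] by (simp add: emeasure_density)
    show "emeasure (density lborel (\<lambda>t. ennreal (g t))) {x<..} = emeasure (density lborel (\<lambda>t. ennreal (- g t))) {x<..}" for x
      using eq[of x, THEN conjunct1] by (simp add: emeasure_density)
  qed simp_all
  then have "AE t in lborel. ennreal (g t) = ennreal (- g t)"
    by (intro sigma_finite_measure.density_unique[OF lborel.sigma_finite_measure_axioms]) auto
  then show ?thesis
  proof (eventually_elim)
    case (elim t)
    then show ?case by (cases "g t > 0") (auto simp: ennreal_neg ennreal_eq_0_iff)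
  qed
qed

abbreviation M01 :: "real measure" where "M01 \<equiv> lebesgue_on I01"

lemma finite_measure_M01: "finite_measure M01"
  by (rule finite_measure_lebesgue_on) auto

text \<open>Testing with the bumps and passing to the limit by dominated convergence shows that all integrals of
  \<open>g\<close> over \<open>(a,1)\<close> vanish. A Borel version of \<open>g\<close> mediates between the Lebesgue and the Borel measure.\<close>

theorem fundamental_lemma_variations:
  assumes g: "integrable M01 g" and orth: "\<And>\<phi>. \<phi> \<in> test_functions \<Longrightarrow> integral\<^sup>L M01 (\<lambda>x. g x * \<phi> x) = 0"
  shows "AE x in M01. g x = 0"
proof -
  have gm: "(\<lambda>x. indicator I01 x * g x) \<in> borel_measurable lebesgue" "integrable lebesgue (\<lambda>x. indicator I01 x * g x)"
    using g by (auto simp: integrable_restrict_space)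
  then obtain h where h [measurable]: "h \<in> borel_measurable lborel"
    and ae: "AE x in lborel. indicator I01 x * g x = h x"
    using completion_ex_borel_measurable_real by blast
  have ae': "AE x in lebesgue. indicator I01 x * g x = h x" using ae by (rule AE_completion)
  have hm: "h \<in> borel_measurable lebesgue" by (rule measurable_completion) simp
  have "integrable lebesgue h"
    using integrable_cong_AE[OF gm(1) hm ae'] gm(2) by simp
  then have hint: "integrable lborel h" by (simp add: integrable_completion)
  have hint': "integrable lebesgue h" by fact
  have "(\<integral>t. h t * indicator {a<..} t \<partial>lborel) = 0" for a
  proof -
    define a' where "a' = max a 0"
    have "(\<lambda>n. integral\<^sup>L M01 (\<lambda>x. g x * bump a' (Suc n) x)) \<longlonglongrightarrow> integral\<^sup>L M01 (\<lambda>x. g x * indicator {a'<..<1} x)"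
    proof (rule integral_dominated_convergence[where w = "\<lambda>x. \<bar>g x\<bar>"])
      have c: "continuous_on UNIV (bump a' n)" if "n > 0" for n
      proof -
        have "bump a' n \<in> test_functions" using that by (intro bump_test_function) (auto simp: a'_def)
        then have "\<And>x. (deriv ^^ 0) (bump a' n) differentiable (at x)" unfolding test_functions_def by blast
        then show ?thesis by (simp add: continuous_at_imp_continuous_on differentiable_imp_continuous_within)
      qed
      show "(\<lambda>x. g x * bump a' (Suc n) x) \<in> borel_measurable M01" for n
        using g c[of "Suc n"]
        by (intro borel_measurable_times borel_measurable_integrable continuous_imp_measurable_on_sets_lebesgue)
           (auto intro: continuous_on_subset)
      show "(\<lambda>x. g x * indicator {a'<..<1} x) \<in> borel_measurable M01"
        by (intro borel_measurable_times borel_measurable_integrable[OF g] measurable_restrict_space1 measurable_completion) simp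
      show "AE x in M01. (\<lambda>n. g x * bump a' (Suc n) x) \<longlonglongrightarrow> g x * indicator {a'<..<1} x"
        by (intro AE_I2 tendsto_mult tendsto_const LIMSEQ_Suc bump_limit)
      show "AE x in M01. norm (g x * bump a' (Suc n) x) \<le> \<bar>g x\<bar>" for n
        using bump_bounds[of a' "Suc n"] by (intro AE_I2) (simp add: abs_mult mult_left_le)
    qed (use g in auto)
    moreover have "integral\<^sup>L M01 (\<lambda>x. g x * bump a' (Suc n) x) = 0" for n
      by (rule orth, rule bump_test_function) (auto simp: a'_def)
    ultimately have "integral\<^sup>L M01 (\<lambda>x. g x * indicator {a'<..<1} x) = 0"
      by (simp add: LIMSEQ_const_iff)
    then have 1: "integral\<^sup>L lebesgue (\<lambda>x. indicator I01 x *\<^sub>R (g x * indicator {a'<..<1} x)) = 0"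
      by (subst (asm) integral_restrict_space) auto
    have "(\<integral>t. h t * indicator {a<..} t \<partial>lborel) = integral\<^sup>L lebesgue (\<lambda>t. h t * indicator {a<..} t)"
      by (rule integral_completion[symmetric]) measurable
    also have "\<dots> = integral\<^sup>L lebesgue (\<lambda>t. indicator I01 t * g t * indicator {a<..} t)"
    proof (rule integral_cong_AE)
      have mi: "(\<lambda>t. indicator {a<..} t) \<in> borel_measurable lebesgue" by (rule measurable_completion) simp
      show "(\<lambda>t. h t * indicator {a<..} t) \<in> borel_measurable lebesgue"
        "(\<lambda>t. indicator I01 t * g t * indicator {a<..} t) \<in> borel_measurable lebesgue"
        by (intro borel_measurable_times gm(1) hm mi)+
      show "AE t in lebesgue. h t * indicator {a<..} t = indicator I01 t * g t * indicator {a<..} t"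
        using ae' by eventually_elim simp
    qed
    also have "(\<lambda>t. indicator I01 t * g t * indicator {a<..} t) = (\<lambda>x. indicator I01 x *\<^sub>R (g x * indicator {a'<..<1} x))"
      by (auto simp: a'_def indicator_def)
    finally show ?thesis using 1 by simp
  qed
  then have "AE x in lborel. h x = 0" by (rule ae_zero_if_tail_integrals_zero[OF hint])
  with ae have "AE x in lborel. indicator I01 x * g x = 0" by eventually_elim simp
  then have "AE x in lebesgue. indicator I01 x * g x = 0" by (rule AE_completion)
  then have "AE x in lebesgue. x \<in> I01 \<longrightarrow> g x = 0" by eventually_elim (auto simp: indicator_def)
  then show ?thesis by (subst AE_restrict_space_iff) auto
qed

section \<open>Piecewise smooth functions and their weak derivatives\<close>

text \<open>All integrands below are sums and products of such functions, and on a finite measure space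
  the class is closed under both; integrability is thus settled once and for all.\<close>

definition bounded_measurable :: "(real \<Rightarrow> real) \<Rightarrow> bool" where
  "bounded_measurable f \<longleftrightarrow> f \<in> borel_measurable M01 \<and> (\<exists>B. \<forall>x\<in>I01. \<bar>f x\<bar> \<le> B)"

named_theorems bm_intros

lemma bm_add [bm_intros]:
  assumes "bounded_measurable f" "bounded_measurable g" shows "bounded_measurable (\<lambda>x. f x + g x)"
proof -
  obtain B B' where B: "\<And>x. x \<in> I01 \<Longrightarrow> \<bar>f x\<bar> \<le> B" "\<And>x. x \<in> I01 \<Longrightarrow> \<bar>g x\<bar> \<le> B'"
    using assms unfolding bounded_measurable_def by blast
  have "\<forall>x\<in>I01. \<bar>f x + g x\<bar> \<le> B + B'"
    using B abs_triangle_ineq by (meson add_mono order.trans)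
  moreover have "(\<lambda>x. f x + g x) \<in> borel_measurable M01"
    using assms unfolding bounded_measurable_def by (intro borel_measurable_add) auto
  ultimately show ?thesis unfolding bounded_measurable_def by blast
qed

lemma bm_const [bm_intros]: "bounded_measurable (\<lambda>x. c)"
  unfolding bounded_measurable_def by auto

lemma bm_mult [bm_intros]: 
  assumes "bounded_measurable f" "bounded_measurable g" shows "bounded_measurable (\<lambda>x. f x * g x)"
proof -
  obtain B B' where B: "\<And>x. x \<in> I01 \<Longrightarrow> \<bar>f x\<bar> \<le> B" "\<And>x. x \<in> I01 \<Longrightarrow> \<bar>g x\<bar> \<le> B'"
    using assms unfolding bounded_measurable_def by blast
  have "\<bar>f x * g x\<bar> \<le> B * B'" if "x \<in> I01" for x
    unfolding abs_mult using B[OF that] by (intro mult_mono) auto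
  then have "\<forall>x\<in>I01. \<bar>f x * g x\<bar> \<le> B * B'" by blast
  moreover have "(\<lambda>x. f x * g x) \<in> borel_measurable M01"
    using assms unfolding bounded_measurable_def by (intro borel_measurable_times) auto
  ultimately show ?thesis unfolding bounded_measurable_def by blast
qed

lemma bm_uminus [bm_intros]: "bounded_measurable f \<Longrightarrow> bounded_measurable (\<lambda>x. - f x)"
  using bm_mult[OF bm_const[of "-1"], of f] by simp

lemma bm_diff [bm_intros]: "bounded_measurable f \<Longrightarrow> bounded_measurable g \<Longrightarrow> bounded_measurable (\<lambda>x. f x - g x)"
  using bm_add[OF _ bm_uminus, of f g] by simp

lemma bm_power2 [bm_intros]: "bounded_measurable f \<Longrightarrow> bounded_measurable (\<lambda>x. (f x)\<^sup>2)"
  using bm_mult[of f f] by (simp add: power2_eq_square)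

lemma bm_integrable: assumes "bounded_measurable f" shows "integrable M01 f"
proof -
  obtain B where "\<forall>x\<in>I01. \<bar>f x\<bar> \<le> B" using assms unfolding bounded_measurable_def by blast
  then have "AE x in M01. norm (f x) \<le> B" by (intro AE_I2) simp
  then show ?thesis using assms unfolding bounded_measurable_def
    by (intro finite_measure.integrable_const_bound[OF finite_measure_M01]) auto
qed

lemma bm_continuous: "continuous_on {0..1} f \<Longrightarrow> bounded_measurable f"
proof -
  assume c: "continuous_on {0..1} f"
  then have "bounded (f ` {0..1})" by (intro compact_imp_bounded compact_continuous_image) auto
  then obtain B where "\<forall>x\<in>{0..1}. \<bar>f x\<bar> \<le> B" unfolding bounded_iff by auto
  moreover have "f \<in> borel_measurable M01"
    by (rule continuous_imp_measurable_on_sets_lebesgue) (auto intro: continuous_on_subset[OF c])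
  ultimately show ?thesis unfolding bounded_measurable_def by fastforce
qed

lemma AE_M01_off_finite: "finite S \<Longrightarrow> AE x in M01. x \<notin> S"
proof -
  assume "finite S"
  then have "S \<in> null_sets lebesgue" by (simp add: negligible_iff_null_sets[symmetric] negligible_finite)
  then have "AE x in lebesgue. x \<notin> S" by (rule AE_not_in)
  then show ?thesis by (subst AE_restrict_space_iff) auto
qed

lemma bm_continuous_off_finite:
  assumes S: "finite S" and c: "continuous_on (I01 - S) f" and b: "bounded (f ` (I01 - S))"
  shows "bounded_measurable f"
proof -
  have "bounded (f ` (I01 - S) \<union> f ` S)" using b S by (intro bounded_Un[THEN iffD2]) (auto intro: finite_imp_bounded)
  then obtain B where B: "\<And>y. y \<in> f ` (I01 - S) \<union> f ` S \<Longrightarrow> \<bar>y\<bar> \<le> B" unfolding bounded_iff by auto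
  have "\<forall>x\<in>I01. \<bar>f x\<bar> \<le> B" using B by blast
  moreover have "f \<in> borel_measurable M01"
  proof -
    have n: "S \<inter> I01 \<in> null_sets M01"
      using S by (subst null_sets_restrict_space) (auto simp: negligible_iff_null_sets[symmetric] negligible_finite)
    have "I01 - S \<inter> I01 = I01 - S" by auto
    moreover have "f \<in> borel_measurable (lebesgue_on (I01 - S))"
      using S by (intro continuous_imp_measurable_on_sets_lebesgue c sets.Diff) (auto intro: negligible_imp_sets negligible_finite)
    ultimately show ?thesis using borel_measurable_diff_null[OF n, of f] by simp
  qed
  ultimately show ?thesis unfolding bounded_measurable_def by blast
qed

text \<open>Finitely many exceptional points are allowed because finite element functions have kinks at the nodes.\<close>

lemma integral_derivative_M01:
  assumes "finite S" "continuous_on {0..1} H" "\<And>x. x \<in> I01 - S \<Longrightarrow> (H has_real_derivative h x) (at x)"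
    and "bounded_measurable h"
  shows "integral\<^sup>L M01 h = H 1 - H 0"
proof -
  have "(h has_integral (H 1 - H 0)) {0..1}"
    by (rule fundamental_theorem_of_calculus_interior_strong[OF assms(1)])
      (use assms in \<open>auto simp: has_real_derivative_iff_has_vector_derivative\<close>)
  moreover have "(h has_integral integral\<^sup>L M01 h) {0..1}"
    using has_integral_integral_lebesgue_on[OF bm_integrable[OF assms(4)]]
    by (simp add: has_integral_Icc_iff_Ioo)
  ultimately show ?thesis by (rule has_integral_unique[symmetric])
qed

text \<open>A class containing both the classical solution and the finite element functions; for its members the weak derivative
  is the almost everywhere derivative.\<close>

definition piecewise_C1 :: "(real \<Rightarrow> real) \<Rightarrow> bool" where
  "piecewise_C1 v \<longleftrightarrow> continuous_on {0..1} v \<and>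
     (\<exists>S. finite S \<and> (\<forall>x\<in>I01 - S. v differentiable (at x)) \<and>
          continuous_on (I01 - S) (deriv v) \<and> bounded (deriv v ` (I01 - S)))"

lemma piecewise_C1_continuous: "piecewise_C1 v \<Longrightarrow> continuous_on {0..1} v"
  by (simp add: piecewise_C1_def)

lemma piecewise_C1_bm: "piecewise_C1 v \<Longrightarrow> bounded_measurable v"
  by (simp add: piecewise_C1_def bm_continuous)

lemma piecewise_C1_deriv_bm: "piecewise_C1 v \<Longrightarrow> bounded_measurable (deriv v)"
  unfolding piecewise_C1_def by (auto intro: bm_continuous_off_finite)

lemma piecewise_C1_deriv:
  assumes "piecewise_C1 v"
  obtains S where "finite S" "\<And>x. x \<in> I01 - S \<Longrightarrow> (v has_real_derivative deriv v x) (at x)"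
  using assms unfolding piecewise_C1_def by (metis DERIV_deriv_iff_real_differentiable)

lemma piecewise_C1I:
  assumes "finite S" "continuous_on {0..1} v" "\<And>x. x \<in> I01 - S \<Longrightarrow> (v has_real_derivative g x) (at x)"
    "continuous_on (I01 - S) g" "bounded (g ` (I01 - S))"
  shows "piecewise_C1 v"
proof -
  have eq: "deriv v x = g x" if "x \<in> I01 - S" for x using assms(3)[OF that] by (rule DERIV_imp_deriv)
  show ?thesis unfolding piecewise_C1_def
  proof (intro conjI exI[of _ S] ballI)
    show "continuous_on (I01 - S) (deriv v)" by (rule iffD2[OF continuous_on_cong[OF refl eq] assms(4)])
    have "deriv v ` (I01 - S) = g ` (I01 - S)" by (rule image_cong[OF refl eq])
    then show "bounded (deriv v ` (I01 - S))" using assms(5) by (simp only:)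
  qed (use assms in \<open>auto simp: real_differentiable_def\<close>)
qed

lemma piecewise_C1_lincomb:
  assumes v: "piecewise_C1 v" and w: "piecewise_C1 w"
  shows "piecewise_C1 (\<lambda>x. v x + c * w x)"
    and "AE x in M01. deriv (\<lambda>x. v x + c * w x) x = deriv v x + c * deriv w x"
proof -
  obtain S where S: "finite S" "\<And>x. x \<in> I01 - S \<Longrightarrow> v differentiable (at x)"
     "continuous_on (I01 - S) (deriv v)" "bounded (deriv v ` (I01 - S))"
    using v unfolding piecewise_C1_def by blast
  obtain T where T: "finite T" "\<And>x. x \<in> I01 - T \<Longrightarrow> w differentiable (at x)"
     "continuous_on (I01 - T) (deriv w)" "bounded (deriv w ` (I01 - T))"
    using w unfolding piecewise_C1_def by blast
  have d: "((\<lambda>x. v x + c * w x) has_real_derivative deriv v x + c * deriv w x) (at x)" if "x \<in> I01 - (S \<union> T)" for x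
    using S(2)[of x] T(2)[of x] that
    by (intro DERIV_add DERIV_cmult) (auto simp: DERIV_deriv_iff_real_differentiable)
  show "piecewise_C1 (\<lambda>x. v x + c * w x)"
  proof (rule piecewise_C1I[OF _ _ d])
    show "continuous_on (I01 - (S \<union> T)) (\<lambda>x. deriv v x + c * deriv w x)"
      using S T by (intro continuous_intros) (auto intro: continuous_on_subset)
    have "bounded (deriv v ` (I01 - (S \<union> T)))" "bounded (deriv w ` (I01 - (S \<union> T)))"
      using S T by (auto intro: bounded_subset)
    then obtain A B where AB: "\<And>x. x \<in> I01 - (S \<union> T) \<Longrightarrow> \<bar>deriv v x\<bar> \<le> A" "\<And>x. x \<in> I01 - (S \<union> T) \<Longrightarrow> \<bar>deriv w x\<bar> \<le> B"
      unfolding bounded_iff by (metis image_eqI real_norm_def)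
    have "norm (deriv v x + c * deriv w x) \<le> A + \<bar>c\<bar> * B" if "x \<in> I01 - (S \<union> T)" for x
      using AB[OF that] abs_triangle_ineq[of "deriv v x" "c * deriv w x"] mult_left_mono[of "\<bar>deriv w x\<bar>" B "\<bar>c\<bar>"]
      by (simp add: abs_mult)
    then show "bounded ((\<lambda>x. deriv v x + c * deriv w x) ` (I01 - (S \<union> T)))"
      by (intro boundedI[of _ "A + \<bar>c\<bar> * B"]) blast
  qed (use S T v w in \<open>auto simp: piecewise_C1_def intro!: continuous_intros\<close>)
  have "AE x in M01. x \<notin> S \<union> T" using S T by (intro AE_M01_off_finite) auto
  then show "AE x in M01. deriv (\<lambda>x. v x + c * w x) x = deriv v x + c * deriv w x"
    using AE_space
    by eventually_elim (auto intro!: DERIV_imp_deriv d)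
qed

lemma L2_integrable: assumes "g \<in> L2" shows "integrable M01 g"
proof -
  interpret finite_measure M01 by (rule finite_measure_M01)
  show ?thesis
  proof (rule Bochner_Integration.integrable_bound)
    show "integrable M01 (\<lambda>x. 1 + (g x)\<^sup>2)" using assms by (auto simp: L2_def)
    show "AE x in M01. norm (g x) \<le> norm (1 + (g x)\<^sup>2)"
    proof (intro AE_I2)
      fix x
      have "0 \<le> (\<bar>g x\<bar> - 1/2)\<^sup>2" by simp
      then have "\<bar>g x\<bar> \<le> 1 + (g x)\<^sup>2" by (simp add: power2_diff power_divide)
      then show "norm (g x) \<le> norm (1 + (g x)\<^sup>2)" by simp
    qed
  qed (use assms in \<open>simp add: L2_def\<close>)
qed

lemma bm_L2: "bounded_measurable g \<Longrightarrow> g \<in> L2"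
  using bm_integrable[OF bm_power2] by (auto simp: L2_def bounded_measurable_def)

lemma test_function_props:
  assumes "\<phi> \<in> test_functions"
  shows "continuous_on {0..1} \<phi>" "continuous_on {0..1} (deriv \<phi>)"
    "(\<phi> has_real_derivative deriv \<phi> x) (at x)" "\<phi> 0 = 0" "\<phi> 1 = 0"
proof -
  have "(deriv ^^ n) \<phi> differentiable (at x)" for n x using assms by (auto simp: test_functions_def)
  from this[of 0] this[of 1]
  have d: "\<And>x. \<phi> differentiable (at x)" "\<And>x. deriv \<phi> differentiable (at x)" by simp_all
  then show "(\<phi> has_real_derivative deriv \<phi> x) (at x)" by (simp add: DERIV_deriv_iff_real_differentiable)
  show "continuous_on {0..1} \<phi>" "continuous_on {0..1} (deriv \<phi>)"
    using d by (auto intro!: continuous_at_imp_continuous_on differentiable_imp_continuous_within)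
  obtain K where "K \<subseteq> I01" "\<And>x. x \<notin> K \<Longrightarrow> \<phi> x = 0" using assms by (auto simp: test_functions_def)
  then show "\<phi> 0 = 0" "\<phi> 1 = 0" by (meson subsetD greaterThanLessThan_iff less_irrefl)+
qed

lemma piecewise_C1_weak_deriv:
  assumes v: "piecewise_C1 v"
  shows "is_weak_deriv v (deriv v)"
  unfolding is_weak_deriv_def
proof
  fix \<phi> assume \<phi>: "\<phi> \<in> test_functions"
  note p = test_function_props[OF \<phi>]
  obtain S where S: "finite S" "\<And>x. x \<in> I01 - S \<Longrightarrow> (v has_real_derivative deriv v x) (at x)"
    using piecewise_C1_deriv[OF v] by blast
  have bm: "bounded_measurable (\<lambda>x. v x * deriv \<phi> x)" "bounded_measurable (\<lambda>x. deriv v x * \<phi> x)"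
    by (intro bm_mult bm_continuous[OF p(1)] bm_continuous[OF p(2)] piecewise_C1_bm[OF v] piecewise_C1_deriv_bm[OF v])+
  have "integral\<^sup>L M01 (\<lambda>x. v x * deriv \<phi> x + deriv v x * \<phi> x) = v 1 * \<phi> 1 - v 0 * \<phi> 0"
  proof (rule integral_derivative_M01[OF S(1)])
    fix x assume "x \<in> I01 - S"
    from DERIV_mult[OF S(2)[OF this] p(3)]
    show "((\<lambda>x. v x * \<phi> x) has_real_derivative v x * deriv \<phi> x + deriv v x * \<phi> x) (at x)"
      by (simp add: algebra_simps)
  qed (auto intro!: continuous_intros p piecewise_C1_continuous[OF v] bm_add bm)
  then have "integral\<^sup>L M01 (\<lambda>x. v x * deriv \<phi> x) + integral\<^sup>L M01 (\<lambda>x. deriv v x * \<phi> x) = 0"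
    by (subst (asm) Bochner_Integration.integral_add) (auto intro: bm_integrable bm simp: p)
  then show "L2_inner v (deriv \<phi>) = - L2_inner (deriv v) \<phi>" by (simp add: L2_inner_def)
qed

lemma piecewise_C1_H1: "piecewise_C1 v \<Longrightarrow> v \<in> H1"
  unfolding H1_def using piecewise_C1_weak_deriv bm_L2 piecewise_C1_bm piecewise_C1_deriv_bm by blast

text \<open>The function \<open>weak_deriv v\<close> is an arbitrary choice; uniqueness almost everywhere
  (from the fundamental lemma) is what identifies it with \<open>deriv v\<close>.\<close>

theorem weak_deriv_piecewise_C1:
  assumes v: "piecewise_C1 v"
  shows "weak_deriv v \<in> borel_measurable M01" "AE x in M01. weak_deriv v x = deriv v x"
proof -
  have w: "weak_deriv v \<in> L2 \<and> is_weak_deriv v (weak_deriv v)"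
    unfolding weak_deriv_def
    by (rule someI[of _ "deriv v"]) (use v in \<open>simp add: piecewise_C1_weak_deriv bm_L2 piecewise_C1_deriv_bm\<close>)
  then show "weak_deriv v \<in> borel_measurable M01" by (simp add: L2_def)
  have int: "integrable M01 (weak_deriv v)" "integrable M01 (deriv v)"
    using w v by (auto intro: L2_integrable bm_L2 piecewise_C1_deriv_bm)
  have "AE x in M01. weak_deriv v x - deriv v x = 0"
  proof (rule fundamental_lemma_variations)
    fix \<phi> assume \<phi>: "\<phi> \<in> test_functions"
    obtain B where B: "\<forall>x\<in>I01. \<bar>\<phi> x\<bar> \<le> B" and m: "\<phi> \<in> borel_measurable M01"
      using bm_continuous[OF test_function_props(1)[OF \<phi>]] unfolding bounded_measurable_def by blast
    have i: "integrable M01 (\<lambda>x. g x * \<phi> x)" if "integrable M01 g" for g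
    proof (rule Bochner_Integration.integrable_bound)
      show "integrable M01 (\<lambda>x. B * g x)" using that by simp
      show "AE x in M01. norm (g x * \<phi> x) \<le> norm (B * g x)"
      proof (rule AE_I2)
        fix x assume "x \<in> space M01"
        then have "\<bar>\<phi> x\<bar> \<le> \<bar>B\<bar>" using B by force
        then show "norm (g x * \<phi> x) \<le> norm (B * g x)"
          using mult_right_mono[of "\<bar>\<phi> x\<bar>" "\<bar>B\<bar>" "\<bar>g x\<bar>"] by (simp add: abs_mult mult.commute)
      qed
    qed (use that m in auto)
    have "L2_inner (weak_deriv v) \<phi> = L2_inner (deriv v) \<phi>"
      using w piecewise_C1_weak_deriv[OF v] \<phi> unfolding is_weak_deriv_def by force
    then show "integral\<^sup>L M01 (\<lambda>x. (weak_deriv v x - deriv v x) * \<phi> x) = 0"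
      unfolding L2_inner_def left_diff_distrib
      by (subst Bochner_Integration.integral_diff) (auto intro: i int)
  qed (use int in auto)
  then show "AE x in M01. weak_deriv v x = deriv v x" by eventually_elim simp
qed

lemma energy_norm_piecewise_C1:
  assumes v: "piecewise_C1 v"
  shows "energy_norm \<epsilon> v = sqrt (\<epsilon> * integral\<^sup>L M01 (\<lambda>x. (deriv v x)\<^sup>2) + integral\<^sup>L M01 (\<lambda>x. (v x)\<^sup>2))"
proof -
  have m: "deriv v \<in> borel_measurable M01" using piecewise_C1_deriv_bm[OF v] by (simp add: bounded_measurable_def)
  have "integral\<^sup>L M01 (\<lambda>x. weak_deriv v x * weak_deriv v x) = integral\<^sup>L M01 (\<lambda>x. (deriv v x)\<^sup>2)"
  proof (rule integral_cong_AE)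
    show "AE x in M01. weak_deriv v x * weak_deriv v x = (deriv v x)\<^sup>2"
      using weak_deriv_piecewise_C1(2)[OF v] by eventually_elim (simp add: power2_eq_square)
  qed (use weak_deriv_piecewise_C1(1)[OF v] m in auto)
  then have "(L2_norm (weak_deriv v))\<^sup>2 = integral\<^sup>L M01 (\<lambda>x. (deriv v x)\<^sup>2)"
    unfolding L2_norm_def L2_inner_def by (simp add: integral_nonneg_AE)
  moreover have "(L2_norm v)\<^sup>2 = integral\<^sup>L M01 (\<lambda>x. (v x)\<^sup>2)"
    unfolding L2_norm_def L2_inner_def by (simp add: integral_nonneg_AE power2_eq_square)
  ultimately show ?thesis unfolding energy_norm_def by simp
qed

lemma bilinear_form_piecewise_C1:
  assumes w: "piecewise_C1 w" and v: "piecewise_C1 v" and b: "bounded_measurable b" and c: "bounded_measurable c"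
  shows "bilinear_form \<epsilon>1 \<epsilon>2 b c w v
    = integral\<^sup>L M01 (\<lambda>x. \<epsilon>1 * (deriv w x * deriv v x) + \<epsilon>2 * (b x * deriv w x * v x) + c x * w x * v x)"
proof -
  note bms = bm_intros b c piecewise_C1_bm[OF w] piecewise_C1_bm[OF v] piecewise_C1_deriv_bm[OF w] piecewise_C1_deriv_bm[OF v]
  have ms: "deriv w \<in> borel_measurable M01" "deriv v \<in> borel_measurable M01" "v \<in> borel_measurable M01" "b \<in> borel_measurable M01"
    using bms by (auto simp: bounded_measurable_def)
  note ms' = ms weak_deriv_piecewise_C1(1)[OF v] weak_deriv_piecewise_C1(1)[OF w]
  have 1: "L2_inner (weak_deriv w) (weak_deriv v) = integral\<^sup>L M01 (\<lambda>x. deriv w x * deriv v x)"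
    unfolding L2_inner_def
  proof (rule integral_cong_AE)
    show "AE x in M01. weak_deriv w x * weak_deriv v x = deriv w x * deriv v x"
      using weak_deriv_piecewise_C1(2)[OF v] weak_deriv_piecewise_C1(2)[OF w] by eventually_elim simp
  qed (intro borel_measurable_times ms')+
  have 2: "L2_inner (\<lambda>x. b x * weak_deriv w x) v = integral\<^sup>L M01 (\<lambda>x. b x * deriv w x * v x)"
    unfolding L2_inner_def
  proof (rule integral_cong_AE)
    show "AE x in M01. b x * weak_deriv w x * v x = b x * deriv w x * v x"
      using weak_deriv_piecewise_C1(2)[OF w] by eventually_elim simp
  qed (intro borel_measurable_times ms')+
  have i: "integrable M01 (\<lambda>x. deriv w x * deriv v x)" "integrable M01 (\<lambda>x. b x * deriv w x * v x)"
    "integrable M01 (\<lambda>x. c x * w x * v x)"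
    by (auto intro!: bm_integrable bms)
  show ?thesis unfolding bilinear_form_def 1 2 unfolding L2_inner_def using i by simp
qed

section \<open>Coercivity and the energy estimate\<close>

text \<open>Integration by parts of \<open>b v w\<close>; one vanishing factor at the end points is enough.\<close>

lemma convection_antisymmetric:
  assumes b: "continuous_on {0..1} b" "\<And>x. x \<in> I01 \<Longrightarrow> (b has_real_derivative b' x) (at x)" "bounded_measurable b'"
    and v: "piecewise_C1 v" and w: "piecewise_C1 w" and bc: "w 0 = 0" "w 1 = 0"
  shows "integral\<^sup>L M01 (\<lambda>x. b x * deriv v x * w x) = - integral\<^sup>L M01 (\<lambda>x. b' x * v x * w x + b x * v x * deriv w x)"
proof -
  obtain S where S: "finite S" "\<And>x. x \<in> I01 - S \<Longrightarrow> (v has_real_derivative deriv v x) (at x)"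
    using piecewise_C1_deriv[OF v] by blast
  obtain T where T: "finite T" "\<And>x. x \<in> I01 - T \<Longrightarrow> (w has_real_derivative deriv w x) (at x)"
    using piecewise_C1_deriv[OF w] by blast
  note bms = bm_intros bm_continuous[OF b(1)] b(3) piecewise_C1_bm[OF w] piecewise_C1_bm[OF v]
    piecewise_C1_deriv_bm[OF w] piecewise_C1_deriv_bm[OF v]
  have "integral\<^sup>L M01 (\<lambda>x. b x * deriv v x * w x + (b' x * v x * w x + b x * v x * deriv w x))
     = b 1 * v 1 * w 1 - b 0 * v 0 * w 0"
  proof (rule integral_derivative_M01[of "S \<union> T"])
    fix x assume x: "x \<in> I01 - (S \<union> T)"
    have "(b has_real_derivative b' x) (at x)" "(v has_real_derivative deriv v x) (at x)" "(w has_real_derivative deriv w x) (at x)"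
      using b(2) S(2) T(2) x by auto
    from DERIV_mult[OF DERIV_mult[OF this(1,2)] this(3)]
    show "((\<lambda>x. b x * v x * w x) has_real_derivative
       b x * deriv v x * w x + (b' x * v x * w x + b x * v x * deriv w x)) (at x)"
      by (simp add: algebra_simps)
  next
    show "continuous_on {0..1} (\<lambda>x. b x * v x * w x)"
      by (intro continuous_intros b piecewise_C1_continuous v w)
    show "bounded_measurable (\<lambda>x. b x * deriv v x * w x + (b' x * v x * w x + b x * v x * deriv w x))"
      by (intro bms)
  qed (use S T in auto)
  also have "integral\<^sup>L M01 (\<lambda>x. b x * deriv v x * w x + (b' x * v x * w x + b x * v x * deriv w x))
    = integral\<^sup>L M01 (\<lambda>x. b x * deriv v x * w x) + integral\<^sup>L M01 (\<lambda>x. b' x * v x * w x + b x * v x * deriv w x)"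
    by (intro Bochner_Integration.integral_add bm_integrable bms)
  finally show ?thesis using bc by simp
qed

lemma bm_integral_mono:
  assumes "bounded_measurable f" "bounded_measurable g" "\<And>x. x \<in> I01 \<Longrightarrow> f x \<le> g x"
  shows "integral\<^sup>L M01 f \<le> integral\<^sup>L M01 g"
  using assms by (intro integral_mono bm_integrable) auto

lemma young_product:
  fixes x y t :: real
  assumes "t > 0"
  shows "x * y \<le> t * x\<^sup>2 / 4 + y\<^sup>2 / t"
proof -
  have "0 \<le> (t * x / 2 - y)\<^sup>2 / t" using assms by simp
  also have "\<dots> = t * x\<^sup>2 / 4 + y\<^sup>2 / t - x * y"
    using assms by (simp add: power2_eq_square field_simps)
  finally show ?thesis by simp
qed

text \<open>The convection term contributes \<open>- \<epsilon>2 / 2 * b'\<close> to the coefficient of \<open>\<eta>\<^sup>2\<close>,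
  since \<open>b \<eta> \<eta>' = b (\<eta>\<^sup>2)' / 2\<close>.\<close>

lemma coercivity:
  fixes \<epsilon>1 \<epsilon>2 \<rho> :: real
  assumes eps: "0 < \<epsilon>1"
    and b: "continuous_on {0..1} b" "\<And>x. x \<in> I01 \<Longrightarrow> (b has_real_derivative b' x) (at x)" "bounded_measurable b'"
    and c: "continuous_on {0..1} c"
    and coer: "\<And>x. x \<in> I01 \<Longrightarrow> c x - \<epsilon>2 / 2 * b' x \<ge> \<rho>"
    and \<eta>: "piecewise_C1 \<eta>" "\<eta> 0 = 0" "\<eta> 1 = 0"
  shows "integral\<^sup>L M01 (\<lambda>x. \<epsilon>1 * (deriv \<eta> x)\<^sup>2 + \<rho> * (\<eta> x)\<^sup>2)
    \<le> integral\<^sup>L M01 (\<lambda>x. \<epsilon>1 * (deriv \<eta> x * deriv \<eta> x) + \<epsilon>2 * (b x * deriv \<eta> x * \<eta> x) + c x * \<eta> x * \<eta> x)"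
proof -
  note bms = bm_intros bm_continuous[OF b(1)] bm_continuous[OF c] b(3) piecewise_C1_bm[OF \<eta>(1)] piecewise_C1_deriv_bm[OF \<eta>(1)]
  note ints = bm_integrable bms
  let ?E = "\<lambda>x. \<epsilon>1 * (deriv \<eta> x)\<^sup>2 + \<rho> * (\<eta> x)\<^sup>2"
  have anti: "integral\<^sup>L M01 (\<lambda>x. b x * deriv \<eta> x * \<eta> x) = - integral\<^sup>L M01 (\<lambda>x. b' x * (\<eta> x)\<^sup>2 / 2)"
  proof -
    have "integral\<^sup>L M01 (\<lambda>x. b x * deriv \<eta> x * \<eta> x) = - integral\<^sup>L M01 (\<lambda>x. b' x * \<eta> x * \<eta> x + b x * \<eta> x * deriv \<eta> x)"
      by (rule convection_antisymmetric[OF b \<eta>(1,1-3)])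
    also have "\<dots> = - (integral\<^sup>L M01 (\<lambda>x. b' x * \<eta> x * \<eta> x) + integral\<^sup>L M01 (\<lambda>x. b x * \<eta> x * deriv \<eta> x))"
      by (subst Bochner_Integration.integral_add) (intro ints refl)+
    finally have "2 * integral\<^sup>L M01 (\<lambda>x. b x * deriv \<eta> x * \<eta> x) = - integral\<^sup>L M01 (\<lambda>x. b' x * \<eta> x * \<eta> x)"
      by (simp add: mult_ac)
    then show ?thesis by (simp add: power2_eq_square mult.assoc)
  qed
  have "integral\<^sup>L M01 ?E \<le> integral\<^sup>L M01 (\<lambda>x. \<epsilon>1 * (deriv \<eta> x * deriv \<eta> x) + c x * \<eta> x * \<eta> x - \<epsilon>2 * (b' x * (\<eta> x)\<^sup>2 * (1/2)))"
  proof (rule bm_integral_mono)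
    fix x assume "x \<in> I01"
    from mult_right_mono[OF coer[OF this], of "(\<eta> x)\<^sup>2"]
    show "?E x \<le> \<epsilon>1 * (deriv \<eta> x * deriv \<eta> x) + c x * \<eta> x * \<eta> x - \<epsilon>2 * (b' x * (\<eta> x)\<^sup>2 * (1/2))"
      by (simp add: power2_eq_square algebra_simps)
  qed (intro bms)+
  also have "\<dots> = integral\<^sup>L M01 (\<lambda>x. \<epsilon>1 * (deriv \<eta> x * deriv \<eta> x) + c x * \<eta> x * \<eta> x)
       - \<epsilon>2 * integral\<^sup>L M01 (\<lambda>x. b' x * (\<eta> x)\<^sup>2 * (1/2))"
    by (subst Bochner_Integration.integral_diff) (intro ints integral_mult_right_zero arg_cong2[where f="(-)"] refl)+
  also have "\<dots> = integral\<^sup>L M01 (\<lambda>x. \<epsilon>1 * (deriv \<eta> x * deriv \<eta> x) + c x * \<eta> x * \<eta> x)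
       + integral\<^sup>L M01 (\<lambda>x. \<epsilon>2 * (b x * deriv \<eta> x * \<eta> x))"
    using anti by simp
  also have "\<dots> = integral\<^sup>L M01 (\<lambda>x. (\<epsilon>1 * (deriv \<eta> x * deriv \<eta> x) + c x * \<eta> x * \<eta> x) + \<epsilon>2 * (b x * deriv \<eta> x * \<eta> x))"
    by (rule Bochner_Integration.integral_add[symmetric]) (intro ints)+
  also have "\<dots> = integral\<^sup>L M01 (\<lambda>x. \<epsilon>1 * (deriv \<eta> x * deriv \<eta> x) + \<epsilon>2 * (b x * deriv \<eta> x * \<eta> x) + c x * \<eta> x * \<eta> x)"
    by (rule arg_cong[where f = "integral\<^sup>L M01"]) auto
  finally show ?thesis .
qed

text \<open>In the application \<open>\<eta>\<close> is the discrete part of the error and \<open>ea + eb\<close> the interpolation error. The two parts of the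
  latter are treated differently in the convection term: \<open>\<epsilon>2 b ea' \<eta>\<close> is estimated as it stands,
  which costs \<open>\<epsilon>2\<^sup>2 ea'\<^sup>2\<close>, while \<open>\<epsilon>2 b eb' \<eta>\<close> is first integrated by parts and then absorbed in
  \<open>\<epsilon>1 \<eta>'\<^sup>2\<close>, which costs \<open>\<epsilon>2\<^sup>2 / \<epsilon>1 * eb\<^sup>2\<close>. Either treatment alone would lose a negative
  power of \<open>\<epsilon>1\<close> for one of the layers.\<close>

theorem energy_estimate:
  fixes \<epsilon>1 \<epsilon>2 K \<rho> :: real
  assumes eps: "0 < \<epsilon>1" "\<epsilon>1 \<le> 1" "0 < \<epsilon>2" "\<epsilon>2 \<le> 1" and \<rho>: "\<rho> > 0"
    and b: "continuous_on {0..1} b" "\<And>x. x \<in> I01 \<Longrightarrow> (b has_real_derivative b' x) (at x)" "bounded_measurable b'"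
    and c: "continuous_on {0..1} c"
    and K: "\<And>x. x \<in> I01 \<Longrightarrow> \<bar>b x\<bar> \<le> K \<and> \<bar>b' x\<bar> \<le> K \<and> \<bar>c x\<bar> \<le> K"
    and coer: "\<And>x. x \<in> I01 \<Longrightarrow> c x - \<epsilon>2 / 2 * b' x \<ge> \<rho>"
    and ea: "piecewise_C1 ea" and eb: "piecewise_C1 eb" and \<eta>: "piecewise_C1 \<eta>" "\<eta> 0 = 0" "\<eta> 1 = 0"
    and orth: "integral\<^sup>L M01 (\<lambda>x. \<epsilon>1 * (deriv \<eta> x * deriv \<eta> x) + \<epsilon>2 * (b x * deriv \<eta> x * \<eta> x) + c x * \<eta> x * \<eta> x)
      = - integral\<^sup>L M01 (\<lambda>x. \<epsilon>1 * ((deriv ea x + deriv eb x) * deriv \<eta> x)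
          + \<epsilon>2 * (b x * (deriv ea x + deriv eb x) * \<eta> x) + c x * (ea x + eb x) * \<eta> x)"
  shows "integral\<^sup>L M01 (\<lambda>x. \<epsilon>1 * (deriv \<eta> x)\<^sup>2 + \<rho> * (\<eta> x)\<^sup>2)
    \<le> 2 * (1 + K\<^sup>2 + 8 * K\<^sup>2 / \<rho>) * integral\<^sup>L M01 (\<lambda>x. \<epsilon>1 * (deriv ea x + deriv eb x)\<^sup>2 + (ea x + eb x)\<^sup>2
        + \<epsilon>2\<^sup>2 * (deriv ea x)\<^sup>2 + \<epsilon>2\<^sup>2 / \<epsilon>1 * (eb x)\<^sup>2)"
proof -
  note bms = bm_intros bm_continuous[OF b(1)] bm_continuous[OF c] b(3) piecewise_C1_bm[OF ea] piecewise_C1_bm[OF eb]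
    piecewise_C1_bm[OF \<eta>(1)] piecewise_C1_deriv_bm[OF ea] piecewise_C1_deriv_bm[OF eb] piecewise_C1_deriv_bm[OF \<eta>(1)]
  note ints = bm_integrable bms
  let ?G = "\<lambda>x. \<epsilon>1 * (deriv ea x + deriv eb x)\<^sup>2 + (ea x + eb x)\<^sup>2
        + \<epsilon>2\<^sup>2 * (deriv ea x)\<^sup>2 + \<epsilon>2\<^sup>2 / \<epsilon>1 * (eb x)\<^sup>2"
  let ?E = "\<lambda>x. \<epsilon>1 * (deriv \<eta> x)\<^sup>2 + \<rho> * (\<eta> x)\<^sup>2"
  define Q where "Q = 1 + K\<^sup>2 + 8 * K\<^sup>2 / \<rho>"
  define P where "P x = \<epsilon>1 * ((deriv ea x + deriv eb x) * deriv \<eta> x) + \<epsilon>2 * (b x * deriv ea x * \<eta> x)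
      - \<epsilon>2 * (b' x * eb x * \<eta> x + b x * eb x * deriv \<eta> x) + c x * (ea x + eb x) * \<eta> x" for x
  have K0: "K \<ge> 0" using K[of "1/2"] by auto
  have "integral\<^sup>L M01 ?E \<le> integral\<^sup>L M01 (\<lambda>x. \<epsilon>1 * (deriv \<eta> x * deriv \<eta> x) + \<epsilon>2 * (b x * deriv \<eta> x * \<eta> x) + c x * \<eta> x * \<eta> x)"
    by (rule coercivity[OF eps(1) b c coer \<eta>])
  also have "\<dots> = - integral\<^sup>L M01 (\<lambda>x. \<epsilon>1 * ((deriv ea x + deriv eb x) * deriv \<eta> x)
          + \<epsilon>2 * (b x * (deriv ea x + deriv eb x) * \<eta> x) + c x * (ea x + eb x) * \<eta> x)"
    by (rule orth)
  also have "integral\<^sup>L M01 (\<lambda>x. \<epsilon>1 * ((deriv ea x + deriv eb x) * deriv \<eta> x)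
          + \<epsilon>2 * (b x * (deriv ea x + deriv eb x) * \<eta> x) + c x * (ea x + eb x) * \<eta> x)
     = integral\<^sup>L M01 (\<lambda>x. (\<epsilon>1 * ((deriv ea x + deriv eb x) * deriv \<eta> x) + \<epsilon>2 * (b x * deriv ea x * \<eta> x)
          + c x * (ea x + eb x) * \<eta> x) + \<epsilon>2 * (b x * deriv eb x * \<eta> x))"
    by (rule arg_cong[where f = "integral\<^sup>L M01"]) (auto simp: algebra_simps)
  also have "\<dots> = integral\<^sup>L M01 (\<lambda>x. \<epsilon>1 * ((deriv ea x + deriv eb x) * deriv \<eta> x) + \<epsilon>2 * (b x * deriv ea x * \<eta> x)
          + c x * (ea x + eb x) * \<eta> x) + integral\<^sup>L M01 (\<lambda>x. \<epsilon>2 * (b x * deriv eb x * \<eta> x))"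
    by (rule Bochner_Integration.integral_add) (intro ints)+
  also have "integral\<^sup>L M01 (\<lambda>x. \<epsilon>2 * (b x * deriv eb x * \<eta> x))
     = - integral\<^sup>L M01 (\<lambda>x. \<epsilon>2 * (b' x * eb x * \<eta> x + b x * eb x * deriv \<eta> x))"
    using convection_antisymmetric[OF b eb \<eta>] by simp
  also have "integral\<^sup>L M01 (\<lambda>x. \<epsilon>1 * ((deriv ea x + deriv eb x) * deriv \<eta> x) + \<epsilon>2 * (b x * deriv ea x * \<eta> x)
          + c x * (ea x + eb x) * \<eta> x) + - integral\<^sup>L M01 (\<lambda>x. \<epsilon>2 * (b' x * eb x * \<eta> x + b x * eb x * deriv \<eta> x))
      = integral\<^sup>L M01 (\<lambda>x. (\<epsilon>1 * ((deriv ea x + deriv eb x) * deriv \<eta> x) + \<epsilon>2 * (b x * deriv ea x * \<eta> x)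
          + c x * (ea x + eb x) * \<eta> x) - \<epsilon>2 * (b' x * eb x * \<eta> x + b x * eb x * deriv \<eta> x))"
    unfolding add_uminus_conv_diff by (rule Bochner_Integration.integral_diff[symmetric]) (intro ints)+
  also have "- \<dots> = integral\<^sup>L M01 (\<lambda>x. - P x)"
    unfolding P_def by (subst Bochner_Integration.integral_minus[symmetric]) (rule arg_cong[where f = "integral\<^sup>L M01"], auto)
  also have "\<dots> \<le> integral\<^sup>L M01 (\<lambda>x. ?E x * (1/2) + Q * ?G x)"
  proof (rule bm_integral_mono)
    show "bounded_measurable (\<lambda>x. - P x)" unfolding P_def by (intro bms)
    show "bounded_measurable (\<lambda>x. ?E x * (1/2) + Q * ?G x)" by (intro bms)
    fix x assume x: "x \<in> I01"
    define e' where "e' = deriv ea x + deriv eb x"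
    define h where "h = deriv \<eta> x"
    have bK: "(b x)\<^sup>2 \<le> K\<^sup>2" "(b' x)\<^sup>2 \<le> K\<^sup>2" "(c x)\<^sup>2 \<le> K\<^sup>2"
      using K[OF x] by (auto simp: abs_le_square_iff[symmetric])
    have 1: "- (\<epsilon>1 * (e' * h)) \<le> \<epsilon>1 * (h\<^sup>2 / 4 + e'\<^sup>2)"
    proof -
      have "h * (- e') \<le> h\<^sup>2 / 4 + e'\<^sup>2" using young_product[of 1 h "- e'"] by simp
      then have "\<epsilon>1 * (h * (- e')) \<le> \<epsilon>1 * (h\<^sup>2 / 4 + e'\<^sup>2)" using eps by (intro mult_left_mono) auto
      then show ?thesis by (simp add: mult_ac)
    qed
    have yr: "y * \<eta> x \<le> \<rho> * (\<eta> x)\<^sup>2 / 8 + 2 * (K\<^sup>2 * z) / \<rho>" if "y\<^sup>2 \<le> K\<^sup>2 * z" for y z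
    proof -
      have "\<eta> x * y \<le> (\<rho>/2) * (\<eta> x)\<^sup>2 / 4 + y\<^sup>2 / (\<rho>/2)" using young_product[of "\<rho>/2"] \<rho> by simp
      also have "y\<^sup>2 / (\<rho>/2) \<le> K\<^sup>2 * z / (\<rho>/2)" using that \<rho> by (intro divide_right_mono) auto
      finally show ?thesis by (simp add: mult_ac)
    qed
    have 2: "- (\<epsilon>2 * (b x * deriv ea x * \<eta> x)) \<le> \<rho> * (\<eta> x)\<^sup>2 / 8 + 2 * (K\<^sup>2 * (\<epsilon>2\<^sup>2 * (deriv ea x)\<^sup>2)) / \<rho>"
      using yr[of "- (\<epsilon>2 * (b x * deriv ea x))" "\<epsilon>2\<^sup>2 * (deriv ea x)\<^sup>2"] mult_right_mono[OF bK(1), of "\<epsilon>2\<^sup>2 * (deriv ea x)\<^sup>2"]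
      by (simp add: power_mult_distrib mult_ac)
    have e2: "\<epsilon>2\<^sup>2 * (eb x)\<^sup>2 \<le> \<epsilon>2\<^sup>2 / \<epsilon>1 * (eb x)\<^sup>2"
      using eps by (intro mult_right_mono) (auto simp: field_simps)
    have 3: "\<epsilon>2 * (b' x * eb x * \<eta> x) \<le> \<rho> * (\<eta> x)\<^sup>2 / 8 + 2 * (K\<^sup>2 * (\<epsilon>2\<^sup>2 / \<epsilon>1 * (eb x)\<^sup>2)) / \<rho>"
    proof -
      have "(\<epsilon>2 * (b' x * eb x))\<^sup>2 = (b' x)\<^sup>2 * (\<epsilon>2\<^sup>2 * (eb x)\<^sup>2)" by (simp add: power_mult_distrib)
      also have "\<dots> \<le> K\<^sup>2 * (\<epsilon>2\<^sup>2 / \<epsilon>1 * (eb x)\<^sup>2)" by (rule mult_mono[OF bK(2) e2]) auto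
      finally have "(\<epsilon>2 * (b' x * eb x))\<^sup>2 \<le> K\<^sup>2 * (\<epsilon>2\<^sup>2 / \<epsilon>1 * (eb x)\<^sup>2)" .
      from yr[OF this] show ?thesis by (simp only: mult.assoc)
    qed
    have 4: "\<epsilon>2 * (b x * eb x * h) \<le> \<epsilon>1 * h\<^sup>2 / 4 + K\<^sup>2 * (\<epsilon>2\<^sup>2 / \<epsilon>1 * (eb x)\<^sup>2)"
    proof -
      have "h * (\<epsilon>2 * (b x * eb x)) \<le> \<epsilon>1 * h\<^sup>2 / 4 + (\<epsilon>2 * (b x * eb x))\<^sup>2 / \<epsilon>1"
        using young_product[of \<epsilon>1 h] eps by simp
      also have "(\<epsilon>2 * (b x * eb x))\<^sup>2 / \<epsilon>1 = (b x)\<^sup>2 * (\<epsilon>2\<^sup>2 / \<epsilon>1 * (eb x)\<^sup>2)" by (simp add: power_mult_distrib)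
      also have "\<dots> \<le> K\<^sup>2 * (\<epsilon>2\<^sup>2 / \<epsilon>1 * (eb x)\<^sup>2)" using bK eps by (intro mult_right_mono) auto
      finally show ?thesis by (simp add: mult_ac)
    qed
    have 5: "- (c x * (ea x + eb x) * \<eta> x) \<le> \<rho> * (\<eta> x)\<^sup>2 / 8 + 2 * (K\<^sup>2 * (ea x + eb x)\<^sup>2) / \<rho>"
      using yr[of "- (c x * (ea x + eb x))" "(ea x + eb x)\<^sup>2"] mult_right_mono[OF bK(3), of "(ea x + eb x)\<^sup>2"]
      by (simp add: power_mult_distrib)
    define g1 g2 g3 g4 where "g1 = \<epsilon>1 * e'\<^sup>2" and "g2 = (ea x + eb x)\<^sup>2" and "g3 = \<epsilon>2\<^sup>2 * (deriv ea x)\<^sup>2" and "g4 = \<epsilon>2\<^sup>2 / \<epsilon>1 * (eb x)\<^sup>2"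
    have g0: "g1 \<ge> 0" "g2 \<ge> 0" "g3 \<ge> 0" "g4 \<ge> 0" using eps by (auto simp: g1_def g2_def g3_def g4_def)
    define r where "r = K\<^sup>2 / \<rho>"
    have r: "r \<ge> 0" using \<rho> by (simp add: r_def)
    have "- P x \<le> \<epsilon>1 * h\<^sup>2 / 2 + 3 * \<rho> * (\<eta> x)\<^sup>2 / 8 + g1 + 2 * r * g3 + 2 * r * g4 + K\<^sup>2 * g4 + 2 * r * g2"
      using 1 2 3 4 5 unfolding P_def e'_def[symmetric] h_def[symmetric] g1_def g2_def g3_def g4_def r_def
      by (simp add: algebra_simps)
    also have "\<dots> \<le> \<epsilon>1 * h\<^sup>2 / 2 + \<rho> * (\<eta> x)\<^sup>2 / 2 + (1 + K\<^sup>2 + 8 * r) * (g1 + g2 + g3 + g4)"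
    proof -
      have "0 \<le> \<rho> * (\<eta> x)\<^sup>2" "0 \<le> r * g1" "0 \<le> r * g2" "0 \<le> r * g3" "0 \<le> r * g4"
        "0 \<le> K\<^sup>2 * g1" "0 \<le> K\<^sup>2 * g2" "0 \<le> K\<^sup>2 * g3" "0 \<le> K\<^sup>2 * g4" using r g0 \<rho> by auto
      then show ?thesis using g0 by (simp add: algebra_simps)
    qed
    finally show "- P x \<le> ?E x * (1/2) + Q * ?G x"
      unfolding Q_def h_def e'_def g1_def g2_def g3_def g4_def r_def by (simp add: algebra_simps)
  qed
  also have "\<dots> = integral\<^sup>L M01 ?E * (1/2) + Q * integral\<^sup>L M01 ?G"
    by (subst Bochner_Integration.integral_add) (intro ints integral_mult_right_zero integral_mult_left_zero arg_cong2[where f="(+)"] refl)+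
  finally have fin: "integral\<^sup>L M01 ?E \<le> integral\<^sup>L M01 ?E * (1/2) + Q * integral\<^sup>L M01 ?G" .
  have "I \<le> 2 * J" if "I \<le> I * (1/2) + J" for I J :: real using that by simp
  from this[OF fin] show ?thesis by (simp only: Q_def mult.assoc)
qed

section \<open>Polynomial approximation of holomorphic functions\<close>

fun cheb_U :: "nat \<Rightarrow> real poly" where
  "cheb_U 0 = 1"
| "cheb_U (Suc 0) = [:0, 2:]"
| "cheb_U (Suc (Suc n)) = [:0, 2:] * cheb_U (Suc n) - cheb_U n"

lemma degree_cheb_U: "degree (cheb_U n) \<le> n"
proof (induction n rule: cheb_U.induct)
  case (3 n)
  have "degree ([:0, 2:] * cheb_U (Suc n)) \<le> Suc (Suc n)"
    using degree_mult_le[of "[:0, 2:]" "cheb_U (Suc n)"] 3 by simp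
  then show ?case using 3 by (auto intro!: degree_diff_le)
qed simp_all

text \<open>The point is \<open>exp (i \<phi>)\<close> for \<open>t = cos \<phi>\<close>; it factors \<open>1 - 2 t w + w\<^sup>2\<close> as
  \<open>(1 - e w) (1 - cnj e w)\<close>, the generating function of the Chebyshev polynomials.\<close>

lemma unit_circle_over_interval:
  fixes t :: real
  assumes "\<bar>t\<bar> \<le> 1"
  obtains e :: complex where "cmod e = 1" "e + cnj e = 2 * of_real t" "e * cnj e = 1"
proof
  let ?e = "Complex t (sqrt (1 - t^2))"
  have t: "t^2 \<le> 1" using assms by (simp add: abs_square_le_1)
  show "cmod ?e = 1" using t by (simp add: cmod_def)
  then show "?e * cnj ?e = 1"
    by (metis complex_norm_square of_real_1 one_power2)
  show "?e + cnj ?e = 2 * of_real t" by (simp add: complex_eq_iff)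
qed

lemma cheb_U_step:
  fixes e :: complex
  assumes "e + cnj e = 2 * of_real t" "e * cnj e = 1"
  shows "of_real (poly (cheb_U (Suc n)) t) - cnj e * of_real (poly (cheb_U n) t) = e ^ Suc n"
proof (induction n)
  case 0
  have "of_real (2 * t) = e + cnj e" using assms by simp
  then show ?case by (simp add: algebra_simps)
next
  case (Suc n)
  let ?a = "complex_of_real (poly (cheb_U n) t)" and ?b = "complex_of_real (poly (cheb_U (Suc n)) t)"
  have "complex_of_real (poly (cheb_U (Suc (Suc n))) t) - cnj e * ?b
      = (e + cnj e) * ?b - ?a - cnj e * ?b"
    by (simp add: assms(1))
  also have "\<dots> = e * ?b - (e * cnj e) * ?a" by (simp only: assms(2)) (simp add: algebra_simps)
  also have "\<dots> = e * (?b - cnj e * ?a)" by (simp add: algebra_simps)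
  also have "\<dots> = e ^ Suc (Suc n)" using Suc.IH by simp
  finally show ?case .
qed

text \<open>The value is \<open>\<Sum>k\<le>n. e ^ (n - 2 k)\<close> for the unit complex number \<open>e\<close> above \<open>t\<close>. This bound on
  \<open>[-1,1]\<close> is the reason for using the second kind: no derivative or square root appears.\<close>

lemma abs_cheb_U_le:
  assumes "\<bar>t\<bar> \<le> 1"
  shows "\<bar>poly (cheb_U n) t\<bar> \<le> real n + 1"
proof -
  obtain e where e: "cmod e = 1" "e + cnj e = 2 * of_real t" "e * cnj e = 1"
    using unit_circle_over_interval assms by blast
  show ?thesis
  proof (induction n)
    case (Suc n)
    have "complex_of_real (poly (cheb_U (Suc n)) t) = e ^ Suc n + cnj e * of_real (poly (cheb_U n) t)"
      using cheb_U_step[OF e(2,3), of n] by (simp add: algebra_simps)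
    then have "cmod (of_real (poly (cheb_U (Suc n)) t)) \<le> 1 + \<bar>poly (cheb_U n) t\<bar>"
      using norm_triangle_ineq[of "e ^ Suc n" "cnj e * of_real (poly (cheb_U n) t)"]
      by (simp add: norm_mult norm_power e(1))
    then show ?case using Suc by simp
  qed simp
qed

lemma cheb_U_partial_sum:
  fixes w :: complex and t :: real
  shows "(1 - 2 * of_real t * w + w^2) * (\<Sum>n\<le>N. w ^ n * of_real (poly (cheb_U n) t))
    = 1 - w ^ Suc N * (of_real (poly (cheb_U (Suc N)) t) - w * of_real (poly (cheb_U N) t))"
proof (induction N)
  case 0
  show ?case by (simp add: power2_eq_square algebra_simps)
next
  case (Suc N)
  show ?case unfolding sum.atMost_Suc distrib_left Suc
    by (simp add: power2_eq_square algebra_simps)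
qed

definition joukowski :: "complex \<Rightarrow> complex" where
  "joukowski w = (w + inverse w) / 2"

lemma joukowski_deriv:
  assumes "w \<noteq> 0"
  shows "(joukowski has_field_derivative (1 - inverse w ^ 2) / 2) (at w)"
  unfolding joukowski_def using assms
  by (auto intro!: derivative_eq_intros simp: power2_eq_square)

lemma joukowski_minus:
  assumes "w \<noteq> 0"
  shows "2 * inverse w * (joukowski w - of_real t) = 1 - 2 * of_real t * inverse w + inverse w ^ 2"
  using assms unfolding joukowski_def by (simp add: field_simps power2_eq_square)

lemma joukowski_kernel_bound:
  assumes "\<bar>t\<bar> \<le> 1" "cmod w < 1"
  shows "(1 - cmod w)^2 \<le> cmod (1 - 2 * of_real t * w + w^2)"
proof -
  obtain e where e: "cmod e = 1" "e + cnj e = 2 * of_real t" "e * cnj e = 1"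
    using unit_circle_over_interval assms by blast
  have "1 - 2 * of_real t * w + w^2 = 1 - (e + cnj e) * w + (e * cnj e) * w^2"
    by (simp add: e)
  also have "\<dots> = (1 - e * w) * (1 - cnj e * w)"
    by (simp add: algebra_simps power2_eq_square)
  finally have eq: "cmod (1 - 2 * of_real t * w + w^2) = cmod (1 - e * w) * cmod (1 - cnj e * w)"
    by (simp add: norm_mult)
  have "1 - cmod w \<le> cmod (1 - e * w)" "1 - cmod w \<le> cmod (1 - cnj e * w)"
    using norm_triangle_ineq2[of 1 "e * w"] norm_triangle_ineq2[of 1 "cnj e * w"] e(1)
    by (simp_all add: norm_mult)
  then have "(1 - cmod w) * (1 - cmod w) \<le> cmod (1 - e * w) * cmod (1 - cnj e * w)"
    using assms by (intro mult_mono) auto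
  then show ?thesis unfolding eq by (simp add: power2_eq_square)
qed

text \<open>Cauchy's formula on the ellipse, transported to the circle of radius \<open>R\<close>. The division
  \<open>(F - F (of_real t)) / (z - of_real t)\<close> has a primitive on the convex set \<open>D\<close>, so only the
  constant \<open>F (of_real t)\<close> contributes; its integrand splits into partial fractions
  with poles \<open>0\<close>, \<open>e\<close>, \<open>cnj e\<close>, which contribute \<open>- 1 + 1 + 1\<close>.\<close>

lemma joukowski_Cauchy:
  assumes "open D" "convex D" "F holomorphic_on D" "R > 1" "\<bar>t\<bar> \<le> 1"
    and "of_real t \<in> D" "\<And>w. cmod w = R \<Longrightarrow> joukowski w \<in> D"
  shows "((\<lambda>w. F (joukowski w) * ((1 - inverse w ^ 2) / 2) / (joukowski w - of_real t))
     has_contour_integral (2 * of_real pi * \<i> * F (of_real t))) (circlepath 0 R)"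
proof -
  define x where "x = complex_of_real t"
  define Q where "Q = (\<lambda>z. if z = x then deriv F x else (F z - F x) / (z - x))"
  obtain e where e: "cmod e = 1" "e + cnj e = 2 * of_real t" "e * cnj e = 1"
    using unit_circle_over_interval assms by blast
  have circ: "w \<noteq> 0" "joukowski w \<noteq> x" "w \<noteq> e" "w \<noteq> cnj e" if "cmod w = R" for w
  proof -
    show "w \<noteq> 0" "w \<noteq> e" "w \<noteq> cnj e" using that assms(4) e(1) by auto
    have "cmod (inverse w) < 1" using that assms(4) by (simp add: norm_inverse inverse_less_1_iff)
    then have "(1 - cmod (inverse w))^2 > 0" by simp
    then have "1 - 2 * of_real t * inverse w + inverse w ^ 2 \<noteq> 0"
      using joukowski_kernel_bound[OF assms(5) \<open>cmod (inverse w) < 1\<close>] by auto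
    then show "joukowski w \<noteq> x"
      using joukowski_minus[OF \<open>w \<noteq> 0\<close>, of t] by (auto simp: x_def)
  qed
  have "Q holomorphic_on D" unfolding Q_def by (rule pole_lemma_open) (use assms in auto)
  then obtain P where P: "\<And>z. z \<in> D \<Longrightarrow> (P has_field_derivative Q z) (at z within D)"
    using holomorphic_convex_primitive' assms(1,2) by blast
  have "((\<lambda>w. Q (joukowski w) * ((1 - inverse w ^ 2) / 2)) has_contour_integral
     (P \<circ> joukowski) (pathfinish (circlepath 0 R)) - (P \<circ> joukowski) (pathstart (circlepath 0 R))) (circlepath 0 R)"
  proof (rule contour_integral_primitive[where S = "sphere 0 R"])
    fix w :: complex assume "w \<in> sphere 0 R"
    then have w: "cmod w = R" by simp
    have "(P has_field_derivative Q (joukowski w)) (at (joukowski w))"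
      using P[OF assms(7)[OF w]] at_within_open[OF assms(7)[OF w] assms(1)] by simp
    from DERIV_chain[OF this joukowski_deriv[OF circ(1)[OF w]]]
    show "(P \<circ> joukowski has_field_derivative Q (joukowski w) * ((1 - inverse w ^ 2) / 2)) (at w within sphere 0 R)"
      by (rule has_field_derivative_at_within)
  qed (use assms(4) in auto)
  then have 1: "((\<lambda>w. Q (joukowski w) * ((1 - inverse w ^ 2) / 2)) has_contour_integral 0) (circlepath 0 R)"
    by simp
  have pt: "((\<lambda>w. F x / (w - a)) has_contour_integral (2 * of_real pi * \<i> * F x)) (circlepath 0 R)"
    if "cmod a < R" for a
    using Cauchy_integral_circlepath_simple[of "\<lambda>_. F x" 0 R a] that by simp
  have 2: "((\<lambda>w. F x / (w - e) + F x / (w - cnj e) - F x / (w - 0)) has_contour_integral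
      (2 * of_real pi * \<i> * F x + 2 * of_real pi * \<i> * F x - 2 * of_real pi * \<i> * F x)) (circlepath 0 R)"
    by (intro has_contour_integral_add has_contour_integral_diff pt) (use assms(4) e in auto)
  have eq: "Q (joukowski w) * ((1 - inverse w ^ 2) / 2) + (F x / (w - e) + F x / (w - cnj e) - F x / (w - 0))
     = F (joukowski w) * ((1 - inverse w ^ 2) / 2) / (joukowski w - x)" if "cmod w = R" for w
  proof -
    note c = circ[OF that]
    have "2 * w * (joukowski w - x) = w^2 - (e + cnj e) * w + e * cnj e"
      using c(1) e(2,3) by (simp add: joukowski_def x_def field_simps power2_eq_square)
    also have "\<dots> = (w - e) * (w - cnj e)" by (simp add: algebra_simps power2_eq_square)
    finally have j: "joukowski w - x = (w - e) * (w - cnj e) / (2 * w)" using c(1) by (simp add: field_simps)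
    have *: "w * (w - cnj e) + w * (w - e) - (w - e) * (w - cnj e) = w\<^sup>2 - e * cnj e"
      by (simp add: algebra_simps power2_eq_square)
    have "1 / (w - e) + 1 / (w - cnj e) - 1 / w = (w\<^sup>2 - e * cnj e) / (w * ((w - e) * (w - cnj e)))"
    proof -
      have "1 / a + 1 / d - 1 / w = (w * d + w * a - a * d) / (w * (a * d))"
        if "a \<noteq> 0" "d \<noteq> 0" for a d :: complex
        using that c(1) by (simp add: field_simps)
      from this[of "w - e" "w - cnj e"] show ?thesis unfolding * using c by simp
    qed
    also have "\<dots> = ((1 - inverse w ^ 2) / 2) / (joukowski w - x)"
      unfolding j e(3) using c by (simp add: divide_simps power2_eq_square)
    finally have k: "1 / (w - e) + 1 / (w - cnj e) - 1 / w = ((1 - inverse w ^ 2) / 2) / (joukowski w - x)" .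
    have "F x / (w - e) + F x / (w - cnj e) - F x / (w - 0) = F x * (1 / (w - e) + 1 / (w - cnj e) - 1 / w)"
      by (simp add: algebra_simps)
    moreover have "Q (joukowski w) * H = F (joukowski w) * H / (joukowski w - x) - F x * (H / (joukowski w - x))" for H
      using c(2) by (simp add: Q_def diff_divide_distrib left_diff_distrib)
    ultimately show ?thesis by (simp only: k) simp
  qed
  have "((\<lambda>w. F (joukowski w) * ((1 - inverse w ^ 2) / 2) / (joukowski w - x))
     has_contour_integral (0 + (2 * of_real pi * \<i> * F x + 2 * of_real pi * \<i> * F x - 2 * of_real pi * \<i> * F x))) (circlepath 0 R)"
    by (rule has_contour_integral_eq[OF has_contour_integral_add[OF 1 2]])
       (use eq assms(4) in \<open>auto simp: path_image_circlepath\<close>)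
  then show ?thesis unfolding x_def by (simp only: add_0_left add_diff_cancel_right')
qed

text \<open>Insert the truncated generating function of the Chebyshev polynomials into the Cauchy kernel.
  The remainder is \<open>(1 / w) ^ (N + 1)\<close> times a combination of two Chebyshev values, which are at most linear in \<open>N\<close>.
  Real parts of the coefficients give a real polynomial.\<close>

lemma Bernstein_approximation_unit:
  assumes "open D" "convex D" "F holomorphic_on D" "R > 1"
    and seg: "\<And>t. \<bar>t\<bar> \<le> 1 \<Longrightarrow> of_real t \<in> D" and ell: "\<And>w. cmod w = R \<Longrightarrow> joukowski w \<in> D"
    and M: "\<And>w. cmod w = R \<Longrightarrow> cmod (F (joukowski w)) \<le> M"
  shows "\<exists>q::real poly. degree q \<le> N \<and> (\<forall>t. \<bar>t\<bar> \<le> 1 \<longrightarrow>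
     \<bar>Re (F (of_real t)) - poly q t\<bar> \<le> M * (4 * (real N + 2) * inverse R ^ Suc N / (1 - inverse R)^2))"
proof -
  define g where "g n w = F (joukowski w) * ((1 - inverse w ^ 2) / 2) * (2 * inverse w ^ Suc n)" for n w
  define cf where "cf n = contour_integral (circlepath 0 R) (g n)" for n
  have M0: "0 \<le> M" using M[of "of_real R"] assms(4) norm_ge_zero by (metis abs_of_pos le_less_trans less_trans norm_of_real not_le zero_less_one)
  have cF: "continuous_on (sphere 0 R) (\<lambda>w. F (joukowski w))"
  proof (rule continuous_on_compose2[of D F])
    show "continuous_on D F" using assms by (simp add: holomorphic_on_imp_continuous_on)
    show "continuous_on (sphere 0 R) joukowski" unfolding joukowski_def using assms(4)
      by (intro continuous_intros) auto
  qed (use ell in auto)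
  have int: "(g n has_contour_integral cf n) (circlepath 0 R)" for n
    unfolding cf_def
  proof (rule has_contour_integral_integral, rule contour_integrable_continuous_circlepath)
    show "continuous_on (path_image (circlepath 0 R)) (g n)"
      unfolding g_def using assms(4) cF
      by (intro continuous_intros) (auto simp: path_image_circlepath)
  qed
  define q where "q = (\<Sum>n\<le>N. smult (Re (cf n / (2 * of_real pi * \<i>))) (cheb_U n))"
  have degq: "degree q \<le> N" unfolding q_def
    by (intro degree_sum_le) (auto intro: order.trans[OF degree_smult_le] order.trans[OF degree_cheb_U])
  have "\<bar>Re (F (of_real t)) - poly q t\<bar> \<le> M * (4 * (real N + 2) * inverse R ^ Suc N / (1 - inverse R)^2)"
    if t: "\<bar>t\<bar> \<le> 1" for t
  proof -
    define S where "S = (\<Sum>n\<le>N. cf n * of_real (poly (cheb_U n) t))"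
    have 1: "((\<lambda>w. F (joukowski w) * ((1 - inverse w ^ 2) / 2) / (joukowski w - of_real t)
         - (\<Sum>n\<le>N. g n w * of_real (poly (cheb_U n) t)))
       has_contour_integral (2 * of_real pi * \<i> * F (of_real t) - S)) (circlepath 0 R)"
      unfolding S_def
      by (intro has_contour_integral_diff joukowski_Cauchy[OF assms(1-4) t seg[OF t] ell]
          has_contour_integral_sum has_contour_integral_rmul int) auto
    have bound: "cmod (F (joukowski w) * ((1 - inverse w ^ 2) / 2) / (joukowski w - of_real t)
         - (\<Sum>n\<le>N. g n w * of_real (poly (cheb_U n) t)))
        \<le> M * (4 * (real N + 2) * inverse R ^ Suc (Suc N) / (1 - inverse R)^2)" if w: "cmod w = R" for w
    proof -
      define v where "v = inverse w"
      define k where "k = 1 - 2 * of_real t * v + v^2"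
      define r where "r = of_real (poly (cheb_U (Suc N)) t) - v * of_real (poly (cheb_U N) t)"
      have w0: "w \<noteq> 0" using w assms(4) by auto
      have v: "cmod v = inverse R" using w by (simp add: v_def norm_inverse)
      have R1: "inverse R < 1" "inverse R > 0" using assms(4) by (auto simp: inverse_less_1_iff)
      have v0: "v \<noteq> 0" using w0 by (simp add: v_def)
      have kb: "(1 - inverse R)^2 \<le> cmod k" unfolding k_def
        using joukowski_kernel_bound[OF t, of v] v R1 by simp
      then have k0: "k \<noteq> 0" using R1 by auto
      have j: "2 * v * (joukowski w - of_real t) = k"
        unfolding v_def k_def by (rule joukowski_minus[OF w0])
      have j': "1 / (joukowski w - of_real t) = 2 * v / k"
      proof -
        have "joukowski w - of_real t \<noteq> 0" using j k0 by auto
        then show ?thesis using v0 by (simp flip: j)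
      qed
      have s: "(\<Sum>n\<le>N. v ^ n * of_real (poly (cheb_U n) t)) = (1 - v ^ Suc N * r) / k"
        using cheb_U_partial_sum[of t v N] k0 unfolding k_def[symmetric] r_def by (simp add: field_simps)
      have "(\<Sum>n\<le>N. g n w * of_real (poly (cheb_U n) t))
          = F (joukowski w) * ((1 - v ^ 2) / 2) * (2 * v) * (\<Sum>n\<le>N. v ^ n * of_real (poly (cheb_U n) t))"
        unfolding g_def v_def[symmetric] sum_distrib_left
        by (intro sum.cong) (auto simp: algebra_simps)
      also have "\<dots> = F (joukowski w) * ((1 - v ^ 2) / 2) * (2 * v / k - 2 * v ^ Suc (Suc N) * r / k)"
        unfolding s using k0 by (simp add: field_simps)
      finally have "F (joukowski w) * ((1 - inverse w ^ 2) / 2) / (joukowski w - of_real t)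
         - (\<Sum>n\<le>N. g n w * of_real (poly (cheb_U n) t))
         = F (joukowski w) * ((1 - v ^ 2) / 2) * (2 * v ^ Suc (Suc N) * r / k)"
        using j' unfolding v_def[symmetric] divide_inverse by (simp add: algebra_simps)
      then have "cmod (F (joukowski w) * ((1 - inverse w ^ 2) / 2) / (joukowski w - of_real t)
         - (\<Sum>n\<le>N. g n w * of_real (poly (cheb_U n) t)))
         = cmod (F (joukowski w)) * cmod ((1 - v ^ 2) / 2) * (2 * inverse R ^ Suc (Suc N) * cmod r / cmod k)"
        using v by (simp add: norm_mult norm_divide norm_power)
      also have "\<dots> \<le> M * 1 * (2 * inverse R ^ Suc (Suc N) * (2 * (real N + 2)) / (1 - inverse R)^2)"
      proof (intro mult_mono frac_le)
        have "cmod (1 - v^2) \<le> 1 + (cmod v)^2"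
          using norm_triangle_ineq4[of 1 "v^2"] by (simp add: norm_power)
        also have "\<dots> \<le> 2" using v R1 by (simp add: power_le_one)
        finally show "cmod ((1 - v ^ 2) / 2) \<le> 1" by (simp add: norm_divide)
        have "cmod r \<le> \<bar>poly (cheb_U (Suc N)) t\<bar> + cmod v * \<bar>poly (cheb_U N) t\<bar>"
          unfolding r_def using norm_triangle_ineq4[of "of_real (poly (cheb_U (Suc N)) t)" "v * of_real (poly (cheb_U N) t)"]
          by (simp add: norm_mult)
        also have "\<dots> \<le> (real (Suc N) + 1) + 1 * (real N + 1)"
          using v R1 abs_cheb_U_le[OF t, of "Suc N"] abs_cheb_U_le[OF t, of N]
          by (intro add_mono mult_mono) auto
        finally show "cmod r \<le> 2 * (real N + 2)" by simp
      qed (use M[OF w] M0 R1 kb in auto)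
      finally show ?thesis by (simp add: algebra_simps)
    qed
    have "cmod (2 * of_real pi * \<i> * F (of_real t) - S)
        \<le> M * (4 * (real N + 2) * inverse R ^ Suc (Suc N) / (1 - inverse R)^2) * (2 * pi * R)"
      by (rule has_contour_integral_bound_circlepath[OF 1]) (use M0 assms(4) bound in auto)
    also have "\<dots> = 2 * pi * (M * (4 * (real N + 2) * inverse R ^ Suc N / (1 - inverse R)^2))"
      using assms(4) by (simp add: field_simps)
    finally have 3: "cmod (2 * of_real pi * \<i> * F (of_real t) - S) \<le> 2 * pi * (M * (4 * (real N + 2) * inverse R ^ Suc N / (1 - inverse R)^2))" .
    have "Re (F (of_real t)) - poly q t = Re (F (of_real t) - S / (2 * of_real pi * \<i>))"
    proof -
      have "Re (cf n * complex_of_real y / (2 * of_real pi * \<i>)) = Re (cf n / (2 * of_real pi * \<i>)) * y" for n y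
        by (metis Re_complex_of_real Im_complex_of_real mult.commute mult_zero_left diff_zero times_complex.sel(1) times_divide_eq_right)
      then show ?thesis
        unfolding q_def S_def by (simp add: poly_sum sum_divide_distrib)
    qed
    then have "\<bar>Re (F (of_real t)) - poly q t\<bar> \<le> cmod (F (of_real t) - S / (2 * of_real pi * \<i>))"
      by (simp only: abs_Re_le_cmod)
    also have "F (of_real t) - S / (2 * of_real pi * \<i>) = (2 * of_real pi * \<i> * F (of_real t) - S) / (2 * of_real pi * \<i>)"
      by (simp add: field_simps)
    also have "cmod \<dots> \<le> M * (4 * (real N + 2) * inverse R ^ Suc N / (1 - inverse R)^2)"
      using 3 by (simp add: norm_divide norm_mult divide_le_eq mult.commute)
    finally show ?thesis .
  qed
  with degq show ?thesis by blast
qed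

section \<open>Holomorphic extension of real analytic functions\<close>

lemma real_analytic_local_extension:
  assumes "real_analytic_on f {0..1}" "x \<in> {0..1}"
  shows "\<exists>r>0. \<exists>F. F holomorphic_on ball (of_real x) r \<and>
     (\<forall>y\<in>{0..1}. \<bar>y - x\<bar> < r \<longrightarrow> F (of_real y) = of_real (f y))"
proof -
  obtain r a where r: "r > 0" and a: "\<And>y. y \<in> {0..1} \<Longrightarrow> \<bar>y - x\<bar> < r \<Longrightarrow> (\<lambda>n. a n * (y - x) ^ n) sums f y"
    using assms unfolding real_analytic_on_def by blast
  define \<rho> where "\<rho> = min (r / 2) (1 / 2)"
  have \<rho>: "\<rho> > 0" "\<rho> < r" "\<rho> \<le> 1/2" using r by (auto simp: \<rho>_def)
  define y1 where "y1 = (if x \<le> 1/2 then x + \<rho> else x - \<rho>)"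
  have y1: "y1 \<in> {0..1}" "\<bar>y1 - x\<bar> = \<rho>" using assms(2) \<rho> by (auto simp: y1_def)
  have "summable (\<lambda>n. a n * (y1 - x) ^ n)" using a[OF y1(1)] y1(2) \<rho> by (auto simp: sums_iff)
  then have "summable (\<lambda>n. complex_of_real (a n * (y1 - x) ^ n))" by (simp only: summable_of_real)
  then have "summable (\<lambda>n. complex_of_real (a n) * (of_real (y1 - x)) ^ n)" by simp
  moreover have "cmod (complex_of_real y1 - of_real x) = \<rho>"
    using y1(2) by (metis norm_of_real of_real_diff)
  ultimately have sm: "summable (\<lambda>n. complex_of_real (a n) * w ^ n)" if "norm w < \<rho>" for w
    using powser_inside[of "\<lambda>n. complex_of_real (a n)" "of_real (y1 - x)" w] that by simp
  define F where "F = (\<lambda>z. \<Sum>n. complex_of_real (a n) * (z - of_real x) ^ n)"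
  have "F holomorphic_on ball (of_real x) \<rho>"
  proof (rule power_series_holomorphic)
    fix w assume "w \<in> ball (complex_of_real x) \<rho>"
    then show "(\<lambda>n. complex_of_real (a n) * (w - of_real x) ^ n) sums F w"
      unfolding F_def by (intro summable_sums sm) (simp add: dist_norm norm_minus_commute)
  qed
  moreover have "F (of_real y) = of_real (f y)" if "y \<in> {0..1}" "\<bar>y - x\<bar> < \<rho>" for y
  proof -
    have "(\<lambda>n. complex_of_real (a n * (y - x) ^ n)) sums of_real (f y)"
      unfolding sums_of_real_iff using a[OF that(1)] that(2) \<rho> by simp
    then show ?thesis unfolding F_def by (simp add: sums_iff)
  qed
  ultimately show ?thesis using \<rho> by blast
qed

definition clamp01 :: "complex \<Rightarrow> real" where
  "clamp01 z = max 0 (min 1 (Re z))"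

lemma clamp01_in: "clamp01 z \<in> {0..1}" by (auto simp: clamp01_def)

lemma clamp01_of_real: "x \<in> {0..1} \<Longrightarrow> clamp01 (of_real x) = x" by (auto simp: clamp01_def)

lemma clamp01_lipschitz: "\<bar>clamp01 z - clamp01 w\<bar> \<le> cmod (z - w)"
proof -
  have "\<bar>clamp01 z - clamp01 w\<bar> \<le> \<bar>Re (z - w)\<bar>" by (auto simp: clamp01_def)
  then show ?thesis using abs_Re_le_cmod order.trans by blast
qed

definition nbhd01 :: "real \<Rightarrow> complex set" where
  "nbhd01 \<delta> = {z. cmod (z - of_real (clamp01 z)) < \<delta>}"

lemma open_nbhd01: "open (nbhd01 \<delta>)"
  unfolding nbhd01_def clamp01_def by (intro open_Collect_less continuous_intros)

text \<open>The local power series are glued by choosing at \<open>z\<close> the one that belongs to the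
  nearest point of \<open>[0,1]\<close>. Two of them agree on overlaps by the identity theorem: the overlap of two
  discs meeting the interval is connected and contains an accumulation point of \<open>[0,1]\<close>. A Lebesgue number gives the uniform width.\<close>

theorem real_analytic_holomorphic_extension:
  assumes "real_analytic_on f {0..1}"
  obtains \<delta> F where "\<delta> > 0" "F holomorphic_on nbhd01 \<delta>"
    "\<And>x. x \<in> {0..1} \<Longrightarrow> F (of_real x) = of_real (f x)"
proof -
  have "\<forall>x\<in>{0..1}. \<exists>r F. r > 0 \<and> F holomorphic_on ball (of_real x) r \<and>
     (\<forall>y\<in>{0..1}. \<bar>y - x\<bar> < r \<longrightarrow> F (complex_of_real y) = of_real (f y))"
    using real_analytic_local_extension[OF assms] by blast
  then obtain r G where r: "\<And>x. x \<in> {0..1} \<Longrightarrow> r x > 0"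
    and G: "\<And>x. x \<in> {0..1} \<Longrightarrow> G x holomorphic_on ball (of_real x) (r x)"
    and Gf: "\<And>x y. x \<in> {0..1} \<Longrightarrow> y \<in> {0..1} \<Longrightarrow> \<bar>y - x\<bar> < r x \<Longrightarrow> G x (complex_of_real y) = of_real (f y)"
    by metis
  have "compact (complex_of_real ` {0..1})"
    by (intro compact_continuous_image continuous_intros) auto
  then obtain \<delta> where \<delta>: "\<delta> > 0"
    and cov: "\<And>y. y \<in> complex_of_real ` {0..1} \<Longrightarrow> \<exists>B\<in>(\<lambda>x. ball (of_real x) (r x)) ` {0..1}. ball y \<delta> \<subseteq> B"
    by (rule Heine_Borel_lemma[where \<G> = "(\<lambda>x. ball (of_real x) (r x)) ` {0..1}"]) (use r in auto)
  have "\<forall>y\<in>{0..1}. \<exists>x. x \<in> {0..1} \<and> ball (complex_of_real y) \<delta> \<subseteq> ball (of_real x) (r x)"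
    using cov by blast
  then obtain c where c: "\<And>y. y \<in> {0..1} \<Longrightarrow> c y \<in> {0..1}"
    "\<And>y. y \<in> {0..1} \<Longrightarrow> ball (complex_of_real y) \<delta> \<subseteq> ball (of_real (c y)) (r (c y))"
    by metis
  define F where "F z = G (c (clamp01 z)) z" for z
  have Fx: "F (of_real x) = of_real (f x)" if x: "x \<in> {0..1}" for x
  proof -
    have "complex_of_real x \<in> ball (of_real (c x)) (r (c x))"
      by (rule subsetD[OF c(2)[OF x]]) (simp add: \<delta>)
    then have "dist (complex_of_real (c x)) (of_real x) < r (c x)" by simp
    then have "\<bar>x - c x\<bar> < r (c x)" by (simp add: dist_real_def abs_minus_commute)
    then show ?thesis using Gf[OF c(1)[OF x] x] by (simp add: F_def clamp01_of_real[OF x])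
  qed
  have same: "G x z = G x' z" if x: "x \<in> {0..1}" "x' \<in> {0..1}" and y: "y \<in> {0..1}"
    and yb: "of_real y \<in> ball (complex_of_real x) (r x) \<inter> ball (of_real x') (r x')"
    and zb: "z \<in> ball (complex_of_real x) (r x) \<inter> ball (of_real x') (r x')" for x x' y z
  proof -
    let ?A = "ball (complex_of_real x) (r x) \<inter> ball (of_real x') (r x')"
    let ?U = "complex_of_real ` {0..1} \<inter> ?A"
    have "(\<lambda>z. G x z - G x' z) z = 0"
    proof (rule analytic_continuation[where f = "\<lambda>z. G x z - G x' z" and S = ?A and U = ?U and \<xi> = "of_real y"])
      show "(\<lambda>z. G x z - G x' z) holomorphic_on ?A"
        by (intro holomorphic_intros holomorphic_on_subset[OF G[OF x(1)]] holomorphic_on_subset[OF G[OF x(2)]]) auto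
      show "connected ?A" by (intro convex_connected convex_Int convex_ball)
      have "y islimpt {0..1::real}" using y islimpt_Icc[of 0 1 y] by simp
      have "of_real y islimpt complex_of_real ` {0..1}"
        unfolding islimpt_approachable
      proof (intro allI impI)
        fix e :: real assume "e > 0"
        then obtain y' where "y' \<in> {0..1}" "y' \<noteq> y" "dist y' y < e"
          using \<open>y islimpt {0..1::real}\<close> unfolding islimpt_approachable by blast
        then show "\<exists>x'\<in>complex_of_real ` {0..1}. x' \<noteq> of_real y \<and> dist x' (of_real y) < e"
          by (intro bexI[of _ "of_real y'"]) auto
      qed
      then show "of_real y islimpt ?U"
        using islimpt_Int_eventually[of "complex_of_real y" "complex_of_real ` {0..1}" ?A]
          eventually_at_in_open'[of ?A "of_real y"] yb
        by (auto intro: eventually_at_in_open')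
      fix w assume "w \<in> ?U"
      then obtain v where "v \<in> {0..1}" "w = of_real v" "w \<in> ?A" by auto
      then show "G x w - G x' w = 0"
        using Gf[OF x(1), of v] Gf[OF x(2), of v] by (auto simp: dist_real_def abs_minus_commute)
    qed (use yb zb in auto)
    then show ?thesis by simp
  qed
  have "F holomorphic_on nbhd01 \<delta>"
    unfolding holomorphic_on_open[OF open_nbhd01]
  proof
    fix z0 assume z0: "z0 \<in> nbhd01 \<delta>"
    define y0 where "y0 = clamp01 z0"
    have y0: "y0 \<in> {0..1}" by (simp only: y0_def clamp01_in)
    define d where "d = \<delta> - cmod (z0 - of_real y0)"
    have d: "d > 0" using z0 by (simp add: d_def nbhd01_def y0_def)
    have eq: "G (c y0) z = F z" if z: "z \<in> ball z0 d \<inter> nbhd01 \<delta>" for z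
      unfolding F_def
    proof (rule same[where y = "clamp01 z"])
      have z': "cmod (z - z0) < d" using z by (simp add: dist_norm norm_minus_commute)
      have "dist (complex_of_real y0) (of_real (clamp01 z)) \<le> cmod (z - z0)"
        using clamp01_lipschitz[of z z0] by (simp add: y0_def dist_real_def abs_minus_commute)
      then have a: "of_real (clamp01 z) \<in> ball (complex_of_real y0) \<delta>" using z' by (simp add: d_def) (smt (verit) norm_ge_zero)
      have "cmod (z - of_real y0) \<le> cmod (z - z0) + cmod (z0 - of_real y0)"
        by (metis diff_add_cancel add_diff_eq norm_triangle_ineq)
      then have b: "z \<in> ball (complex_of_real y0) \<delta>" using z' by (simp add: d_def dist_norm norm_minus_commute)
      have e: "z \<in> ball (complex_of_real (clamp01 z)) \<delta>" using z by (simp add: nbhd01_def dist_norm norm_minus_commute)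
      show "of_real (clamp01 z) \<in> ball (complex_of_real (c y0)) (r (c y0)) \<inter> ball (of_real (c (clamp01 z))) (r (c (clamp01 z)))"
        using subsetD[OF c(2)[OF y0] a] subsetD[OF c(2)[OF clamp01_in[of z]], of "of_real (clamp01 z)"] \<delta>
        by simp
      show "z \<in> ball (complex_of_real (c y0)) (r (c y0)) \<inter> ball (of_real (c (clamp01 z))) (r (c (clamp01 z)))"
        using b e c(2)[OF y0] c(2)[OF clamp01_in[of z]] by blast
    qed (use c y0 clamp01_in in auto)
    have in0: "z0 \<in> ball (of_real (c y0)) (r (c y0))"
      using c(2)[OF y0] z0 by (auto simp: nbhd01_def y0_def dist_norm norm_minus_commute subset_iff)
    then obtain D where D: "(G (c y0) has_field_derivative D) (at z0)"
      using G[OF c(1)[OF y0]] unfolding holomorphic_on_open[OF open_ball] by blast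
    have "(F has_field_derivative D) (at z0)"
      by (rule has_field_derivative_transform_within_open[OF D, of "ball z0 d \<inter> nbhd01 \<delta>"])
         (use z0 d eq open_nbhd01 in auto)
    then show "\<exists>f'. (F has_field_derivative f') (at z0)" by blast
  qed
  with that[OF \<delta> _ Fx] show ?thesis by blast
qed

section \<open>Linear and Riccati equations on a complex rhombus\<close>

text \<open>A thin rhombus with the vertices \<open>- r\<close> and \<open>1 + r\<close>. What matters is that every direction from a
  point towards the right vertex lies in a narrow cone around the real axis.\<close>

definition rhombus :: "real \<Rightarrow> real \<Rightarrow> complex set" where
  "rhombus \<theta> r = {z. \<bar>Im z\<bar> < \<theta> * (Re z + r) \<and> \<bar>Im z\<bar> < \<theta> * (1 + r - Re z)}"

lemma open_rhombus: "open (rhombus \<theta> r)"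
  unfolding rhombus_def by (intro open_Collect_conj open_Collect_less continuous_intros)

lemma convex_rhombus: "convex (rhombus \<theta> r)"
proof -
  have "rhombus \<theta> r = {z. inner (Complex (-\<theta>) 1) z < \<theta> * r} \<inter> {z. inner (Complex (-\<theta>) (-1)) z < \<theta> * r}
     \<inter> {z. inner (Complex \<theta> 1) z < \<theta> * (1 + r)} \<inter> {z. inner (Complex \<theta> (-1)) z < \<theta> * (1 + r)}"
    by (auto simp: rhombus_def inner_complex_def abs_less_iff algebra_simps)
  then show ?thesis by (simp add: convex_Int convex_halfspace_lt)
qed

lemma rhombus_reflect: "1 - z \<in> rhombus \<theta> r \<longleftrightarrow> z \<in> rhombus \<theta> r"
  by (auto simp: rhombus_def algebra_simps)

lemma rhombus_ray:
  assumes "z \<in> rhombus \<theta> r" "0 \<le> t" "t < 1" "0 < \<theta>" "0 < r"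
  shows "z + of_real t * (of_real (1 + r) - z) \<in> rhombus \<theta> r"
proof -
  have i: "Im (z + of_real t * (of_real (1 + r) - z)) = (1 - t) * Im z"
    and re: "Re (z + of_real t * (of_real (1 + r) - z)) = (1 - t) * Re z + t * (1 + r)"
    by (simp_all add: algebra_simps)
  have "\<bar>(1 - t) * Im z\<bar> = (1 - t) * \<bar>Im z\<bar>" using assms by (simp add: abs_mult)
  moreover have "(1 - t) * \<bar>Im z\<bar> < (1 - t) * (\<theta> * (Re z + r))" "(1 - t) * \<bar>Im z\<bar> < (1 - t) * (\<theta> * (1 + r - Re z))"
    using assms by (auto simp: rhombus_def)
  moreover have "0 \<le> t * (\<theta> * (1 + 2 * r))" using assms by auto
  ultimately show ?thesis unfolding rhombus_def mem_Collect_eq i re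
    by (simp add: algebra_simps)
qed

lemma rhombus_cone:
  assumes "z \<in> rhombus \<theta> r" "0 < \<theta>" "\<theta> \<le> 1/2"
  shows "\<bar>Im (of_real (1 + r) - z)\<bar> \<le> Re (of_real (1 + r) - z) / 2" "0 < Re (of_real (1 + r) - z)"
proof -
  have *: "\<bar>Im z\<bar> < \<theta> * (1 + r - Re z)" using assms by (simp add: rhombus_def)
  then have "0 < \<theta> * (1 + r - Re z)" by (smt (verit) abs_ge_zero)
  then show p: "0 < Re (of_real (1 + r) - z)" using assms by (simp add: zero_less_mult_iff)
  then have "\<theta> * (1 + r - Re z) \<le> 1/2 * (1 + r - Re z)" using assms by (intro mult_right_mono) auto
  then show "\<bar>Im (of_real (1 + r) - z)\<bar> \<le> Re (of_real (1 + r) - z) / 2" using * by simp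
qed

lemma rhombus_bounds:
  assumes "z \<in> rhombus \<theta> r" "0 < \<theta>"
  shows "- r < Re z" "Re z < 1 + r" "\<bar>Im z\<bar> < \<theta> * (1/2 + r)"
proof -
  have *: "\<bar>Im z\<bar> < \<theta> * (1 + r - Re z)" "\<bar>Im z\<bar> < \<theta> * (Re z + r)" using assms by (simp_all add: rhombus_def)
  then have "0 < \<theta> * (1 + r - Re z)" "0 < \<theta> * (Re z + r)" by (smt (verit) abs_ge_zero)+
  then show "- r < Re z" "Re z < 1 + r" using assms by (auto simp: zero_less_mult_iff)
  show "\<bar>Im z\<bar> < \<theta> * (1/2 + r)" using * by (simp add: algebra_simps)
qed

lemma rhombus_norm:
  assumes "z \<in> rhombus \<theta> r" "0 < \<theta>" "\<theta> \<le> 1/2" "0 < r"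
  shows "cmod z \<le> 2 * (1 + r)"
proof -
  have "\<theta> * (1/2 + r) \<le> 1 * (1 + r)" using assms by (intro mult_mono) auto
  moreover have "\<bar>Re z\<bar> \<le> 1 + r" using rhombus_bounds[OF assms(1,2)] assms(4) by (auto simp: abs_le_iff)
  moreover have "\<bar>Im z\<bar> \<le> \<theta> * (1/2 + r)" using rhombus_bounds(3)[OF assms(1,2)] by simp
  ultimately have "\<bar>Re z\<bar> + \<bar>Im z\<bar> \<le> (1 + r) + 1 * (1 + r)" by (meson add_mono order.trans)
  then show ?thesis using cmod_le[of z] by simp
qed

lemma rhombus_contains:
  assumes "x \<in> {0..1}" "cmod (z - of_real x) < \<theta> * r / 2" "0 < \<theta>" "\<theta> \<le> 1/2" "0 < r"
  shows "z \<in> rhombus \<theta> r"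
proof -
  have i: "\<bar>Im z\<bar> < \<theta> * r / 2" using assms(2) abs_Im_le_cmod[of "z - of_real x"] by simp
  have "\<bar>Re z - x\<bar> < \<theta> * r / 2" using assms(2) abs_Re_le_cmod[of "z - of_real x"] by simp
  moreover have "\<theta> * r / 2 \<le> r / 2" using mult_right_mono[OF assms(4), of r] assms by simp
  ultimately have "r / 2 < Re z + r" "r / 2 < 1 + r - Re z" using assms(1) unfolding atLeastAtMost_iff by linarith+
  then have "\<theta> * (r / 2) < \<theta> * (Re z + r)" "\<theta> * (r / 2) < \<theta> * (1 + r - Re z)" using assms(3) by simp_all
  then show ?thesis using i by (simp add: rhombus_def)
qed

text \<open>Compare \<open>P\<close> along the segment with \<open>- A / \<Lambda> * exp (- Re K)\<close>, whose derivative dominates that of \<open>P\<close>.\<close>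

lemma weighted_primitive_bound:
  assumes P: "\<And>\<zeta>. \<zeta> \<in> closed_segment z w \<Longrightarrow> (P has_field_derivative g \<zeta>) (at \<zeta>)"
    and K: "\<And>\<zeta>. \<zeta> \<in> closed_segment z w \<Longrightarrow> (K has_field_derivative k \<zeta>) (at \<zeta>)"
    and g: "\<And>\<zeta>. \<zeta> \<in> closed_segment z w \<Longrightarrow> cmod (g \<zeta>) \<le> A * exp (- Re (K \<zeta>))"
    and k: "\<And>\<zeta>. \<zeta> \<in> closed_segment z w \<Longrightarrow> Re (k \<zeta> * (w - z)) \<ge> \<Lambda> * cmod (w - z)"
    and pos: "\<Lambda> > 0" "A \<ge> 0"
  shows "cmod (P w - P z) \<le> A / \<Lambda> * (exp (- Re (K z)) - exp (- Re (K w)))"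
proof -
  define \<gamma> where "\<gamma> t = z + of_real t * (w - z)" for t :: real
  have seg: "\<gamma> t \<in> closed_segment z w" if "0 \<le> t" "t \<le> 1" for t
    using that by (auto simp: \<gamma>_def closed_segment_def scaleR_conv_of_real algebra_simps intro!: exI[of _ t])
  have \<gamma>': "(\<gamma> has_vector_derivative (w - z)) (at t)" for t
    unfolding \<gamma>_def by (auto intro!: derivative_eq_intros)
  define F where "F = P \<circ> \<gamma>"
  define \<phi> where "\<phi> t = - (A / \<Lambda>) * exp (- Re ((K \<circ> \<gamma>) t))" for t
  have F': "(F has_vector_derivative (w - z) * g (\<gamma> t)) (at t)" if "0 \<le> t" "t \<le> 1" for t
    unfolding F_def by (rule field_vector_diff_chain_at[OF \<gamma>' P[OF seg[OF that]]])
  have K': "((K \<circ> \<gamma>) has_vector_derivative (w - z) * k (\<gamma> t)) (at t)" if "0 \<le> t" "t \<le> 1" for t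
    by (rule field_vector_diff_chain_at[OF \<gamma>' K[OF seg[OF that]]])
  have \<phi>': "(\<phi> has_vector_derivative (A / \<Lambda>) * exp (- Re ((K \<circ> \<gamma>) t)) * Re ((w - z) * k (\<gamma> t))) (at t)" if "0 \<le> t" "t \<le> 1" for t
  proof -
    have "((\<lambda>t. Re ((K \<circ> \<gamma>) t)) has_vector_derivative Re ((w - z) * k (\<gamma> t))) (at t)"
      by (rule bounded_linear.has_vector_derivative[OF bounded_linear_Re K'[OF that]])
    then have "((\<lambda>t. Re ((K \<circ> \<gamma>) t)) has_real_derivative Re ((w - z) * k (\<gamma> t))) (at t)"
      by (simp add: has_real_derivative_iff_has_vector_derivative)
    from DERIV_cmult[OF DERIV_fun_exp[OF DERIV_minus[OF this]], of "- (A / \<Lambda>)"]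
    show ?thesis unfolding \<phi>_def has_real_derivative_iff_has_vector_derivative[symmetric]
      by (simp add: algebra_simps)
  qed
  have "norm (F 1 - F 0) \<le> \<phi> 1 - \<phi> 0"
  proof (rule differentiable_bound_general[of 0 1 F \<phi> "\<lambda>t. (w - z) * g (\<gamma> t)"
        "\<lambda>t. (A / \<Lambda>) * exp (- Re ((K \<circ> \<gamma>) t)) * Re ((w - z) * k (\<gamma> t))"])
    show "continuous_on {0..1} F"
      by (intro continuous_at_imp_continuous_on ballI) (use F' in \<open>auto intro: has_vector_derivative_continuous\<close>)
    show "continuous_on {0..1} \<phi>"
      by (intro continuous_at_imp_continuous_on ballI) (use \<phi>' in \<open>auto intro: has_vector_derivative_continuous\<close>)
    fix t :: real assume t: "0 < t" "t < 1"
    then have s: "\<gamma> t \<in> closed_segment z w" by (intro seg) auto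
    have "norm ((w - z) * g (\<gamma> t)) \<le> cmod (w - z) * (A * exp (- Re (K (\<gamma> t))))"
      unfolding norm_mult by (intro mult_left_mono g s) auto
    also have "\<dots> = (A / \<Lambda>) * exp (- Re (K (\<gamma> t))) * (\<Lambda> * cmod (w - z))" using pos by simp
    also have "\<dots> \<le> (A / \<Lambda>) * exp (- Re (K (\<gamma> t))) * Re (k (\<gamma> t) * (w - z))"
      by (intro mult_left_mono k s) (use pos in auto)
    finally show "norm ((w - z) * g (\<gamma> t)) \<le> (A / \<Lambda>) * exp (- Re ((K \<circ> \<gamma>) t)) * Re ((w - z) * k (\<gamma> t))"
      by (simp add: mult.commute)
  qed (use F' \<phi>' in auto)
  then show ?thesis by (simp add: F_def \<phi>_def \<gamma>_def algebra_simps)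
qed

definition rhombus_ok :: "real \<Rightarrow> real \<Rightarrow> bool" where
  "rhombus_ok \<theta> r \<longleftrightarrow> 0 < \<theta> \<and> \<theta> \<le> 1/2 \<and> 0 < r"

text \<open>The product of \<open>k z\<close> with a direction pointing to the right vertex then has real part at least
  \<open>\<Lambda>\<close> times the length of the direction: \<open>exp (- K)\<close> decays on the way, for any primitive \<open>K\<close> of \<open>k\<close>.\<close>

definition cone_coeff :: "complex set \<Rightarrow> real \<Rightarrow> (complex \<Rightarrow> complex) \<Rightarrow> bool" where
  "cone_coeff W \<Lambda> k \<longleftrightarrow> k holomorphic_on W \<and> 0 < \<Lambda> \<and> (\<exists>B. \<forall>z\<in>W. cmod (k z) \<le> B) \<and>
     (\<forall>z\<in>W. \<bar>Im (k z)\<bar> \<le> Re (k z) \<and> 4 * \<Lambda> \<le> Re (k z))"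

lemma cone_product:
  assumes "\<bar>Im a\<bar> \<le> Re a" "4 * \<Lambda> \<le> Re a" "\<bar>Im v\<bar> \<le> Re v / 2" "0 < Re v" "0 < \<Lambda>"
  shows "\<Lambda> * cmod v \<le> Re (a * v)"
proof -
  have "\<bar>Im a\<bar> * \<bar>Im v\<bar> \<le> Re a * (Re v / 2)" using assms by (intro mult_mono) auto
  then have "Re a * Re v / 2 \<le> Re (a * v)"
    using abs_ge_self[of "Im a * Im v"] by (simp add: abs_mult)
  moreover have "4 * \<Lambda> * Re v \<le> Re a * Re v" using assms by (intro mult_right_mono) auto
  moreover have "cmod v \<le> 2 * Re v" using cmod_le[of v] assms by linarith
  then have "\<Lambda> * cmod v \<le> \<Lambda> * (2 * Re v)" using assms by (intro mult_left_mono) auto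
  ultimately show ?thesis by simp
qed

lemma primitive_on_rhombus:
  assumes "f holomorphic_on rhombus \<theta> r"
  obtains F where "\<And>z. z \<in> rhombus \<theta> r \<Longrightarrow> (F has_field_derivative f z) (at z)"
proof -
  obtain F where "\<And>z. z \<in> rhombus \<theta> r \<Longrightarrow> (F has_field_derivative f z) (at z within rhombus \<theta> r)"
    using holomorphic_convex_primitive'[OF convex_rhombus open_rhombus assms] by blast
  then show ?thesis using that at_within_open[OF _ open_rhombus] by metis
qed

text \<open>The equation \<open>v' = k v - g\<close> is unstable to the right, so the bounded solution is obtained by integrating from the
  right vertex: \<open>v z = exp (K z) * (\<integral> exp (- K) g)\<close> over the segment from \<open>z\<close> to \<open>1 + r\<close>. The bound does not see
  the size of \<open>k\<close> but only the lower bound \<open>\<Lambda>\<close>, which is what makes it robust for singular perturbations. The vertex is not in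
  \<open>W\<close>; the primitive extends continuously to it.\<close>

theorem backward_solution:
  fixes \<theta> r :: real
  defines "W \<equiv> rhombus \<theta> r"
  assumes ok: "rhombus_ok \<theta> r" and k: "cone_coeff W \<Lambda> k"
    and g: "g holomorphic_on W" "\<And>z. z \<in> W \<Longrightarrow> cmod (g z) \<le> G"
  shows "\<exists>v. \<forall>z\<in>W. (v has_field_derivative k z * v z - g z) (at z) \<and> cmod (v z) \<le> G / \<Lambda>"
proof -
  have ok': "0 < \<theta>" "\<theta> \<le> 1/2" "0 < r" using ok by (auto simp: rhombus_ok_def)
  obtain B where kh: "k holomorphic_on W" and \<Lambda>: "0 < \<Lambda>" and B: "\<And>z. z \<in> W \<Longrightarrow> cmod (k z) \<le> B"
    and kc: "\<And>z. z \<in> W \<Longrightarrow> \<bar>Im (k z)\<bar> \<le> Re (k z) \<and> 4 * \<Lambda> \<le> Re (k z)"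
    using k unfolding cone_coeff_def by blast
  obtain K where K: "\<And>z. z \<in> W \<Longrightarrow> (K has_field_derivative k z) (at z)"
    using primitive_on_rhombus kh unfolding W_def by blast
  have Kh: "K holomorphic_on W" using K by (auto simp: holomorphic_on_open open_rhombus W_def)
  have "(\<lambda>z. exp (- K z) * g z) holomorphic_on rhombus \<theta> r"
    using g(1) Kh unfolding W_def by (intro holomorphic_intros)
  then obtain P where P: "\<And>z. z \<in> W \<Longrightarrow> (P has_field_derivative exp (- K z) * g z) (at z)"
    unfolding W_def by (rule primitive_on_rhombus) blast
  have half: "1/2 \<in> W" using rhombus_contains[of "1/2" "1/2"] ok' by (simp add: W_def)
  have G0: "0 \<le> G" using g(2)[OF half] norm_ge_zero order.trans by blast
  have B0: "0 \<le> B" using B[OF half] norm_ge_zero order.trans by blast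
  define D where "D = 4 * (1 + r)"
  have diam: "cmod (z - w) \<le> D" if "z \<in> W" "w \<in> W" for z w
    using norm_triangle_ineq4[of z w] rhombus_norm[of z \<theta> r] rhombus_norm[of w \<theta> r] that ok'
    by (simp add: W_def D_def)
  define L where "L = exp (cmod (K (1/2)) + B * D)"
  have L: "cmod (exp (- K z)) \<le> L" if z: "z \<in> W" for z
  proof -
    have "cmod (K z - K (1/2)) \<le> B * cmod (z - 1/2)"
      by (rule field_differentiable_bound[of W K k])
        (use K B z half convex_rhombus in \<open>auto simp: W_def intro: has_field_derivative_at_within\<close>)
    also have "\<dots> \<le> B * D" using diam[OF z half] B0 by (intro mult_left_mono) auto
    finally have "cmod (K z) \<le> cmod (K (1/2)) + B * D"
      using norm_triangle_ineq2[of "K z" "K (1/2)"] by linarith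
    moreover have "- Re (K z) \<le> cmod (K z)" using abs_Re_le_cmod[of "K z"] by linarith
    ultimately show ?thesis by (simp add: L_def)
  qed
  have lip: "cmod (P z - P w) \<le> L * G * cmod (z - w)" if "z \<in> W" "w \<in> W" for z w
  proof (rule field_differentiable_bound[of W P "\<lambda>z. exp (- K z) * g z"])
    fix u assume u: "u \<in> W"
    have "cmod (exp (- K u)) * cmod (g u) \<le> L * G"
      by (rule mult_mono[OF L[OF u] g(2)[OF u]]) (auto simp: L_def)
    then show "cmod (exp (- K u) * g u) \<le> L * G" by (simp only: norm_mult)
  qed (use P that convex_rhombus in \<open>auto simp: W_def intro: has_field_derivative_at_within\<close>)
  have LG: "L * G \<ge> 0" using G0 by (simp add: L_def)
  have "uniformly_continuous_on W P"
    unfolding uniformly_continuous_on_def dist_norm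
  proof (intro allI impI)
    fix e :: real assume e: "e > 0"
    show "\<exists>d>0. \<forall>x\<in>W. \<forall>x'\<in>W. cmod (x' - x) < d \<longrightarrow> cmod (P x' - P x) < e"
    proof (intro exI[of _ "e / (L * G + 1)"] conjI ballI impI)
      fix x x' assume "x \<in> W" "x' \<in> W" "cmod (x' - x) < e / (L * G + 1)"
      then have "cmod (x' - x) * (L * G + 1) < e" using LG by (simp add: field_simps)
      moreover have "cmod (P x' - P x) \<le> L * G * cmod (x' - x)" by (rule lip) fact+
      moreover have "cmod (x' - x) * (L * G + 1) = L * G * cmod (x' - x) + cmod (x' - x)" by (simp add: algebra_simps)
      ultimately show "cmod (P x' - P x) < e" using norm_ge_zero[of "x' - x"] by linarith
    qed (use e LG in auto)
  qed
  then obtain P0 where P0: "uniformly_continuous_on (closure W) P0" "\<And>z. z \<in> W \<Longrightarrow> P z = P0 z"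
    by (rule uniformly_continuous_on_extension_on_closure) blast
  \<comment> \<open>the right vertex, approached along the segment from each point\<close>
  define a where "a = complex_of_real (1 + r)"
  define t where "t n = 1 - inverse (real (Suc n))" for n
  have t: "0 \<le> t n" "t n < 1" for n by (auto simp: t_def inverse_le_1_iff)
  define w where "w z n = z + of_real (t n) * (a - z)" for z n
  have wW: "w z n \<in> W" if "z \<in> W" for z n
    unfolding w_def a_def W_def by (rule rhombus_ray) (use that t ok' in \<open>auto simp: W_def\<close>)
  have tlim: "t \<longlonglongrightarrow> 1"
    using tendsto_diff[OF tendsto_const[of 1] LIMSEQ_inverse_real_of_nat] by (simp add: t_def[abs_def])
  have wlim: "w z \<longlonglongrightarrow> a" for z
  proof -
    have "(\<lambda>n. z + of_real (t n) * (a - z)) \<longlonglongrightarrow> z + of_real 1 * (a - z)"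
      by (intro tendsto_intros tlim)
    then show ?thesis by (simp add: w_def[abs_def])
  qed
  have acl: "a \<in> closure W" unfolding closure_sequential using wW[OF half] wlim by blast
  define v where "v z = exp (K z) * (P0 a - P z)" for z
  have bound: "cmod (P0 a - P z) \<le> G / \<Lambda> * exp (- Re (K z))" if z: "z \<in> W" for z
  proof (rule Lim_norm_ubound[of sequentially "\<lambda>n. P (w z n) - P z"])
    have "(\<lambda>n. P0 (w z n)) \<longlonglongrightarrow> P0 a"
      by (rule continuous_on_tendsto_compose[OF uniformly_continuous_imp_continuous[OF P0(1)] wlim acl])
        (use wW[OF z] closure_subset in \<open>auto intro!: always_eventually\<close>)
    then show "(\<lambda>n. P (w z n) - P z) \<longlonglongrightarrow> P0 a - P z"
      using P0(2)[OF wW[OF z]] by (intro tendsto_diff) auto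
    show "\<forall>\<^sub>F n in sequentially. cmod (P (w z n) - P z) \<le> G / \<Lambda> * exp (- Re (K z))"
    proof (intro always_eventually allI)
      fix n
      have seg: "\<zeta> \<in> W" if "\<zeta> \<in> closed_segment z (w z n)" for \<zeta>
        using that closed_segment_subset[OF z wW[OF z] convex_rhombus[of \<theta> r, folded W_def]] by blast
      have "cmod (P (w z n) - P z) \<le> G / \<Lambda> * (exp (- Re (K z)) - exp (- Re (K (w z n))))"
      proof (rule weighted_primitive_bound[where g = "\<lambda>z. exp (- K z) * g z" and k = k])
        fix \<zeta> assume "\<zeta> \<in> closed_segment z (w z n)"
        then have \<zeta>: "\<zeta> \<in> W" by (rule seg)
        show "(P has_field_derivative exp (- K \<zeta>) * g \<zeta>) (at \<zeta>)" "(K has_field_derivative k \<zeta>) (at \<zeta>)"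
          using P K \<zeta> by auto
        show "cmod (exp (- K \<zeta>) * g \<zeta>) \<le> G * exp (- Re (K \<zeta>))"
          using g(2)[OF \<zeta>] by (simp add: norm_mult mult.commute)
        have "\<Lambda> * cmod (a - z) \<le> Re (k \<zeta> * (a - z))"
          unfolding a_def by (rule cone_product) (use kc[OF \<zeta>] \<Lambda> rhombus_cone[of z \<theta> r] z ok' in \<open>auto simp: W_def\<close>)
        then have "t n * (\<Lambda> * cmod (a - z)) \<le> t n * Re (k \<zeta> * (a - z))" using t by (intro mult_left_mono) auto
        moreover have "w z n - z = of_real (t n) * (a - z)" by (simp add: w_def)
        moreover have "Re (k \<zeta> * (of_real (t n) * (a - z))) = t n * Re (k \<zeta> * (a - z))"
          by (simp add: algebra_simps)
        ultimately show "\<Lambda> * cmod (w z n - z) \<le> Re (k \<zeta> * (w z n - z))"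
          using t by (simp only: norm_mult norm_of_real) (simp add: mult_ac)
      qed (use \<Lambda> G0 in auto)
      also have "\<dots> \<le> G / \<Lambda> * exp (- Re (K z))" using \<Lambda> G0 by (intro mult_left_mono) auto
      finally show "cmod (P (w z n) - P z) \<le> G / \<Lambda> * exp (- Re (K z))" .
    qed
  qed auto
  show ?thesis
  proof (intro exI[of _ v] ballI conjI)
    fix z assume z: "z \<in> W"
    have "(v has_field_derivative exp (K z) * (0 - exp (- K z) * g z) + exp (K z) * k z * (P0 a - P z)) (at z)"
      unfolding v_def using K[OF z] P[OF z] by (auto intro!: derivative_eq_intros)
    moreover have "exp (K z) * exp (- K z) = 1" by (simp flip: exp_add)
    then have "exp (K z) * (0 - exp (- K z) * g z) = - g z" by (simp add: mult.assoc[symmetric])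
    then have "exp (K z) * (0 - exp (- K z) * g z) + exp (K z) * k z * (P0 a - P z) = k z * v z - g z"
      by (simp add: v_def)
    ultimately show "(v has_field_derivative k z * v z - g z) (at z)" by (simp only:)
    have "cmod (v z) = exp (Re (K z)) * cmod (P0 a - P z)" by (simp add: v_def norm_mult)
    also have "\<dots> \<le> exp (Re (K z)) * (G / \<Lambda> * exp (- Re (K z)))" by (intro mult_left_mono bound z) auto
    also have "\<dots> = G / \<Lambda> * (exp (Re (K z)) * exp (- Re (K z)))" by (simp only: mult_ac)
    also have "\<dots> = G / \<Lambda>" by (simp flip: exp_add)
    finally show "cmod (v z) \<le> G / \<Lambda>" .
  qed
qed

text \<open>Locally uniform limits of holomorphic functions are holomorphic, and their derivatives converge.\<close>

lemma geometric_iteration_limit: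
  fixes D D' :: "nat \<Rightarrow> complex \<Rightarrow> complex"
  assumes "open W" and D': "\<And>n z. z \<in> W \<Longrightarrow> (D n has_field_derivative D' n z) (at z)"
    and step: "\<And>n z. z \<in> W \<Longrightarrow> cmod (D (Suc n) z - D n z) \<le> Q * (1/2) ^ n"
  obtains d d' where "\<And>z. z \<in> W \<Longrightarrow> (\<lambda>n. D n z) \<longlonglongrightarrow> d z"
    "\<And>z. z \<in> W \<Longrightarrow> (d has_field_derivative d' z) (at z)" "\<And>z. z \<in> W \<Longrightarrow> (\<lambda>n. D' n z) \<longlonglongrightarrow> d' z"
proof -
  have "uniform_limit W (\<lambda>n z. \<Sum>i<n. D (Suc i) z - D i z) (\<lambda>z. \<Sum>i. D (Suc i) z - D i z) sequentially"
    by (rule Weierstrass_m_test[where M = "\<lambda>n. Q * (1/2) ^ n"]) (use step in \<open>auto intro!: summable_mult summable_geometric\<close>)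
  then have "uniform_limit W (\<lambda>n z. D 0 z + (\<Sum>i<n. D (Suc i) z - D i z)) (\<lambda>z. D 0 z + (\<Sum>i. D (Suc i) z - D i z)) sequentially"
    by (intro uniform_limit_intros)
  moreover have "(\<lambda>n z. D 0 z + (\<Sum>i<n. D (Suc i) z - D i z)) = D"
    by (intro ext, subst sum_lessThan_telescope) simp
  ultimately obtain d where u: "uniform_limit W D d sequentially" by auto
  obtain d' where d': "\<And>z. z \<in> W \<Longrightarrow> (d has_field_derivative d' z) (at z) \<and> (\<lambda>n. D' n z) \<longlonglongrightarrow> d' z"
  proof -
    have "\<exists>d'. \<forall>z\<in>W. (d has_field_derivative d' z) (at z) \<and> (\<lambda>n. D' n z) \<longlonglongrightarrow> d' z"
    proof (rule has_complex_derivative_uniform_sequence[OF assms(1) D'])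
      fix x assume "x \<in> W"
      then obtain e where "e > 0" "cball x e \<subseteq> W" using assms(1) open_contains_cball by blast
      then show "\<exists>e>0. cball x e \<subseteq> W \<and> uniform_limit (cball x e) D d sequentially"
        using uniform_limit_on_subset[OF u] by blast
    qed
    then show ?thesis using that by blast
  qed
  show ?thesis using that[of d d'] d' tendsto_uniform_limitI[OF u] by blast
qed

text \<open>Picard iteration \<open>d' = k d - (g - d\<^sup>2)\<close> with \<open>backward_solution\<close>. On the ball
  of radius \<open>2 G / \<Lambda>\<close> the map \<open>d \<mapsto> d\<^sup>2\<close> followed by the solution operator has the
  Lipschitz constant \<open>4 G / \<Lambda>\<^sup>2 \<le> 1 / 2\<close>.\<close>

theorem riccati_solution:
  fixes \<theta> r :: real
  defines "W \<equiv> rhombus \<theta> r"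
  assumes ok: "rhombus_ok \<theta> r" and k: "cone_coeff W \<Lambda> k"
    and g: "g holomorphic_on W" "\<And>z. z \<in> W \<Longrightarrow> cmod (g z) \<le> G" and small: "8 * G \<le> \<Lambda>\<^sup>2"
  shows "\<exists>d. \<forall>z\<in>W. (d has_field_derivative k z * d z + (d z)\<^sup>2 - g z) (at z) \<and> cmod (d z) \<le> 2 * (G / \<Lambda>)"
proof -
  have \<Lambda>: "0 < \<Lambda>" and kh: "k holomorphic_on W" using k by (auto simp: cone_coeff_def)
  have half: "1/2 \<in> W" using rhombus_contains[of "1/2" "1/2"] ok by (simp add: W_def rhombus_ok_def)
  have G0: "0 \<le> G" using g(2)[OF half] norm_ge_zero order.trans by blast
  define q where "q = G / \<Lambda>"
  have q: "0 \<le> q" "8 * q \<le> \<Lambda>" using \<Lambda> G0 small by (auto simp: q_def field_simps power2_eq_square)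
  let ?inv = "\<lambda>n (P, D). P holomorphic_on W \<and> (\<forall>z\<in>W. (D has_field_derivative k z * D z + (P z)\<^sup>2 - g z) (at z) \<and>
      cmod (P z) \<le> 2 * q \<and> cmod (D z) \<le> 2 * q - q * (1/2) ^ n \<and> cmod (D z - P z) \<le> q * (1/2) ^ n)"
  have "\<exists>f. \<forall>n. ?inv n (f n) \<and> fst (f (Suc n)) = snd (f n)"
  proof (rule dependent_nat_choice)
    obtain D where "\<forall>z\<in>W. (D has_field_derivative k z * D z - g z) (at z) \<and> cmod (D z) \<le> G / \<Lambda>"
      using backward_solution[OF ok k[unfolded W_def] g[unfolded W_def]] unfolding W_def by blast
    then have "?inv 0 (\<lambda>z. 0, D)" using q by (auto simp: q_def)
    then show "\<exists>x. ?inv 0 x" by blast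
  next
    fix x :: "(complex \<Rightarrow> complex) \<times> (complex \<Rightarrow> complex)" and n assume inv: "?inv n x"
    obtain P D where x: "x = (P, D)" by (cases x)
    have Ph: "P holomorphic_on W" and D': "\<And>z. z \<in> W \<Longrightarrow> (D has_field_derivative k z * D z + (P z)\<^sup>2 - g z) (at z)"
      and b: "\<And>z. z \<in> W \<Longrightarrow> cmod (P z) \<le> 2 * q \<and> cmod (D z) \<le> 2 * q - q * (1/2) ^ n \<and> cmod (D z - P z) \<le> q * (1/2) ^ n"
      using inv unfolding x by auto
    have Dh: "D holomorphic_on W" using D' by (auto simp: holomorphic_on_open open_rhombus W_def)
    have "\<exists>E. \<forall>z\<in>W. (E has_field_derivative k z * E z - ((P z)\<^sup>2 - (D z)\<^sup>2)) (at z) \<and> cmod (E z) \<le> (4 * q * (q * (1/2) ^ n)) / \<Lambda>"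
      unfolding W_def
    proof (rule backward_solution[OF ok k[unfolded W_def]])
      show "(\<lambda>z. (P z)\<^sup>2 - (D z)\<^sup>2) holomorphic_on rhombus \<theta> r"
        using Ph Dh unfolding W_def by (intro holomorphic_intros)
      fix z assume "z \<in> rhombus \<theta> r"
      then have z: "z \<in> W" by (simp add: W_def)
      have "0 \<le> q * (1/2) ^ n" using q by simp
      then have "cmod (P z + D z) \<le> 4 * q" using b[OF z] norm_triangle_ineq[of "P z" "D z"] by linarith
      then have "cmod (P z + D z) * cmod (D z - P z) \<le> (4 * q) * (q * (1/2) ^ n)"
        using b[OF z] by (intro mult_mono) (use q in auto)
      moreover have "cmod ((P z)\<^sup>2 - (D z)\<^sup>2) = cmod (P z + D z) * cmod (D z - P z)"
        unfolding norm_mult[symmetric] by (subst norm_minus_commute) (simp add: power2_eq_square algebra_simps)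
      ultimately show "cmod ((P z)\<^sup>2 - (D z)\<^sup>2) \<le> 4 * q * (q * (1/2) ^ n)" by simp
    qed
    then obtain E where E: "\<And>z. z \<in> W \<Longrightarrow> (E has_field_derivative k z * E z - ((P z)\<^sup>2 - (D z)\<^sup>2)) (at z)"
      "\<And>z. z \<in> W \<Longrightarrow> cmod (E z) \<le> (4 * q * (q * (1/2) ^ n)) / \<Lambda>" by blast
    have "(4 * q * (q * (1/2) ^ n)) / \<Lambda> = (8 * q) / \<Lambda> * (q * (1/2) ^ n) / 2" by simp
    also have "\<dots> \<le> 1 * (q * (1/2) ^ n) / 2" using q \<Lambda> by (intro divide_right_mono mult_right_mono) auto
    finally have E2: "cmod (E z) \<le> q * (1/2) ^ n / 2" if "z \<in> W" for z using E(2)[OF that] by linarith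
    have "?inv (Suc n) (D, \<lambda>z. D z + E z)"
    proof (unfold prod.case, intro conjI ballI Dh)
      fix z assume z: "z \<in> W"
      have "((\<lambda>z. D z + E z) has_field_derivative (k z * D z + (P z)\<^sup>2 - g z) + (k z * E z - ((P z)\<^sup>2 - (D z)\<^sup>2))) (at z)"
        by (intro DERIV_add D' E z)
      then show "((\<lambda>z. D z + E z) has_field_derivative k z * (D z + E z) + (D z)\<^sup>2 - g z) (at z)"
        by (simp add: algebra_simps)
      have p: "0 \<le> q * (1/2) ^ n" using q by simp
      show "cmod (D z) \<le> 2 * q" using b[OF z] p by linarith
      show "cmod (D z + E z - D z) \<le> q * (1/2) ^ Suc n" using E2[OF z] by simp
      have "cmod (D z + E z) \<le> 2 * q - q * (1/2) ^ n / 2"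
        using b[OF z] E2[OF z] norm_triangle_ineq[of "D z" "E z"] by linarith
      then show "cmod (D z + E z) \<le> 2 * q - q * (1/2) ^ Suc n" by simp
    qed
    then show "\<exists>y. ?inv (Suc n) y \<and> fst y = snd x" unfolding x by force
  qed
  then obtain f where f0: "\<forall>n. ?inv n (f n) \<and> fst (f (Suc n)) = snd (f n)" ..
  have f: "?inv n (f n)" "fst (f (Suc n)) = snd (f n)" for n
    using spec[OF f0, of n] by (rule conjunct1, rule conjunct2)
  define D where "D n = snd (f n)" for n
  define P where "P n = fst (f n)" for n
  have D': "(D n has_field_derivative k z * D n z + (P n z)\<^sup>2 - g z) (at z)"
    and Db: "cmod (D n z) \<le> 2 * q - q * (1/2) ^ n" and Ds: "cmod (D n z - P n z) \<le> q * (1/2) ^ n"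
    if "z \<in> W" for n z
    using f(1)[of n] that by (auto simp: D_def P_def split: prod.splits)
  have PS: "P (Suc n) = D n" for n by (simp add: P_def D_def f(2))
  obtain d d' where d: "\<And>z. z \<in> W \<Longrightarrow> (\<lambda>n. D n z) \<longlonglongrightarrow> d z"
    "\<And>z. z \<in> W \<Longrightarrow> (d has_field_derivative d' z) (at z)"
    "\<And>z. z \<in> W \<Longrightarrow> (\<lambda>n. k z * D n z + (P n z)\<^sup>2 - g z) \<longlonglongrightarrow> d' z"
  proof (rule geometric_iteration_limit[where W = W and D = D and D' = "\<lambda>n z. k z * D n z + (P n z)\<^sup>2 - g z" and Q = q])
    fix n z assume z: "z \<in> W"
    have "cmod (D (Suc n) z - D n z) \<le> q * (1/2) ^ Suc n" using Ds[OF z, of "Suc n"] by (simp add: PS)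
    also have "\<dots> \<le> q * (1/2) ^ n" using q by (intro mult_left_mono power_decreasing) auto
    finally show "cmod (D (Suc n) z - D n z) \<le> q * (1/2) ^ n" .
  qed (use D' open_rhombus in \<open>auto simp: W_def\<close>)
  show ?thesis
  proof (intro exI[of _ d] ballI conjI)
    fix z assume z: "z \<in> W"
    have "(\<lambda>n. P (Suc n) z) \<longlonglongrightarrow> d z" using d(1)[OF z] by (simp add: PS)
    then have "(\<lambda>n. P n z) \<longlonglongrightarrow> d z" by (rule LIMSEQ_imp_Suc)
    then have "(\<lambda>n. k z * D n z + (P n z)\<^sup>2 - g z) \<longlonglongrightarrow> k z * d z + (d z)\<^sup>2 - g z"
      by (intro tendsto_intros d z)
    then have "d' z = k z * d z + (d z)\<^sup>2 - g z" using d(3)[OF z] LIMSEQ_unique by blast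
    then show "(d has_field_derivative k z * d z + (d z)\<^sup>2 - g z) (at z)" using d(2)[OF z] by simp
    have "cmod (D n z) \<le> 2 * q" for n
    proof -
      have "0 \<le> q * (1/2) ^ n" using q by simp
      then show ?thesis using Db[OF z, of n] by linarith
    qed
    then have "cmod (d z) \<le> 2 * q"
      by (intro Lim_norm_ubound[OF _ d(1)[OF z]]) auto
    then show "cmod (d z) \<le> 2 * (G / \<Lambda>)" by (simp add: q_def)
  qed
qed

section \<open>Layer functions of the singularly perturbed equation\<close>

text \<open>Narrow sectors around the positive real axis. Opening angles are tracked through squares, square roots and quotients
  so that the characteristic roots built from the coefficients still satisfy \<open>cone_coeff\<close>.\<close>

definition sector :: "real \<Rightarrow> complex \<Rightarrow> bool" where
  "sector t z \<longleftrightarrow> \<bar>Im z\<bar> \<le> t * Re z"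

lemma sector_add: "sector t z \<Longrightarrow> sector t w \<Longrightarrow> sector t (z + w)"
  unfolding sector_def by (simp add: distrib_left)

lemma sector_scale: assumes "sector t z" "0 \<le> a" shows "sector t (of_real a * z)"
proof -
  have "a * \<bar>Im z\<bar> \<le> a * (t * Re z)" using assms by (intro mult_left_mono) (auto simp: sector_def)
  then show ?thesis using assms by (simp add: sector_def abs_mult mult_ac)
qed

lemma sector_weaken: "sector t z \<Longrightarrow> t \<le> t' \<Longrightarrow> 0 \<le> Re z \<Longrightarrow> sector t' z"
  unfolding sector_def by (meson mult_right_mono order.trans)

lemma sector_square:
  assumes "sector (1/20) z" "0 \<le> Re z"
  shows "sector (1/9) (z\<^sup>2)" "4/5 * (Re z)\<^sup>2 \<le> Re (z\<^sup>2)"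
proof -
  have i: "\<bar>Im z\<bar> \<le> Re z / 20" using assms by (simp add: sector_def)
  have "\<bar>Im z\<bar> * \<bar>Im z\<bar> \<le> (Re z / 20) * (Re z / 20)" using i assms by (intro mult_mono) auto
  then have 1: "(Im z)\<^sup>2 \<le> (Re z)\<^sup>2 / 400" by (simp add: power2_eq_square flip: abs_mult)
  have 2: "0 \<le> (Re z)\<^sup>2" by simp
  have re: "Re (z\<^sup>2) = (Re z)\<^sup>2 - (Im z)\<^sup>2" and im: "Im (z\<^sup>2) = 2 * (Re z * Im z)"
    by (simp_all add: power2_eq_square)
  show "4/5 * (Re z)\<^sup>2 \<le> Re (z\<^sup>2)" unfolding re using 1 2 by linarith
  have "\<bar>Re z * Im z\<bar> \<le> Re z * (Re z / 20)" unfolding abs_mult using i assms by (intro mult_mono) auto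
  then have "\<bar>Im (z\<^sup>2)\<bar> \<le> (Re z)\<^sup>2 / 10" unfolding im abs_mult by (simp add: power2_eq_square)
  then have "9 * \<bar>Im (z\<^sup>2)\<bar> \<le> (Re z)\<^sup>2 - (Im z)\<^sup>2" using 1 2 by argo
  then show "sector (1/9) (z\<^sup>2)" unfolding sector_def re by simp
qed

lemma sector_csqrt:
  assumes "sector (1/9) q" "0 < Re q"
  shows "sector (1/18) (csqrt q)" "sqrt (Re q) \<le> Re (csqrt q)"
proof -
  define k where "k = csqrt q"
  have k2: "k\<^sup>2 = q" by (simp add: k_def)
  have re: "Re q = (Re k)\<^sup>2 - (Im k)\<^sup>2" and im: "Im q = 2 * (Re k * Im k)"
    by (simp_all add: k2[symmetric] power2_eq_square)
  have k0: "0 \<le> Re k" unfolding k_def using csqrt_principal[of q] by auto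
  have "Re q \<le> (Re k)\<^sup>2" unfolding re by simp
  then show "sqrt (Re q) \<le> Re (csqrt q)" using k0 by (simp add: k_def real_le_lsqrt)
  have kp: "0 < Re k" using assms(2) k0 re by (cases "Re k = 0") auto
  have "2 * (Re k * \<bar>Im k\<bar>) = \<bar>Im q\<bar>" unfolding im abs_mult using k0 by simp
  also have "\<dots> \<le> Re q / 9" using assms by (simp add: sector_def)
  also have "\<dots> \<le> (Re k)\<^sup>2 / 9" using \<open>Re q \<le> (Re k)\<^sup>2\<close> by simp
  finally have "Re k * \<bar>Im k\<bar> \<le> Re k * (Re k / 18)" by (simp add: power2_eq_square)
  then have "\<bar>Im k\<bar> \<le> Re k / 18" using kp by (simp only: mult_le_cancel_left_pos)
  then show "sector (1/18) (csqrt q)" unfolding sector_def k_def[symmetric] by simp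
qed

lemma sector_divide:
  assumes "sector (1/20) z" "sector (1/18) w" "0 < Re z" "0 < Re w"
  shows "sector (1/9) (z / w)" "Re z / (2 * Re w) \<le> Re (z / w)"
proof -
  define a b where "a = Re z * Re w" and "b = Im z * Im w"
  have zi: "\<bar>Im z\<bar> \<le> Re z / 20" "\<bar>Im w\<bar> \<le> Re w / 18" using assms by (auto simp: sector_def)
  have a: "0 < a" using assms by (simp add: a_def)
  have "\<bar>b\<bar> \<le> (Re z / 20) * (Re w / 18)" unfolding b_def abs_mult using zi assms by (intro mult_mono) auto
  then have b: "\<bar>b\<bar> \<le> a / 360" by (simp add: a_def)
  have c: "\<bar>Im z * Re w\<bar> \<le> a / 20" "\<bar>Re z * Im w\<bar> \<le> a / 18"
    using mult_right_mono[OF zi(1), of "Re w"] mult_left_mono[OF zi(2), of "Re z"] assms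
    by (auto simp: abs_mult a_def)
  define d where "d = (Re w)\<^sup>2 + (Im w)\<^sup>2"
  have d: "0 < d" using assms by (simp add: d_def add_pos_nonneg)
  have re: "Re (z / w) = (a + b) / d" and im: "Im (z / w) = (Im z * Re w - Re z * Im w) / d"
    by (simp_all add: Re_divide Im_divide d_def a_def b_def)
  have "\<bar>Im z * Re w - Re z * Im w\<bar> \<le> a / 20 + a / 18"
    using c by (meson abs_triangle_ineq4 add_mono order.trans)
  also have "\<dots> \<le> 1/9 * (a - a / 360)" using a by simp
  also have "\<dots> \<le> 1/9 * (a + b)" using b by (simp add: abs_le_iff)
  finally have "\<bar>Im z * Re w - Re z * Im w\<bar> \<le> 1/9 * (a + b)" .
  then show "sector (1/9) (z / w)" unfolding sector_def re im using d
    by (simp add: abs_divide divide_right_mono flip: times_divide_eq_right) (simp add: field_simps)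
  have "\<bar>Im w\<bar> * \<bar>Im w\<bar> \<le> (Re w / 18) * (Re w / 18)" using zi assms by (intro mult_mono) auto
  then have "(Im w)\<^sup>2 \<le> (Re w)\<^sup>2 / 324" by (simp add: power2_eq_square flip: abs_mult)
  then have "d \<le> 3/2 * (Re w)\<^sup>2" using zero_le_power2[of "Re w"] unfolding d_def by linarith
  then have "Re z * d \<le> Re z * (3/2 * (Re w)\<^sup>2)" using assms by (intro mult_left_mono) auto
  also have "\<dots> = 3/2 * a * Re w" by (simp add: a_def power2_eq_square)
  also have "\<dots> \<le> 2 * (a + b) * Re w" using b a assms by (intro mult_right_mono) (auto simp: abs_le_iff)
  finally show "Re z / (2 * Re w) \<le> Re (z / w)" unfolding re using d assms by (simp add: field_simps)
qed

definition cx_solution :: "complex set \<Rightarrow> real \<Rightarrow> real \<Rightarrow> (complex \<Rightarrow> complex) \<Rightarrow> (complex \<Rightarrow> complex) \<Rightarrow>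
    (complex \<Rightarrow> complex) \<Rightarrow> (complex \<Rightarrow> complex) \<Rightarrow> bool" where
  "cx_solution W \<epsilon>1 \<epsilon>2 B C F u \<longleftrightarrow> (\<exists>u' u''. \<forall>z\<in>W. (u has_field_derivative u' z) (at z) \<and>
     (u' has_field_derivative u'' z) (at z) \<and>
     - of_real \<epsilon>1 * u'' z + of_real \<epsilon>2 * B z * u' z + C z * u z = F z)"

text \<open>The function \<open>exp (- M)\<close> is a boundary layer at \<open>0\<close> of rate \<open>\<mu>\<close>: on \<open>W\<close> the derivative of
  \<open>M\<close> is comparable to \<open>\<mu>\<close>, with constants \<open>c\<close> and \<open>A\<close>.\<close>

definition layer_phase :: "complex set \<Rightarrow> real \<Rightarrow> real \<Rightarrow> real \<Rightarrow> (complex \<Rightarrow> complex) \<Rightarrow> bool" where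
  "layer_phase W c A \<mu> M \<longleftrightarrow> M 0 = 0 \<and> (\<exists>m. \<forall>z\<in>W. (M has_field_derivative m z) (at z) \<and>
     c * \<mu> \<le> Re (m z) \<and> cmod (m z) \<le> A * \<mu>)"

text \<open>Up to constants, \<open>1 / scale\<close> and \<open>scale / \<epsilon>1\<close> are the moduli of the two characteristic roots.\<close>

definition scale :: "real \<Rightarrow> real \<Rightarrow> real" where
  "scale \<epsilon>1 \<epsilon>2 = \<epsilon>2 + sqrt \<epsilon>1"

lemma scale_bounds:
  assumes "0 < \<epsilon>1" "\<epsilon>1 < \<epsilon>2" "\<epsilon>2 \<le> 1"
  shows "0 < scale \<epsilon>1 \<epsilon>2" "scale \<epsilon>1 \<epsilon>2 \<le> 2" "\<epsilon>1 \<le> (scale \<epsilon>1 \<epsilon>2)\<^sup>2" "\<epsilon>2 \<le> scale \<epsilon>1 \<epsilon>2" "\<epsilon>1 \<le> scale \<epsilon>1 \<epsilon>2"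
    "(scale \<epsilon>1 \<epsilon>2)\<^sup>2 \<le> 2 * (\<epsilon>2\<^sup>2 + \<epsilon>1)" "\<epsilon>2\<^sup>2 \<le> (scale \<epsilon>1 \<epsilon>2)\<^sup>2"
proof -
  have q: "0 < sqrt \<epsilon>1" "sqrt \<epsilon>1 \<le> 1" "(sqrt \<epsilon>1)\<^sup>2 = \<epsilon>1" using assms by auto
  show "0 < scale \<epsilon>1 \<epsilon>2" "scale \<epsilon>1 \<epsilon>2 \<le> 2" "\<epsilon>2 \<le> scale \<epsilon>1 \<epsilon>2" "\<epsilon>1 \<le> scale \<epsilon>1 \<epsilon>2"
    unfolding scale_def using q(1,2) assms by linarith+
  have e: "(scale \<epsilon>1 \<epsilon>2)\<^sup>2 = \<epsilon>2\<^sup>2 + 2 * (\<epsilon>2 * sqrt \<epsilon>1) + \<epsilon>1"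
    using q(3) by (simp add: scale_def power2_sum)
  have p: "0 \<le> \<epsilon>2 * sqrt \<epsilon>1" using assms by simp
  show "\<epsilon>1 \<le> (scale \<epsilon>1 \<epsilon>2)\<^sup>2" "\<epsilon>2\<^sup>2 \<le> (scale \<epsilon>1 \<epsilon>2)\<^sup>2" unfolding e using p assms by auto
  have "0 \<le> (\<epsilon>2 - sqrt \<epsilon>1)\<^sup>2" by simp
  then have "2 * (\<epsilon>2 * sqrt \<epsilon>1) \<le> \<epsilon>2\<^sup>2 + \<epsilon>1" using q(3) by (simp add: power2_diff)
  then show "(scale \<epsilon>1 \<epsilon>2)\<^sup>2 \<le> 2 * (\<epsilon>2\<^sup>2 + \<epsilon>1)" unfolding e by (simp add: distrib_left)
qed

text \<open>The complex set-up in which all constants are fixed before \<open>\<epsilon>1\<close> and \<open>\<epsilon>2\<close>. The margin \<open>\<omega>\<close> between the rhombus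
  and the domain \<open>U\<close> of the coefficients serves for Cauchy estimates of derivatives.\<close>

locale holomorphic_coefficients =
  fixes b c f :: "real \<Rightarrow> real" and \<beta> \<gamma> :: real and B C F :: "complex \<Rightarrow> complex"
    and \<theta> r \<omega> K :: real and U :: "complex set"
  assumes ok: "rhombus_ok \<theta> r" and \<omega>: "0 < \<omega>" and K: "0 < K" and \<beta>\<gamma>: "0 < \<beta>" "0 < \<gamma>"
    and U: "open U" "\<And>z. z \<in> rhombus \<theta> r \<Longrightarrow> cball z \<omega> \<subseteq> U"
    and hol: "B holomorphic_on U" "C holomorphic_on U" "F holomorphic_on U"
    and bnd: "\<And>z. z \<in> U \<Longrightarrow> cmod (B z) \<le> K" "\<And>z. z \<in> U \<Longrightarrow> cmod (C z) \<le> K" "\<And>z. z \<in> U \<Longrightarrow> cmod (F z) \<le> K"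
    and sect: "\<And>z. z \<in> U \<Longrightarrow> sector (1/20) (B z)" "\<And>z. z \<in> U \<Longrightarrow> sector (1/20) (C z)"
    and low: "\<And>z. z \<in> U \<Longrightarrow> \<beta> / 2 \<le> Re (B z)" "\<And>z. z \<in> U \<Longrightarrow> \<gamma> / 2 \<le> Re (C z)"
    and real: "\<And>x. x \<in> {0..1} \<Longrightarrow> B (of_real x) = of_real (b x)" "\<And>x. x \<in> {0..1} \<Longrightarrow> C (of_real x) = of_real (c x)"
      "\<And>x. x \<in> {0..1} \<Longrightarrow> F (of_real x) = of_real (f x)"
begin

abbreviation "W \<equiv> rhombus \<theta> r"

lemma W_U: "z \<in> W \<Longrightarrow> z \<in> U"
  using U(2)[of z] \<omega> by (meson centre_in_cball less_imp_le subsetD)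

lemma W_U': "W \<subseteq> U" using W_U by blast

lemma deriv_bound_W:
  assumes "g holomorphic_on U" "\<And>z. z \<in> U \<Longrightarrow> cmod (g z) \<le> A" "z \<in> W"
  shows "cmod (deriv g z) \<le> A / \<omega>"
proof -
  have "cmod ((deriv ^^ 1) g z) \<le> fact 1 * A / \<omega> ^ 1"
  proof (rule Cauchy_inequality)
    have "g holomorphic_on cball z \<omega>" using assms U by (meson holomorphic_on_subset)
    then show "g holomorphic_on ball z \<omega>" "continuous_on (cball z \<omega>) g"
      by (auto intro: holomorphic_on_subset ball_subset_cball holomorphic_on_imp_continuous_on)
    fix x assume "cmod (z - x) = \<omega>"
    then have "x \<in> cball z \<omega>" by (simp add: dist_norm)
    then show "cmod (g x) \<le> A" using assms U by blast
  qed (use \<omega> in auto)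
  then show ?thesis by simp
qed

text \<open>The constants \<open>c1\<close> and \<open>c2\<close> are lower bounds for \<open>Re droot / s\<close> and \<open>s * Re slow\<close>. The singular regime is
  \<open>\<epsilon>1 / s \<le> \<tau>0\<close>: below this threshold the Riccati equations are solvable with a correction that is small
  against the root. The constants \<open>rate\<close> and \<open>bound\<close> are those of the resulting layers and smooth part.\<close>

definition "c1 = sqrt (min (\<beta>\<^sup>2 / 5) (2 * \<gamma>) / 2)"
definition "c2 = \<gamma> / (4 * (K + 1))"

definition "\<tau>0 = min (c1 ^ 3 * \<omega> / (256 * K)) (min (c2 * c1\<^sup>2 * \<omega> / (128 * K)) (c1\<^sup>2 * \<omega> / (128 * (K + 1))))"

definition "rate = min (c2 / 2) (c1 / 4)"
definition "bound = (2 * K / c1 + c2) + (K + 1 + c1) + 128 * K / (c1 * c2)"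

lemma \<tau>0_le: "\<tau>0 \<le> c1 ^ 3 * \<omega> / (256 * K)" "\<tau>0 \<le> c2 * c1\<^sup>2 * \<omega> / (128 * K)"
    "\<tau>0 \<le> c1\<^sup>2 * \<omega> / (128 * (K + 1))"
  unfolding \<tau>0_def by (simp_all only: min_le_iff_disj order_refl simp_thms)

lemma c1_pos: "0 < c1" and c2_pos: "0 < c2"
  using \<beta>\<gamma> K by (auto simp: c1_def c2_def)

context
  fixes \<epsilon>1 \<epsilon>2 :: real
  assumes eps: "0 < \<epsilon>1" "\<epsilon>1 < \<epsilon>2" "\<epsilon>2 \<le> 1"
begin

definition "disc z = of_real (\<epsilon>2\<^sup>2) * (B z)\<^sup>2 + of_real (4 * \<epsilon>1) * C z"
definition "droot z = csqrt (disc z)"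
definition "slow z = (droot z - of_real \<epsilon>2 * B z) / of_real (2 * \<epsilon>1)"
definition "fast z = (droot z + of_real \<epsilon>2 * B z) / of_real (2 * \<epsilon>1)"

abbreviation "s \<equiv> scale \<epsilon>1 \<epsilon>2"

lemmas s_bounds = scale_bounds[OF eps]

lemma disc_props:
  assumes z: "z \<in> U"
  shows "sector (1/9) (disc z)" "c1\<^sup>2 * s\<^sup>2 \<le> Re (disc z)" "cmod (disc z) \<le> ((K + 2) * s)\<^sup>2"
proof -
  have B0: "0 \<le> Re (B z)" and C0: "0 \<le> Re (C z)" using low[OF z] \<beta>\<gamma> by linarith+
  note sB = sector_square[OF sect(1)[OF z] B0]
  show "sector (1/9) (disc z)" unfolding disc_def
    by (intro sector_add sector_scale sB sector_weaken[OF sect(2)[OF z]] C0) (use eps in auto)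
  define m where "m = min (\<beta>\<^sup>2 / 5) (2 * \<gamma>)"
  have m: "0 < m" "m \<le> \<beta>\<^sup>2 / 5" "m \<le> 2 * \<gamma>" using \<beta>\<gamma> by (auto simp: m_def)
  have "(\<beta> / 2)\<^sup>2 \<le> (Re (B z))\<^sup>2" using low[OF z] \<beta>\<gamma> by (intro power_mono) auto
  then have "\<beta>\<^sup>2 / 5 \<le> Re ((B z)\<^sup>2)" using sB(2) by (simp add: power_divide)
  then have "\<epsilon>2\<^sup>2 * m \<le> \<epsilon>2\<^sup>2 * Re ((B z)\<^sup>2)" using m by (intro mult_left_mono) auto
  moreover have "\<epsilon>1 * m \<le> \<epsilon>1 * (4 * Re (C z))" using m low[OF z] eps by (intro mult_left_mono) auto
  moreover have "c1\<^sup>2 * s\<^sup>2 \<le> m / 2 * (2 * (\<epsilon>2\<^sup>2 + \<epsilon>1))"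
    using m s_bounds(6) unfolding c1_def m_def[symmetric] by (intro mult_mono) auto
  moreover have "Re (disc z) = \<epsilon>2\<^sup>2 * Re ((B z)\<^sup>2) + \<epsilon>1 * (4 * Re (C z))" unfolding disc_def by simp
  ultimately show "c1\<^sup>2 * s\<^sup>2 \<le> Re (disc z)" by (simp add: algebra_simps)
  have "cmod (disc z) \<le> \<epsilon>2\<^sup>2 * (cmod (B z))\<^sup>2 + 4 * \<epsilon>1 * cmod (C z)"
    unfolding disc_def using eps by (intro norm_triangle_le) (simp add: norm_mult norm_power)
  also have "\<dots> \<le> s\<^sup>2 * K\<^sup>2 + 4 * s\<^sup>2 * K"
    using s_bounds bnd[OF z] eps by (intro add_mono mult_mono power_mono) auto
  also have "\<dots> \<le> ((K + 2) * s)\<^sup>2" using K by (simp add: power2_eq_square algebra_simps)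
  finally show "cmod (disc z) \<le> ((K + 2) * s)\<^sup>2" .
qed

lemma droot_props:
  assumes z: "z \<in> U"
  shows "sector (1/18) (droot z)" "c1 * s \<le> Re (droot z)" "cmod (droot z) \<le> (K + 2) * s" "(droot z)\<^sup>2 = disc z"
proof -
  note d = disc_props[OF z]
  have "0 < c1\<^sup>2 * s\<^sup>2" using c1_pos s_bounds by simp
  then have p: "0 < Re (disc z)" using d by linarith
  show "sector (1/18) (droot z)" unfolding droot_def by (rule sector_csqrt[OF d(1) p])
  have "c1 * s = sqrt (c1\<^sup>2 * s\<^sup>2)" using c1_pos s_bounds by (simp add: real_sqrt_mult)
  also have "\<dots> \<le> sqrt (Re (disc z))" using d by simp
  also have "\<dots> \<le> Re (droot z)" unfolding droot_def by (rule sector_csqrt[OF d(1) p])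
  finally show "c1 * s \<le> Re (droot z)" .
  show sq: "(droot z)\<^sup>2 = disc z" by (simp add: droot_def)
  have "(cmod (droot z))\<^sup>2 \<le> ((K + 2) * s)\<^sup>2" using d(3) unfolding sq[symmetric] norm_power .
  then show "cmod (droot z) \<le> (K + 2) * s" by (rule power2_le_imp_le) (use K s_bounds in auto)
qed

lemma droot_hol: "droot holomorphic_on U"
proof -
  have "disc z \<notin> \<real>\<^sub>\<le>\<^sub>0" if "z \<in> U" for z
  proof -
    have "0 < c1\<^sup>2 * s\<^sup>2" using c1_pos s_bounds by simp
    then have "0 < Re (disc z)" using disc_props[OF that] by linarith
    then show ?thesis by (auto simp: complex_nonpos_Reals_iff)
  qed
  then show ?thesis unfolding droot_def[abs_def] disc_def[abs_def]
    by (intro holomorphic_intros holomorphic_on_csqrt' hol) auto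
qed

lemma slow_fast_hol: "slow holomorphic_on U" "fast holomorphic_on U"
  unfolding slow_def[abs_def] fast_def[abs_def] using eps
  by (intro holomorphic_intros droot_hol hol; simp)+

text \<open>The roots of the characteristic equation are \<open>- slow z\<close> and \<open>fast z\<close>. The last two identities give the coefficient of the
  linearisation of the Riccati equations at these roots.\<close>

lemma characteristic:
  assumes z: "z \<in> U"
  shows "(slow z)\<^sup>2 + of_real (\<epsilon>2 / \<epsilon>1) * B z * slow z - C z / of_real \<epsilon>1 = 0"
    "(fast z)\<^sup>2 - of_real (\<epsilon>2 / \<epsilon>1) * B z * fast z - C z / of_real \<epsilon>1 = 0"
    "fast z = slow z + of_real (\<epsilon>2 / \<epsilon>1) * B z"
    "2 * slow z + of_real (\<epsilon>2 / \<epsilon>1) * B z = droot z / of_real \<epsilon>1"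
    "2 * fast z - of_real (\<epsilon>2 / \<epsilon>1) * B z = droot z / of_real \<epsilon>1"
proof -
  have sq: "droot z * droot z = of_real (\<epsilon>2\<^sup>2) * (B z)\<^sup>2 + of_real (4 * \<epsilon>1) * C z"
    using droot_props(4)[OF z] by (simp add: disc_def power2_eq_square)
  have e: "complex_of_real \<epsilon>1 \<noteq> 0" using eps by simp
  show "(slow z)\<^sup>2 + of_real (\<epsilon>2 / \<epsilon>1) * B z * slow z - C z / of_real \<epsilon>1 = 0"
    "(fast z)\<^sup>2 - of_real (\<epsilon>2 / \<epsilon>1) * B z * fast z - C z / of_real \<epsilon>1 = 0"
    using e sq unfolding slow_def fast_def by (simp_all add: field_simps power2_eq_square)
  show "fast z = slow z + of_real (\<epsilon>2 / \<epsilon>1) * B z" "2 * slow z + of_real (\<epsilon>2 / \<epsilon>1) * B z = droot z / of_real \<epsilon>1"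
    "2 * fast z - of_real (\<epsilon>2 / \<epsilon>1) * B z = droot z / of_real \<epsilon>1"
    using e unfolding slow_def fast_def by (simp_all add: field_simps)
qed

lemma fast_props:
  assumes z: "z \<in> U"
  shows "sector (1/18) (fast z)" "c1 * (s / \<epsilon>1) / 2 \<le> Re (fast z)" "cmod (fast z) \<le> (K + 1) * (s / \<epsilon>1)"
proof -
  have B0: "0 \<le> Re (B z)" using low[OF z] \<beta>\<gamma> by linarith
  have eq: "fast z = of_real (1 / (2 * \<epsilon>1)) * (droot z + of_real \<epsilon>2 * B z)" using eps by (simp add: fast_def)
  have "sector (1/18) (B z)" by (rule sector_weaken[OF sect(1)[OF z] _ B0]) simp
  then show "sector (1/18) (fast z)" unfolding eq
    by (intro sector_scale sector_add droot_props z) (use eps in auto)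
  have "Re (fast z) = 1 / (2 * \<epsilon>1) * (Re (droot z) + \<epsilon>2 * Re (B z))" unfolding eq by simp
  also have "\<dots> \<ge> 1 / (2 * \<epsilon>1) * (c1 * s)"
    using droot_props(2)[OF z] B0 eps by (intro mult_left_mono) (auto intro: add_increasing2)
  finally show "c1 * (s / \<epsilon>1) / 2 \<le> Re (fast z)" by simp
  have "cmod (fast z) = 1 / (2 * \<epsilon>1) * cmod (droot z + of_real \<epsilon>2 * B z)" unfolding eq norm_mult using eps by (simp add: norm_divide norm_mult)
  also have "\<dots> \<le> 1 / (2 * \<epsilon>1) * ((K + 2) * s + s * K)"
  proof (intro mult_left_mono norm_triangle_le add_mono droot_props z)
    show "cmod (of_real \<epsilon>2 * B z) \<le> s * K"
      unfolding norm_mult using eps s_bounds bnd[OF z] by (intro mult_mono) auto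
  qed (use eps in auto)
  also have "(K + 2) * s + s * K = 2 * ((K + 1) * s)" by (simp add: algebra_simps)
  also have "1 / (2 * \<epsilon>1) * \<dots> = (K + 1) * (s / \<epsilon>1)" by simp
  finally show "cmod (fast z) \<le> (K + 1) * (s / \<epsilon>1)" .
qed

text \<open>The numerator \<open>droot - \<epsilon>2 B\<close> suffers from cancellation; rewriting the root as \<open>2 C / (droot + \<epsilon>2 B)\<close>
  shows that it is comparable to \<open>1 / s\<close>.\<close>

lemma slow_props:
  assumes z: "z \<in> U"
  shows "sector (1/9) (slow z)" "c2 / s \<le> Re (slow z)" "cmod (slow z) \<le> 2 * K / c1 / s"
proof -
  define D where "D = droot z + of_real \<epsilon>2 * B z"
  have B0: "0 \<le> Re (B z)" and C0: "0 < Re (C z)" using low[OF z] \<beta>\<gamma> by linarith+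
  have "sector (1/18) (B z)" by (rule sector_weaken[OF sect(1)[OF z] _ B0]) simp
  then have Ds: "sector (1/18) D" unfolding D_def
    by (intro sector_scale sector_add droot_props z) (use eps in auto)
  have "0 \<le> \<epsilon>2 * Re (B z)" using B0 eps by simp
  then have Dl: "c1 * s \<le> Re D" using droot_props(2)[OF z] unfolding D_def by simp
  moreover have c1s: "0 < c1 * s" using c1_pos s_bounds by simp
  ultimately have Dp: "0 < Re D" by linarith
  have D0: "D \<noteq> 0" using Dp by auto
  have "(droot z - of_real \<epsilon>2 * B z) * D = (droot z)\<^sup>2 - of_real (\<epsilon>2\<^sup>2) * (B z)\<^sup>2"
    unfolding D_def by (simp add: algebra_simps power2_eq_square)
  also have "\<dots> = of_real (4 * \<epsilon>1) * C z" unfolding droot_props(4)[OF z] disc_def by simp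
  finally have "slow z = of_real 2 * (C z / D)" unfolding slow_def using D0 eps by (simp add: field_simps)
  note eq = this
  note sd = sector_divide[OF sect(2)[OF z] Ds C0 Dp]
  show "sector (1/9) (slow z)" unfolding eq by (intro sector_scale sd) auto
  have "Re D \<le> cmod (droot z) + \<epsilon>2 * cmod (B z)"
    unfolding D_def using complex_Re_le_cmod[of "droot z"] complex_Re_le_cmod[of "B z"] eps
    by (simp add: add_mono mult_left_mono)
  also have "\<dots> \<le> (K + 2) * s + s * K" using droot_props(3)[OF z] bnd[OF z] s_bounds eps by (intro add_mono mult_mono) auto
  finally have Du: "Re D \<le> 2 * (K + 1) * s" by (simp add: algebra_simps)
  have "c2 / s \<le> (\<gamma> / 2) / (2 * (K + 1) * s)" unfolding c2_def using \<beta>\<gamma> K s_bounds by (simp add: field_simps)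
  also have "\<dots> \<le> Re (C z) / Re D" using low[OF z] \<beta>\<gamma> Du Dp by (intro frac_le) auto
  also have "\<dots> = 2 * (Re (C z) / (2 * Re D))" by simp
  also have "\<dots> \<le> 2 * Re (C z / D)" by (intro mult_left_mono sd) auto
  also have "\<dots> = Re (slow z)" unfolding eq
    by (simp only: times_complex.sel Re_complex_of_real Im_complex_of_real mult_zero_left diff_zero)
  finally show "c2 / s \<le> Re (slow z)" .
  have "cmod (slow z) = 2 * (cmod (C z) / cmod D)" unfolding eq by (simp add: norm_mult norm_divide)
  also have "\<dots> \<le> 2 * (K / (c1 * s))"
    using bnd(2)[OF z] Dl complex_Re_le_cmod[of D] c1s K by (intro mult_left_mono frac_le) auto
  finally show "cmod (slow z) \<le> 2 * K / c1 / s" by simp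
qed

text \<open>With \<open>m = slow + d\<close> the equation for \<open>d\<close> is \<open>d' = (droot / \<epsilon>1) d + d\<^sup>2 - slow'\<close>.
  The linear coefficient has size \<open>s / \<epsilon>1\<close> and the forcing only \<open>1 / s\<close>, so the smallness
  condition of \<open>riccati_solution\<close> holds as soon as \<open>\<epsilon>1 / s\<close> is below a fixed constant.\<close>

lemma slow_riccati:
  assumes small: "1 \<le> \<tau>0 * (s / \<epsilon>1)"
  shows "\<exists>m. \<forall>z\<in>W. (m has_field_derivative (m z)\<^sup>2 + of_real (\<epsilon>2 / \<epsilon>1) * B z * m z - C z / of_real \<epsilon>1) (at z)
    \<and> sector (1/2) (m z) \<and> c2 / 2 / s \<le> Re (m z) \<and> cmod (m z) \<le> (2 * K / c1 + c2) / s
    \<and> c1 / 4 * (s / \<epsilon>1) \<le> Re (m z + of_real (\<epsilon>2 / \<epsilon>1) * B z)"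
proof -
  define L where "L = s / \<epsilon>1"
  define \<Lambda> where "\<Lambda> = c1 / 4 * L"
  define G where "G = 2 * K / c1 / s / \<omega>"
  note pos = c1_pos c2_pos K \<omega> s_bounds(1) eps(1)
  have L: "0 < L" using pos by (simp add: L_def)
  have \<Lambda>: "0 < \<Lambda>" using L pos by (simp add: \<Lambda>_def)
  have G: "0 < G" using pos by (simp add: G_def)
  have sL: "1 \<le> s * L" using s_bounds(3) pos by (simp add: L_def power2_eq_square field_simps)
  have t: "1 \<le> c1 ^ 3 * \<omega> / (256 * K) * L" "1 \<le> c2 * c1\<^sup>2 * \<omega> / (128 * K) * L"
  proof -
    have "\<tau>0 * L \<le> c1 ^ 3 * \<omega> / (256 * K) * L" "\<tau>0 * L \<le> c2 * c1\<^sup>2 * \<omega> / (128 * K) * L"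
      using L \<tau>0_le by (simp_all only: mult_right_mono less_imp_le)
    then show "1 \<le> c1 ^ 3 * \<omega> / (256 * K) * L" "1 \<le> c2 * c1\<^sup>2 * \<omega> / (128 * K) * L"
      using small unfolding L_def[symmetric] by linarith+
  qed
  have 8: "8 * G \<le> \<Lambda>\<^sup>2"
  proof -
    have "256 * K \<le> c1 ^ 3 * \<omega> * L" using t(1) pos by (simp add: field_simps)
    also have "\<dots> \<le> c1 ^ 3 * \<omega> * L * (s * L)" using sL L pos by simp
    finally show ?thesis using pos unfolding G_def \<Lambda>_def by (simp add: field_simps power2_eq_square power3_eq_cube)
  qed
  have k: "cone_coeff W \<Lambda> (\<lambda>z. droot z / of_real \<epsilon>1)"
    unfolding cone_coeff_def
  proof (intro conjI ballI \<Lambda>)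
    show "(\<lambda>z. droot z / of_real \<epsilon>1) holomorphic_on W"
      using pos by (intro holomorphic_intros holomorphic_on_subset[OF droot_hol W_U']) auto
    show "\<exists>B. \<forall>z\<in>W. cmod (droot z / of_real \<epsilon>1) \<le> B"
      using droot_props(3)[OF W_U] pos by (intro exI[of _ "(K + 2) * s / \<epsilon>1"]) (simp add: norm_divide divide_right_mono)
    fix z assume z: "z \<in> W"
    note rp = droot_props[OF W_U[OF z]]
    have "0 < c1 * s" using pos by simp
    then have "\<bar>Im (droot z)\<bar> \<le> Re (droot z)" using rp(1,2) unfolding sector_def by argo
    then show "\<bar>Im (droot z / of_real \<epsilon>1)\<bar> \<le> Re (droot z / of_real \<epsilon>1)"
      using pos by (simp add: divide_right_mono)
    show "4 * \<Lambda> \<le> Re (droot z / of_real \<epsilon>1)"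
      using rp(2) pos by (simp add: \<Lambda>_def L_def divide_right_mono)
  qed
  have "deriv slow holomorphic_on W"
    using holomorphic_deriv[OF slow_fast_hol(1) U(1)] W_U' by (rule holomorphic_on_subset)
  then obtain d where d: "\<And>z. z \<in> W \<Longrightarrow> (d has_field_derivative droot z / of_real \<epsilon>1 * d z + (d z)\<^sup>2 - deriv slow z) (at z)"
    and db: "\<And>z. z \<in> W \<Longrightarrow> cmod (d z) \<le> 2 * (G / \<Lambda>)"
    using riccati_solution[OF ok k, of "deriv slow" G] deriv_bound_W[OF slow_fast_hol(1) slow_props(3)] 8
    unfolding G_def by blast
  have "2 * (G / \<Lambda>) \<le> c2 / 8 / s"
    using t(2) pos L unfolding G_def \<Lambda>_def by (simp add: field_simps power2_eq_square)
  then have db1: "cmod (d z) \<le> c2 / 8 / s" if "z \<in> W" for z using db[OF that] by linarith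
  have "2 * (G / \<Lambda>) \<le> c1 / 4 * L"
    using 8 \<Lambda> G unfolding \<Lambda>_def[symmetric] by (simp add: field_simps power2_eq_square)
  then have db2: "cmod (d z) \<le> c1 / 4 * L" if "z \<in> W" for z using db[OF that] by linarith
  show ?thesis
  proof (intro exI[of _ "\<lambda>z. slow z + d z"] ballI conjI)
    fix z assume z: "z \<in> W"
    note zU = W_U[OF z] and sp = slow_props[OF W_U[OF z]] and ch = characteristic[OF W_U[OF z]]
    have "(slow has_field_derivative deriv slow z) (at z)"
      using slow_fast_hol(1) U(1) zU by (rule holomorphic_derivI)
    from DERIV_add[OF this d[OF z]]
    have "((\<lambda>z. slow z + d z) has_field_derivative droot z / of_real \<epsilon>1 * d z + (d z)\<^sup>2) (at z)" by simp
    moreover have "droot z / of_real \<epsilon>1 * d z + (d z)\<^sup>2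
       = ((slow z)\<^sup>2 + of_real (\<epsilon>2 / \<epsilon>1) * B z * slow z - C z / of_real \<epsilon>1) + (2 * slow z + of_real (\<epsilon>2 / \<epsilon>1) * B z) * d z + (d z)\<^sup>2"
      unfolding ch(1,4) by simp
    moreover have "\<dots> = (slow z + d z)\<^sup>2 + of_real (\<epsilon>2 / \<epsilon>1) * B z * (slow z + d z) - C z / of_real \<epsilon>1"
      by (simp add: power2_eq_square algebra_simps)
    ultimately show "((\<lambda>z. slow z + d z) has_field_derivative
        (slow z + d z)\<^sup>2 + of_real (\<epsilon>2 / \<epsilon>1) * B z * (slow z + d z) - C z / of_real \<epsilon>1) (at z)" by (simp only:)
    define \<delta> where "\<delta> = c2 / s"
    have \<delta>: "0 < \<delta>" using pos by (simp add: \<delta>_def)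
    have dz: "cmod (d z) \<le> \<delta> / 8" using db1[OF z] by (simp add: \<delta>_def)
    have dre: "\<bar>Re (d z)\<bar> \<le> \<delta> / 8" "\<bar>Im (d z)\<bar> \<le> \<delta> / 8"
      using dz abs_Re_le_cmod[of "d z"] abs_Im_le_cmod[of "d z"] by linarith+
    have sl: "\<delta> \<le> Re (slow z)" "\<bar>Im (slow z)\<bar> \<le> Re (slow z) / 9" using sp(1,2) by (auto simp: sector_def \<delta>_def)
    have "\<bar>Im (slow z + d z)\<bar> \<le> \<bar>Im (slow z)\<bar> + \<bar>Im (d z)\<bar>" by simp
    then show "sector (1/2) (slow z + d z)" unfolding sector_def using dre sl \<delta> by simp argo
    show "c2 / 2 / s \<le> Re (slow z + d z)" using dre sl \<delta> by (simp add: \<delta>_def)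
    have "cmod (slow z + d z) \<le> 2 * K / c1 / s + c2 / s"
      using norm_triangle_ineq[of "slow z" "d z"] sp(3) dz \<delta> unfolding \<delta>_def[symmetric] by linarith
    then show "cmod (slow z + d z) \<le> (2 * K / c1 + c2) / s" by (simp add: add_divide_distrib)
    have eq: "slow z + d z + of_real (\<epsilon>2 / \<epsilon>1) * B z = fast z + d z" unfolding ch(3) by simp
    have "c1 / 4 * L + c1 / 4 * L \<le> Re (fast z)" using fast_props(2)[OF zU] by (simp add: L_def)
    moreover have "- Re (d z) \<le> c1 / 4 * L" using db2[OF z] abs_Re_le_cmod[of "d z"] by linarith
    ultimately show "c1 / 4 * (s / \<epsilon>1) \<le> Re (slow z + d z + of_real (\<epsilon>2 / \<epsilon>1) * B z)"
      unfolding L_def[symmetric] eq plus_complex.sel by argo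
  qed
qed

text \<open>The substitution \<open>z \<mapsto> 1 - z\<close> turns the equation for \<open>n - fast\<close> into one of the form solved by \<open>riccati_solution\<close>.
  The correction is of the order of the logarithmic derivative of \<open>fast\<close>, hence bounded.\<close>

lemma fast_riccati:
  assumes small: "1 \<le> \<tau>0 * (s / \<epsilon>1)"
  shows "\<exists>n. \<forall>z\<in>W. (n has_field_derivative - (n z)\<^sup>2 + of_real (\<epsilon>2 / \<epsilon>1) * B z * n z + C z / of_real \<epsilon>1) (at z)
    \<and> c1 / 4 * (s / \<epsilon>1) \<le> Re (n z) \<and> cmod (n z) \<le> (K + 1 + c1) * (s / \<epsilon>1)"
proof -
  define L where "L = s / \<epsilon>1"
  define \<Lambda> where "\<Lambda> = c1 / 4 * L"
  define G where "G = (K + 1) * L / \<omega>"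
  note pos = c1_pos c2_pos K \<omega> s_bounds(1) eps(1)
  have L: "0 < L" using pos by (simp add: L_def)
  have \<Lambda>: "0 < \<Lambda>" using L pos by (simp add: \<Lambda>_def)
  have G: "0 < G" using pos L by (simp add: G_def)
  have "\<tau>0 * L \<le> c1\<^sup>2 * \<omega> / (128 * (K + 1)) * L"
    using L \<tau>0_le by (simp only: mult_right_mono less_imp_le)
  then have "1 \<le> c1\<^sup>2 * \<omega> / (128 * (K + 1)) * L" using small unfolding L_def[symmetric] by linarith
  then have "128 * (K + 1) \<le> c1\<^sup>2 * \<omega> * L" using pos by (simp add: field_simps)
  then have "128 * (K + 1) * L \<le> c1\<^sup>2 * \<omega> * L * L" using L by (intro mult_right_mono) auto
  then have 8: "8 * G \<le> \<Lambda>\<^sup>2"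
    using pos unfolding G_def \<Lambda>_def by (simp add: field_simps power2_eq_square)
  have refl: "1 - z \<in> W" if "z \<in> W" for z using that by (simp add: rhombus_reflect)
  have k: "cone_coeff W \<Lambda> (\<lambda>z. droot (1 - z) / of_real \<epsilon>1)"
    unfolding cone_coeff_def
  proof (intro conjI ballI \<Lambda>)
    have "(\<lambda>z. droot (1 - z)) holomorphic_on W"
      by (rule holomorphic_on_compose_gen[of "\<lambda>z. 1 - z" W droot U, unfolded o_def])
        (use refl W_U droot_hol in \<open>auto intro!: holomorphic_intros\<close>)
    then show "(\<lambda>z. droot (1 - z) / of_real \<epsilon>1) holomorphic_on W"
      using pos by (intro holomorphic_intros) auto
    show "\<exists>B. \<forall>z\<in>W. cmod (droot (1 - z) / of_real \<epsilon>1) \<le> B"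
      using droot_props(3)[OF W_U[OF refl]] pos by (intro exI[of _ "(K + 2) * s / \<epsilon>1"]) (simp add: norm_divide divide_right_mono)
    fix z assume z: "z \<in> W"
    note rp = droot_props[OF W_U[OF refl[OF z]]]
    have "0 < c1 * s" using pos by simp
    then have "\<bar>Im (droot (1 - z))\<bar> \<le> Re (droot (1 - z))" using rp(1,2) unfolding sector_def by argo
    then show "\<bar>Im (droot (1 - z) / of_real \<epsilon>1)\<bar> \<le> Re (droot (1 - z) / of_real \<epsilon>1)"
      using pos by (simp add: divide_right_mono)
    show "4 * \<Lambda> \<le> Re (droot (1 - z) / of_real \<epsilon>1)"
      using rp(2) pos by (simp add: \<Lambda>_def L_def divide_right_mono)
  qed
  have "(\<lambda>z. - deriv fast (1 - z)) holomorphic_on W"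
  proof (intro holomorphic_intros)
    show "(\<lambda>z. deriv fast (1 - z)) holomorphic_on W"
      by (rule holomorphic_on_compose_gen[of "\<lambda>z. 1 - z" W "deriv fast" U, unfolded o_def])
        (use refl W_U holomorphic_deriv[OF slow_fast_hol(2) U(1)] in \<open>auto intro!: holomorphic_intros\<close>)
  qed
  then have "\<exists>d. \<forall>z\<in>W. (d has_field_derivative droot (1 - z) / of_real \<epsilon>1 * d z + (d z)\<^sup>2 - (- deriv fast (1 - z))) (at z)
     \<and> cmod (d z) \<le> 2 * (G / \<Lambda>)"
  proof (rule riccati_solution[OF ok k])
    fix z assume "z \<in> W"
    then show "cmod (- deriv fast (1 - z)) \<le> G"
      using deriv_bound_W[OF slow_fast_hol(2) fast_props(3) refl] by (simp add: G_def L_def)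
  qed (rule 8)
  then obtain d where d: "\<And>z. z \<in> W \<Longrightarrow> (d has_field_derivative droot (1 - z) / of_real \<epsilon>1 * d z + (d z)\<^sup>2 + deriv fast (1 - z)) (at z)"
    and db: "\<And>z. z \<in> W \<Longrightarrow> cmod (d z) \<le> 2 * (G / \<Lambda>)" by auto
  have "2 * (G / \<Lambda>) \<le> c1 / 4 * L"
    using 8 \<Lambda> G unfolding \<Lambda>_def[symmetric] by (simp add: field_simps power2_eq_square)
  then have db2: "cmod (d z) \<le> c1 / 4 * L" if "z \<in> W" for z using db[OF that] by linarith
  show ?thesis
  proof (intro exI[of _ "\<lambda>z. fast z + d (1 - z)"] ballI conjI)
    fix z assume z: "z \<in> W"
    note zU = W_U[OF z] and sp = fast_props[OF W_U[OF z]] and ch = characteristic[OF W_U[OF z]]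
    have "(fast has_field_derivative deriv fast z) (at z)"
      using slow_fast_hol(2) U(1) zU by (rule holomorphic_derivI)
    moreover have "((\<lambda>z. d (1 - z)) has_field_derivative - (droot z / of_real \<epsilon>1 * d (1 - z) + (d (1 - z))\<^sup>2 + deriv fast z)) (at z)"
    proof -
      have "((\<lambda>z. 1 - z) has_field_derivative - 1) (at z)" by (auto intro!: derivative_eq_intros)
      from DERIV_chain2[where f = d and g = "\<lambda>z. 1 - z", OF d[OF refl[OF z]] this]
      show ?thesis by simp
    qed
    ultimately have "((\<lambda>z. fast z + d (1 - z)) has_field_derivative
       deriv fast z + - (droot z / of_real \<epsilon>1 * d (1 - z) + (d (1 - z))\<^sup>2 + deriv fast z)) (at z)" by (rule DERIV_add)
    moreover have "deriv fast z + - (droot z / of_real \<epsilon>1 * d (1 - z) + (d (1 - z))\<^sup>2 + deriv fast z)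
       = - ((fast z)\<^sup>2 - of_real (\<epsilon>2 / \<epsilon>1) * B z * fast z - C z / of_real \<epsilon>1) - (2 * fast z - of_real (\<epsilon>2 / \<epsilon>1) * B z) * d (1 - z) - (d (1 - z))\<^sup>2"
      unfolding ch(2,5) by simp
    moreover have "\<dots> = - (fast z + d (1 - z))\<^sup>2 + of_real (\<epsilon>2 / \<epsilon>1) * B z * (fast z + d (1 - z)) + C z / of_real \<epsilon>1"
      by (simp add: power2_eq_square algebra_simps)
    ultimately show "((\<lambda>z. fast z + d (1 - z)) has_field_derivative
        - (fast z + d (1 - z))\<^sup>2 + of_real (\<epsilon>2 / \<epsilon>1) * B z * (fast z + d (1 - z)) + C z / of_real \<epsilon>1) (at z)" by (simp only:)
    have dz: "cmod (d (1 - z)) \<le> c1 / 4 * L" by (rule db2[OF refl[OF z]])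
    have "c1 / 4 * L + c1 / 4 * L \<le> Re (fast z)" using sp(2) by (simp add: L_def)
    moreover have "- Re (d (1 - z)) \<le> c1 / 4 * L" using dz abs_Re_le_cmod[of "d (1 - z)"] by linarith
    ultimately show "c1 / 4 * (s / \<epsilon>1) \<le> Re (fast z + d (1 - z))"
      unfolding L_def[symmetric] plus_complex.sel by argo
    have "0 \<le> c1 * L" using pos L by simp
    then have "cmod (fast z + d (1 - z)) \<le> (K + 1) * L + c1 * L"
      using norm_triangle_ineq[of "fast z" "d (1 - z)"] sp(3) dz unfolding L_def[symmetric] by linarith
    then show "cmod (fast z + d (1 - z)) \<le> (K + 1 + c1) * (s / \<epsilon>1)" unfolding L_def[symmetric] by (simp add: distrib_right)
  qed
qed

text \<open>With \<open>m\<close> and \<open>n\<close> from the two Riccati equations, \<open>exp (- \<integral> m)\<close> and \<open>exp (\<integral> n)\<close>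
  solve the homogeneous equation exactly. The solution \<open>m\<close> also factorises the operator: \<open>S' = - m S + v\<close> with
  \<open>v' = (m + \<epsilon>2 B / \<epsilon>1) v - F / \<epsilon>1\<close> solves the inhomogeneous one. Both
  equations are first order with cone coefficients, one integrated from the right vertex and, after reflection, the other
  from the left one. This gives \<open>v = O(1 / s)\<close> and then \<open>S = O(1)\<close>.\<close>

theorem singular_decomposition:
  assumes small: "1 \<le> \<tau>0 * (s / \<epsilon>1)"
  shows "\<exists>S M0 M1. cx_solution W \<epsilon>1 \<epsilon>2 B C F S \<and> (\<forall>z\<in>W. cmod (S z) \<le> bound)
    \<and> layer_phase W rate bound (1 / s) M0 \<and> cx_solution W \<epsilon>1 \<epsilon>2 B C (\<lambda>z. 0) (\<lambda>z. exp (- M0 z))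
    \<and> layer_phase W rate bound (s / \<epsilon>1) M1 \<and> cx_solution W \<epsilon>1 \<epsilon>2 B C (\<lambda>z. 0) (\<lambda>z. exp (- M1 (1 - z)))"
proof -
  note pos = c1_pos c2_pos K \<omega> s_bounds(1) eps(1)
  define a where "a = complex_of_real (\<epsilon>2 / \<epsilon>1)"
  define e where "e = complex_of_real \<epsilon>1"
  have e0: "e \<noteq> 0" and ae: "of_real \<epsilon>2 = a * e" using pos by (auto simp: a_def e_def)
  have bound0: "2 * K / c1 + c2 \<le> bound" "K + 1 + c1 \<le> bound" "128 * K / (c1 * c2) \<le> bound"
    unfolding bound_def using pos by (auto simp: add_pos_pos less_imp_le add.assoc intro!: add_increasing add_increasing2)
  have rate: "rate \<le> c2 / 2" "rate \<le> c1 / 4" by (auto simp: rate_def)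
  obtain m where m': "\<And>z. z \<in> W \<Longrightarrow> (m has_field_derivative (m z)\<^sup>2 + a * B z * m z - C z / e) (at z)"
    and ms: "\<And>z. z \<in> W \<Longrightarrow> sector (1/2) (m z)" and ml: "\<And>z. z \<in> W \<Longrightarrow> c2 / 2 / s \<le> Re (m z)"
    and mu: "\<And>z. z \<in> W \<Longrightarrow> cmod (m z) \<le> (2 * K / c1 + c2) / s"
    and mn: "\<And>z. z \<in> W \<Longrightarrow> c1 / 4 * (s / \<epsilon>1) \<le> Re (m z + a * B z)"
    using slow_riccati[OF small] unfolding a_def e_def by blast
  obtain n where n': "\<And>z. z \<in> W \<Longrightarrow> (n has_field_derivative - (n z)\<^sup>2 + a * B z * n z + C z / e) (at z)"
    and nl: "\<And>z. z \<in> W \<Longrightarrow> c1 / 4 * (s / \<epsilon>1) \<le> Re (n z)" and nu: "\<And>z. z \<in> W \<Longrightarrow> cmod (n z) \<le> (K + 1 + c1) * (s / \<epsilon>1)"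
    using fast_riccati[OF small] unfolding a_def e_def by blast
  have refl: "1 - z \<in> W" if "z \<in> W" for z using that by (simp add: rhombus_reflect)
  have r': "((\<lambda>z. 1 - z) has_field_derivative - 1) (at z)" for z :: complex by (auto intro!: derivative_eq_intros)
  have mh: "m holomorphic_on W" and nh: "n holomorphic_on W"
    using m' n' by (auto simp: holomorphic_on_open open_rhombus)
  have reflh: "(\<lambda>z. g (1 - z)) holomorphic_on W" if "g holomorphic_on W" for g
    by (rule holomorphic_on_compose_gen[of "\<lambda>z. 1 - z" W g W, unfolded o_def])
      (use refl that in \<open>auto intro!: holomorphic_intros\<close>)
  have WBF: "B holomorphic_on W" "F holomorphic_on W" using hol W_U' by (auto intro: holomorphic_on_subset)
  have c1L: "0 < c1 / 16 * (s / \<epsilon>1)" using pos by simp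
  have kn: "cone_coeff W (c1 / 16 * (s / \<epsilon>1)) (\<lambda>z. m z + a * B z)"
    unfolding cone_coeff_def
  proof (intro conjI ballI c1L)
    show "(\<lambda>z. m z + a * B z) holomorphic_on W" by (intro holomorphic_intros mh WBF)
    have "cmod (m z + a * B z) \<le> (2 * K / c1 + c2) / s + cmod a * K" if "z \<in> W" for z
      using norm_triangle_ineq[of "m z" "a * B z"] mu[OF that] mult_left_mono[OF bnd(1)[OF W_U[OF that]], of "cmod a"]
      by (simp add: norm_mult)
    then show "\<exists>B'. \<forall>z\<in>W. cmod (m z + a * B z) \<le> B'" by blast
    fix z assume z: "z \<in> W"
    have B0: "0 \<le> Re (B z)" using low(1)[OF W_U[OF z]] \<beta>\<gamma> by linarith
    have "sector (1/2) (B z)" by (rule sector_weaken[OF sect(1)[OF W_U[OF z]] _ B0]) simp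
    then have "sector (1/2) (m z + a * B z)" unfolding a_def by (intro sector_add ms z sector_scale) (use eps in auto)
    moreover have p: "4 * (c1 / 16 * (s / \<epsilon>1)) \<le> Re (m z + a * B z)" using mn[OF z] by simp
    ultimately show "\<bar>Im (m z + a * B z)\<bar> \<le> Re (m z + a * B z)" using c1L unfolding sector_def by argo
    show "4 * (c1 / 16 * (s / \<epsilon>1)) \<le> Re (m z + a * B z)" by (rule p)
  qed
  obtain v where v': "\<And>z. z \<in> W \<Longrightarrow> (v has_field_derivative (m z + a * B z) * v z - F z / e) (at z)"
    and vb: "\<And>z. z \<in> W \<Longrightarrow> cmod (v z) \<le> K / \<epsilon>1 / (c1 / 16 * (s / \<epsilon>1))"
  proof -
    have "\<exists>v. \<forall>z\<in>W. (v has_field_derivative (m z + a * B z) * v z - F z / e) (at z) \<and> cmod (v z) \<le> K / \<epsilon>1 / (c1 / 16 * (s / \<epsilon>1))"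
    proof (rule backward_solution[OF ok kn])
      show "(\<lambda>z. F z / e) holomorphic_on W" using e0 by (intro holomorphic_intros WBF) auto
      fix z assume "z \<in> W"
      then show "cmod (F z / e) \<le> K / \<epsilon>1" using bnd(3)[OF W_U] pos by (simp add: norm_divide e_def divide_right_mono)
    qed
    then show ?thesis using that by blast
  qed
  have vb': "cmod (v z) \<le> 16 * K / c1 / s" if "z \<in> W" for z
    using vb[OF that] pos by (simp add: field_simps)
  have vh: "v holomorphic_on W" using v' by (auto simp: holomorphic_on_open open_rhombus)
  have c2s: "0 < c2 / 8 / s" using pos by simp
  have km: "cone_coeff W (c2 / 8 / s) (\<lambda>z. m (1 - z))"
    unfolding cone_coeff_def
  proof (intro conjI ballI c2s reflh mh)
    show "\<exists>B. \<forall>z\<in>W. cmod (m (1 - z)) \<le> B" using mu refl by blast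
    fix z assume z: "z \<in> W"
    show "4 * (c2 / 8 / s) \<le> Re (m (1 - z))" using ml[OF refl[OF z]] by simp
    then show "\<bar>Im (m (1 - z))\<bar> \<le> Re (m (1 - z))" using ms[OF refl[OF z]] c2s unfolding sector_def by argo
  qed
  have "\<exists>w. \<forall>z\<in>W. (w has_field_derivative m (1 - z) * w z - v (1 - z)) (at z) \<and> cmod (w z) \<le> 16 * K / c1 / s / (c2 / 8 / s)"
    by (rule backward_solution[OF ok km]) (use reflh[OF vh] vb' refl in auto)
  then obtain w where w': "\<And>z. z \<in> W \<Longrightarrow> (w has_field_derivative m (1 - z) * w z - v (1 - z)) (at z)"
    and wb: "\<And>z. z \<in> W \<Longrightarrow> cmod (w z) \<le> 16 * K / c1 / s / (c2 / 8 / s)" by blast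
  define S where "S z = w (1 - z)" for z
  have Sb: "cmod (S z) \<le> bound" if "z \<in> W" for z
  proof -
    have "16 * K / c1 / s / (c2 / 8 / s) = 128 * K / (c1 * c2)" using pos by simp
    then show ?thesis using wb[OF refl[OF that]] bound0(3) unfolding S_def by linarith
  qed
  have S': "(S has_field_derivative - m z * S z + v z) (at z)" if z: "z \<in> W" for z
    using DERIV_chain2[where f = w and g = "\<lambda>z. 1 - z", OF w'[OF refl[OF z]] r']
    by (simp add: S_def[abs_def] algebra_simps)
  have solS: "cx_solution W \<epsilon>1 \<epsilon>2 B C F S"
    unfolding cx_solution_def
  proof (intro exI ballI conjI)
    fix z assume z: "z \<in> W"
    show "(S has_field_derivative - m z * S z + v z) (at z)" by (rule S'[OF z])
    show "((\<lambda>z. - m z * S z + v z) has_field_derivative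
        - ((m z)\<^sup>2 + a * B z * m z - C z / e) * S z + (- m z * S z + v z) * - m z + ((m z + a * B z) * v z - F z / e)) (at z)"
      by (intro DERIV_add DERIV_mult DERIV_minus m' S' v' z)
    show "- of_real \<epsilon>1 * (- ((m z)\<^sup>2 + a * B z * m z - C z / e) * S z + (- m z * S z + v z) * - m z + ((m z + a * B z) * v z - F z / e))
        + of_real \<epsilon>2 * B z * (- m z * S z + v z) + C z * S z = F z"
      unfolding ae e_def[symmetric] using e0 by (simp add: field_simps power2_eq_square)
  qed
  have zero: "0 \<in> W" using rhombus_contains[of 0 0] ok by (simp add: rhombus_ok_def)
  obtain M0 where M0: "\<And>z. z \<in> W \<Longrightarrow> (M0 has_field_derivative m z) (at z)" "M0 0 = 0"
  proof -
    obtain M where "\<And>z. z \<in> W \<Longrightarrow> (M has_field_derivative m z) (at z)" using primitive_on_rhombus[OF mh] by blast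
    then have "\<And>z. z \<in> W \<Longrightarrow> ((\<lambda>z. M z - M 0) has_field_derivative m z) (at z)" by (auto intro!: derivative_eq_intros)
    then show ?thesis using that[of "\<lambda>z. M z - M 0"] by simp
  qed
  obtain M1 where M1: "\<And>z. z \<in> W \<Longrightarrow> (M1 has_field_derivative n (1 - z)) (at z)" "M1 0 = 0"
  proof -
    obtain M where "\<And>z. z \<in> W \<Longrightarrow> (M has_field_derivative n (1 - z)) (at z)" using primitive_on_rhombus[OF reflh[OF nh]] by blast
    then have "\<And>z. z \<in> W \<Longrightarrow> ((\<lambda>z. M z - M 0) has_field_derivative n (1 - z)) (at z)" by (auto intro!: derivative_eq_intros)
    then show ?thesis using that[of "\<lambda>z. M z - M 0"] by simp
  qed
  have ph0: "layer_phase W rate bound (1 / s) M0"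
    unfolding layer_phase_def
  proof (intro conjI exI[of _ m] ballI M0)
    fix z assume z: "z \<in> W"
    have "rate * (1 / s) \<le> c2 / 2 * (1 / s)" using rate pos by (intro mult_right_mono) auto
    then show "rate * (1 / s) \<le> Re (m z)" using ml[OF z] by simp
    have "(2 * K / c1 + c2) / s \<le> bound / s" using bound0 pos by (intro divide_right_mono) auto
    then show "cmod (m z) \<le> bound * (1 / s)" using mu[OF z] by simp
  qed
  have sL: "0 < s / \<epsilon>1" using pos by simp
  have ph1: "layer_phase W rate bound (s / \<epsilon>1) M1"
    unfolding layer_phase_def
  proof (intro conjI exI[of _ "\<lambda>z. n (1 - z)"] ballI M1)
    fix z assume z: "z \<in> W"
    have "rate * (s / \<epsilon>1) \<le> c1 / 4 * (s / \<epsilon>1)" using rate sL by (intro mult_right_mono) auto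
    then show "rate * (s / \<epsilon>1) \<le> Re (n (1 - z))" using nl[OF refl[OF z]] by linarith
    have "(K + 1 + c1) * (s / \<epsilon>1) \<le> bound * (s / \<epsilon>1)" using bound0 sL by (intro mult_right_mono) auto
    then show "cmod (n (1 - z)) \<le> bound * (s / \<epsilon>1)" using nu[OF refl[OF z]] by linarith
  qed
  have sol0: "cx_solution W \<epsilon>1 \<epsilon>2 B C (\<lambda>z. 0) (\<lambda>z. exp (- M0 z))"
    unfolding cx_solution_def
  proof (intro exI ballI conjI)
    fix z assume z: "z \<in> W"
    have E: "((\<lambda>z. exp (- M0 z)) has_field_derivative - m z * exp (- M0 z)) (at z)" if "z \<in> W" for z
      using DERIV_fun_exp[OF DERIV_minus[OF M0(1)[OF that]]] by (simp add: mult.commute)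
    show "((\<lambda>z. exp (- M0 z)) has_field_derivative - m z * exp (- M0 z)) (at z)" by (rule E[OF z])
    show "((\<lambda>z. - m z * exp (- M0 z)) has_field_derivative
        - ((m z)\<^sup>2 + a * B z * m z - C z / e) * exp (- M0 z) + - m z * exp (- M0 z) * - m z) (at z)"
      by (intro DERIV_mult DERIV_minus m' E z)
    show "- of_real \<epsilon>1 * (- ((m z)\<^sup>2 + a * B z * m z - C z / e) * exp (- M0 z) + - m z * exp (- M0 z) * - m z)
       + of_real \<epsilon>2 * B z * (- m z * exp (- M0 z)) + C z * exp (- M0 z) = 0"
      unfolding ae e_def[symmetric] using e0 by (simp add: field_simps power2_eq_square)
  qed
  have sol1: "cx_solution W \<epsilon>1 \<epsilon>2 B C (\<lambda>z. 0) (\<lambda>z. exp (- M1 (1 - z)))"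
    unfolding cx_solution_def
  proof (intro exI ballI conjI)
    fix z assume z: "z \<in> W"
    have E: "((\<lambda>z. exp (- M1 (1 - z))) has_field_derivative n z * exp (- M1 (1 - z))) (at z)" if "z \<in> W" for z
    proof -
      have "((\<lambda>z. M1 (1 - z)) has_field_derivative n z * - 1) (at z)"
        using DERIV_chain2[where f = M1 and g = "\<lambda>z. 1 - z", OF M1(1)[OF refl[OF that]] r'] by simp
      from DERIV_fun_exp[OF DERIV_minus[OF this]] show ?thesis by (simp add: mult.commute)
    qed
    show "((\<lambda>z. exp (- M1 (1 - z))) has_field_derivative n z * exp (- M1 (1 - z))) (at z)" by (rule E[OF z])
    show "((\<lambda>z. n z * exp (- M1 (1 - z))) has_field_derivative
        (- (n z)\<^sup>2 + a * B z * n z + C z / e) * exp (- M1 (1 - z)) + n z * exp (- M1 (1 - z)) * n z) (at z)"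
      by (intro DERIV_mult n' E z)
    show "- of_real \<epsilon>1 * ((- (n z)\<^sup>2 + a * B z * n z + C z / e) * exp (- M1 (1 - z)) + n z * exp (- M1 (1 - z)) * n z)
       + of_real \<epsilon>2 * B z * (n z * exp (- M1 (1 - z))) + C z * exp (- M1 (1 - z)) = 0"
      unfolding ae e_def[symmetric] using e0 by (simp add: field_simps power2_eq_square)
  qed
  show ?thesis using solS Sb ph0 ph1 sol0 sol1 by blast
qed

end

end

section \<open>The maximum principle and the regular regime\<close>

text \<open>At an interior minimum with a negative value \<open>w' = 0\<close> and \<open>w'' \<ge> 0\<close>, so the operator would be negative there.\<close>

lemma maximum_principle:
  fixes w :: "real \<Rightarrow> real"
  assumes w: "continuous_on {0..1} w" "\<And>x. x \<in> I01 \<Longrightarrow> (w has_real_derivative w' x) (at x)"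
      "\<And>x. x \<in> I01 \<Longrightarrow> (w' has_real_derivative w'' x) (at x)"
    and op: "\<And>x. x \<in> I01 \<Longrightarrow> 0 \<le> - \<epsilon> * w'' x + b x * w' x + c x * w x"
    and c: "\<And>x. x \<in> I01 \<Longrightarrow> 0 < c x" and \<epsilon>: "0 < \<epsilon>" and bc: "0 \<le> w 0" "0 \<le> w 1"
    and x: "x \<in> {0..1}"
  shows "0 \<le> w x"
proof (rule ccontr)
  assume neg: "\<not> 0 \<le> w x"
  obtain y where y: "y \<in> {0..1}" "\<And>z. z \<in> {0..1} \<Longrightarrow> w y \<le> w z"
    using continuous_attains_inf[of "{0..1}" w] w(1) by auto
  have wy: "w y < 0" using y(2)[OF x] neg by simp
  then have "y \<noteq> 0" "y \<noteq> 1" using bc by auto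
  then have yI: "y \<in> I01" using y(1) by auto
  have "w' y = 0"
  proof (rule DERIV_local_min[OF w(2)[OF yI]])
    show "0 < min y (1 - y)" using yI by auto
    show "\<forall>z. \<bar>y - z\<bar> < min y (1 - y) \<longrightarrow> w y \<le> w z" using y(2) by (auto simp: abs_less_iff)
  qed
  moreover have "c y * w y < 0" using c[OF yI] wy by (simp add: mult_pos_neg)
  ultimately have "\<epsilon> * w'' y < 0" using op[OF yI] by simp
  then have "w'' y < 0" using \<epsilon> by (simp add: mult_less_0_iff)
  then obtain d where d: "0 < d" "\<And>h. 0 < h \<Longrightarrow> h < d \<Longrightarrow> w' (y + h) < w' y"
    using DERIV_neg_dec_right[OF w(3)[OF yI]] by blast
  define h where "h = min (d / 2) ((1 - y) / 2)"
  have h: "0 < h" "h < d" "y + h < 1" using d yI by (auto simp: h_def min_def field_simps)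
  have "\<exists>z. y < z \<and> z < y + h \<and> w (y + h) - w y = (y + h - y) * w' z"
  proof (rule MVT2)
    fix z assume "y \<le> z" "z \<le> y + h"
    then show "(w has_real_derivative w' z) (at z)" using yI h by (intro w(2)) auto
  qed (use h in auto)
  then obtain z where z: "y < z" "z < y + h" "w (y + h) - w y = h * w' z" by auto
  have "w' z < 0" using d(2)[of "z - y"] z h \<open>w' y = 0\<close> by simp
  then have "h * w' z < 0" using h by (simp add: mult_pos_neg)
  then have "w (y + h) < w y" using z(3) by linarith
  moreover have "w y \<le> w (y + h)" using h yI by (intro y(2)) auto
  ultimately show False by simp
qed

lemma weighted_primitive_at_0:
  fixes \<theta> r :: real
  defines "W \<equiv> rhombus \<theta> r"
  assumes ok: "rhombus_ok \<theta> r" and g: "g holomorphic_on W" "\<And>z. z \<in> W \<Longrightarrow> cmod (g z) \<le> A * exp (\<Lambda> * cmod z)"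
    and \<Lambda>: "0 < \<Lambda>" and A: "0 \<le> A"
  shows "\<exists>P. P 0 = 0 \<and> (\<forall>z\<in>W. (P has_field_derivative g z) (at z) \<and> cmod (P z) \<le> A / \<Lambda> * exp (\<Lambda> * cmod z))"
proof -
  obtain P0 where P0: "\<And>z. z \<in> W \<Longrightarrow> (P0 has_field_derivative g z) (at z)"
    using primitive_on_rhombus g(1) unfolding W_def by blast
  have zero: "0 \<in> W" using rhombus_contains[of 0 0] ok by (simp add: rhombus_ok_def W_def)
  define P where "P z = P0 z - P0 0" for z
  have P: "(P has_field_derivative g z) (at z)" if "z \<in> W" for z
    unfolding P_def using P0[OF that] by (auto intro!: derivative_eq_intros)
  have "cmod (P z) \<le> A / \<Lambda> * exp (\<Lambda> * cmod z)" if z: "z \<in> W" for z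
  proof (cases "z = 0")
    case False
    define u where "u = cnj z / of_real (cmod z)"
    have uz: "u * z = of_real (cmod z)" using False
      by (simp add: u_def complex_norm_square[symmetric] power2_eq_square mult.commute)
    define k where "k = - of_real \<Lambda> * u"
    have seg: "\<zeta> \<in> W \<and> (\<exists>t\<ge>0. \<zeta> = of_real t * z)" if \<zeta>: "\<zeta> \<in> closed_segment z 0" for \<zeta>
    proof
      show "\<zeta> \<in> W" using \<zeta> closed_segment_subset[OF z zero convex_rhombus[of \<theta> r, folded W_def]] by blast
      obtain t where "\<zeta> = (1 - t) *\<^sub>R z + t *\<^sub>R 0" "0 \<le> t" "t \<le> 1" using \<zeta> by (auto simp: closed_segment_def)
      then show "\<exists>t\<ge>0. \<zeta> = of_real t * z" by (intro exI[of _ "1 - t"]) (simp add: scaleR_conv_of_real)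
    qed
    have "cmod (P 0 - P z) \<le> A / \<Lambda> * (exp (- Re (k * z)) - exp (- Re (k * 0)))"
    proof (rule weighted_primitive_bound[where g = g and K = "\<lambda>\<zeta>. k * \<zeta>" and k = "\<lambda>_. k"])
      fix \<zeta> assume "\<zeta> \<in> closed_segment z 0"
      from seg[OF this] obtain t where \<zeta>: "\<zeta> \<in> W" "0 \<le> t" "\<zeta> = of_real t * z" by blast
      show "(P has_field_derivative g \<zeta>) (at \<zeta>)" by (rule P[OF \<zeta>(1)])
      show "((\<lambda>\<zeta>. k * \<zeta>) has_field_derivative k) (at \<zeta>)" by (auto intro!: derivative_eq_intros)
      have "k * \<zeta> = - of_real \<Lambda> * of_real t * (u * z)" by (simp add: k_def \<zeta>(3) mult_ac)
      then have "k * \<zeta> = of_real (- (\<Lambda> * cmod \<zeta>))" using \<zeta>(2) unfolding uz by (simp add: \<zeta>(3) norm_mult)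
      then have "- Re (k * \<zeta>) = \<Lambda> * cmod \<zeta>" by simp
      then show "cmod (g \<zeta>) \<le> A * exp (- Re (k * \<zeta>))" using g(2)[OF \<zeta>(1)] by simp
      have "k * (0 - z) = of_real \<Lambda> * (u * z)" by (simp add: k_def)
      then show "\<Lambda> * cmod (0 - z) \<le> Re (k * (0 - z))" unfolding uz by simp
    qed (use \<Lambda> A in auto)
    moreover have "k * z = of_real (- (\<Lambda> * cmod z))" by (simp add: k_def mult.assoc uz)
    ultimately have "cmod (P z) \<le> A / \<Lambda> * (exp (\<Lambda> * cmod z) - 1)" by (simp add: P_def norm_minus_commute)
    also have "\<dots> \<le> A / \<Lambda> * exp (\<Lambda> * cmod z)" using \<Lambda> A by (intro mult_left_mono) auto
    finally show ?thesis .
  qed (use \<Lambda> A in \<open>simp add: P_def\<close>)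
  then show ?thesis using P by (intro exI[of _ P]) (auto simp: P_def)
qed

text \<open>Picard iteration in the norm weighted by \<open>exp (- 4 K |z|)\<close>, in which integration from \<open>0\<close> gains the
  factor \<open>1 / (4 K)\<close>; so the contraction holds on the whole rhombus at once.\<close>

theorem linear_initial_value_problem:
  fixes \<theta> r :: real
  defines "W \<equiv> rhombus \<theta> r"
  assumes ok: "rhombus_ok \<theta> r" and K: "1 \<le> K"
    and hol: "a1 holomorphic_on W" "a0 holomorphic_on W" "g holomorphic_on W"
    and bnd: "\<And>z. z \<in> W \<Longrightarrow> cmod (a1 z) \<le> K" "\<And>z. z \<in> W \<Longrightarrow> cmod (a0 z) \<le> K" "\<And>z. z \<in> W \<Longrightarrow> cmod (g z) \<le> K"
  shows "\<exists>U Y. U 0 = 0 \<and> Y 0 = \<tau> \<and> (\<forall>z\<in>W. (U has_field_derivative Y z) (at z) \<and>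
     (Y has_field_derivative a1 z * Y z + a0 z * U z - g z) (at z) \<and>
     cmod (U z) \<le> 2 * (cmod \<tau> + 1) * exp (4 * K * (2 * (1 + r))))"
proof -
  define \<Lambda> where "\<Lambda> = 4 * K"
  define Q where "Q = cmod \<tau> + 1"
  define E where "E z = exp (\<Lambda> * cmod z)" for z :: complex
  have \<Lambda>: "0 < \<Lambda>" "1 \<le> \<Lambda>" using K by (auto simp: \<Lambda>_def)
  have Q: "0 < Q" unfolding Q_def by (intro add_nonneg_pos) auto
  have E1: "1 \<le> E z" for z using \<Lambda> by (simp add: E_def)
  have zero: "0 \<in> W" using rhombus_contains[of 0 0] ok by (simp add: rhombus_ok_def W_def)
  have prim: "\<exists>P. P 0 = 0 \<and> (\<forall>z\<in>W. (P has_field_derivative h z) (at z) \<and> cmod (P z) \<le> A / \<Lambda> * E z)"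
    if "h holomorphic_on W" "\<And>z. z \<in> W \<Longrightarrow> cmod (h z) \<le> A * E z" "0 \<le> A" for h A
    using weighted_primitive_at_0[OF ok, of h A \<Lambda>] that \<Lambda> unfolding W_def E_def by blast
  have holI: "h holomorphic_on W" if "\<And>z. z \<in> W \<Longrightarrow> (h has_field_derivative h' z) (at z)" for h h'
    using that by (auto simp: holomorphic_on_open open_rhombus W_def)
  let ?inv = "\<lambda>n (Y0, Z0, Y1, Z1). Y0 holomorphic_on W \<and> Z0 holomorphic_on W \<and> Y1 0 = \<tau> \<and> Z1 0 = 0 \<and>
     (n = 0 \<longrightarrow> (\<forall>z. Z0 z = 0)) \<and> (\<forall>z\<in>W. (Y1 has_field_derivative a1 z * Y0 z + a0 z * Z0 z - g z) (at z) \<and> (Z1 has_field_derivative Y1 z) (at z) \<and>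
        cmod (Y1 z - Y0 z) \<le> Q * (1/2) ^ n * E z \<and> cmod (Z1 z - Z0 z) \<le> Q * (1/2) ^ n * E z)"
  let ?nxt = "\<lambda>n (Y0, Z0, Y1, Z1) (Y0', Z0', Y1', Z1'). Y0' = Y1 \<and> Z0' = Z1"
  have "\<exists>f. \<forall>n. ?inv n (f n) \<and> ?nxt n (f n) (f (Suc n))"
  proof (rule dependent_nat_choice)
    have "\<exists>P. P 0 = 0 \<and> (\<forall>z\<in>W. (P has_field_derivative - g z) (at z) \<and> cmod (P z) \<le> K / \<Lambda> * E z)"
    proof (rule prim)
      fix z assume "z \<in> W"
      then have "cmod (- g z) \<le> K * 1" using bnd(3)[of z] by simp
      also have "\<dots> \<le> K * E z" using E1[of z] K by (intro mult_left_mono) auto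
      finally show "cmod (- g z) \<le> K * E z" .
    qed (use hol K in \<open>auto intro!: holomorphic_intros\<close>)
    then obtain P where P: "P 0 = 0" "\<And>z. z \<in> W \<Longrightarrow> (P has_field_derivative - g z) (at z)"
      "\<And>z. z \<in> W \<Longrightarrow> cmod (P z) \<le> K / \<Lambda> * E z" by blast
    define Y where "Y z = \<tau> + P z" for z
    have Y': "(Y has_field_derivative - g z) (at z)" if "z \<in> W" for z
      unfolding Y_def using P(2)[OF that] by (auto intro!: derivative_eq_intros)
    have Yb: "cmod (Y z) \<le> Q * E z" if z: "z \<in> W" for z
    proof -
      have "K / \<Lambda> * E z \<le> 1 * E z" using K E1[of z] by (intro mult_right_mono) (auto simp: \<Lambda>_def)
      moreover have "cmod \<tau> * 1 \<le> cmod \<tau> * E z" using E1[of z] by (intro mult_left_mono) auto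
      ultimately show ?thesis using norm_triangle_ineq[of \<tau> "P z"] P(3)[OF z] by (simp add: Y_def Q_def distrib_right)
    qed
    obtain Z where Z: "Z 0 = 0" "\<And>z. z \<in> W \<Longrightarrow> (Z has_field_derivative Y z) (at z)"
      "\<And>z. z \<in> W \<Longrightarrow> cmod (Z z) \<le> Q / \<Lambda> * E z"
      using prim[OF holI[OF Y'] Yb] Q by (metis less_imp_le)
    have Zb: "cmod (Z z) \<le> Q * E z" if "z \<in> W" for z
    proof -
      have "Q / \<Lambda> * E z \<le> Q * E z" using Q \<Lambda> E1[of z] by (intro mult_right_mono) (auto simp: divide_le_eq)
      then show ?thesis using Z(3)[OF that] by linarith
    qed
    have "?inv 0 (\<lambda>z. 0, \<lambda>z. 0, Y, Z)" using Y' Yb Z Zb P(1) by (simp add: Y_def)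
    then show "\<exists>x. ?inv 0 x" by blast
  next
    fix x and n :: nat assume inv: "?inv n x"
    obtain Y0 Z0 Y1 Z1 where x: "x = (Y0, Z0, Y1, Z1)" by (cases x) auto
    have h0: "Y0 holomorphic_on W" "Z0 holomorphic_on W" and i1: "Y1 0 = \<tau>" "Z1 0 = 0"
      and Y1: "\<And>z. z \<in> W \<Longrightarrow> (Y1 has_field_derivative a1 z * Y0 z + a0 z * Z0 z - g z) (at z)"
      and Z1: "\<And>z. z \<in> W \<Longrightarrow> (Z1 has_field_derivative Y1 z) (at z)"
      and b: "\<And>z. z \<in> W \<Longrightarrow> cmod (Y1 z - Y0 z) \<le> Q * (1/2) ^ n * E z" "\<And>z. z \<in> W \<Longrightarrow> cmod (Z1 z - Z0 z) \<le> Q * (1/2) ^ n * E z"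
      using inv unfolding x by auto
    have h1: "Y1 holomorphic_on W" "Z1 holomorphic_on W" by (rule holI, erule Y1, rule holI, erule Z1)
    define q where "q = Q * (1/2) ^ n"
    have q: "0 \<le> q" using Q by (simp add: q_def)
    have "\<exists>P. P 0 = 0 \<and> (\<forall>z\<in>W. (P has_field_derivative a1 z * (Y1 z - Y0 z) + a0 z * (Z1 z - Z0 z)) (at z) \<and> cmod (P z) \<le> (2 * K * q) / \<Lambda> * E z)"
    proof (rule prim)
      show "(\<lambda>z. a1 z * (Y1 z - Y0 z) + a0 z * (Z1 z - Z0 z)) holomorphic_on W" by (intro holomorphic_intros hol h0 h1)
      fix z assume z: "z \<in> W"
      have "cmod (a1 z * (Y1 z - Y0 z) + a0 z * (Z1 z - Z0 z)) \<le> K * (q * E z) + K * (q * E z)"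
        unfolding q_def by (intro norm_triangle_le add_mono) (unfold norm_mult, (intro mult_mono bnd b z; use K in simp)+)
      then show "cmod (a1 z * (Y1 z - Y0 z) + a0 z * (Z1 z - Z0 z)) \<le> 2 * K * q * E z" by simp
    qed (use K q in simp)
    then obtain P where P: "P 0 = 0" "\<And>z. z \<in> W \<Longrightarrow> (P has_field_derivative a1 z * (Y1 z - Y0 z) + a0 z * (Z1 z - Z0 z)) (at z)"
      "\<And>z. z \<in> W \<Longrightarrow> cmod (P z) \<le> (2 * K * q) / \<Lambda> * E z" by blast
    have "(2 * K * q) / \<Lambda> = q / 2" using K by (simp add: \<Lambda>_def)
    then have Pb: "cmod (P z) \<le> (q / 2) * E z" if "z \<in> W" for z using P(3)[OF that] by (simp only:)
    obtain R where R: "R 0 = 0" "\<And>z. z \<in> W \<Longrightarrow> (R has_field_derivative P z) (at z)"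
      "\<And>z. z \<in> W \<Longrightarrow> cmod (R z) \<le> (q / 2) / \<Lambda> * E z"
      using prim[OF holI[OF P(2)] Pb] q by (metis divide_nonneg_nonneg zero_le_numeral)
    have Rb: "cmod (R z) \<le> (q / 2) * E z" if "z \<in> W" for z
    proof -
      have "(q / 2) / \<Lambda> * E z \<le> (q / 2) * E z"
        using q \<Lambda> E1[of z] by (intro mult_right_mono) (auto simp: divide_le_eq mult_le_cancel_left1)
      then show ?thesis using R(3)[OF that] by linarith
    qed
    have "?inv (Suc n) (Y1, Z1, \<lambda>z. Y1 z + P z, \<lambda>z. Z1 z + R z)"
    proof (unfold prod.case, intro conjI ballI h1)
      fix z assume z: "z \<in> W"
      show "((\<lambda>z. Y1 z + P z) has_field_derivative a1 z * Y1 z + a0 z * Z1 z - g z) (at z)"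
        using DERIV_add[OF Y1[OF z] P(2)[OF z]] by (simp add: algebra_simps)
      show "((\<lambda>z. Z1 z + R z) has_field_derivative Y1 z + P z) (at z)" by (intro DERIV_add Z1 R z)
      show "cmod (Y1 z + P z - Y1 z) \<le> Q * (1/2) ^ Suc n * E z" using Pb[OF z] by (simp add: q_def)
      show "cmod (Z1 z + R z - Z1 z) \<le> Q * (1/2) ^ Suc n * E z" using Rb[OF z] by (simp add: q_def)
    qed (use i1 P(1) R(1) in auto)
    then show "\<exists>y. ?inv (Suc n) y \<and> ?nxt n x y" unfolding x by (intro exI[of _ "(Y1, Z1, \<lambda>z. Y1 z + P z, \<lambda>z. Z1 z + R z)"]) simp
  qed
  then obtain f where f: "\<forall>n. ?inv n (f n) \<and> ?nxt n (f n) (f (Suc n))" ..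
  define Y0 where "Y0 n = fst (f n)" for n
  define Z0 where "Z0 n = fst (snd (f n))" for n
  define Y where "Y n = fst (snd (snd (f n)))" for n
  define Z where "Z n = snd (snd (snd (f n)))" for n
  have S: "Y0 (Suc n) = Y n" "Z0 (Suc n) = Z n" for n
    using f[rule_format, of n] by (auto simp: Y0_def Z0_def Y_def Z_def split: prod.splits)
  have i: "Y n 0 = \<tau>" "Z n 0 = 0" for n
    using f[rule_format, of n] by (auto simp: Y_def Z_def split: prod.splits)
  have Y': "(Y n has_field_derivative a1 z * Y0 n z + a0 z * Z0 n z - g z) (at z)"
    and Z': "(Z n has_field_derivative Y n z) (at z)"
    and st: "cmod (Y n z - Y0 n z) \<le> Q * (1/2) ^ n * E z" "cmod (Z n z - Z0 n z) \<le> Q * (1/2) ^ n * E z"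
    if "z \<in> W" for n z
    using f[rule_format, of n] that by (auto simp: Y0_def Z0_def Y_def Z_def split: prod.splits)
  define H where "H = exp (\<Lambda> * (2 * (1 + r)))"
  have EH: "E z \<le> H" if "z \<in> W" for z
    using rhombus_norm[of z \<theta> r] that ok \<Lambda> by (simp add: E_def H_def W_def rhombus_ok_def)
  have step: "cmod (Y (Suc n) z - Y n z) \<le> Q * H * (1/2) ^ n" "cmod (Z (Suc n) z - Z n z) \<le> Q * H * (1/2) ^ n" if z: "z \<in> W" for n z
  proof -
    have "Q * (1/2) ^ Suc n * E z \<le> Q * (1/2) ^ n * H"
      using Q EH[OF z] E1[of z] by (intro mult_mono power_decreasing) auto
    then show "cmod (Y (Suc n) z - Y n z) \<le> Q * H * (1/2) ^ n" "cmod (Z (Suc n) z - Z n z) \<le> Q * H * (1/2) ^ n"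
      using st[OF z, of "Suc n"] unfolding S by (simp_all only: mult_ac)
  qed
  obtain y y' where y: "\<And>z. z \<in> W \<Longrightarrow> (\<lambda>n. Y n z) \<longlonglongrightarrow> y z" "\<And>z. z \<in> W \<Longrightarrow> (y has_field_derivative y' z) (at z)"
    "\<And>z. z \<in> W \<Longrightarrow> (\<lambda>n. a1 z * Y0 n z + a0 z * Z0 n z - g z) \<longlonglongrightarrow> y' z"
    by (rule geometric_iteration_limit[of W Y "\<lambda>n z. a1 z * Y0 n z + a0 z * Z0 n z - g z" "Q * H"])
      (use Y' step open_rhombus in \<open>auto simp: W_def\<close>)
  obtain u u' where u: "\<And>z. z \<in> W \<Longrightarrow> (\<lambda>n. Z n z) \<longlonglongrightarrow> u z" "\<And>z. z \<in> W \<Longrightarrow> (u has_field_derivative u' z) (at z)"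
    "\<And>z. z \<in> W \<Longrightarrow> (\<lambda>n. Y n z) \<longlonglongrightarrow> u' z"
    by (rule geometric_iteration_limit[of W Z Y "Q * H"]) (use Z' step open_rhombus in \<open>auto simp: W_def\<close>)
  have Zb: "cmod (Z n z) \<le> Q * H * (2 - (1/2) ^ n)" if z: "z \<in> W" for n z
  proof (induction n)
    case 0
    have "Q * E z \<le> Q * H" using EH[OF z] Q by simp
    moreover have "Z0 0 z = 0" using f[rule_format, of 0] by (auto simp: Z0_def split: prod.splits)
    ultimately show ?case using st(2)[OF z, of 0] by simp
  next
    case (Suc n)
    have "cmod (Z (Suc n) z) \<le> cmod (Z n z) + Q * H * (1/2) ^ n / 2"
    proof -
      have "Q * (1/2) ^ Suc n * E z \<le> Q * (1/2) ^ Suc n * H" using Q EH[OF z] by (intro mult_left_mono) auto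
      then have "cmod (Z (Suc n) z - Z n z) \<le> Q * H * (1/2) ^ n / 2" using st(2)[OF z, of "Suc n"] by (simp add: S mult_ac)
      then show ?thesis using norm_triangle_ineq2[of "Z (Suc n) z" "Z n z"] by linarith
    qed
    then show ?case using Suc by (simp add: algebra_simps)
  qed
  show ?thesis
  proof (rule exI[of _ u], rule exI[of _ y], intro conjI ballI)
    show "u 0 = 0" using u(1)[OF zero] by (simp add: i LIMSEQ_const_iff)
    show "y 0 = \<tau>" using y(1)[OF zero] by (simp add: i LIMSEQ_const_iff)
    fix z assume z: "z \<in> W"
    have "u' z = y z" by (rule LIMSEQ_unique[OF u(3)[OF z] y(1)[OF z]])
    then show "(u has_field_derivative y z) (at z)" using u(2)[OF z] by simp
    have "(\<lambda>n. Y0 n z) \<longlonglongrightarrow> y z" by (rule LIMSEQ_imp_Suc) (simp add: S y(1)[OF z])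
    moreover have "(\<lambda>n. Z0 n z) \<longlonglongrightarrow> u z" by (rule LIMSEQ_imp_Suc) (simp add: S u(1)[OF z])
    ultimately have "(\<lambda>n. a1 z * Y0 n z + a0 z * Z0 n z - g z) \<longlonglongrightarrow> a1 z * y z + a0 z * u z - g z"
      by (intro tendsto_intros)
    then have "y' z = a1 z * y z + a0 z * u z - g z" using y(3)[OF z] LIMSEQ_unique by blast
    then show "(y has_field_derivative a1 z * y z + a0 z * u z - g z) (at z)" using y(2)[OF z] by simp
    have "cmod (Z n z) \<le> 2 * Q * H" for n
    proof -
      have "Q * H * (2 - (1/2) ^ n) \<le> Q * H * 2" using Q by (intro mult_left_mono) (auto simp: H_def)
      then show ?thesis using Zb[OF z, of n] by simp
    qed
    then have "cmod (u z) \<le> 2 * Q * H" by (intro Lim_norm_ubound[OF _ u(1)[OF z]]) auto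
    then show "cmod (u z) \<le> 2 * (cmod \<tau> + 1) * exp (4 * K * (2 * (1 + r)))" by (simp add: Q_def H_def \<Lambda>_def)
  qed
qed

lemma cx_deriv_real:
  assumes "(u has_field_derivative u') (at (complex_of_real x))"
  shows "((\<lambda>x. Re (u (of_real x))) has_real_derivative Re u') (at x)"
proof -
  have "((\<lambda>x. u (of_real x)) has_vector_derivative u') (at x)"
    by (rule has_vector_derivative_real_field[OF assms])
  from bounded_linear.has_vector_derivative[OF bounded_linear_Re this]
  show ?thesis by (simp add: has_real_derivative_iff_has_vector_derivative)
qed

context holomorphic_coefficients
begin

lemma real_in_W: "x \<in> {0..1} \<Longrightarrow> of_real x \<in> W"
  by (rule rhombus_contains[of x]) (use ok in \<open>auto simp: rhombus_ok_def\<close>)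

lemma W01: "0 \<in> W" "1 \<in> W" using real_in_W[of 0] real_in_W[of 1] by simp_all

lemma cx_solution_real:
  assumes "cx_solution W \<epsilon>1 \<epsilon>2 B C G u"
  shows "\<exists>w1 w2. \<forall>x\<in>{0..1}. ((\<lambda>x. Re (u (of_real x))) has_real_derivative w1 x) (at x) \<and>
     (w1 has_real_derivative w2 x) (at x) \<and>
     - \<epsilon>1 * w2 x + \<epsilon>2 * b x * w1 x + c x * Re (u (of_real x)) = Re (G (of_real x))"
proof -
  obtain u' u'' where u: "\<And>z. z \<in> W \<Longrightarrow> (u has_field_derivative u' z) (at z)"
    "\<And>z. z \<in> W \<Longrightarrow> (u' has_field_derivative u'' z) (at z)"
    "\<And>z. z \<in> W \<Longrightarrow> - of_real \<epsilon>1 * u'' z + of_real \<epsilon>2 * B z * u' z + C z * u z = G z"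
    using assms unfolding cx_solution_def by blast
  show ?thesis
  proof (rule exI[of _ "\<lambda>x. Re (u' (of_real x))"], rule exI[of _ "\<lambda>x. Re (u'' (of_real x))"], intro ballI conjI)
    fix x :: real assume x: "x \<in> {0..1}"
    show "((\<lambda>x. Re (u (of_real x))) has_real_derivative Re (u' (of_real x))) (at x)"
      "((\<lambda>x. Re (u' (of_real x))) has_real_derivative Re (u'' (of_real x))) (at x)"
      by (rule cx_deriv_real, rule u, rule real_in_W[OF x])+
    show "- \<epsilon>1 * Re (u'' (of_real x)) + \<epsilon>2 * b x * Re (u' (of_real x)) + c x * Re (u (of_real x)) = Re (G (of_real x))"
      using arg_cong[OF u(3)[OF real_in_W[OF x]], of Re] by (simp add: real[OF x])
  qed
qed

lemma cx_solution_add: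
  assumes "cx_solution W \<epsilon>1 \<epsilon>2 B C G u" "cx_solution W \<epsilon>1 \<epsilon>2 B C (\<lambda>z. 0) v"
  shows "cx_solution W \<epsilon>1 \<epsilon>2 B C G (\<lambda>z. u z + \<alpha> * v z)"
proof -
  obtain u' u'' where u: "\<And>z. z \<in> W \<Longrightarrow> (u has_field_derivative u' z) (at z)"
    "\<And>z. z \<in> W \<Longrightarrow> (u' has_field_derivative u'' z) (at z)"
    "\<And>z. z \<in> W \<Longrightarrow> - of_real \<epsilon>1 * u'' z + of_real \<epsilon>2 * B z * u' z + C z * u z = G z"
    using assms(1) unfolding cx_solution_def by blast
  obtain v' v'' where v: "\<And>z. z \<in> W \<Longrightarrow> (v has_field_derivative v' z) (at z)"
    "\<And>z. z \<in> W \<Longrightarrow> (v' has_field_derivative v'' z) (at z)"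
    "\<And>z. z \<in> W \<Longrightarrow> - of_real \<epsilon>1 * v'' z + of_real \<epsilon>2 * B z * v' z + C z * v z = 0"
    using assms(2) unfolding cx_solution_def by blast
  show ?thesis unfolding cx_solution_def
  proof (intro exI ballI conjI)
    fix z assume z: "z \<in> W"
    show "((\<lambda>z. u z + \<alpha> * v z) has_field_derivative u' z + \<alpha> * v' z) (at z)"
      by (intro DERIV_add DERIV_cmult u v z)
    show "((\<lambda>z. u' z + \<alpha> * v' z) has_field_derivative u'' z + \<alpha> * v'' z) (at z)"
      by (intro DERIV_add DERIV_cmult u v z)
    have "- of_real \<epsilon>1 * (u'' z + \<alpha> * v'' z) + of_real \<epsilon>2 * B z * (u' z + \<alpha> * v' z) + C z * (u z + \<alpha> * v z)
      = (- of_real \<epsilon>1 * u'' z + of_real \<epsilon>2 * B z * u' z + C z * u z)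
        + \<alpha> * (- of_real \<epsilon>1 * v'' z + of_real \<epsilon>2 * B z * v' z + C z * v z)"
      by (simp add: algebra_simps)
    then show "- of_real \<epsilon>1 * (u'' z + \<alpha> * v'' z) + of_real \<epsilon>2 * B z * (u' z + \<alpha> * v' z) + C z * (u z + \<alpha> * v z) = G z"
      unfolding u(3)[OF z] v(3)[OF z] by simp
  qed
qed

lemma c_pos: "x \<in> {0..1} \<Longrightarrow> 0 < c x"
  using low(2)[OF W_U[OF real_in_W[of x]]] real(2)[of x] \<beta>\<gamma> by simp

lemma b_pos: "x \<in> {0..1} \<Longrightarrow> 0 < b x"
  using low(1)[OF W_U[OF real_in_W[of x]]] real(1)[of x] \<beta>\<gamma> by simp

lemma BVP_solution_unique:
  assumes u: "is_BVP_solution \<epsilon>1 \<epsilon>2 b c f u" and H: "cx_solution W \<epsilon>1 \<epsilon>2 B C F H"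
    and bc: "H 0 = 0" "H 1 = 0" and eps: "0 < \<epsilon>1" and x: "x \<in> {0..1}"
  shows "u x = Re (H (of_real x))"
proof -
  obtain h1 h2 where h: "\<And>x. x \<in> {0..1} \<Longrightarrow> ((\<lambda>x. Re (H (of_real x))) has_real_derivative h1 x) (at x)"
    "\<And>x. x \<in> {0..1} \<Longrightarrow> (h1 has_real_derivative h2 x) (at x)"
    "\<And>x. x \<in> {0..1} \<Longrightarrow> - \<epsilon>1 * h2 x + \<epsilon>2 * b x * h1 x + c x * Re (H (of_real x)) = f x"
    using cx_solution_real[OF H] real(3) by (metis Re_complex_of_real)
  have uc: "continuous_on {0..1} u" and u0: "u 0 = 0" "u 1 = 0"
    and ud: "\<And>x. x \<in> I01 \<Longrightarrow> (u has_real_derivative deriv u x) (at x)"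
      "\<And>x. x \<in> I01 \<Longrightarrow> (deriv u has_real_derivative deriv (deriv u) x) (at x)"
    and ue: "\<And>x. x \<in> I01 \<Longrightarrow> - \<epsilon>1 * deriv (deriv u) x + \<epsilon>2 * b x * deriv u x + c x * u x = f x"
    using u unfolding is_BVP_solution_def by (auto simp: DERIV_deriv_iff_real_differentiable)
  have hc: "continuous_on {0..1} (\<lambda>x. Re (H (of_real x)))"
    by (intro continuous_at_imp_continuous_on ballI) (rule DERIV_isCont, erule h(1))
  have I: "x \<in> {0..1}" if "x \<in> I01" for x :: real using that by auto
  have "0 \<le> u x - Re (H (of_real x))"
  proof (rule maximum_principle[where w = "\<lambda>x. u x - Re (H (of_real x))" and w' = "\<lambda>x. deriv u x - h1 x" and w'' = "\<lambda>x. deriv (deriv u) x - h2 x" and b = "\<lambda>x. \<epsilon>2 * b x" and c = c and \<epsilon> = \<epsilon>1])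
    fix x :: real assume x: "x \<in> I01"
    show "((\<lambda>x. u x - Re (H (of_real x))) has_real_derivative deriv u x - h1 x) (at x)"
      "((\<lambda>x. deriv u x - h1 x) has_real_derivative deriv (deriv u) x - h2 x) (at x)"
      by (intro DERIV_diff ud h x I)+
    show "0 \<le> - \<epsilon>1 * (deriv (deriv u) x - h2 x) + \<epsilon>2 * b x * (deriv u x - h1 x) + c x * (u x - Re (H (of_real x)))"
      using ue[OF x] h(3)[OF I[OF x]] by (simp add: algebra_simps)
  qed (use uc hc u0 bc eps c_pos x in \<open>auto intro!: continuous_intros\<close>)
  moreover have "0 \<le> Re (H (of_real x)) - u x"
  proof (rule maximum_principle[where w = "\<lambda>x. Re (H (of_real x)) - u x" and w' = "\<lambda>x. h1 x - deriv u x" and w'' = "\<lambda>x. h2 x - deriv (deriv u) x" and b = "\<lambda>x. \<epsilon>2 * b x" and c = c and \<epsilon> = \<epsilon>1])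
    fix x :: real assume x: "x \<in> I01"
    show "((\<lambda>x. Re (H (of_real x)) - u x) has_real_derivative h1 x - deriv u x) (at x)"
      "((\<lambda>x. h1 x - deriv u x) has_real_derivative h2 x - deriv (deriv u) x) (at x)"
      by (intro DERIV_diff ud h x I)+
    show "0 \<le> - \<epsilon>1 * (h2 x - deriv (deriv u) x) + \<epsilon>2 * b x * (h1 x - deriv u x) + c x * (Re (H (of_real x)) - u x)"
      using ue[OF x] h(3)[OF I[OF x]] by (simp add: algebra_simps)
  qed (use uc hc u0 bc eps c_pos x in \<open>auto intro!: continuous_intros\<close>)
  ultimately show ?thesis by simp
qed

end

section \<open>Decomposition of the solution\<close>

context holomorphic_coefficients
begin

text \<open>When \<open>\<epsilon>1 \<ge> e0\<close> all coefficients of the equation solved for \<open>u''\<close> are bounded, and shooting from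
  \<open>0\<close> is stable: the homogeneous solution with slope \<open>1\<close> at \<open>0\<close> has value at least \<open>1\<close> at \<open>1\<close> by comparison with
  linear functions, so the coefficient that corrects the right boundary value is bounded.\<close>

theorem regular_decomposition:
  assumes e0: "0 < e0"
  shows "\<exists>A. \<forall>\<epsilon>1 \<epsilon>2. e0 \<le> \<epsilon>1 \<and> \<epsilon>1 < \<epsilon>2 \<and> \<epsilon>2 \<le> 1 \<longrightarrow>
     (\<exists>S. cx_solution W \<epsilon>1 \<epsilon>2 B C F S \<and> (\<forall>z\<in>W. cmod (S z) \<le> A) \<and> S 0 = 0 \<and> S 1 = 0)"
proof -
  define K' where "K' = max 1 (K / e0)"
  define A where "A \<tau> = 2 * (cmod \<tau> + 1) * exp (4 * K' * (2 * (1 + r)))" for \<tau>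
  have A0: "0 \<le> A \<tau>" for \<tau> by (simp add: A_def)
  have "\<exists>S. cx_solution W \<epsilon>1 \<epsilon>2 B C F S \<and> (\<forall>z\<in>W. cmod (S z) \<le> A 0 + A 0 * A 1) \<and> S 0 = 0 \<and> S 1 = 0"
    if eps: "e0 \<le> \<epsilon>1" "\<epsilon>1 < \<epsilon>2" "\<epsilon>2 \<le> 1" for \<epsilon>1 \<epsilon>2
  proof -
    define e where "e = complex_of_real \<epsilon>1"
    have p: "0 < \<epsilon>1" "0 < \<epsilon>2" using e0 eps by auto
    have en: "e \<noteq> 0" using p by (simp add: e_def)
    have hW: "B holomorphic_on W" "C holomorphic_on W" "F holomorphic_on W" using hol W_U' by (auto intro: holomorphic_on_subset)
    have q: "t / \<epsilon>1 \<le> K'" if "t \<le> K" "0 \<le> t" for t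
    proof -
      have "t / \<epsilon>1 \<le> K / e0" using that eps e0 K by (intro frac_le) auto
      then show ?thesis by (simp add: K'_def)
    qed
    have bds: "cmod (of_real \<epsilon>2 * B z / e) \<le> K'" "cmod (C z / e) \<le> K'" "cmod (F z / e) \<le> K'" if z: "z \<in> W" for z
    proof -
      have "\<epsilon>2 * cmod (B z) \<le> 1 * K" using bnd(1)[OF W_U[OF z]] p eps by (intro mult_mono) auto
      then show "cmod (of_real \<epsilon>2 * B z / e) \<le> K'" "cmod (C z / e) \<le> K'" "cmod (F z / e) \<le> K'"
        using bnd[OF W_U[OF z]] p q by (auto simp: norm_mult norm_divide e_def)
    qed
    have ivp: "\<exists>U Y. U 0 = 0 \<and> Y 0 = \<tau> \<and> (\<forall>z\<in>W. (U has_field_derivative Y z) (at z) \<and>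
      (Y has_field_derivative (of_real \<epsilon>2 * B z / e) * Y z + (C z / e) * U z - g z) (at z) \<and> cmod (U z) \<le> A \<tau>)"
      if "g holomorphic_on W" "\<And>z. z \<in> W \<Longrightarrow> cmod (g z) \<le> K'" for \<tau> g
      unfolding A_def
      by (rule linear_initial_value_problem[OF ok])
        (use that bds en hW in \<open>auto intro!: holomorphic_intros simp: K'_def\<close>)
    have sol: "cx_solution W \<epsilon>1 \<epsilon>2 B C G U" if "\<And>z. z \<in> W \<Longrightarrow> (U has_field_derivative Y z) (at z)"
       "\<And>z. z \<in> W \<Longrightarrow> (Y has_field_derivative (of_real \<epsilon>2 * B z / e) * Y z + (C z / e) * U z - G z / e) (at z)" for U Y G
      unfolding cx_solution_def
    proof (rule exI[of _ Y], rule exI[of _ "\<lambda>z. of_real \<epsilon>2 * B z / e * Y z + C z / e * U z - G z / e"], intro ballI conjI)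
      fix z assume "z \<in> W"
      then show "(U has_field_derivative Y z) (at z)"
        "(Y has_field_derivative of_real \<epsilon>2 * B z / e * Y z + C z / e * U z - G z / e) (at z)" by (rule that)+
      show "- of_real \<epsilon>1 * (of_real \<epsilon>2 * B z / e * Y z + C z / e * U z - G z / e) + of_real \<epsilon>2 * B z * Y z + C z * U z = G z"
        unfolding e_def[symmetric] using en by (simp add: field_simps)
    qed
    have "\<exists>U Y. U 0 = 0 \<and> Y 0 = 0 \<and> (\<forall>z\<in>W. (U has_field_derivative Y z) (at z) \<and>
      (Y has_field_derivative (of_real \<epsilon>2 * B z / e) * Y z + (C z / e) * U z - F z / e) (at z) \<and> cmod (U z) \<le> A 0)"
      by (rule ivp) (use en hW bds in \<open>auto intro!: holomorphic_intros\<close>)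
    then obtain Up Yp where Up: "Up 0 = 0" "\<And>z. z \<in> W \<Longrightarrow> cmod (Up z) \<le> A 0"
      and solp: "cx_solution W \<epsilon>1 \<epsilon>2 B C F Up" using sol[of _ _ F] by metis
    have "\<exists>U Y. U 0 = 0 \<and> Y 0 = 1 \<and> (\<forall>z\<in>W. (U has_field_derivative Y z) (at z) \<and>
      (Y has_field_derivative (of_real \<epsilon>2 * B z / e) * Y z + (C z / e) * U z - 0 / e) (at z) \<and> cmod (U z) \<le> A 1)"
      by (rule ivp) (auto simp: K'_def)
    then obtain Uh Yh where Uh: "Uh 0 = 0" "Yh 0 = 1" "\<And>z. z \<in> W \<Longrightarrow> cmod (Uh z) \<le> A 1"
      and dUh: "\<And>z. z \<in> W \<Longrightarrow> (Uh has_field_derivative Yh z) (at z)"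
      and solh: "cx_solution W \<epsilon>1 \<epsilon>2 B C (\<lambda>z. 0) Uh" using sol[of _ _ "\<lambda>z. 0"] by metis
    obtain h1 h2 where h: "\<And>x. x \<in> {0..1} \<Longrightarrow> ((\<lambda>x. Re (Uh (of_real x))) has_real_derivative h1 x) (at x)"
      "\<And>x. x \<in> {0..1} \<Longrightarrow> (h1 has_real_derivative h2 x) (at x)"
      "\<And>x. x \<in> {0..1} \<Longrightarrow> - \<epsilon>1 * h2 x + \<epsilon>2 * b x * h1 x + c x * Re (Uh (of_real x)) = 0"
      using cx_solution_real[OF solh] by (metis zero_complex.sel(1))
    define \<eta> where "\<eta> = max 0 (Re (Uh 1))"
    have "1 \<le> \<eta>"
    proof -
      have le: "Re (Uh (of_real x)) \<le> \<eta> * x" if x: "x \<in> {0..1}" for x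
      proof -
        have "0 \<le> \<eta> * x - Re (Uh (of_real x))"
        proof (rule maximum_principle[where w = "\<lambda>x. \<eta> * x - Re (Uh (of_real x))" and w' = "\<lambda>x. \<eta> - h1 x" and w'' = "\<lambda>x. 0 - h2 x" and b = "\<lambda>x. \<epsilon>2 * b x" and c = c and \<epsilon> = \<epsilon>1])
          fix x :: real assume x: "x \<in> I01"
          then have x': "x \<in> {0..1}" by auto
          have "((\<lambda>x. \<eta> * x) has_real_derivative \<eta>) (at x)" by (auto intro!: derivative_eq_intros)
          then show "((\<lambda>x. \<eta> * x - Re (Uh (of_real x))) has_real_derivative \<eta> - h1 x) (at x)"
            by (intro DERIV_diff h x')
          show "((\<lambda>x. \<eta> - h1 x) has_real_derivative 0 - h2 x) (at x)" by (intro DERIV_diff DERIV_const h x')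
          have "0 \<le> \<epsilon>2 * b x * \<eta> + c x * (\<eta> * x)"
            using b_pos[OF x'] c_pos[OF x'] p x by (auto simp: \<eta>_def)
          then show "0 \<le> - \<epsilon>1 * (0 - h2 x) + \<epsilon>2 * b x * (\<eta> - h1 x) + c x * (\<eta> * x - Re (Uh (of_real x)))"
            using h(3)[OF x'] by (simp add: algebra_simps)
        next
          show "continuous_on {0..1} (\<lambda>x. \<eta> * x - Re (Uh (of_real x)))"
            by (intro continuous_intros continuous_at_imp_continuous_on ballI) (rule DERIV_isCont, erule h(1))
        qed (use p c_pos Uh(1) x in \<open>auto simp: \<eta>_def\<close>)
        then show ?thesis by simp
      qed
      have "((\<lambda>x. Re (Uh (of_real x))) has_real_derivative 1) (at 0)"
        using cx_deriv_real[of Uh "Yh 0" 0] dUh[OF W01(1)] Uh(2) by simp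
      moreover have "((\<lambda>x. \<eta> * x) has_real_derivative \<eta>) (at 0)" by (auto intro!: derivative_eq_intros)
      ultimately have 1: "((\<lambda>x. \<eta> * x - Re (Uh (of_real x))) has_real_derivative \<eta> - 1) (at 0)"
        by (intro DERIV_diff)
      show ?thesis
      proof (rule ccontr)
        assume "\<not> 1 \<le> \<eta>"
        then have "\<eta> - 1 < 0" by simp
        from DERIV_neg_dec_right[OF 1 this] obtain d where d: "0 < d"
          "\<And>t. 0 < t \<Longrightarrow> t < d \<Longrightarrow> \<eta> * (0 + t) - Re (Uh (of_real (0 + t))) < \<eta> * 0 - Re (Uh (of_real 0))" by blast
        define t where "t = min (d / 2) 1"
        have t: "0 < t" "t < d" "t \<le> 1" using d(1) by (auto simp: t_def)
        show False using d(2)[OF t(1,2)] le[of t] t Uh(1) by simp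
      qed
    qed
    then have U1: "1 \<le> cmod (Uh 1)" using complex_Re_le_cmod[of "Uh 1"] by (simp add: \<eta>_def max_def split: if_splits)
    define \<alpha> where "\<alpha> = - Up 1 / Uh 1"
    have \<alpha>: "cmod \<alpha> \<le> A 0"
    proof -
      have "cmod (Up 1) / cmod (Uh 1) \<le> A 0 / 1" using U1 Up(2)[OF W01(2)] A0 by (intro frac_le) auto
      then show ?thesis by (simp add: \<alpha>_def norm_divide)
    qed
    have Uh0: "Uh 1 \<noteq> 0" using U1 by auto
    show ?thesis
    proof (intro exI[of _ "\<lambda>z. Up z + \<alpha> * Uh z"] conjI ballI)
      show "cx_solution W \<epsilon>1 \<epsilon>2 B C F (\<lambda>z. Up z + \<alpha> * Uh z)" by (rule cx_solution_add[OF solp solh])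
      show "Up 0 + \<alpha> * Uh 0 = 0" "Up 1 + \<alpha> * Uh 1 = 0" using Up(1) Uh(1) Uh0 by (auto simp: \<alpha>_def)
      fix z assume z: "z \<in> W"
      show "cmod (Up z + \<alpha> * Uh z) \<le> A 0 + A 0 * A 1"
        by (intro norm_triangle_le add_mono Up z) (unfold norm_mult, intro mult_mono \<alpha> Uh z A0 norm_ge_zero)
    qed
  qed
  then show ?thesis by blast
qed

end

context holomorphic_coefficients
begin

text \<open>In the singular regime the amplitudes solve a \<open>2 \<times> 2\<close> system for the boundary values with determinant
  \<open>1 - V0 V1\<close>, where \<open>V0\<close>, \<open>V1\<close> are the values of the layers at the opposite end
  points; it stays away from \<open>0\<close> because \<open>\<bar>V0\<bar> \<le> exp (- rate / 2)\<close>. In the regular regime the amplitudes are \<open>0\<close>, and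
  the linear phases are placeholders. Uniqueness of the boundary value problem transfers the result to \<open>u\<close>.\<close>

theorem solution_decomposition:
  "\<exists>A \<delta>. 0 < A \<and> 0 < \<delta> \<and> (\<forall>\<epsilon>1 \<epsilon>2 u. 0 < \<epsilon>1 \<and> \<epsilon>1 < \<epsilon>2 \<and> \<epsilon>2 \<le> 1 \<and> is_BVP_solution \<epsilon>1 \<epsilon>2 b c f u \<longrightarrow>
     (\<exists>S \<alpha>0 \<alpha>1 M0 M1. S holomorphic_on W \<and> (\<forall>z\<in>W. cmod (S z) \<le> A) \<and> cmod \<alpha>0 \<le> A \<and> cmod \<alpha>1 \<le> A \<and>
        layer_phase W \<delta> A (1 / scale \<epsilon>1 \<epsilon>2) M0 \<and> layer_phase W \<delta> A (scale \<epsilon>1 \<epsilon>2 / \<epsilon>1) M1 \<and>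
        (\<forall>x\<in>{0..1}. u x = Re (S (of_real x) + \<alpha>0 * exp (- M0 (of_real x)) + \<alpha>1 * exp (- M1 (1 - of_real x))))))"
proof -
  have cx_hol: "S holomorphic_on W" if "cx_solution W \<epsilon>1 \<epsilon>2 B C G S" for \<epsilon>1 \<epsilon>2 G S
    using that unfolding cx_solution_def by (auto simp: holomorphic_on_open open_rhombus)
  have bp: "0 < bound" and rp: "0 < rate" using c1_pos c2_pos K by (auto simp: bound_def rate_def intro!: add_pos_pos)
  have \<tau>0: "0 < \<tau>0" using c1_pos c2_pos K \<omega> by (auto simp: \<tau>0_def)
  have "0 < \<tau>0\<^sup>2" using \<tau>0 by simp
  from regular_decomposition[OF this] obtain A1 where A1': "\<forall>\<epsilon>1 \<epsilon>2. \<tau>0\<^sup>2 \<le> \<epsilon>1 \<and> \<epsilon>1 < \<epsilon>2 \<and> \<epsilon>2 \<le> 1 \<longrightarrow>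
     (\<exists>S. cx_solution W \<epsilon>1 \<epsilon>2 B C F S \<and> (\<forall>z\<in>W. cmod (S z) \<le> A1) \<and> S 0 = 0 \<and> S 1 = 0)" ..
  have A1: "\<exists>S. cx_solution W \<epsilon>1 \<epsilon>2 B C F S \<and> (\<forall>z\<in>W. cmod (S z) \<le> A1) \<and> S 0 = 0 \<and> S 1 = 0"
    if "\<tau>0\<^sup>2 \<le> \<epsilon>1" "\<epsilon>1 < \<epsilon>2" "\<epsilon>2 \<le> 1" for \<epsilon>1 \<epsilon>2
    using A1' that by blast
  \<comment> \<open>a lower bound for the determinant of the boundary value system\<close>
  define g where "g = 1 - exp (- (rate / 2))"
  have g: "0 < g" using rp by (simp add: g_def)
  define A where "A = max (max bound A1) (max 1 (2 * bound / g))"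
  define \<delta> where "\<delta> = min rate 1"
  have A: "0 < A" "bound \<le> A" "A1 \<le> A" "1 \<le> A" "2 * bound / g \<le> A" by (auto simp: A_def)
  have \<delta>: "0 < \<delta>" "\<delta> \<le> rate" "\<delta> \<le> 1" using rp by (auto simp: \<delta>_def)
  have main: "\<exists>S \<alpha>0 \<alpha>1 M0 M1. S holomorphic_on W \<and> (\<forall>z\<in>W. cmod (S z) \<le> A) \<and> cmod \<alpha>0 \<le> A \<and> cmod \<alpha>1 \<le> A \<and>
        layer_phase W \<delta> A (1 / scale \<epsilon>1 \<epsilon>2) M0 \<and> layer_phase W \<delta> A (scale \<epsilon>1 \<epsilon>2 / \<epsilon>1) M1 \<and>
        (\<forall>x\<in>{0..1}. u x = Re (S (of_real x) + \<alpha>0 * exp (- M0 (of_real x)) + \<alpha>1 * exp (- M1 (1 - of_real x))))"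
    if eps: "0 < \<epsilon>1" "\<epsilon>1 < \<epsilon>2" "\<epsilon>2 \<le> 1" and u: "is_BVP_solution \<epsilon>1 \<epsilon>2 b c f u" for \<epsilon>1 \<epsilon>2 u
  proof -
    let ?s = "scale \<epsilon>1 \<epsilon>2"
    note sb = scale_bounds[OF eps]
    have ps: "0 < 1 / ?s" "0 < ?s / \<epsilon>1" using sb eps by auto
    have mono: "layer_phase W \<delta> A \<mu> M" if "layer_phase W rate bound \<mu> M" "0 < \<mu>" for \<mu> M
    proof -
      have "\<delta> * \<mu> \<le> rate * \<mu>" "bound * \<mu> \<le> A * \<mu>" using that(2) \<delta> A by (auto intro!: mult_right_mono)
      then show ?thesis using that(1) unfolding layer_phase_def by (meson order.trans)
    qed
    show ?thesis
    proof (cases "1 \<le> \<tau>0 * (?s / \<epsilon>1)")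
      case True
      obtain S M0 M1 where S: "cx_solution W \<epsilon>1 \<epsilon>2 B C F S" "\<And>z. z \<in> W \<Longrightarrow> cmod (S z) \<le> bound"
        and l0: "layer_phase W rate bound (1 / ?s) M0" and s0: "cx_solution W \<epsilon>1 \<epsilon>2 B C (\<lambda>z. 0) (\<lambda>z. exp (- M0 z))"
        and l1: "layer_phase W rate bound (?s / \<epsilon>1) M1" and s1: "cx_solution W \<epsilon>1 \<epsilon>2 B C (\<lambda>z. 0) (\<lambda>z. exp (- M1 (1 - z)))"
        using singular_decomposition[OF eps True] by blast
      define V0 V1 where "V0 = exp (- M0 1)" and "V1 = exp (- M1 1)"
      have decay: "cmod (exp (- M 1)) \<le> exp (- (rate * \<mu>))" if "layer_phase W rate bound \<mu> M" for M \<mu>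
      proof -
        obtain m where m: "M 0 = 0" "\<And>z. z \<in> W \<Longrightarrow> (M has_field_derivative m z) (at z)" "\<And>z. z \<in> W \<Longrightarrow> rate * \<mu> \<le> Re (m z)"
          using \<open>layer_phase W rate bound \<mu> M\<close> unfolding layer_phase_def by blast
        have "\<exists>z. 0 < z \<and> z < 1 \<and> Re (M (of_real 1)) - Re (M (of_real 0)) = (1 - 0) * Re (m (of_real z))"
          by (rule MVT2) (auto intro!: cx_deriv_real m real_in_W)
        then obtain z where "0 < z" "z < 1" "Re (M 1) = Re (m (complex_of_real z))" using m(1) by auto
        then have "rate * \<mu> \<le> Re (M 1)" using m(3)[OF real_in_W[of z]] by simp
        then show ?thesis by simp
      qed
      have V0: "cmod V0 \<le> exp (- (rate / 2))"
      proof -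
        have "rate * (1 / 2) \<le> rate * (1 / ?s)" using rp sb by (intro mult_left_mono) (auto simp: field_simps)
        then have "exp (- (rate * (1 / ?s))) \<le> exp (- (rate / 2))" by simp
        then show ?thesis using decay[OF l0] unfolding V0_def by linarith
      qed
      have V1: "cmod V1 \<le> 1"
      proof -
        have "0 \<le> rate * (?s / \<epsilon>1)" using rp ps by (intro mult_nonneg_nonneg) auto
        then have "exp (- (rate * (?s / \<epsilon>1))) \<le> 1" by simp
        then show ?thesis using decay[OF l1] unfolding V1_def by linarith
      qed
      define D where "D = 1 - V0 * V1"
      have "cmod (V0 * V1) \<le> exp (- (rate / 2)) * 1" unfolding norm_mult using V0 V1 by (intro mult_mono) auto
      then have D: "g \<le> cmod D" using norm_triangle_ineq2[of 1 "V0 * V1"] by (simp add: D_def g_def)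
      then have D0: "D \<noteq> 0" using g by auto
      \<comment> \<open>Cramer's rule for the amplitudes that annihilate the boundary values of \<open>S\<close>\<close>
      define \<alpha>0 \<alpha>1 where "\<alpha>0 = (S 1 * V1 - S 0) / D" and "\<alpha>1 = (S 0 * V0 - S 1) / D"
      have V0': "cmod V0 \<le> 1"
      proof -
        have "exp (- (rate / 2)) \<le> 1" using rp by simp
        then show ?thesis using V0 by linarith
      qed
      have ab: "cmod (x * V - y) / cmod D \<le> A" if "cmod x \<le> bound" "cmod y \<le> bound" "cmod V \<le> 1" for x y V
      proof -
        have "cmod (x * V - y) \<le> bound * 1 + bound"
          using that by (intro norm_triangle_le_diff add_mono) (unfold norm_mult, intro mult_mono, auto simp: bp less_imp_le)
        then have "cmod (x * V - y) / cmod D \<le> (2 * bound) / g" using D g bp by (intro frac_le) auto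
        then show ?thesis using A by linarith
      qed
      have a0: "cmod \<alpha>0 \<le> A" "cmod \<alpha>1 \<le> A"
        unfolding \<alpha>0_def \<alpha>1_def norm_divide by (intro ab S W01 V1 V0')+
      define H where "H z = S z + \<alpha>0 * exp (- M0 z) + \<alpha>1 * exp (- M1 (1 - z))" for z
      have H: "cx_solution W \<epsilon>1 \<epsilon>2 B C F H"
        unfolding H_def by (intro cx_solution_add S s0 s1)
      have M00: "M0 0 = 0" "M1 0 = 0" using l0 l1 by (auto simp: layer_phase_def)
      have "H 0 * D = 0" "H 1 * D = 0"
        using D0 M00 unfolding H_def \<alpha>0_def \<alpha>1_def V0_def[symmetric] V1_def[symmetric]
        by (simp_all add: V0_def[symmetric] V1_def[symmetric] field_simps) (simp_all add: D_def algebra_simps)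
      then have H0: "H 0 = 0" "H 1 = 0" using D0 by auto
      have "\<forall>x\<in>{0..1}. u x = Re (H (of_real x))" using BVP_solution_unique[OF u H H0 eps(1)] by blast
      then show ?thesis unfolding H_def
        using cx_hol[OF S(1)] S(2) A(2) a0 mono[OF l0 ps(1)] mono[OF l1 ps(2)] by (meson order.trans)
    next
      case False
      have "\<tau>0\<^sup>2 \<le> \<epsilon>1"
      proof -
        have "\<tau>0 * ?s < \<epsilon>1" using False eps by (simp add: field_simps)
        moreover have "sqrt \<epsilon>1 \<le> ?s" using eps by (simp add: scale_def)
        then have "\<tau>0 * sqrt \<epsilon>1 \<le> \<tau>0 * ?s" using \<tau>0 by (intro mult_left_mono) auto
        ultimately have "\<tau>0 * sqrt \<epsilon>1 \<le> sqrt \<epsilon>1 * sqrt \<epsilon>1" using eps by simp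
        then have "\<tau>0 \<le> sqrt \<epsilon>1" using eps by (simp only: mult_le_cancel_right_pos real_sqrt_gt_zero)
        then have "\<tau>0\<^sup>2 \<le> (sqrt \<epsilon>1)\<^sup>2" using \<tau>0 by (intro power_mono) auto
        then show ?thesis using eps by simp
      qed
      then obtain S where S: "cx_solution W \<epsilon>1 \<epsilon>2 B C F S" "\<And>z. z \<in> W \<Longrightarrow> cmod (S z) \<le> A1" "S 0 = 0" "S 1 = 0"
        using A1[of \<epsilon>1 \<epsilon>2] eps by blast
      have lin: "layer_phase W \<delta> A \<mu> (\<lambda>z. of_real \<mu> * z)" if "0 < \<mu>" for \<mu>
        unfolding layer_phase_def
      proof (intro conjI exI[of _ "\<lambda>z. of_real \<mu>"] ballI)
        fix z
        show "((\<lambda>z. of_real \<mu> * z) has_field_derivative of_real \<mu>) (at z)" by (auto intro!: derivative_eq_intros)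
        show "\<delta> * \<mu> \<le> Re (complex_of_real \<mu>)" "cmod (complex_of_real \<mu>) \<le> A * \<mu>" using that \<delta> A by auto
      qed simp
      have "\<forall>x\<in>{0..1}. u x = Re (S (of_real x) + 0 * exp (- (of_real (1 / ?s) * of_real x)) + 0 * exp (- (of_real (?s / \<epsilon>1) * (1 - of_real x))))"
        using BVP_solution_unique[OF u S(1,3,4) eps(1)] by simp
      moreover have "\<forall>z\<in>W. cmod (S z) \<le> A" using S(2) A(3) by (meson order.trans)
      moreover have "cmod 0 \<le> A" using A by simp
      ultimately show ?thesis using cx_hol[OF S(1)] lin[OF ps(1)] lin[OF ps(2)] by blast
    qed
  qed
  show ?thesis
    by (intro exI[of _ A] exI[of _ \<delta>] conjI A \<delta> allI impI) (use main in blast)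
qed

end

section \<open>Approximation of a function and its derivative\<close>

lemma poly_antiderivative:
  fixes q :: "real poly"
  shows "\<exists>Q. pderiv Q = q \<and> degree Q \<le> Suc (degree q)"
proof -
  define Q where "Q = (\<Sum>i\<le>degree q. monom (coeff q i / real (Suc i)) (Suc i))"
  have pderiv_sum: "pderiv (\<Sum>i\<in>S. g i) = (\<Sum>i\<in>S. pderiv (g i))" if "finite S" for S and g :: "nat \<Rightarrow> real poly"
    using that by induction (auto simp: pderiv_add)
  have "pderiv Q = (\<Sum>i\<le>degree q. monom (coeff q i) i)"
    unfolding Q_def pderiv_sum[OF finite_atMost] by (intro sum.cong) (auto simp: pderiv_monom simp del: of_nat_Suc)
  moreover have "degree Q \<le> Suc (degree q)"
    unfolding Q_def by (intro degree_sum_le) (auto intro: order.trans[OF degree_monom_le])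
  ultimately show ?thesis by (auto simp: poly_as_sum_of_monoms)
qed

text \<open>Integrate the approximation of the derivative and correct the slope by a constant of size at most \<open>E\<close>, so that both end
  point values are met. Exact nodal values are what allows continuous gluing across elements.\<close>

lemma interpolating_primitive:
  fixes F :: "real \<Rightarrow> real"
  assumes ab: "a < b" and p: "1 \<le> p" and q: "degree q \<le> p - 1"
    and F: "\<And>x. x \<in> {a..b} \<Longrightarrow> (F has_real_derivative F' x) (at x)"
    and E: "\<And>x. x \<in> {a..b} \<Longrightarrow> \<bar>F' x - poly q x\<bar> \<le> E"
  shows "\<exists>Q. degree Q \<le> p \<and> poly Q a = F a \<and> poly Q b = F b \<and>
    (\<forall>x\<in>{a..b}. \<bar>F' x - poly (pderiv Q) x\<bar> \<le> 2 * E \<and> \<bar>F x - poly Q x\<bar> \<le> 2 * E * (b - a))"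
proof -
  obtain Q1 where Q1: "pderiv Q1 = q" "degree Q1 \<le> Suc (degree q)" using poly_antiderivative by blast
  define G where "G x = F x - poly Q1 x" for x
  have G': "(G has_real_derivative F' x - poly q x) (at x)" if "x \<in> {a..b}" for x
    unfolding G_def using DERIV_diff[OF F[OF that] poly_DERIV[of Q1 x]] by (simp add: Q1)
  define k where "k = (G b - G a) / (b - a)"
  have "\<exists>z. a < z \<and> z < b \<and> G b - G a = (b - a) * (F' z - poly q z)"
    using ab by (intro MVT2 G') auto
  then obtain z where "a < z" "z < b" and "G b - G a = (b - a) * (F' z - poly q z)" by blast
  moreover from \<open>a < z\<close> \<open>z < b\<close> have "z \<in> {a..b}" by simp
  ultimately have "z \<in> {a..b}" "G b - G a = (b - a) * (F' z - poly q z)" by auto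
  then have k: "\<bar>k\<bar> \<le> E" using E[of z] ab by (simp add: k_def)
  define Q where "Q = Q1 + [:G a - k * a, k:]"
  have Qp: "poly Q x = poly Q1 x + G a + k * (x - a)" for x by (simp add: Q_def algebra_simps)
  have dQ: "poly (pderiv Q) x = poly q x + k" for x by (simp add: Q_def pderiv_add pderiv_pCons Q1)
  have d: "\<bar>F' x - poly (pderiv Q) x\<bar> \<le> 2 * E" if "x \<in> {a..b}" for x
    using E[OF that] k unfolding dQ by (auto simp: abs_le_iff)
  show ?thesis
  proof (intro exI[of _ Q] conjI ballI)
    show "degree Q \<le> p" unfolding Q_def using Q1(2) q p by (intro degree_add_le) auto
    show a: "poly Q a = F a" by (simp add: Qp G_def)
    have "k * (b - a) = G b - G a" using ab by (simp add: k_def)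
    then show "poly Q b = F b" by (simp add: Qp G_def)
    fix x assume x: "x \<in> {a..b}"
    show "\<bar>F' x - poly (pderiv Q) x\<bar> \<le> 2 * E" by (rule d[OF x])
    show "\<bar>F x - poly Q x\<bar> \<le> 2 * E * (b - a)"
    proof (cases "x = a")
      case False
      have H: "((\<lambda>x. F x - poly Q x) has_real_derivative F' y - poly (pderiv Q) y) (at y)" if "y \<in> {a..b}" for y
        by (intro DERIV_diff F that poly_DERIV)
      have "\<exists>z. a < z \<and> z < x \<and> (F x - poly Q x) - (F a - poly Q a) = (x - a) * (F' z - poly (pderiv Q) z)"
        using False x by (intro MVT2 H) auto
      then obtain z where "a < z" "z < x" and eq: "F x - poly Q x = (x - a) * (F' z - poly (pderiv Q) z)" using a by auto
      then have z: "z \<in> {a..b}" "F x - poly Q x = (x - a) * (F' z - poly (pderiv Q) z)" using x by auto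
      have "\<bar>F x - poly Q x\<bar> = (x - a) * \<bar>F' z - poly (pderiv Q) z\<bar>" unfolding z(2) using x by (simp add: abs_mult)
      also have "\<dots> \<le> (b - a) * (2 * E)" using x d[OF z(1)] by (intro mult_mono) auto
      finally show ?thesis by (simp add: mult_ac)
    next
      case True
      have "0 \<le> E" using k by linarith
      then show ?thesis using True a ab by simp
    qed
  qed
qed

text \<open>The error factor of Bernstein's theorem for polynomials of degree \<open>p - 1\<close>, as used for derivatives.\<close>

definition bernstein_err :: "real \<Rightarrow> nat \<Rightarrow> real" where
  "bernstein_err R p = 4 * (real p + 1) * inverse R ^ p / (1 - inverse R)^2"

lemma Bernstein_approximation:
  assumes D: "open D" "convex D" "F holomorphic_on D" and ab: "a < b" and R: "R > 1" and p: "1 \<le> p"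
    and seg: "\<And>t. t \<in> {a..b} \<Longrightarrow> complex_of_real t \<in> D"
    and ell: "\<And>w. cmod w = R \<Longrightarrow> of_real ((a + b) / 2) + of_real ((b - a) / 2) * joukowski w \<in> D"
    and M: "\<And>w. cmod w = R \<Longrightarrow> cmod (F (of_real ((a + b) / 2) + of_real ((b - a) / 2) * joukowski w)) \<le> M"
  shows "\<exists>q::real poly. degree q \<le> p - 1 \<and> (\<forall>x\<in>{a..b}. \<bar>Re (F (of_real x)) - poly q x\<bar> \<le> M * bernstein_err R p)"
proof -
  define m h where "m = (a + b) / 2" and "h = (b - a) / 2"
  have h: "0 < h" using ab by (simp add: h_def)
  define A where "A z = of_real m + of_real h * z" for z :: complex
  define D' where "D' = A -` D"
  have Ah: "A holomorphic_on X" for X unfolding A_def[abs_def] by (intro holomorphic_intros)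
  have D'o: "open D'" unfolding D'_def using D(1)
    by (intro open_vimage) (auto simp: A_def[abs_def] intro!: continuous_intros)
  have D'c: "convex D'"
    unfolding convex_def
  proof (intro ballI allI impI)
    fix x y :: complex and u v :: real assume xy: "x \<in> D'" "y \<in> D'" "0 \<le> u" "0 \<le> v" "u + v = 1"
    have "A (u *\<^sub>R x + v *\<^sub>R y) = of_real (u + v) * of_real m + of_real h * (u *\<^sub>R x + v *\<^sub>R y)"
      unfolding xy(5) by (simp add: A_def)
    also have "\<dots> = u *\<^sub>R A x + v *\<^sub>R A y" by (simp add: A_def scaleR_conv_of_real algebra_simps)
    finally show "u *\<^sub>R x + v *\<^sub>R y \<in> D'" using D(2) xy unfolding D'_def convex_def by auto
  qed
  have Fh: "(\<lambda>z. F (A z)) holomorphic_on D'"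
    by (rule holomorphic_on_compose_gen[of A D' F D, unfolded o_def]) (use Ah D in \<open>auto simp: D'_def\<close>)
  have *: "\<exists>q::real poly. degree q \<le> p - 1 \<and> (\<forall>t. \<bar>t\<bar> \<le> 1 \<longrightarrow>
     \<bar>Re (F (A (of_real t))) - poly q t\<bar> \<le> M * (4 * (real (p - 1) + 2) * inverse R ^ Suc (p - 1) / (1 - inverse R)^2))"
  proof (rule Bernstein_approximation_unit[OF D'o D'c Fh R])
    fix t :: real assume t: "\<bar>t\<bar> \<le> 1"
    have "\<bar>h * t\<bar> \<le> h * 1" unfolding abs_mult using t h by (intro mult_mono) auto
    then have "m + h * t \<in> {a..b}" unfolding m_def h_def by (auto simp: abs_le_iff field_simps)
    from seg[OF this] show "complex_of_real t \<in> D'" by (simp add: D'_def A_def)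
  next
    fix w assume "cmod w = R"
    then show "joukowski w \<in> D'" "cmod (F (A (joukowski w))) \<le> M"
      using ell M by (auto simp: D'_def A_def m_def h_def)
  qed
  obtain q where q: "degree q \<le> p - 1" "\<And>t. \<bar>t\<bar> \<le> 1 \<Longrightarrow>
     \<bar>Re (F (A (of_real t))) - poly q t\<bar> \<le> M * bernstein_err R p"
  proof -
    have "4 * (real (p - 1) + 2) * inverse R ^ Suc (p - 1) / (1 - inverse R)^2 = bernstein_err R p"
      using p by (simp add: bernstein_err_def of_nat_diff)
    then show ?thesis using * that by (simp only:) blast
  qed
  show ?thesis
  proof (intro exI[of _ "pcompose q [:- m / h, 1 / h:]"] conjI ballI)
    show "degree (pcompose q [:- m / h, 1 / h:]) \<le> p - 1"
      using q(1) degree_pcompose_le[of q "[:- m / h, 1 / h:]"] h by simp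
    fix x assume x: "x \<in> {a..b}"
    define t where "t = (x - m) / h"
    have "\<bar>t\<bar> \<le> 1" using x h by (auto simp: t_def m_def h_def abs_le_iff field_simps)
    moreover have "A (of_real t) = of_real x" using h by (simp add: A_def t_def)
    moreover have "poly (pcompose q [:- m / h, 1 / h:]) x = poly q t"
      by (simp add: poly_pcompose t_def diff_divide_distrib)
    ultimately show "\<bar>Re (F (of_real x)) - poly (pcompose q [:- m / h, 1 / h:]) x\<bar> \<le> M * bernstein_err R p"
      using q(2)[of t] by simp
  qed
qed

text \<open>Since \<open>ln (1 + \<rho>) \<ge> \<rho> / 2\<close>, the rate \<open>\<rho> / 2\<close> is available; half of it absorbs the factor \<open>p + 1\<close>.\<close>

lemma bernstein_err_bound:
  assumes "0 < \<rho>" "\<rho> \<le> 1/2"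
  shows "\<exists>C>0. \<forall>p. bernstein_err (1 + \<rho>) p \<le> C * exp (- (\<rho> / 4) * real p)"
proof -
  define R where "R = 1 + \<rho>"
  have R: "1 < R" using assms by (simp add: R_def)
  have "\<rho> - \<rho>\<^sup>2 \<le> ln R" unfolding R_def using assms by (intro ln_one_plus_pos_lower_bound) auto
  moreover have "\<rho> * \<rho> \<le> \<rho> * (1/2)" using assms by (intro mult_left_mono) auto
  ultimately have l: "\<rho> / 2 \<le> ln R" by (simp add: power2_eq_square)
  define C where "C = 4 * (4 / \<rho> + 1) / (1 - inverse R)^2"
  have k: "0 < (1 - inverse R)^2" using R by simp
  have "bernstein_err R p \<le> C * exp (- (\<rho> / 4) * real p)" for p
  proof -
    have "inverse R ^ p = exp (- (real p * ln R))"
    proof -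
      have "exp (real p * ln R) = R ^ p" using R by (subst exp_of_nat_mult) simp
      then show ?thesis by (simp add: exp_minus power_inverse)
    qed
    also have "\<dots> \<le> exp (- (real p * (\<rho> / 2)))" using mult_left_mono[OF l, of "real p"] by simp
    finally have 1: "inverse R ^ p \<le> exp (- (\<rho> / 4) * real p) * exp (- (\<rho> / 4) * real p)"
      by (simp flip: exp_add add: field_simps)
    have "(\<rho> / 4) * real p \<le> exp ((\<rho> / 4) * real p)" using exp_ge_add_one_self[of "(\<rho> / 4) * real p"] by linarith
    then have "real p \<le> (4 / \<rho>) * exp ((\<rho> / 4) * real p)" using assms by (simp add: field_simps)
    moreover have "1 \<le> exp ((\<rho> / 4) * real p)" using assms by simp
    ultimately have 2: "real p + 1 \<le> (4 / \<rho> + 1) * exp ((\<rho> / 4) * real p)"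
      by (simp only: distrib_right mult_1_left add_mono)
    have "(real p + 1) * inverse R ^ p \<le> ((4 / \<rho> + 1) * exp ((\<rho> / 4) * real p)) * (exp (- (\<rho> / 4) * real p) * exp (- (\<rho> / 4) * real p))"
      using 1 2 R assms by (intro mult_mono) auto
    also have "\<dots> = (4 / \<rho> + 1) * exp (- (\<rho> / 4) * real p)"
      by (simp add: mult.assoc flip: exp_add)
    finally have "4 * ((real p + 1) * inverse R ^ p) \<le> 4 * ((4 / \<rho> + 1) * exp (- (\<rho> / 4) * real p))" by simp
    then have "4 * ((real p + 1) * inverse R ^ p) / (1 - inverse R)^2 \<le> 4 * ((4 / \<rho> + 1) * exp (- (\<rho> / 4) * real p)) / (1 - inverse R)^2"
      using k by (intro divide_right_mono) auto
    then show ?thesis unfolding bernstein_err_def C_def by (simp only: mult.assoc times_divide_eq_left)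
  qed
  moreover have "0 < C" unfolding C_def using assms k by (intro divide_pos_pos) (auto intro: add_pos_pos)
  ultimately show ?thesis unfolding R_def by blast
qed

text \<open>The horizontal semi-axis exceeds \<open>1\<close> only by \<open>O(\<rho>\<^sup>2)\<close>, the vertical one is \<open>O(\<rho>)\<close>; this difference of
  orders is essential for \<open>layer_on_ellipse\<close>.\<close>

lemma joukowski_ellipse:
  assumes w: "cmod w = 1 + \<rho>" and \<rho>: "0 < \<rho>" "\<rho> \<le> 1"
  obtains A B x y where "x\<^sup>2 + y\<^sup>2 = 1" "joukowski w = Complex (A * x) (B * y)"
    "1 \<le> A" "A \<le> 1 + \<rho>\<^sup>2 / 2" "0 \<le> B" "B \<le> \<rho>"
proof
  define R where "R = 1 + \<rho>"
  have R: "1 < R" using \<rho> by (simp add: R_def)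
  define x y where "x = Re w / R" and "y = Im w / R"
  have n: "(Re w)\<^sup>2 + (Im w)\<^sup>2 = R\<^sup>2" using w by (simp add: R_def cmod_power2[symmetric])
  have "x\<^sup>2 + y\<^sup>2 = ((Re w)\<^sup>2 + (Im w)\<^sup>2) / R\<^sup>2" by (simp add: x_def y_def power_divide add_divide_distrib)
  then show "x\<^sup>2 + y\<^sup>2 = 1" using n R by simp
  then have xy: "x * x + y * y = 1" by (simp add: power2_eq_square)
  have we: "w = Complex (R * x) (R * y)" using R by (simp add: complex_eq_iff x_def y_def)
  have "w * Complex (x / R) (- y / R) = 1" unfolding we complex_eq_iff using R xy by simp
  then have "inverse w = Complex (x / R) (- y / R)" by (rule inverse_unique)
  then have "Re (joukowski w) = (R * x + x / R) / 2" "Im (joukowski w) = (R * y - y / R) / 2"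
    unfolding joukowski_def by (simp_all add: we)
  then show "joukowski w = Complex (((R + 1 / R) / 2) * x) (((R - 1 / R) / 2) * y)"
    unfolding complex_eq_iff complex.sel by (simp_all add: distrib_right left_diff_distrib)
  define d where "d = \<rho> / R"
  have "1 / R = (R - \<rho>) / R" by (simp add: R_def)
  then have iR: "1 / R = 1 - d" using R by (simp add: d_def diff_divide_distrib)
  have "\<rho> / R \<le> \<rho> / 1" using R \<rho> by (intro divide_left_mono) auto
  then have d: "0 \<le> d" "d \<le> \<rho>" using R \<rho> by (auto simp: d_def)
  show "1 \<le> (R + 1 / R) / 2" "0 \<le> (R - 1 / R) / 2" "(R - 1 / R) / 2 \<le> \<rho>"
    unfolding iR using d \<rho> by (simp_all add: R_def)
  have "\<rho> - d = \<rho> * (1 - 1 / R)" by (simp add: d_def right_diff_distrib)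
  also have "\<dots> \<le> \<rho> * \<rho>" using d \<rho> unfolding iR by (intro mult_left_mono) auto
  finally show "(R + 1 / R) / 2 \<le> 1 + \<rho>\<^sup>2 / 2" unfolding iR by (simp add: R_def power2_eq_square)
qed

lemma ellipse_near_interval:
  assumes w: "cmod w = 1 + \<rho>" and \<rho>: "0 < \<rho>" "\<rho> \<le> 1" and ab: "0 \<le> a" "a < b" "b \<le> 1"
  shows "\<exists>x\<in>{a..b}. cmod (of_real ((a + b) / 2) + of_real ((b - a) / 2) * joukowski w - of_real x) \<le> 3/4 * \<rho>"
proof -
  obtain A B x y where j: "x\<^sup>2 + y\<^sup>2 = 1" "joukowski w = Complex (A * x) (B * y)"
    "1 \<le> A" "A \<le> 1 + \<rho>\<^sup>2 / 2" "0 \<le> B" "B \<le> \<rho>" by (rule joukowski_ellipse[OF w \<rho>])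
  define h where "h = (b - a) / 2"
  have h: "0 < h" "h \<le> 1/2" using ab by (auto simp: h_def)
  have "x\<^sup>2 \<le> 1" "y\<^sup>2 \<le> 1" using j(1) zero_le_power2[of x] zero_le_power2[of y] by linarith+
  then have xy: "\<bar>x\<bar> \<le> 1" "\<bar>y\<bar> \<le> 1" by (simp_all add: abs_square_le_1)
  have "\<bar>h * x\<bar> \<le> h * 1" unfolding abs_mult using xy h by (intro mult_mono) auto
  moreover have "(a + b) / 2 - h = a" "(a + b) / 2 + h = b" by (simp_all add: h_def field_simps)
  ultimately have "(a + b) / 2 + h * x \<in> {a..b}" unfolding atLeastAtMost_iff by linarith
  moreover have "cmod (of_real ((a + b) / 2) + of_real ((b - a) / 2) * joukowski w - of_real ((a + b) / 2 + h * x)) \<le> 3/4 * \<rho>"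
  proof -
    have "of_real t + of_real h * joukowski w - of_real (t + h * x)
       = of_real h * Complex ((A - 1) * x) (B * y)" for t
      unfolding j(2) by (simp add: complex_eq_iff left_diff_distrib right_diff_distrib)
    then have "of_real ((a + b) / 2) + of_real ((b - a) / 2) * joukowski w - of_real ((a + b) / 2 + h * x)
       = of_real h * Complex ((A - 1) * x) (B * y)" unfolding h_def[symmetric] .
    also have "cmod \<dots> = h * cmod (Complex ((A - 1) * x) (B * y))" using h by (simp add: norm_mult)
    also have "\<dots> \<le> 1/2 * (\<bar>(A - 1) * x\<bar> + \<bar>B * y\<bar>)"
      using h cmod_le[of "Complex ((A - 1) * x) (B * y)"] by (intro mult_mono) auto
    finally have "cmod (of_real ((a + b) / 2) + of_real ((b - a) / 2) * joukowski w - of_real ((a + b) / 2 + h * x))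
      \<le> 1/2 * (\<bar>(A - 1) * x\<bar> + \<bar>B * y\<bar>)" .
    moreover have "\<bar>(A - 1) * x\<bar> \<le> (A - 1) * 1" "\<bar>B * y\<bar> \<le> B * 1"
      unfolding abs_mult using j(3,5) xy by (intro mult_mono; simp)+
    moreover have "\<rho> * \<rho> \<le> \<rho> * 1" using \<rho> by (intro mult_left_mono) auto
    ultimately show ?thesis using j(4,6) unfolding power2_eq_square by argo
  qed
  ultimately show ?thesis by blast
qed

section \<open>Polynomial approximation of layers and of smooth parts\<close>

text \<open>Mean value theorem along the segment from \<open>0\<close> to \<open>z\<close>. To the left of \<open>0\<close> the bound \<open>c * \<mu> \<le> Re (m z)\<close>
  works in the wrong direction and only \<open>cmod (m z) \<le> A * \<mu>\<close> helps, which is the reason for the second term.\<close>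

lemma layer_phase_lower:
  assumes W: "convex W" "open W" "0 \<in> W" and M: "layer_phase W c A \<mu> M" and cA: "0 \<le> c * \<mu>" "c * \<mu> \<le> A * \<mu>" and z: "z \<in> W"
  shows "c * \<mu> * Re z - 2 * (A * \<mu>) * max 0 (- Re z) - A * \<mu> * \<bar>Im z\<bar> \<le> Re (M z)"
proof -
  obtain m where m: "M 0 = 0" "\<And>z. z \<in> W \<Longrightarrow> (M has_field_derivative m z) (at z)"
    "\<And>z. z \<in> W \<Longrightarrow> c * \<mu> \<le> Re (m z)" "\<And>z. z \<in> W \<Longrightarrow> cmod (m z) \<le> A * \<mu>"
    using M unfolding layer_phase_def by blast
  have seg: "of_real t * z \<in> W" if "0 \<le> t" "t \<le> 1" for t
  proof -
    have "(1 - t) *\<^sub>R 0 + t *\<^sub>R z \<in> W" using W z that unfolding convex_alt by blast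
    then show ?thesis by (simp add: scaleR_conv_of_real)
  qed
  have d: "((\<lambda>t. Re (M (of_real t * z))) has_real_derivative Re (m (of_real t * z) * z)) (at t)" if "0 \<le> t" "t \<le> 1" for t
  proof -
    have "((\<lambda>w. w * z) has_field_derivative z) (at (of_real t))" by (auto intro!: derivative_eq_intros)
    from DERIV_chain2[where f = M and g = "\<lambda>w. w * z", OF m(2)[OF seg[OF that]] this]
    show ?thesis by (rule cx_deriv_real)
  qed
  have "\<exists>t. 0 < t \<and> t < 1 \<and> Re (M (of_real 1 * z)) - Re (M (of_real 0 * z)) = (1 - 0) * Re (m (of_real t * z) * z)"
  proof (rule MVT2)
    fix t :: real assume "0 \<le> t" "t \<le> 1"
    then show "((\<lambda>t. Re (M (of_real t * z))) has_real_derivative Re (m (of_real t * z) * z)) (at t)" by (rule d)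
  qed simp
  then obtain t where t: "0 < t" "t < 1" "Re (M z) = Re (m (of_real t * z) * z)" by (auto simp: m(1))
  define w where "w = m (of_real t * z)"
  have tW: "of_real t * z \<in> W" using seg t by simp
  have w: "c * \<mu> \<le> Re w" "\<bar>Re w\<bar> \<le> A * \<mu>" "\<bar>Im w\<bar> \<le> A * \<mu>"
    using m(3,4)[OF tW] abs_Re_le_cmod[of w] abs_Im_le_cmod[of w] unfolding w_def by linarith+
  have "\<bar>Im w * Im z\<bar> \<le> A * \<mu> * \<bar>Im z\<bar>" unfolding abs_mult using w by (intro mult_right_mono) auto
  then have 1: "Re (M z) \<ge> Re w * Re z - A * \<mu> * \<bar>Im z\<bar>" unfolding t(3) w_def[symmetric] by (simp add: abs_le_iff)
  show ?thesis
  proof (cases "0 \<le> Re z")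
    case True
    then have "c * \<mu> * Re z \<le> Re w * Re z" using w by (intro mult_right_mono) auto
    then show ?thesis using 1 True by simp
  next
    case False
    have "A * \<mu> * Re z \<le> Re w * Re z" using w False by (intro mult_right_mono_neg) auto
    moreover have "0 \<le> A * \<mu>" using cA by linarith
    then have "A * \<mu> * Re z \<le> 0" using mult_nonneg_nonneg[of "A * \<mu>" "- Re z"] False by simp
    moreover have "c * \<mu> * Re z \<le> 0" using mult_nonneg_nonneg[of "c * \<mu>" "- Re z"] False cA by simp
    moreover have "2 * (A * \<mu>) * max 0 (- Re z) = - 2 * (A * \<mu> * Re z)" using False by simp
    ultimately show ?thesis using 1 by linarith
  qed
qed

lemma layer_decay:
  assumes W: "convex W" "open W" "0 \<in> W" "of_real x \<in> W" and M: "layer_phase W c A \<mu> M"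
    and cA: "0 \<le> c * \<mu>" "c * \<mu> \<le> A * \<mu>" and x: "0 \<le> x"
  shows "cmod (exp (- M (of_real x))) \<le> exp (- (c * \<mu> * x))"
  using layer_phase_lower[OF W(1-3) M cA W(4)] x by simp

text \<open>The part of the ellipse to the left of \<open>0\<close> protrudes by \<open>O(h \<rho>\<^sup>2)\<close> only. Above the interval the
  vertical deviation at \<open>x\<close> is at most of the order of \<open>\<rho> sqrt (x h)\<close>, so that the loss \<open>A \<mu> \<rho> sqrt (x h)\<close> is compensated by
  the decay \<open>c \<mu> x\<close> up to \<open>A\<^sup>2 / c * \<mu> h \<rho>\<^sup>2\<close>. The exponent is quadratic in \<open>\<rho>\<close>.\<close>

lemma layer_on_ellipse:
  assumes W: "convex W" "open W" "0 \<in> W" and M: "layer_phase W c A \<mu> M" and cA: "0 < c" "c \<le> A" "0 < \<mu>"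
    and w: "cmod w = 1 + \<rho>" and \<rho>: "0 < \<rho>" "\<rho> \<le> 1" and h: "0 < h"
    and zW: "of_real ((0 + h) / 2) + of_real ((h - 0) / 2) * joukowski w \<in> W"
  shows "cmod (exp (- M (of_real ((0 + h) / 2) + of_real ((h - 0) / 2) * joukowski w)))
    \<le> exp ((3 * A + A\<^sup>2 / c) * (\<mu> * h) * \<rho>\<^sup>2)"
proof -
  obtain a b x y where j: "x\<^sup>2 + y\<^sup>2 = 1" "joukowski w = Complex (a * x) (b * y)"
    "1 \<le> a" "a \<le> 1 + \<rho>\<^sup>2 / 2" "0 \<le> b" "b \<le> \<rho>" by (rule joukowski_ellipse[OF w \<rho>])
  define z where "z = of_real ((0 + h) / 2) + of_real ((h - 0) / 2) * joukowski w"
  have re: "Re z = h / 2 * (1 + a * x)" and im: "Im z = h / 2 * (b * y)"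
    by (simp_all add: z_def j(2) algebra_simps)
  have x1: "- 1 \<le> x" "x \<le> 1"
  proof -
    have "x\<^sup>2 \<le> 1" using j(1) zero_le_power2[of y] by linarith
    then show "- 1 \<le> x" "x \<le> 1" by (auto simp: abs_square_le_1 abs_le_iff)
  qed
  define X where "X = 1 + x"
  have X: "0 \<le> X" "X \<le> 2" using x1 by (auto simp: X_def)
  have "(a - 1) * (- x) \<le> (a - 1) * 1" using j x1 by (intro mult_left_mono) auto
  then have ax: "X - (a - 1) \<le> 1 + a * x" by (simp add: X_def algebra_simps)
  have a1: "a - 1 \<le> \<rho>\<^sup>2 / 2" "0 \<le> a - 1" using j by auto
  have low: "h / 2 * X - h / 2 * (\<rho>\<^sup>2 / 2) \<le> Re z"
  proof -
    have "h / 2 * (X - \<rho>\<^sup>2 / 2) \<le> h / 2 * (1 + a * x)" using ax a1 h by (intro mult_left_mono) auto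
    then show ?thesis unfolding re by (simp add: right_diff_distrib)
  qed
  have neg: "max 0 (- Re z) \<le> h / 2 * (\<rho>\<^sup>2 / 2)"
  proof -
    have "0 \<le> h / 2 * X" "0 \<le> h / 2 * (\<rho>\<^sup>2 / 2)" using X h by auto
    then show ?thesis using low by linarith
  qed
  have y2: "y\<^sup>2 \<le> 2 * X"
  proof -
    have "y\<^sup>2 = (1 - x) * X" using j(1) by (simp add: X_def algebra_simps power2_eq_square)
    also have "\<dots> \<le> 2 * X" using x1 X by (intro mult_right_mono) auto
    finally show ?thesis .
  qed
  have A0: "0 < A" using cA by linarith
  have key: "A * (b * \<bar>y\<bar>) \<le> c * X + A\<^sup>2 / c * \<rho>\<^sup>2 / 2"
  proof -
    have "(A * b) * \<bar>y\<bar> \<le> c * y\<^sup>2 / 2 + (A * b)\<^sup>2 / (2 * c)"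
    proof -
      have "0 \<le> (c * \<bar>y\<bar> - A * b)\<^sup>2 / (2 * c)" using cA by simp
      also have "\<dots> = c * y\<^sup>2 / 2 + (A * b)\<^sup>2 / (2 * c) - (A * b) * \<bar>y\<bar>"
        using cA by (simp add: power2_diff power_mult_distrib field_simps power2_eq_square)
      finally show ?thesis by simp
    qed
    also have "c * y\<^sup>2 / 2 \<le> c * X" using y2 cA by simp
    also have "(A * b)\<^sup>2 / (2 * c) \<le> (A * \<rho>)\<^sup>2 / (2 * c)" using j A0 cA by (intro divide_right_mono power_mono mult_left_mono) auto
    also have "(A * \<rho>)\<^sup>2 / (2 * c) = A\<^sup>2 / c * \<rho>\<^sup>2 / 2" by (simp add: power_mult_distrib)
    finally show ?thesis by (simp add: mult.assoc)
  qed
  have "- Re (M z) \<le> - (c * \<mu> * Re z) + 2 * (A * \<mu>) * max 0 (- Re z) + A * \<mu> * \<bar>Im z\<bar>"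
    using layer_phase_lower[OF W M _ _ zW[folded z_def]] cA by simp
  also have "\<dots> \<le> - (c * \<mu> * (h / 2 * X - h / 2 * (\<rho>\<^sup>2 / 2))) + 2 * (A * \<mu>) * (h / 2 * (\<rho>\<^sup>2 / 2)) + \<mu> * (h / 2) * (A * (b * \<bar>y\<bar>))"
  proof (intro add_mono)
    show "- (c * \<mu> * Re z) \<le> - (c * \<mu> * (h / 2 * X - h / 2 * (\<rho>\<^sup>2 / 2)))"
      using mult_left_mono[OF low, of "c * \<mu>"] cA by simp
    show "2 * (A * \<mu>) * max 0 (- Re z) \<le> 2 * (A * \<mu>) * (h / 2 * (\<rho>\<^sup>2 / 2))" using neg A0 cA by (intro mult_left_mono) auto
    show "A * \<mu> * \<bar>Im z\<bar> \<le> \<mu> * (h / 2) * (A * (b * \<bar>y\<bar>))" unfolding im abs_mult using h j by simp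
  qed
  also have "\<mu> * (h / 2) * (A * (b * \<bar>y\<bar>)) \<le> \<mu> * (h / 2) * (c * X + A\<^sup>2 / c * \<rho>\<^sup>2 / 2)"
    using key cA h by (intro mult_left_mono) auto
  also have "- (c * \<mu> * (h / 2 * X - h / 2 * (\<rho>\<^sup>2 / 2))) + 2 * (A * \<mu>) * (h / 2 * (\<rho>\<^sup>2 / 2)) + \<mu> * (h / 2) * (c * X + A\<^sup>2 / c * \<rho>\<^sup>2 / 2)
     = (c / 4 + A / 2 + A\<^sup>2 / c / 4) * (\<mu> * h) * \<rho>\<^sup>2"
    by (simp add: algebra_simps)
  also have "\<dots> \<le> (3 * A + A\<^sup>2 / c) * (\<mu> * h) * \<rho>\<^sup>2"
  proof (intro mult_right_mono)
    define q where "q = A\<^sup>2 / c"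
    have "0 \<le> q" using cA by (simp add: q_def)
    then show "c / 4 + A / 2 + A\<^sup>2 / c / 4 \<le> 3 * A + A\<^sup>2 / c" unfolding q_def[symmetric] using cA A0 by linarith
  qed (use cA h in auto)
  finally show ?thesis unfolding z_def[symmetric] by simp
qed

text \<open>Since \<open>\<mu> h \<le> K2 p\<close>, the layer is at most \<open>exp (G K2 p \<rho>\<^sup>2)\<close> on the ellipse. The choice
  \<open>\<rho> \<le> 1 / (8 G K2)\<close> makes this \<open>exp (p \<rho> / 8)\<close>, half of the exponent gained by Bernstein approximation. The
  derivative is approximated first, then integrated.\<close>

theorem layer_polynomial:
  fixes \<theta> r c A K2 :: real
  defines "W \<equiv> rhombus \<theta> r"
  assumes ok: "rhombus_ok \<theta> r" and cA: "0 < c" "c \<le> A" and K2: "0 < K2"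
  shows "\<exists>C \<sigma>. 0 < C \<and> 0 < \<sigma> \<and> (\<forall>M \<mu> h p \<alpha>. layer_phase W c A \<mu> M \<and> 0 < \<mu> \<and> 0 < h \<and> h \<le> 1 \<and> \<mu> * h \<le> K2 * real p
      \<and> 1 \<le> p \<and> cmod \<alpha> \<le> A \<longrightarrow>
     (\<exists>Q. degree Q \<le> p \<and> poly Q 0 = Re (\<alpha> * exp (- M 0)) \<and> poly Q h = Re (\<alpha> * exp (- M (of_real h))) \<and>
       (\<forall>x\<in>{0..h}. \<bar>deriv (\<lambda>x. Re (\<alpha> * exp (- M (of_real x)))) x - poly (pderiv Q) x\<bar> \<le> C * \<mu> * exp (- \<sigma> * real p)
          \<and> \<bar>Re (\<alpha> * exp (- M (of_real x))) - poly Q x\<bar> \<le> C * exp (- \<sigma> * real p))))"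
proof -
  have ok': "0 < \<theta>" "\<theta> \<le> 1/2" "0 < r" using ok by (auto simp: rhombus_ok_def)
  define G where "G = 3 * A + A\<^sup>2 / c"
  have A0: "0 < A" using cA by linarith
  have G: "0 < G" unfolding G_def using A0 cA by (intro add_pos_pos) auto
  \<comment> \<open>the first two bounds keep the ellipse inside \<open>W\<close>, the third one makes its gain exceed the growth of the layer\<close>
  define \<rho> where "\<rho> = min (min (1/2) (\<theta> * r / 4)) (1 / (8 * G * K2))"
  have \<rho>: "0 < \<rho>" "\<rho> \<le> 1/2" "\<rho> \<le> \<theta> * r / 4" "\<rho> \<le> 1 / (8 * G * K2)" using ok' G K2 by (auto simp: \<rho>_def)
  obtain C0 where C0: "0 < C0" "\<And>p. bernstein_err (1 + \<rho>) p \<le> C0 * exp (- (\<rho> / 4) * real p)"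
    using bernstein_err_bound[OF \<rho>(1,2)] by blast
  define C where "C = 2 * A * A * C0 * (1 + K2 * (16 / \<rho>))"
  have W: "convex W" "open W" "0 \<in> W" "\<And>x. x \<in> {0..1} \<Longrightarrow> complex_of_real x \<in> W"
    using rhombus_contains[of 0 0 \<theta> r] rhombus_contains[of _ "complex_of_real _" \<theta> r] ok'
    by (auto simp: W_def convex_rhombus open_rhombus)
  have K16: "0 < K2 * (16 / \<rho>)" using K2 \<rho> by simp
  have C: "0 < C" unfolding C_def using A0 C0 K16 by simp
  have "\<exists>Q. degree Q \<le> p \<and> poly Q 0 = Re (\<alpha> * exp (- M 0)) \<and> poly Q h = Re (\<alpha> * exp (- M (of_real h))) \<and>
       (\<forall>x\<in>{0..h}. \<bar>deriv (\<lambda>x. Re (\<alpha> * exp (- M (of_real x)))) x - poly (pderiv Q) x\<bar> \<le> C * \<mu> * exp (- (\<rho> / 16) * real p)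
          \<and> \<bar>Re (\<alpha> * exp (- M (of_real x))) - poly Q x\<bar> \<le> C * exp (- (\<rho> / 16) * real p))"
    if M: "layer_phase W c A \<mu> M" and \<mu>: "0 < \<mu>" and h: "0 < h" "h \<le> 1" and \<mu>h: "\<mu> * h \<le> K2 * real p"
      and p: "1 \<le> p" and \<alpha>: "cmod \<alpha> \<le> A" for M \<mu> h p \<alpha>
  proof -
    obtain m where m: "M 0 = 0" "\<And>z. z \<in> W \<Longrightarrow> (M has_field_derivative m z) (at z)"
      "\<And>z. z \<in> W \<Longrightarrow> cmod (m z) \<le> A * \<mu>"
      using M unfolding layer_phase_def by blast
    have Mh: "M holomorphic_on W" using m(2) W(2) by (auto simp: holomorphic_on_open)
    have mh: "m holomorphic_on W"
    proof -
      have "deriv M holomorphic_on W" by (rule holomorphic_deriv[OF Mh W(2)])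
      then show ?thesis by (rule holomorphic_transform) (use m(2) DERIV_imp_deriv in blast)
    qed
    define g where "g z = \<alpha> * (- m z * exp (- M z))" for z
    have gh: "g holomorphic_on W" unfolding g_def by (intro holomorphic_intros mh Mh)
    define F where "F x = Re (\<alpha> * exp (- M (of_real x)))" for x
    have F': "(F has_real_derivative Re (g (of_real x))) (at x)" if x: "x \<in> {0..1}" for x
      unfolding F_def
    proof (rule cx_deriv_real)
      show "((\<lambda>z. \<alpha> * exp (- M z)) has_field_derivative g (of_real x)) (at (of_real x))"
        unfolding g_def using DERIV_cmult[OF DERIV_fun_exp[OF DERIV_minus[OF m(2)[OF W(4)[OF x]]]], of \<alpha>]
        by (simp add: mult_ac)
    qed
    define E where "E = A * A * \<mu> * exp (\<rho> / 8 * real p)"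
    have "\<exists>q::real poly. degree q \<le> p - 1 \<and> (\<forall>x\<in>{0..h}. \<bar>Re (g (of_real x)) - poly q x\<bar> \<le> E * bernstein_err (1 + \<rho>) p)"
    proof (rule Bernstein_approximation[OF W(2) W(1) gh h(1) _ p])
      show "1 < 1 + \<rho>" using \<rho> by simp
      fix t assume "t \<in> {0..h}" then show "complex_of_real t \<in> W" using h W(4) by auto
    next
      fix w assume w: "cmod w = 1 + \<rho>"
      let ?z = "complex_of_real ((0 + h) / 2) + of_real ((h - 0) / 2) * joukowski w"
      obtain x where x: "x \<in> {0..h}" "cmod (?z - of_real x) \<le> 3/4 * \<rho>"
        using ellipse_near_interval[OF w \<rho>(1) _ _ h] \<rho>(2) by auto
      show zW: "?z \<in> W" unfolding W_def
      proof (rule rhombus_contains[of x])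
        have "0 < \<theta> * r" using ok' by simp
        then show "cmod (?z - of_real x) < \<theta> * r / 2" using x(2) \<rho> by linarith
      qed (use x h ok' in auto)
      have "cmod (exp (- M ?z)) \<le> exp (G * (\<mu> * h) * \<rho>\<^sup>2)"
        unfolding G_def by (rule layer_on_ellipse[OF W(1-3) M cA \<mu> w \<rho>(1) _ h(1) zW]) (use \<rho> in auto)
      also have "\<dots> \<le> exp (\<rho> / 8 * real p)"
      proof -
        have "G * (\<mu> * h) * \<rho>\<^sup>2 \<le> G * (K2 * real p) * (\<rho> * (1 / (8 * G * K2)))"
          unfolding power2_eq_square
          by (rule mult_mono[OF mult_left_mono[OF \<mu>h] mult_left_mono[OF \<rho>(4)]]) (use G K2 \<rho> in auto)
        also have "\<dots> = \<rho> / 8 * real p" using G K2 by simp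
        finally show ?thesis by simp
      qed
      finally have e: "cmod (exp (- M ?z)) \<le> exp (\<rho> / 8 * real p)" .
      have "cmod (g ?z) = cmod \<alpha> * (cmod (m ?z) * cmod (exp (- M ?z)))" by (simp only: g_def norm_mult norm_minus_cancel)
      also have "\<dots> \<le> A * (A * \<mu> * exp (\<rho> / 8 * real p))"
        using \<alpha> m(3)[OF zW] e A0 \<mu> by (intro mult_mono) auto
      finally show "cmod (g ?z) \<le> E" by (simp add: E_def mult_ac)
    qed
    then obtain q where q: "degree q \<le> p - 1" "\<And>x. x \<in> {0..h} \<Longrightarrow> \<bar>Re (g (of_real x)) - poly q x\<bar> \<le> E * bernstein_err (1 + \<rho>) p" by blast
    obtain Q where Q: "degree Q \<le> p" "poly Q 0 = F 0" "poly Q h = F h"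
      "\<And>x. x \<in> {0..h} \<Longrightarrow> \<bar>Re (g (of_real x)) - poly (pderiv Q) x\<bar> \<le> 2 * (E * bernstein_err (1 + \<rho>) p) \<and>
         \<bar>F x - poly Q x\<bar> \<le> 2 * (E * bernstein_err (1 + \<rho>) p) * (h - 0)"
      using interpolating_primitive[OF h(1) p q(1) F' q(2)] h by auto
    define err where "err = A * A * C0 * exp (- (\<rho> / 8) * real p)"
    have err: "E * bernstein_err (1 + \<rho>) p \<le> err * \<mu>"
    proof -
      have "E * bernstein_err (1 + \<rho>) p \<le> E * (C0 * exp (- (\<rho> / 4) * real p))"
        using C0(2) A0 \<mu> by (intro mult_left_mono) (auto simp: E_def)
      also have "\<dots> = A * A * C0 * \<mu> * (exp (\<rho> / 8 * real p) * exp (- (\<rho> / 4) * real p))" by (simp add: E_def)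
      also have "exp (\<rho> / 8 * real p) * exp (- (\<rho> / 4) * real p) = exp (- (\<rho> / 8) * real p)"
        unfolding exp_add[symmetric] by (rule arg_cong[where f = exp]) (simp add: field_simps)
      finally show ?thesis by (simp add: err_def mult_ac)
    qed
    have err0: "0 \<le> err" using A0 C0 by (simp add: err_def)
    define X where "X = exp (- (\<rho> / 16) * real p)"
    have X: "0 < X" by (simp add: X_def)
    have eX: "err = A * A * C0 * (X * X)" unfolding err_def X_def exp_add[symmetric] by simp
    have X1: "X \<le> 1" using \<rho> by (simp add: X_def)
    have pX: "real p * X \<le> 16 / \<rho>"
    proof -
      have "\<rho> / 16 * real p \<le> exp (\<rho> / 16 * real p)" using exp_ge_add_one_self[of "\<rho> / 16 * real p"] by linarith
      then have "real p \<le> 16 / \<rho> * exp (\<rho> / 16 * real p)" using \<rho> by (simp add: field_simps)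
      then have "real p * X \<le> 16 / \<rho> * exp (\<rho> / 16 * real p) * X" using X by (intro mult_right_mono) auto
      also have "\<dots> = 16 / \<rho> * (exp (\<rho> / 16 * real p) * exp (- (\<rho> / 16) * real p))" by (simp add: X_def)
      also have "\<dots> = 16 / \<rho>" by (simp flip: exp_add)
      finally show ?thesis .
    qed
    have c1: "2 * err \<le> C * X"
    proof -
      have "2 * err = 2 * A * A * C0 * X * X" by (simp add: eX)
      also have "\<dots> \<le> 2 * A * A * C0 * X * (1 + K2 * (16 / \<rho>))" using A0 C0 X X1 K16 by (intro mult_left_mono) auto
      finally show ?thesis by (simp add: C_def mult_ac)
    qed
    have c2: "2 * err * (K2 * real p) \<le> C * X"
    proof -
      have "2 * err * (K2 * real p) = 2 * A * A * C0 * X * (K2 * (real p * X))" by (simp add: eX mult_ac)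
      also have "\<dots> \<le> 2 * A * A * C0 * X * (1 + K2 * (16 / \<rho>))"
        using A0 C0 X K2 mult_left_mono[OF pX, of K2] by (intro mult_left_mono) auto
      finally show ?thesis by (simp add: C_def mult_ac)
    qed
    show ?thesis
    proof (intro exI[of _ Q] conjI ballI)
      show "degree Q \<le> p" by (rule Q)
      show "poly Q 0 = Re (\<alpha> * exp (- M 0))" "poly Q h = Re (\<alpha> * exp (- M (of_real h)))" using Q by (auto simp: F_def)
      fix x assume x: "x \<in> {0..h}"
      then have x1: "x \<in> {0..1}" using h by auto
      have "deriv F x = Re (g (of_real x))" by (rule DERIV_imp_deriv[OF F'[OF x1]])
      moreover have "\<bar>Re (g (of_real x)) - poly (pderiv Q) x\<bar> \<le> (2 * err) * \<mu>" using Q(4)[OF x] err by linarith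
      moreover have "(2 * err) * \<mu> \<le> C * X * \<mu>" using c1 \<mu> by (intro mult_right_mono) auto
      ultimately show "\<bar>deriv (\<lambda>x. Re (\<alpha> * exp (- M (of_real x)))) x - poly (pderiv Q) x\<bar> \<le> C * \<mu> * exp (- (\<rho> / 16) * real p)"
        unfolding F_def[symmetric] X_def by (simp add: mult_ac)
      have "\<bar>F x - poly Q x\<bar> \<le> 2 * (E * bernstein_err (1 + \<rho>) p) * h" using Q(4)[OF x] by simp
      also have "\<dots> \<le> 2 * (err * \<mu>) * h" using err h by (intro mult_right_mono) auto
      also have "\<dots> = 2 * err * (\<mu> * h)" by simp
      also have "\<dots> \<le> 2 * err * (K2 * real p)" using \<mu>h err0 by (intro mult_left_mono) auto
      also have "\<dots> \<le> C * X" by (rule c2)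
      finally show "\<bar>Re (\<alpha> * exp (- M (of_real x))) - poly Q x\<bar> \<le> C * exp (- (\<rho> / 16) * real p)"
        unfolding F_def X_def .
    qed
  qed
  then show ?thesis using C \<rho> by (intro exI[of _ C] exI[of _ "\<rho> / 16"]) auto
qed

text \<open>The ellipse of parameter \<open>1 + \<rho>\<close> around a subinterval of \<open>[0,1]\<close> stays within distance \<open>\<rho>\<close> of it, so one
  \<open>\<rho>\<close> serves all subintervals.\<close>

theorem smooth_polynomial:
  fixes \<theta> r A :: real
  defines "W \<equiv> rhombus \<theta> r"
  assumes ok: "rhombus_ok \<theta> r" and A: "0 < A"
  shows "\<exists>C \<sigma>. 0 < C \<and> 0 < \<sigma> \<and> (\<forall>S a b p. S holomorphic_on W \<and> (\<forall>z\<in>W. cmod (S z) \<le> A) \<and> 0 \<le> a \<and> a < b \<and> b \<le> 1 \<and> 1 \<le> p \<longrightarrow>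
     (\<exists>Q. degree Q \<le> p \<and> poly Q a = Re (S (of_real a)) \<and> poly Q b = Re (S (of_real b)) \<and>
       (\<forall>x\<in>{a..b}. \<bar>deriv (\<lambda>x. Re (S (of_real x))) x - poly (pderiv Q) x\<bar> \<le> C * exp (- \<sigma> * real p)
          \<and> \<bar>Re (S (of_real x)) - poly Q x\<bar> \<le> C * exp (- \<sigma> * real p))))"
proof -
  have ok': "0 < \<theta>" "\<theta> \<le> 1/2" "0 < r" using ok by (auto simp: rhombus_ok_def)
  define d where "d = \<theta> * r / 4"
  have d: "0 < d" using ok' by (simp add: d_def)
  define \<rho> where "\<rho> = min (1/2) d"
  have \<rho>: "0 < \<rho>" "\<rho> \<le> 1/2" "\<rho> \<le> d" using d by (auto simp: \<rho>_def)
  obtain C0 where C0: "0 < C0" "\<And>p. bernstein_err (1 + \<rho>) p \<le> C0 * exp (- (\<rho> / 4) * real p)"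
    using bernstein_err_bound[OF \<rho>(1,2)] by blast
  define C where "C = 2 * (A / d * C0)"
  have Wo: "open W" and Wc: "convex W" by (auto simp: W_def open_rhombus convex_rhombus)
  have near: "z \<in> W" if "x \<in> {0..1}" "cmod (z - of_real x) < 2 * d" for x z
    unfolding W_def using rhombus_contains[OF that(1), of z \<theta> r] that(2) ok' by (simp add: d_def)
  have C: "0 < C" using A d C0 by (simp add: C_def)
  have "\<exists>Q. degree Q \<le> p \<and> poly Q a = Re (S (of_real a)) \<and> poly Q b = Re (S (of_real b)) \<and>
       (\<forall>x\<in>{a..b}. \<bar>deriv (\<lambda>x. Re (S (of_real x))) x - poly (pderiv Q) x\<bar> \<le> C * exp (- (\<rho> / 4) * real p)
          \<and> \<bar>Re (S (of_real x)) - poly Q x\<bar> \<le> C * exp (- (\<rho> / 4) * real p))"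
    if S: "S holomorphic_on W" "\<And>z. z \<in> W \<Longrightarrow> cmod (S z) \<le> A" and ab: "0 \<le> a" "a < b" "b \<le> 1" and p: "1 \<le> p" for S a b p
  proof -
    have x01: "x \<in> {0..1}" if "x \<in> {a..b}" for x using that ab by auto
    have xW: "complex_of_real x \<in> W" if "x \<in> {a..b}" for x using near[OF x01[OF that]] d by simp
    have S': "((\<lambda>x. Re (S (of_real x))) has_real_derivative Re (deriv S (of_real x))) (at x)" if "x \<in> {a..b}" for x
      by (rule cx_deriv_real, rule holomorphic_derivI[OF S(1) Wo xW[OF that]])
    have "\<exists>q::real poly. degree q \<le> p - 1 \<and> (\<forall>x\<in>{a..b}. \<bar>Re (deriv S (of_real x)) - poly q x\<bar> \<le> A / d * bernstein_err (1 + \<rho>) p)"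
    proof (rule Bernstein_approximation[OF Wo Wc holomorphic_deriv[OF S(1) Wo] ab(2) _ p])
      show "1 < 1 + \<rho>" using \<rho> by simp
      fix t assume "t \<in> {a..b}" then show "complex_of_real t \<in> W" by (rule xW)
    next
      fix w assume w: "cmod w = 1 + \<rho>"
      let ?z = "complex_of_real ((a + b) / 2) + of_real ((b - a) / 2) * joukowski w"
      obtain x where x: "x \<in> {a..b}" "cmod (?z - of_real x) \<le> 3/4 * \<rho>"
        using ellipse_near_interval[OF w \<rho>(1) _ ab] \<rho>(2) by auto
      have zd: "cmod (?z - of_real x) < d" using x(2) \<rho> by linarith
      show "?z \<in> W" by (rule near[OF x01[OF x(1)]]) (use zd d in linarith)
      have sub: "cball ?z d \<subseteq> W"
      proof
        fix y assume "y \<in> cball ?z d"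
        then have "cmod (y - ?z) \<le> d" by (simp only: mem_cball dist_norm norm_minus_commute)
        moreover have "cmod (y - of_real x) \<le> cmod (y - ?z) + cmod (?z - of_real x)"
          by (metis diff_add_cancel add_diff_eq norm_triangle_ineq)
        ultimately show "y \<in> W" by (intro near[OF x01[OF x(1)]]) (use zd in linarith)
      qed
      have "cmod ((deriv ^^ 1) S ?z) \<le> fact 1 * A / d ^ 1"
      proof (rule Cauchy_inequality)
        have "S holomorphic_on cball ?z d" using S(1) sub by (rule holomorphic_on_subset)
        then show "S holomorphic_on ball ?z d" "continuous_on (cball ?z d) S"
          by (auto intro: holomorphic_on_subset ball_subset_cball holomorphic_on_imp_continuous_on)
        fix y assume "cmod (?z - y) = d"
        then have "y \<in> cball ?z d" by (simp only: mem_cball dist_norm)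
        then show "cmod (S y) \<le> A" using S(2) sub by blast
      qed (rule d)
      then show "cmod (deriv S ?z) \<le> A / d" by simp
    qed
    then obtain q where q: "degree q \<le> p - 1" "\<And>x. x \<in> {a..b} \<Longrightarrow> \<bar>Re (deriv S (of_real x)) - poly q x\<bar> \<le> A / d * bernstein_err (1 + \<rho>) p" by blast
    obtain Q where Q: "degree Q \<le> p" "poly Q a = Re (S (of_real a))" "poly Q b = Re (S (of_real b))"
      "\<And>x. x \<in> {a..b} \<Longrightarrow> \<bar>Re (deriv S (of_real x)) - poly (pderiv Q) x\<bar> \<le> 2 * (A / d * bernstein_err (1 + \<rho>) p) \<and>
         \<bar>Re (S (of_real x)) - poly Q x\<bar> \<le> 2 * (A / d * bernstein_err (1 + \<rho>) p) * (b - a)"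
      using interpolating_primitive[OF ab(2) p q(1) S' q(2)] by auto
    define E where "E = 2 * (A / d * bernstein_err (1 + \<rho>) p)"
    have E: "E \<le> C * exp (- (\<rho> / 4) * real p)"
    proof -
      have "A / d * bernstein_err (1 + \<rho>) p \<le> A / d * (C0 * exp (- (\<rho> / 4) * real p))"
        using C0(2) A d by (intro mult_left_mono) auto
      then have "2 * (A / d * bernstein_err (1 + \<rho>) p) \<le> 2 * (A / d * (C0 * exp (- (\<rho> / 4) * real p)))"
        by (rule mult_left_mono) simp
      then show ?thesis unfolding E_def C_def by (simp only: mult.assoc)
    qed
    have "\<bar>Re (deriv S (of_real a)) - poly (pderiv Q) a\<bar> \<le> E" using Q(4)[of a] ab unfolding E_def by auto
    then have E0: "0 \<le> E" by (rule order.trans[OF abs_ge_zero])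
    show ?thesis
    proof (intro exI[of _ Q] conjI ballI)
      fix x assume x: "x \<in> {a..b}"
      have "deriv (\<lambda>x. Re (S (of_real x))) x = Re (deriv S (of_real x))" by (rule DERIV_imp_deriv[OF S'[OF x]])
      then show "\<bar>deriv (\<lambda>x. Re (S (of_real x))) x - poly (pderiv Q) x\<bar> \<le> C * exp (- (\<rho> / 4) * real p)"
        using Q(4)[OF x] E unfolding E_def by linarith
      have "E * (b - a) \<le> E * 1" using E0 ab by (intro mult_left_mono) auto
      then show "\<bar>Re (S (of_real x)) - poly Q x\<bar> \<le> C * exp (- (\<rho> / 4) * real p)"
        using Q(4)[OF x] E unfolding E_def by linarith
    qed (use Q in auto)
  qed
  then show ?thesis using C \<rho> by (intro exI[of _ C] exI[of _ "\<rho> / 4"]) auto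
qed

section \<open>Piecewise polynomials on the mesh\<close>

lemma local_poly_derivative:
  fixes Z :: "real \<Rightarrow> real"
  assumes "\<And>y. y \<in> {a<..<b} \<Longrightarrow> Z y = poly q y" "x \<in> {a<..<b}"
  shows "(Z has_real_derivative poly (pderiv q) x) (at x)"
proof (rule has_field_derivative_transform_within_open[OF poly_DERIV])
  show "open {a<..<b}" by simp
qed (use assms in auto)

text \<open>Both mesh types are treated at once as \<open>{0, h0, 1 - h1, 1}\<close>; the one-element mesh is the case
  \<open>h0 = h1 = 1\<close>, in which the middle interval is empty.\<close>

definition mesh_poly :: "real \<Rightarrow> real \<Rightarrow> nat \<Rightarrow> (real \<Rightarrow> real) \<Rightarrow> bool" where
  "mesh_poly h0 h1 p Z \<longleftrightarrow> continuous_on {0..1} Z \<and>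
     (\<exists>q. degree q \<le> p \<and> (\<forall>x\<in>{0..h0}. Z x = poly q x)) \<and>
     (\<exists>q. degree q \<le> p \<and> (\<forall>x\<in>{h0..1 - h1}. Z x = poly q x)) \<and>
     (\<exists>q. degree q \<le> p \<and> (\<forall>x\<in>{1 - h1..1}. Z x = poly q x))"

definition mesh_widths :: "real \<Rightarrow> real \<Rightarrow> bool" where
  "mesh_widths h0 h1 \<longleftrightarrow> (h0 = 1 \<and> h1 = 1) \<or> (0 < h0 \<and> h0 < 1/2 \<and> 0 < h1 \<and> h1 < 1/2)"

lemma mesh_poly_lincomb:
  assumes "mesh_poly h0 h1 p v" "mesh_poly h0 h1 p w"
  shows "mesh_poly h0 h1 p (\<lambda>x. v x + c * w x)"
proof -
  have *: "\<exists>q. degree q \<le> p \<and> (\<forall>x\<in>K. v x + c * w x = poly q x)"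
    if "\<exists>q. degree q \<le> p \<and> (\<forall>x\<in>K. v x = poly q x)" "\<exists>q. degree q \<le> p \<and> (\<forall>x\<in>K. w x = poly q x)" for K
  proof -
    obtain q1 q2 where "degree q1 \<le> p" "\<forall>x\<in>K. v x = poly q1 x" "degree q2 \<le> p" "\<forall>x\<in>K. w x = poly q2 x" using \<open>\<exists>q. degree q \<le> p \<and> (\<forall>x\<in>K. v x = poly q x)\<close> \<open>\<exists>q. degree q \<le> p \<and> (\<forall>x\<in>K. w x = poly q x)\<close> by blast
    then show ?thesis
      by (intro exI[of _ "q1 + smult c q2"]) (auto intro!: degree_add_le order.trans[OF degree_smult_le])
  qed
  show ?thesis using assms unfolding mesh_poly_def by (intro conjI * continuous_intros) auto
qed

lemma mesh_poly_piecewise_C1: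
  assumes Z: "mesh_poly h0 h1 p Z" and h: "mesh_widths h0 h1"
  shows "piecewise_C1 Z"
proof -
  obtain q1 q2 q3 where q1: "\<And>x. x \<in> {0..h0} \<Longrightarrow> Z x = poly q1 x"
    and q2: "\<And>x. x \<in> {h0..1 - h1} \<Longrightarrow> Z x = poly q2 x" and q3: "\<And>x. x \<in> {1 - h1..1} \<Longrightarrow> Z x = poly q3 x"
    using Z unfolding mesh_poly_def by blast
  define g where "g x = (if x < h0 then poly (pderiv q1) x else if x < 1 - h1 then poly (pderiv q2) x else poly (pderiv q3) x)" for x
  define S where "S = {h0, 1 - h1}"
  have loc: "(Z has_real_derivative g x) (at x) \<and> isCont g x" if x: "x \<in> I01 - S" for x
  proof -
    have h': "0 < h0" "h0 \<le> 1 - h1 \<or> h0 = 1 \<and> h1 = 1" using h by (auto simp: mesh_widths_def)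
    have *: ?thesis if a: "\<And>y. y \<in> {a<..<b} \<Longrightarrow> Z y = poly q y \<and> g y = poly (pderiv q) y" "x \<in> {a<..<b}" for a b q
    proof
      have "(Z has_real_derivative poly (pderiv q) x) (at x)" by (rule local_poly_derivative) (use a in auto)
      then show "(Z has_real_derivative g x) (at x)" using a by simp
      have "(g has_real_derivative poly (pderiv (pderiv q)) x) (at x)" by (rule local_poly_derivative) (use a in auto)
      then show "isCont g x" by (rule DERIV_isCont)
    qed
    consider "x < h0" | "h0 < x" "x < 1 - h1" | "h0 < x" "1 - h1 < x" using x h' by (auto simp: S_def) linarith
    then show ?thesis
    proof cases
      case 1
      show ?thesis by (rule *[of 0 h0 q1]) (use q1 x 1 in \<open>auto simp: g_def\<close>)
    next
      case 2
      show ?thesis by (rule *[of h0 "1 - h1" q2]) (use q2 x 2 in \<open>auto simp: g_def\<close>)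
    next
      case 3
      show ?thesis by (rule *[of "max h0 (1 - h1)" 1 q3]) (use q3 x 3 in \<open>auto simp: g_def\<close>)
    qed
  qed
  have "bounded (g ` (I01 - S))"
  proof (rule bounded_subset)
    have "bounded (poly r ` {0..1})" for r :: "real poly"
      by (intro compact_imp_bounded compact_continuous_image continuous_intros) auto
    then show "bounded (poly (pderiv q1) ` {0..1} \<union> poly (pderiv q2) ` {0..1} \<union> poly (pderiv q3) ` {0..1})" by (simp add: bounded_Un)
    show "g ` (I01 - S) \<subseteq> poly (pderiv q1) ` {0..1} \<union> poly (pderiv q2) ` {0..1} \<union> poly (pderiv q3) ` {0..1}"
      by (auto simp: g_def)
  qed
  moreover have "continuous_on (I01 - S) g" by (intro continuous_at_imp_continuous_on ballI) (use loc in blast)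
  moreover have "continuous_on {0..1} Z" using Z by (simp add: mesh_poly_def)
  moreover have "finite S" by (simp add: S_def)
  ultimately show ?thesis using loc by (intro piecewise_C1I[of S Z g]) blast+
qed

lemma subintervals_mesh:
  assumes h: "mesh_widths h0 h1" and K: "K \<in> subintervals {0, h0, 1 - h1, 1}"
  shows "K = {0..h0} \<or> K = {h0..1 - h1} \<or> K = {1 - h1..1}"
proof -
  obtain x y where K: "K = {x..y}" "x \<in> {0, h0, 1 - h1, 1}" "y \<in> {0, h0, 1 - h1, 1}" "x < y" "{x<..<y} \<inter> {0, h0, 1 - h1, 1} = {}"
    using K unfolding subintervals_def by blast
  have n: "\<not> (x < h0 \<and> h0 < y)" "\<not> (x < 1 - h1 \<and> 1 - h1 < y)" using K(5) by auto
  show ?thesis using K(1-4) n h unfolding mesh_widths_def by auto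
qed

lemma mesh_subintervals:
  assumes h: "mesh_widths h0 h1"
  shows "{0..h0} \<in> subintervals {0, h0, 1 - h1, 1}" "{1 - h1..1} \<in> subintervals {0, h0, 1 - h1, 1}"
    "h0 < 1 - h1 \<Longrightarrow> {h0..1 - h1} \<in> subintervals {0, h0, 1 - h1, 1}"
proof -
  have *: "{x..y} \<in> subintervals \<Delta>" if "x \<in> \<Delta>" "y \<in> \<Delta>" "x < y" "{x<..<y} \<inter> \<Delta> = {}" for x y \<Delta>
    using that unfolding subintervals_def by blast
  show "{0..h0} \<in> subintervals {0, h0, 1 - h1, 1}" "{1 - h1..1} \<in> subintervals {0, h0, 1 - h1, 1}"
    "h0 < 1 - h1 \<Longrightarrow> {h0..1 - h1} \<in> subintervals {0, h0, 1 - h1, 1}"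
    by (rule *; use h in \<open>auto simp: mesh_widths_def\<close>)+
qed

lemma FE_space_mesh_poly:
  assumes h: "mesh_widths h0 h1" and v: "v \<in> FE_space {0, h0, 1 - h1, 1} p"
  shows "mesh_poly h0 h1 p v" "v 0 = 0" "v 1 = 0"
proof -
  have q: "\<exists>q. degree q \<le> p \<and> (\<forall>x\<in>K. v x = poly q x)" if "K \<in> subintervals {0, h0, 1 - h1, 1}" for K
    using v that unfolding FE_space_def by blast
  have "\<exists>q. degree q \<le> p \<and> (\<forall>x\<in>{h0..1 - h1}. v x = poly q x)"
  proof (cases "h0 < 1 - h1")
    case True
    then show ?thesis using q mesh_subintervals(3)[OF h] by blast
  next
    case False
    then have "{h0..1 - h1} = {}" using h by (auto simp: mesh_widths_def)
    then show ?thesis by (intro exI[of _ 0]) simp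
  qed
  then show "mesh_poly h0 h1 p v"
    using v q[OF mesh_subintervals(1)[OF h]] q[OF mesh_subintervals(2)[OF h]]
    unfolding mesh_poly_def FE_space_def H1_0_def by blast
  show "v 0 = 0" "v 1 = 0" using v unfolding FE_space_def H1_0_def by auto
qed

text \<open>Together with \<open>FE_space_mesh_poly\<close>: the finite element space consists of the piecewise polynomials
  with zero boundary values, as far as the unit interval is concerned.\<close>

lemma mesh_poly_FE_space:
  assumes h: "mesh_widths h0 h1" and v: "mesh_poly h0 h1 p v" "v 0 = 0" "v 1 = 0"
  shows "v \<in> FE_space {0, h0, 1 - h1, 1} p"
  using piecewise_C1_H1[OF mesh_poly_piecewise_C1[OF v(1) h]] v subintervals_mesh[OF h]
  unfolding FE_space_def H1_0_def mesh_poly_def by blast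

lemma continuous_glue:
  fixes f g :: "real \<Rightarrow> real"
  assumes "continuous_on {0..h} f" "continuous_on {h..1} g" "f h = g h" "0 \<le> h" "h \<le> 1"
  shows "continuous_on {0..1} (\<lambda>x. if x \<le> h then f x else g x)"
proof -
  have "continuous_on ({0..h} \<union> {h..1}) (\<lambda>x. if x \<le> h then f x else g x)"
    by (rule continuous_on_cases) (use assms in auto)
  moreover have "{0..h} \<union> {h..1} = {0..1}" using assms by auto
  ultimately show ?thesis by simp
qed

text \<open>Element by element; the exact values at the nodes make the pieces fit together continuously.\<close>

theorem smooth_approximation:
  fixes \<theta> r A :: real
  defines "W \<equiv> rhombus \<theta> r"
  assumes ok: "rhombus_ok \<theta> r" and A: "0 < A"
  shows "\<exists>C \<sigma>. 0 < C \<and> 0 < \<sigma> \<and> (\<forall>S h0 h1 p. S holomorphic_on W \<and> (\<forall>z\<in>W. cmod (S z) \<le> A) \<and> mesh_widths h0 h1 \<and> 1 \<le> p \<longrightarrow>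
     (\<exists>Z. mesh_poly h0 h1 p Z \<and> Z 0 = Re (S 0) \<and> Z 1 = Re (S 1) \<and>
       (\<forall>x\<in>I01 - {h0, 1 - h1}. \<bar>deriv (\<lambda>x. Re (S (of_real x))) x - deriv Z x\<bar> \<le> C * exp (- \<sigma> * real p)
          \<and> \<bar>Re (S (of_real x)) - Z x\<bar> \<le> C * exp (- \<sigma> * real p))))"
proof -
  obtain C \<sigma> where C: "0 < C" "0 < \<sigma>" and sp0: "\<forall>S a b p. S holomorphic_on W \<and> (\<forall>z\<in>W. cmod (S z) \<le> A) \<and> 0 \<le> a \<and> a < b \<and> b \<le> 1 \<and> 1 \<le> p \<longrightarrow>
     (\<exists>Q. degree Q \<le> p \<and> poly Q a = Re (S (of_real a)) \<and> poly Q b = Re (S (of_real b)) \<and>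
       (\<forall>x\<in>{a..b}. \<bar>deriv (\<lambda>x. Re (S (of_real x))) x - poly (pderiv Q) x\<bar> \<le> C * exp (- \<sigma> * real p)
          \<and> \<bar>Re (S (of_real x)) - poly Q x\<bar> \<le> C * exp (- \<sigma> * real p)))"
    using smooth_polynomial[OF ok A, folded W_def] by (elim exE conjE) (rule that)
  have "\<exists>Z. mesh_poly h0 h1 p Z \<and> Z 0 = Re (S 0) \<and> Z 1 = Re (S 1) \<and>
       (\<forall>x\<in>I01 - {h0, 1 - h1}. \<bar>deriv (\<lambda>x. Re (S (of_real x))) x - deriv Z x\<bar> \<le> C * exp (- \<sigma> * real p)
          \<and> \<bar>Re (S (of_real x)) - Z x\<bar> \<le> C * exp (- \<sigma> * real p))"
    if S: "S holomorphic_on W" "\<And>z. z \<in> W \<Longrightarrow> cmod (S z) \<le> A" and h: "mesh_widths h0 h1" and p: "1 \<le> p" for S h0 h1 p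
  proof -
    define e where "e = C * exp (- \<sigma> * real p)"
    define v where "v = (\<lambda>x. Re (S (of_real x)))"
    have ap: "\<exists>Q. degree Q \<le> p \<and> poly Q a = v a \<and> poly Q b = v b \<and>
       (\<forall>x\<in>{a..b}. \<bar>deriv v x - poly (pderiv Q) x\<bar> \<le> e \<and> \<bar>v x - poly Q x\<bar> \<le> e)" if "0 \<le> a" "a < b" "b \<le> 1" for a b
      unfolding v_def e_def by (rule sp0[rule_format]) (use S that p in simp)
    have good: "\<bar>deriv v x - deriv Z x\<bar> \<le> e \<and> \<bar>v x - Z x\<bar> \<le> e"
      if Q: "\<forall>x\<in>{a..b}. \<bar>deriv v x - poly (pderiv Q) x\<bar> \<le> e \<and> \<bar>v x - poly Q x\<bar> \<le> e"
        and Z: "\<And>y. y \<in> {a<..<b} \<Longrightarrow> Z y = poly Q y" and x: "x \<in> {a<..<b}" for Z Q a b x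
    proof -
      have "deriv Z x = poly (pderiv Q) x"
        by (rule DERIV_imp_deriv, rule local_poly_derivative[OF Z x])
      then show ?thesis using Q Z[OF x] x by auto
    qed
    have "\<exists>Z. mesh_poly h0 h1 p Z \<and> Z 0 = v 0 \<and> Z 1 = v 1 \<and>
       (\<forall>x\<in>I01 - {h0, 1 - h1}. \<bar>deriv v x - deriv Z x\<bar> \<le> e \<and> \<bar>v x - Z x\<bar> \<le> e)"
    proof (cases "h0 = 1")
      case True
      then have h1: "h1 = 1" using h by (auto simp: mesh_widths_def)
      obtain Q where Q: "degree Q \<le> p" "poly Q 0 = v 0" "poly Q 1 = v 1"
        "\<forall>x\<in>{0..1}. \<bar>deriv v x - poly (pderiv Q) x\<bar> \<le> e \<and> \<bar>v x - poly Q x\<bar> \<le> e" using ap[of 0 1] by auto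
      show ?thesis
      proof (intro exI[of _ "poly Q"] conjI ballI)
        show "mesh_poly h0 h1 p (poly Q)" unfolding mesh_poly_def using Q(1) by (auto intro!: continuous_intros)
      qed (use Q good[OF Q(4), of "poly Q"] in auto)
    next
      case False
      then have hh: "0 < h0" "h0 < 1 - h1" "0 < h1" "h1 < 1/2" "h0 < 1/2" using h by (auto simp: mesh_widths_def)
      obtain Q1 where Q1: "degree Q1 \<le> p" "poly Q1 0 = v 0" "poly Q1 h0 = v h0"
        "\<forall>x\<in>{0..h0}. \<bar>deriv v x - poly (pderiv Q1) x\<bar> \<le> e \<and> \<bar>v x - poly Q1 x\<bar> \<le> e" using ap[of 0 h0] hh by auto
      obtain Q2 where Q2: "degree Q2 \<le> p" "poly Q2 h0 = v h0" "poly Q2 (1 - h1) = v (1 - h1)"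
        "\<forall>x\<in>{h0..1 - h1}. \<bar>deriv v x - poly (pderiv Q2) x\<bar> \<le> e \<and> \<bar>v x - poly Q2 x\<bar> \<le> e" using ap[of h0 "1 - h1"] hh by auto
      obtain Q3 where Q3: "degree Q3 \<le> p" "poly Q3 (1 - h1) = v (1 - h1)" "poly Q3 1 = v 1"
        "\<forall>x\<in>{1 - h1..1}. \<bar>deriv v x - poly (pderiv Q3) x\<bar> \<le> e \<and> \<bar>v x - poly Q3 x\<bar> \<le> e" using ap[of "1 - h1" 1] hh by auto
      define Z where "Z x = (if x \<le> h0 then poly Q1 x else if x \<le> 1 - h1 then poly Q2 x else poly Q3 x)" for x
      have Z1: "Z x = poly Q1 x" if "x \<in> {0..h0}" for x using that by (simp add: Z_def)
      have Z2: "Z x = poly Q2 x" if "x \<in> {h0..1 - h1}" for x using that hh Q1 Q2 by (auto simp: Z_def)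
      have Z3: "Z x = poly Q3 x" if "x \<in> {1 - h1..1}" for x using that hh Q3 Q2 by (auto simp: Z_def)
      have "continuous_on {0..1} Z"
      proof -
        have "continuous_on {h0..1} (\<lambda>x. if x \<le> 1 - h1 then poly Q2 x else poly Q3 x)"
        proof -
          have "continuous_on ({h0..1 - h1} \<union> {1 - h1..1}) (\<lambda>x. if x \<le> 1 - h1 then poly Q2 x else poly Q3 x)"
            by (rule continuous_on_cases) (use Q2 Q3 in \<open>auto intro!: continuous_intros\<close>)
          moreover have "{h0..1 - h1} \<union> {1 - h1..1} = {h0..1}" using hh by auto
          ultimately show ?thesis by simp
        qed
        then show ?thesis unfolding Z_def[abs_def]
          by (intro continuous_glue) (use hh Q1 Q2 in \<open>auto intro!: continuous_intros\<close>)
      qed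
      then have mp: "mesh_poly h0 h1 p Z" unfolding mesh_poly_def using Z1 Z2 Z3 Q1(1) Q2(1) Q3(1) by blast
      have er: "\<bar>deriv v x - deriv Z x\<bar> \<le> e \<and> \<bar>v x - Z x\<bar> \<le> e" if x: "x \<in> I01 - {h0, 1 - h1}" for x
      proof -
        consider "x \<in> {0<..<h0}" | "x \<in> {h0<..<1 - h1}" | "x \<in> {1 - h1<..<1}" using x by fastforce
        then show ?thesis
        proof cases
          case 1 show ?thesis by (rule good[OF Q1(4) Z1 1]) auto
        next
          case 2 show ?thesis by (rule good[OF Q2(4) Z2 2]) auto
        next
          case 3 show ?thesis by (rule good[OF Q3(4) Z3 3]) auto
        qed
      qed
      have "Z 0 = v 0" "Z 1 = v 1" using Z1[of 0] Z3[of 1] Q1 Q3 hh by auto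
      then show ?thesis using mp er by blast
    qed
    then show ?thesis unfolding v_def e_def by simp
  qed
  then show ?thesis using C by blast
qed

section \<open>Uniform constants for the coefficients and the mesh\<close>

lemma clamp01_nearest:
  assumes "x \<in> {0..1}"
  shows "cmod (z - of_real (clamp01 z)) \<le> cmod (z - of_real x)"
proof -
  have "\<bar>Re z - clamp01 z\<bar> \<le> \<bar>Re z - x\<bar>" using assms by (auto simp: clamp01_def)
  then have "(Re z - clamp01 z)\<^sup>2 \<le> (Re z - x)\<^sup>2" by (simp add: abs_le_square_iff)
  then show ?thesis by (simp add: cmod_def)
qed

lemma nbhd01_mono: "\<delta> \<le> \<delta>' \<Longrightarrow> nbhd01 \<delta> \<subseteq> nbhd01 \<delta>'"
  by (auto simp: nbhd01_def)

lemma rhombus_distance: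
  assumes z: "z \<in> rhombus \<theta> r" and p: "0 < \<theta>" "0 < r"
  shows "cmod (z - of_real (clamp01 z)) \<le> r + \<theta> * (1/2 + r)"
proof -
  have "\<bar>Re (z - of_real (clamp01 z))\<bar> \<le> r" using rhombus_bounds[OF z p(1)] p by (auto simp: clamp01_def)
  moreover have "\<bar>Im (z - of_real (clamp01 z))\<bar> \<le> \<theta> * (1/2 + r)" using rhombus_bounds[OF z p(1)] by simp
  ultimately show ?thesis using cmod_le[of "z - of_real (clamp01 z)"] by linarith
qed

text \<open>On a sufficiently small neighbourhood the complex coefficients stay so close to their values at the nearest real point that
  they remain in a narrow sector and keep half of the lower bound. The rhombus is chosen inside it with a margin.\<close>

theorem analytic_coefficients_extend:
  assumes an: "real_analytic_on b {0..1}" "real_analytic_on c {0..1}" "real_analytic_on f {0..1}"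
    and pos: "0 < \<beta>" "0 < \<gamma>" and low: "\<And>x. x \<in> {0..1} \<Longrightarrow> \<beta> \<le> b x" "\<And>x. x \<in> {0..1} \<Longrightarrow> \<gamma> \<le> c x"
  shows "\<exists>B C F \<theta> r \<omega> K U. holomorphic_coefficients b c f \<beta> \<gamma> B C F \<theta> r \<omega> K U"
proof -
  obtain d1 B where B: "d1 > 0" "B holomorphic_on nbhd01 d1" "\<And>x. x \<in> {0..1} \<Longrightarrow> B (of_real x) = of_real (b x)"
    by (rule real_analytic_holomorphic_extension[OF an(1)]) (rule that)
  obtain d2 C where C: "d2 > 0" "C holomorphic_on nbhd01 d2" "\<And>x. x \<in> {0..1} \<Longrightarrow> C (of_real x) = of_real (c x)"
    by (rule real_analytic_holomorphic_extension[OF an(2)]) (rule that)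
  obtain d3 F where F: "d3 > 0" "F holomorphic_on nbhd01 d3" "\<And>x. x \<in> {0..1} \<Longrightarrow> F (of_real x) = of_real (f x)"
    by (rule real_analytic_holomorphic_extension[OF an(3)]) (rule that)
  define d where "d = min d1 (min d2 d3)"
  have d: "0 < d" "d \<le> d1" "d \<le> d2" "d \<le> d3" using B C F by (auto simp: d_def)
  have hol: "B holomorphic_on nbhd01 d" "C holomorphic_on nbhd01 d" "F holomorphic_on nbhd01 d"
    using B(2) C(2) F(2) nbhd01_mono d by (meson holomorphic_on_subset)+
  define N where "N = {z. cmod (z - of_real (clamp01 z)) \<le> d / 2}"
  have Nd: "N \<subseteq> nbhd01 d" using d by (auto simp: N_def nbhd01_def)
  have "compact N"
  proof (rule compact_eq_bounded_closed[THEN iffD2], intro conjI)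
    show "closed N" unfolding N_def clamp01_def by (intro closed_Collect_le continuous_intros)
    have "cmod z \<le> 1 + d / 2" if "z \<in> N" for z
    proof -
      have "cmod z \<le> cmod (z - of_real (clamp01 z)) + cmod (of_real (clamp01 z))"
        using norm_triangle_ineq[of "z - of_real (clamp01 z)" "of_real (clamp01 z)"] by simp
      moreover have "cmod (of_real (clamp01 z)) \<le> 1" using clamp01_in[of z] by simp
      ultimately show ?thesis using that unfolding N_def by simp
    qed
    then show "bounded N" by (rule boundedI)
  qed
  have cont: "continuous_on N B" "continuous_on N C" "continuous_on N F"
    using hol Nd by (meson holomorphic_on_imp_continuous_on holomorphic_on_subset)+
  have bd: "\<exists>k. \<forall>z\<in>N. cmod (g z) \<le> k" if "continuous_on N g" for g
  proof -
    have "bounded (g ` N)" using that \<open>compact N\<close> by (intro compact_imp_bounded compact_continuous_image)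
    then show ?thesis unfolding bounded_iff by auto
  qed
  obtain k1 where k1: "\<forall>z\<in>N. cmod (B z) \<le> k1" using bd[OF cont(1)] ..
  obtain k2 where k2: "\<forall>z\<in>N. cmod (C z) \<le> k2" using bd[OF cont(2)] ..
  obtain k3 where k3: "\<forall>z\<in>N. cmod (F z) \<le> k3" using bd[OF cont(3)] ..
  note k = k1[rule_format] k2[rule_format] k3[rule_format]
  define K where "K = max 1 (max k1 (max k2 k3))"
  have K: "0 < K" "k1 \<le> K" "k2 \<le> K" "k3 \<le> K" by (auto simp: K_def)
  have uc: "\<exists>e>0. \<forall>z\<in>N. \<forall>w\<in>N. cmod (z - w) < e \<longrightarrow> cmod (g z - g w) < t" if "continuous_on N g" "0 < t" for g and t :: real
    using compact_uniformly_continuous[OF that(1) \<open>compact N\<close>] that(2) unfolding uniformly_continuous_on_def dist_norm by blast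
  obtain e1 where e1: "0 < e1" "\<And>z w. z \<in> N \<Longrightarrow> w \<in> N \<Longrightarrow> cmod (z - w) < e1 \<Longrightarrow> cmod (B z - B w) < \<beta> / 40"
    using uc[OF cont(1), of "\<beta> / 40"] pos by auto
  obtain e2 where e2: "0 < e2" "\<And>z w. z \<in> N \<Longrightarrow> w \<in> N \<Longrightarrow> cmod (z - w) < e2 \<Longrightarrow> cmod (C z - C w) < \<gamma> / 40"
    using uc[OF cont(2), of "\<gamma> / 40"] pos by auto
  define \<delta> where "\<delta> = min (min 1 (d / 2)) (min e1 e2)"
  have \<delta>: "0 < \<delta>" "\<delta> \<le> 1" "\<delta> \<le> d / 2" "\<delta> \<le> e1" "\<delta> \<le> e2" using d e1 e2 by (auto simp: \<delta>_def)
  define U where "U = nbhd01 \<delta>"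
  have UN: "z \<in> N" if "z \<in> U" for z using that \<delta> by (auto simp: U_def N_def nbhd01_def)
  have xN: "of_real (clamp01 z) \<in> N" for z
    using d clamp01_of_real[OF clamp01_in[of z]] by (simp add: N_def)
  have sector_of: "sector (1/20) w \<and> t / 2 \<le> Re w" if "cmod (w - of_real x) < t / 40" "t \<le> x" "0 < t" for w x t
  proof -
    have "\<bar>Re w - x\<bar> < t / 40" "\<bar>Im w\<bar> < t / 40"
      using that(1) abs_Re_le_cmod[of "w - of_real x"] abs_Im_le_cmod[of "w - of_real x"] by simp_all
    then have "t / 2 \<le> Re w" "\<bar>Im w\<bar> \<le> 1/20 * Re w" using that(2,3) by linarith+
    then show ?thesis by (simp add: sector_def)
  qed
  have near: "cmod (z - of_real (clamp01 z)) < \<delta>" if "z \<in> U" for z using that by (simp add: U_def nbhd01_def)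
  have sB: "sector (1/20) (B z) \<and> \<beta> / 2 \<le> Re (B z)" if "z \<in> U" for z
    by (rule sector_of[of _ "b (clamp01 z)"])
      (use e1(2)[OF UN[OF that] xN, of z] near[OF that] \<delta> B(3)[OF clamp01_in[of z]] low(1)[OF clamp01_in[of z]] pos in auto)
  have sC: "sector (1/20) (C z) \<and> \<gamma> / 2 \<le> Re (C z)" if "z \<in> U" for z
    by (rule sector_of[of _ "c (clamp01 z)"])
      (use e2(2)[OF UN[OF that] xN, of z] near[OF that] \<delta> C(3)[OF clamp01_in[of z]] low(2)[OF clamp01_in[of z]] pos in auto)
  have Ud: "U \<subseteq> nbhd01 d" unfolding U_def using \<delta> d by (intro nbhd01_mono) auto
  define q where "q = \<delta> / 4"
  have q: "0 < q" "q \<le> 1/4" "4 * q = \<delta>" using \<delta> by (auto simp: q_def)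
  have cb: "cball z q \<subseteq> U" if z: "z \<in> rhombus q q" for z
  proof
    fix w assume "w \<in> cball z q"
    then have w: "cmod (w - z) \<le> q" by (simp add: dist_norm norm_minus_commute)
    have "cmod (w - of_real (clamp01 w)) \<le> cmod (w - of_real (clamp01 z))" by (rule clamp01_nearest[OF clamp01_in])
    also have "\<dots> \<le> cmod (w - z) + cmod (z - of_real (clamp01 z))"
      by (metis diff_add_cancel add_diff_eq norm_triangle_ineq)
    also have "\<dots> \<le> q + (q + q * (1/2 + q))" using w rhombus_distance[OF z q(1) q(1)] by linarith
    also have "\<dots> \<le> q + (q + q * 1)" using q by (intro add_mono mult_left_mono) auto
    also have "\<dots> < \<delta>" using q by simp
    finally show "w \<in> U" by (simp add: U_def nbhd01_def)
  qed
  have "holomorphic_coefficients b c f \<beta> \<gamma> B C F q q q K U"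
  proof
    show "rhombus_ok q q" using q by (simp add: rhombus_ok_def)
    show "open U" by (simp add: U_def open_nbhd01)
    show "B holomorphic_on U" "C holomorphic_on U" "F holomorphic_on U" using hol Ud by (meson holomorphic_on_subset)+
    fix z assume z: "z \<in> U"
    show "cmod (B z) \<le> K" "cmod (C z) \<le> K" "cmod (F z) \<le> K" using k[OF UN[OF z]] K by linarith+
    show "sector (1/20) (B z)" "\<beta> / 2 \<le> Re (B z)" "sector (1/20) (C z)" "\<gamma> / 2 \<le> Re (C z)" using sB[OF z] sC[OF z] by auto
  qed (use q K pos cb B C F in auto)
  then show ?thesis by blast
qed

context holomorphic_coefficients
begin

text \<open>On the real axis the complex roots \<open>slow\<close> and \<open>fast\<close> are real and are the roots in the definition of the mesh,
  so the bounds already proved for them apply.\<close>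

lemma layer_rates:
  assumes eps: "0 < \<epsilon>1" "\<epsilon>1 < \<epsilon>2" "\<epsilon>2 \<le> 1"
  defines "sc \<equiv> scale \<epsilon>1 \<epsilon>2"
  shows "c2 / sc \<le> mu0 \<epsilon>1 \<epsilon>2 b c" "mu0 \<epsilon>1 \<epsilon>2 b c \<le> 2 * K / c1 / sc"
    "c1 * (sc / \<epsilon>1) / 2 \<le> mu1 \<epsilon>1 \<epsilon>2 b c" "mu1 \<epsilon>1 \<epsilon>2 b c \<le> (K + 1) * (sc / \<epsilon>1)"
proof -
  have L: "lambda0 \<epsilon>1 \<epsilon>2 b c x = - Re (slow \<epsilon>1 \<epsilon>2 (of_real x)) \<and> lambda1 \<epsilon>1 \<epsilon>2 b c x = Re (fast \<epsilon>1 \<epsilon>2 (of_real x))"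
    if x: "x \<in> {0..1}" for x
  proof -
    have zU: "of_real x \<in> U" by (rule W_U[OF real_in_W[OF x]])
    define m n where "m = Re (slow \<epsilon>1 \<epsilon>2 (of_real x))" and "n = Re (fast \<epsilon>1 \<epsilon>2 (of_real x))"
    have dr: "disc \<epsilon>1 \<epsilon>2 (of_real x) = of_real (\<epsilon>2\<^sup>2 * (b x)\<^sup>2 + 4 * \<epsilon>1 * c x)"
      unfolding disc_def[OF eps] by (simp add: real[OF x])
    have "0 \<le> \<epsilon>2\<^sup>2 * (b x)\<^sup>2 + 4 * \<epsilon>1 * c x" using c_pos[OF x] eps by simp
    then have rr: "droot \<epsilon>1 \<epsilon>2 (of_real x) = of_real (sqrt (\<epsilon>2\<^sup>2 * (b x)\<^sup>2 + 4 * \<epsilon>1 * c x))"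
      unfolding droot_def[OF eps] dr by (rule of_real_sqrt[symmetric])
    have sm: "slow \<epsilon>1 \<epsilon>2 (of_real x) = of_real m"
      unfolding m_def slow_def[OF eps] rr real[OF x] by (simp add: complex_eq_iff)
    have fn: "fast \<epsilon>1 \<epsilon>2 (of_real x) = of_real n"
      unfolding n_def fast_def[OF eps] rr real[OF x] by (simp add: complex_eq_iff)
    note ch = characteristic[OF eps zU, unfolded sm fn real[OF x]]
    have "complex_of_real (m\<^sup>2 + \<epsilon>2 / \<epsilon>1 * b x * m - c x / \<epsilon>1) = of_real 0" using ch(1) by simp
    then have 1: "m\<^sup>2 + \<epsilon>2 / \<epsilon>1 * b x * m - c x / \<epsilon>1 = 0" by (simp only: of_real_eq_iff)
    have "complex_of_real n = of_real (m + \<epsilon>2 / \<epsilon>1 * b x)" using ch(3) by simp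
    then have 2: "n = m + \<epsilon>2 / \<epsilon>1 * b x" by (simp only: of_real_eq_iff)
    have e2: "\<epsilon>2 * b x = \<epsilon>1 * (n - m)" unfolding 2 using eps by simp
    have e3: "c x = \<epsilon>1 * (m * n)" using 1 unfolding 2 using eps by (simp add: field_simps power2_eq_square)
    have m0: "0 < m"
    proof -
      have "0 < c2 / scale \<epsilon>1 \<epsilon>2" using c2_pos scale_bounds[OF eps] by simp
      then show ?thesis using slow_props(2)[OF eps zU] unfolding m_def by linarith
    qed
    have n0: "0 < n"
    proof -
      have "0 < c1 * (scale \<epsilon>1 \<epsilon>2 / \<epsilon>1) / 2" using c1_pos scale_bounds[OF eps] eps by simp
      then show ?thesis using fast_props(2)[OF eps zU] unfolding n_def by linarith
    qed
    have char: "char_eq \<epsilon>1 \<epsilon>2 b c x l \<longleftrightarrow> l = - m \<or> l = n" for l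
    proof -
      have "- \<epsilon>1 * l\<^sup>2 + \<epsilon>2 * b x * l + c x = - \<epsilon>1 * ((l + m) * (l - n))"
        unfolding e2 e3 by (simp add: power2_eq_square algebra_simps)
      then show ?thesis using eps unfolding char_eq_def by (auto simp: add_eq_0_iff2)
    qed
    have "lambda0 \<epsilon>1 \<epsilon>2 b c x = - m" unfolding lambda0_def char by (rule the_equality) (use m0 n0 in auto)
    moreover have "lambda1 \<epsilon>1 \<epsilon>2 b c x = n" unfolding lambda1_def char by (rule the_equality) (use m0 n0 in auto)
    ultimately show ?thesis by (simp add: m_def n_def)
  qed
  have zU: "of_real x \<in> U" if "x \<in> {0..1}" for x using W_U[OF real_in_W[OF that]] .
  have l0: "lambda0 \<epsilon>1 \<epsilon>2 b c x \<le> - (c2 / sc)" "- (2 * K / c1 / sc) \<le> lambda0 \<epsilon>1 \<epsilon>2 b c x" if "x \<in> {0..1}" for x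
    using L[OF that] slow_props(2,3)[OF eps zU[OF that]] complex_Re_le_cmod[of "slow \<epsilon>1 \<epsilon>2 (of_real x)"]
    unfolding sc_def by linarith+
  have l1: "c1 * (sc / \<epsilon>1) / 2 \<le> lambda1 \<epsilon>1 \<epsilon>2 b c x" "lambda1 \<epsilon>1 \<epsilon>2 b c x \<le> (K + 1) * (sc / \<epsilon>1)" if "x \<in> {0..1}" for x
    using L[OF that] fast_props(2,3)[OF eps zU[OF that]] complex_Re_le_cmod[of "fast \<epsilon>1 \<epsilon>2 (of_real x)"]
    unfolding sc_def by linarith+
  have z: "(0::real) \<in> {0..1}" by simp
  have "(SUP x\<in>{0..1}. lambda0 \<epsilon>1 \<epsilon>2 b c x) \<le> - (c2 / sc)" by (rule cSUP_least) (use l0 in auto)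
  then show "c2 / sc \<le> mu0 \<epsilon>1 \<epsilon>2 b c" by (simp add: mu0_def)
  have "bdd_above (lambda0 \<epsilon>1 \<epsilon>2 b c ` {0..1})" using l0(1) by (intro bdd_aboveI2)
  then have "lambda0 \<epsilon>1 \<epsilon>2 b c 0 \<le> (SUP x\<in>{0..1}. lambda0 \<epsilon>1 \<epsilon>2 b c x)" by (rule cSUP_upper[OF z])
  then show "mu0 \<epsilon>1 \<epsilon>2 b c \<le> 2 * K / c1 / sc" using l0(2)[OF z] unfolding mu0_def by linarith
  show "c1 * (sc / \<epsilon>1) / 2 \<le> mu1 \<epsilon>1 \<epsilon>2 b c" unfolding mu1_def by (rule cINF_greatest) (use l1 in auto)
  have "bdd_below (lambda1 \<epsilon>1 \<epsilon>2 b c ` {0..1})" using l1(1) by (intro bdd_belowI2)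
  then have "(INF x\<in>{0..1}. lambda1 \<epsilon>1 \<epsilon>2 b c x) \<le> lambda1 \<epsilon>1 \<epsilon>2 b c 0" by (rule cINF_lower[OF _ z])
  then show "mu1 \<epsilon>1 \<epsilon>2 b c \<le> (K + 1) * (sc / \<epsilon>1)" using l1(2)[OF z] unfolding mu1_def by linarith
qed

text \<open>The two inequalities for each layer say that \<open>\<mu> h\<close> is comparable to \<open>p\<close>, except that on the one-element
  mesh only the upper bound holds. There it extends from the right layer to the left one, because the rate \<open>1 / s\<close> of the latter is at most a
  constant multiple of \<open>s / \<epsilon>1\<close>.\<close>

theorem SBL_mesh_widths:
  assumes \<kappa>: "0 < \<kappa>"
  shows "\<exists>K1 K2. 0 < K1 \<and> 0 < K2 \<and> (\<forall>\<epsilon>1 \<epsilon>2 p \<Delta>. 0 < \<epsilon>1 \<and> \<epsilon>1 < \<epsilon>2 \<and> \<epsilon>2 \<le> 1 \<and> 1 \<le> p \<and> SBL_mesh \<epsilon>1 \<epsilon>2 b c \<kappa> p = Some \<Delta> \<longrightarrow>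
    (\<exists>h0 h1. mesh_widths h0 h1 \<and> \<Delta> = {0, h0, 1 - h1, 1} \<and>
       1 / scale \<epsilon>1 \<epsilon>2 * h0 \<le> K2 * real p \<and> scale \<epsilon>1 \<epsilon>2 / \<epsilon>1 * h1 \<le> K2 * real p \<and>
       (h0 = 1 \<or> K1 * real p \<le> 1 / scale \<epsilon>1 \<epsilon>2 * h0) \<and> (h1 = 1 \<or> K1 * real p \<le> scale \<epsilon>1 \<epsilon>2 / \<epsilon>1 * h1)))"
proof -
  define k1 where "k1 = min c2 (c1 / 2)"
  define k2 where "k2 = max (2 * K / c1) (K + 1)"
  have k: "0 < k1" "0 < k2" using c1_pos c2_pos K by (auto simp: k1_def k2_def less_max_iff_disj)
  have main: "\<exists>h0 h1. mesh_widths h0 h1 \<and> \<Delta> = {0, h0, 1 - h1, 1} \<and>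
       1 / scale \<epsilon>1 \<epsilon>2 * h0 \<le> (2 * \<kappa> / k1) * real p \<and> scale \<epsilon>1 \<epsilon>2 / \<epsilon>1 * h1 \<le> (2 * \<kappa> / k1) * real p \<and>
       (h0 = 1 \<or> (\<kappa> / k2) * real p \<le> 1 / scale \<epsilon>1 \<epsilon>2 * h0) \<and> (h1 = 1 \<or> (\<kappa> / k2) * real p \<le> scale \<epsilon>1 \<epsilon>2 / \<epsilon>1 * h1)"
    if eps: "0 < \<epsilon>1" "\<epsilon>1 < \<epsilon>2" "\<epsilon>2 \<le> 1" and p: "1 \<le> p" and mesh: "SBL_mesh \<epsilon>1 \<epsilon>2 b c \<kappa> p = Some \<Delta>" for \<epsilon>1 \<epsilon>2 p \<Delta>
  proof -
    define a0 a1 where "a0 = 1 / scale \<epsilon>1 \<epsilon>2" and "a1 = scale \<epsilon>1 \<epsilon>2 / \<epsilon>1"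
    note sb = scale_bounds[OF eps]
    have a: "0 < a0" "0 < a1" "a0 \<le> a1"
      using sb eps by (auto simp: a0_def a1_def field_simps power2_eq_square)
    define m0 m1 where "m0 = mu0 \<epsilon>1 \<epsilon>2 b c" and "m1 = mu1 \<epsilon>1 \<epsilon>2 b c"
    have "k1 * a0 \<le> c2 * a0" "2 * K / c1 * a0 \<le> k2 * a0" "k1 * a1 \<le> c1 / 2 * a1" "(K + 1) * a1 \<le> k2 * a1"
      unfolding k1_def k2_def using a by (simp_all only: mult_right_mono less_imp_le min.cobounded1 min.cobounded2 max.cobounded1 max.cobounded2)
    then have m: "k1 * a0 \<le> m0" "m0 \<le> k2 * a0" "k1 * a1 \<le> m1" "m1 \<le> k2 * a1"
      using layer_rates[OF eps] by (auto simp: a0_def a1_def m0_def m1_def)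
    have k1a: "0 < k1 * a0" "0 < k1 * a1" using k a by auto
    then have mp: "0 < m0" "0 < m1" using m by linarith+
    have pp: "0 < real p" using p by simp
    show ?thesis
    proof (cases "\<kappa> * real p * inverse m1 \<ge> 1 / 2")
      case True
      then have "\<Delta> = {0, 1}" using mesh by (simp add: SBL_mesh_def m1_def)
      moreover have "m1 \<le> 2 * \<kappa> * real p" using True mp by (simp add: field_simps)
      then have "k1 * a1 \<le> 2 * \<kappa> * real p" using m by linarith
      then have "a1 \<le> 2 * \<kappa> / k1 * real p" using k by (simp add: field_simps)
      ultimately show ?thesis using a unfolding a0_def[symmetric] a1_def[symmetric]
        by (intro exI[of _ 1]) (auto simp: mesh_widths_def)
    next
      case False
      define h0 h1 where "h0 = \<kappa> * real p * inverse m0" and "h1 = \<kappa> * real p * inverse m1"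
      have D: "h0 < 1/2" "\<Delta> = {0, h0, 1 - h1, 1}" using mesh False by (auto simp: SBL_mesh_def m1_def m0_def h0_def h1_def split: if_splits)
      have h: "0 < h0" "0 < h1" "h1 < 1/2" using \<kappa> pp mp False by (auto simp: h0_def h1_def)
      have w: "a * (\<kappa> * real p * inverse m) \<le> (2 * \<kappa> / k1) * real p \<and> (\<kappa> / k2) * real p \<le> a * (\<kappa> * real p * inverse m)"
        if "0 < a" "k1 * a \<le> m" "m \<le> k2 * a" for a m
      proof -
        have "0 < k1 * a" using k that by simp
        then have m0: "0 < m" using that by linarith
        have "a / m \<le> 1 / k1" "1 / k2 \<le> a / m" using that k m0 by (auto simp: field_simps)
        then have "\<kappa> * real p * (a / m) \<le> \<kappa> * real p * (1 / k1)" "\<kappa> * real p * (1 / k2) \<le> \<kappa> * real p * (a / m)"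
          using \<kappa> pp by (intro mult_left_mono; simp)+
        moreover have "\<kappa> * real p * (1 / k1) \<le> 2 * (\<kappa> * real p * (1 / k1))"
        proof -
          have "0 \<le> \<kappa> * real p * (1 / k1)" using \<kappa> k by simp
          then show ?thesis by linarith
        qed
        ultimately show ?thesis by (simp add: divide_inverse mult_ac)
      qed
      show ?thesis
        unfolding a0_def[symmetric] a1_def[symmetric]
        by (rule exI[of _ h0], rule exI[of _ h1]) (use D h w[OF a(1) m(1,2)] w[OF a(2) m(3,4)] in \<open>auto simp: mesh_widths_def h0_def[symmetric] h1_def[symmetric]\<close>)
    qed
  qed
  show ?thesis
    by (rule exI[of _ "\<kappa> / k2"], rule exI[of _ "2 * \<kappa> / k1"]) (use main \<kappa> k in simp)
qed

end

section \<open>Layers on the whole interval\<close>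

text \<open>If \<open>h = 1\<close>, \<open>layer_polynomial\<close> suffices. Otherwise, on \<open>[0,h]\<close> its polynomial is changed by a linear function to vanish at \<open>h\<close>; there the layer has size
  \<open>exp (- c K1 p)\<close>, so the change is harmless. On \<open>[h,1]\<close> a linear function with the correct value at \<open>1\<close> is enough. The weight
  \<open>exp (- \<omega> \<mu> x)\<close> is inserted on \<open>[0,h]\<close> at the expense of part of the rate \<open>\<sigma>\<close>, because
  \<open>\<mu> x \<le> K2 p\<close> there, and on \<open>[h,1]\<close> it comes from the decay of the layer itself.\<close>

theorem layer_approximation:
  fixes \<theta> r c A K1 K2 :: real
  defines "W \<equiv> rhombus \<theta> r"
  assumes ok: "rhombus_ok \<theta> r" and cA: "0 < c" "c \<le> A" and K: "0 < K1" "0 < K2"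
  shows "\<exists>C \<sigma> \<omega>. 0 < C \<and> 0 < \<sigma> \<and> 0 < \<omega> \<and> (\<forall>M \<mu> h p \<alpha>. layer_phase W c A \<mu> M \<and> 1/2 \<le> \<mu> \<and> \<mu> * h \<le> K2 * real p
      \<and> 1 \<le> p \<and> cmod \<alpha> \<le> A \<and> (h = 1 \<or> 0 < h \<and> h \<le> 1/2 \<and> K1 * real p \<le> \<mu> * h) \<longrightarrow>
     (\<exists>Z. continuous_on {0..1} Z \<and> Z 0 = Re (\<alpha> * exp (- M 0)) \<and> Z 1 = Re (\<alpha> * exp (- M 1)) \<and>
       (\<exists>q. degree q \<le> p \<and> (\<forall>x\<in>{0..h}. Z x = poly q x)) \<and> (\<exists>q. degree q \<le> p \<and> (\<forall>x\<in>{h..1}. Z x = poly q x)) \<and>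
       (\<forall>x\<in>I01 - {h}. \<bar>deriv (\<lambda>x. Re (\<alpha> * exp (- M (of_real x)))) x - deriv Z x\<bar> \<le> C * \<mu> * exp (- \<sigma> * real p) * exp (- \<omega> * \<mu> * x)
          \<and> \<bar>Re (\<alpha> * exp (- M (of_real x))) - Z x\<bar> \<le> C * exp (- \<sigma> * real p) * exp (- \<omega> * \<mu> * x))))"
proof -
  obtain C0 \<sigma>0 where C0: "0 < C0" "0 < \<sigma>0" and lp: "\<forall>M \<mu> h p \<alpha>. layer_phase W c A \<mu> M \<and> 0 < \<mu> \<and> 0 < h \<and> h \<le> 1 \<and> \<mu> * h \<le> K2 * real p
      \<and> 1 \<le> p \<and> cmod \<alpha> \<le> A \<longrightarrow>
     (\<exists>Q. degree Q \<le> p \<and> poly Q 0 = Re (\<alpha> * exp (- M 0)) \<and> poly Q h = Re (\<alpha> * exp (- M (of_real h))) \<and>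
       (\<forall>x\<in>{0..h}. \<bar>deriv (\<lambda>x. Re (\<alpha> * exp (- M (of_real x)))) x - poly (pderiv Q) x\<bar> \<le> C0 * \<mu> * exp (- \<sigma>0 * real p)
          \<and> \<bar>Re (\<alpha> * exp (- M (of_real x))) - poly Q x\<bar> \<le> C0 * exp (- \<sigma>0 * real p)))"
    using layer_polynomial[OF ok cA K(2), folded W_def] by (elim exE conjE) (rule that)
  have ok': "0 < \<theta>" "\<theta> \<le> 1/2" "0 < r" using ok by (auto simp: rhombus_ok_def)
  have A0: "0 < A" using cA by linarith
  \<comment> \<open>one half of each available rate is spent on the weight \<open>exp (- \<omega> \<mu> x)\<close>\<close>
  define \<sigma> where "\<sigma> = min \<sigma>0 (c * K1) / 2"
  define \<omega> where "\<omega> = min (\<sigma> / K2) (c / 2)"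
  define C where "C = C0 + A + A / K1 + A * A + 4 * A"
  have s: "0 < \<sigma>" "2 * \<sigma> \<le> \<sigma>0" "2 * \<sigma> \<le> c * K1" using C0 cA K by (auto simp: \<sigma>_def)
  have o: "0 < \<omega>" "\<omega> * K2 \<le> \<sigma>" "\<omega> \<le> c / 2"
  proof -
    show "0 < \<omega>" using s K cA by (auto simp: \<omega>_def)
    show "\<omega> \<le> c / 2" unfolding \<omega>_def by (rule min.cobounded2)
    have "\<omega> * K2 \<le> \<sigma> / K2 * K2" using K by (intro mult_right_mono) (auto simp: \<omega>_def)
    then show "\<omega> * K2 \<le> \<sigma>" using K by simp
  qed
  have Cp: "0 < C" "C0 + A \<le> C" "C0 + A / K1 \<le> C" "A * A + 4 * A \<le> C" "A + A \<le> C"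
  proof -
    have "0 < A / K1" "0 < A * A" using A0 K by (auto simp: zero_less_mult_iff)
    then show "0 < C" "C0 + A \<le> C" "C0 + A / K1 \<le> C" "A * A + 4 * A \<le> C" "A + A \<le> C"
      using C0 A0 unfolding C_def by linarith+
  qed
  have W: "convex W" "open W" "0 \<in> W" "\<And>x. x \<in> {0..1} \<Longrightarrow> complex_of_real x \<in> W"
    using rhombus_contains[of 0 0 \<theta> r] rhombus_contains[of _ "complex_of_real _" \<theta> r] ok'
    by (auto simp: W_def convex_rhombus open_rhombus)
  have main: "\<exists>Z. continuous_on {0..1} Z \<and> Z 0 = v 0 \<and> Z 1 = v 1 \<and>
       (\<exists>q. degree q \<le> p \<and> (\<forall>x\<in>{0..h}. Z x = poly q x)) \<and> (\<exists>q. degree q \<le> p \<and> (\<forall>x\<in>{h..1}. Z x = poly q x)) \<and>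
       (\<forall>x\<in>I01 - {h}. \<bar>deriv v x - deriv Z x\<bar> \<le> C * \<mu> * exp (- \<sigma> * real p) * exp (- \<omega> * \<mu> * x)
          \<and> \<bar>v x - Z x\<bar> \<le> C * exp (- \<sigma> * real p) * exp (- \<omega> * \<mu> * x))"
    if M: "layer_phase W c A \<mu> M" and \<mu>: "1/2 \<le> \<mu>" and \<mu>h: "\<mu> * h \<le> K2 * real p" and p: "1 \<le> p" and \<alpha>: "cmod \<alpha> \<le> A"
      and h: "h = 1 \<or> 0 < h \<and> h \<le> 1/2 \<and> K1 * real p \<le> \<mu> * h" and v: "v = (\<lambda>x. Re (\<alpha> * exp (- M (of_real x))))" for M \<mu> h p \<alpha> v
  proof -
    have \<mu>0: "0 < \<mu>" using \<mu> by linarith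
    have h01: "0 < h" "h \<le> 1" using h by auto
    have c\<mu>: "0 \<le> c * \<mu>" "c * \<mu> \<le> A * \<mu>" using cA \<mu>0 by (auto intro: mult_right_mono)
    obtain m where m: "\<And>z. z \<in> W \<Longrightarrow> (M has_field_derivative m z) (at z)" "\<And>z. z \<in> W \<Longrightarrow> cmod (m z) \<le> A * \<mu>"
      using M unfolding layer_phase_def by blast
    have dec: "cmod (exp (- M (of_real x))) \<le> exp (- (c * \<mu> * x))" if "x \<in> {0..1}" for x
      by (rule layer_decay[OF W(1-3) W(4)[OF that] M c\<mu>]) (use that in auto)
    have vb: "\<bar>v x\<bar> \<le> A * exp (- (c * \<mu> * x))" if x: "x \<in> {0..1}" for x
    proof -
      have "\<bar>v x\<bar> \<le> cmod (\<alpha> * exp (- M (of_real x)))" unfolding v by (rule abs_Re_le_cmod)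
      also have "\<dots> \<le> A * exp (- (c * \<mu> * x))" unfolding norm_mult using \<alpha> dec[OF x] A0 by (intro mult_mono) auto
      finally show ?thesis .
    qed
    have vd: "\<bar>deriv v x\<bar> \<le> A * A * \<mu> * exp (- (c * \<mu> * x))" if x: "x \<in> {0..1}" for x
    proof -
      have "((\<lambda>z. \<alpha> * exp (- M z)) has_field_derivative \<alpha> * (- m (of_real x) * exp (- M (of_real x)))) (at (of_real x))"
        using DERIV_cmult[OF DERIV_fun_exp[OF DERIV_minus[OF m(1)[OF W(4)[OF x]]]], of \<alpha>] by (simp add: mult_ac)
      then have "(v has_real_derivative Re (\<alpha> * (- m (of_real x) * exp (- M (of_real x))))) (at x)" unfolding v by (rule cx_deriv_real)
      then have "deriv v x = Re (\<alpha> * (- m (of_real x) * exp (- M (of_real x))))" by (rule DERIV_imp_deriv)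
      then have "\<bar>deriv v x\<bar> \<le> cmod (\<alpha> * (- m (of_real x) * exp (- M (of_real x))))" by (simp only: abs_Re_le_cmod)
      also have "\<dots> = cmod \<alpha> * (cmod (m (of_real x)) * cmod (exp (- M (of_real x))))" by (simp only: norm_mult norm_minus_cancel)
      also have "\<dots> \<le> A * (A * \<mu> * exp (- (c * \<mu> * x)))" using \<alpha> dec[OF x] m(2)[OF W(4)[OF x]] A0 \<mu>0 by (intro mult_mono) auto
      finally show ?thesis by (simp add: mult_ac)
    qed
    define X where "X x = exp (- \<sigma> * real p) * exp (- \<omega> * \<mu> * x)" for x
    have X0: "0 < X x" for x by (simp add: X_def)
    have near: "exp (- \<sigma>0 * real p) \<le> X x" "exp (- (c * (K1 * real p))) \<le> X x" if x: "x \<in> {0..h}" for x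
    proof -
      have "\<omega> * \<mu> * x \<le> \<omega> * (\<mu> * h)" using o \<mu>0 x by (simp add: mult.assoc mult_left_mono)
      also have "\<dots> \<le> \<omega> * (K2 * real p)" using o \<mu>h by (intro mult_left_mono) auto
      also have "\<dots> \<le> \<sigma> * real p" using mult_right_mono[OF o(2), of "real p"] by (simp add: mult.assoc)
      finally have 1: "\<omega> * \<mu> * x \<le> \<sigma> * real p" .
      have "2 * \<sigma> * real p \<le> \<sigma>0 * real p" "2 * \<sigma> * real p \<le> c * K1 * real p" using s by (auto intro: mult_right_mono)
      then have "\<sigma> * real p + \<omega> * \<mu> * x \<le> \<sigma>0 * real p" "\<sigma> * real p + \<omega> * \<mu> * x \<le> c * (K1 * real p)" using 1 by (simp_all add: mult.assoc)
      then show "exp (- \<sigma>0 * real p) \<le> X x" "exp (- (c * (K1 * real p))) \<le> X x" unfolding X_def exp_add[symmetric] by simp_all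
    qed
    obtain Q where Q: "degree Q \<le> p" "poly Q 0 = v 0" "poly Q h = v h"
      "\<And>x. x \<in> {0..h} \<Longrightarrow> \<bar>deriv v x - poly (pderiv Q) x\<bar> \<le> C0 * \<mu> * exp (- \<sigma>0 * real p) \<and> \<bar>v x - poly Q x\<bar> \<le> C0 * exp (- \<sigma>0 * real p)"
    proof -
      have "\<exists>Q. degree Q \<le> p \<and> poly Q 0 = Re (\<alpha> * exp (- M 0)) \<and> poly Q h = Re (\<alpha> * exp (- M (of_real h))) \<and>
       (\<forall>x\<in>{0..h}. \<bar>deriv (\<lambda>x. Re (\<alpha> * exp (- M (of_real x)))) x - poly (pderiv Q) x\<bar> \<le> C0 * \<mu> * exp (- \<sigma>0 * real p)
          \<and> \<bar>Re (\<alpha> * exp (- M (of_real x))) - poly Q x\<bar> \<le> C0 * exp (- \<sigma>0 * real p))"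
        by (rule lp[rule_format]) (use M \<mu>0 h01 \<mu>h p \<alpha> in simp)
      then show ?thesis using that unfolding v by auto
    qed
    have Qe: "\<bar>deriv v x - poly (pderiv Q) x\<bar> \<le> C0 * \<mu> * X x" "\<bar>v x - poly Q x\<bar> \<le> C0 * X x" if x: "x \<in> {0..h}" for x
    proof -
      have "C0 * \<mu> * exp (- \<sigma>0 * real p) \<le> C0 * \<mu> * X x" "C0 * exp (- \<sigma>0 * real p) \<le> C0 * X x"
        using near(1)[OF x] C0 \<mu>0 by (auto intro!: mult_left_mono)
      then show "\<bar>deriv v x - poly (pderiv Q) x\<bar> \<le> C0 * \<mu> * X x" "\<bar>v x - poly Q x\<bar> \<le> C0 * X x" using Q(4)[OF x] by linarith+
    qed
    have "\<exists>Z. continuous_on {0..1} Z \<and> Z 0 = v 0 \<and> Z 1 = v 1 \<and>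
       (\<exists>q. degree q \<le> p \<and> (\<forall>x\<in>{0..h}. Z x = poly q x)) \<and> (\<exists>q. degree q \<le> p \<and> (\<forall>x\<in>{h..1}. Z x = poly q x)) \<and>
       (\<forall>x\<in>I01 - {h}. \<bar>deriv v x - deriv Z x\<bar> \<le> C * \<mu> * X x \<and> \<bar>v x - Z x\<bar> \<le> C * X x)"
    proof (cases "h = 1")
      case True
      have "\<bar>deriv v x - deriv (poly Q) x\<bar> \<le> C * \<mu> * X x \<and> \<bar>v x - poly Q x\<bar> \<le> C * X x" if x: "x \<in> I01" for x
      proof -
        have "deriv (poly Q) x = poly (pderiv Q) x" by (rule DERIV_imp_deriv[OF poly_DERIV])
        moreover have "C0 * \<mu> * X x \<le> C * \<mu> * X x" "C0 * X x \<le> C * X x"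
          using Cp A0 X0[of x] \<mu>0 by (auto intro!: mult_right_mono)
        ultimately show ?thesis using Qe[of x] x True by auto
      qed
      then show ?thesis using Q True by (intro exI[of _ "poly Q"]) (auto intro!: continuous_intros)
    next
      case False
      then have hh: "0 < h" "h \<le> 1/2" "K1 * real p \<le> \<mu> * h" using h by auto
      have hb: "\<bar>v h\<bar> \<le> A * exp (- (c * (K1 * real p)))"
      proof -
        have "c * (K1 * real p) \<le> c * \<mu> * h" using mult_left_mono[OF hh(3), of c] cA by (simp add: mult.assoc)
        then have "A * exp (- (c * \<mu> * h)) \<le> A * exp (- (c * (K1 * real p)))" using A0 by simp
        then show ?thesis using vb[of h] hh by simp
      qed
      have hd: "\<bar>v h / h\<bar> \<le> A / K1 * \<mu> * exp (- (c * (K1 * real p)))"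
      proof -
        have "K1 * 1 \<le> K1 * real p" using K p by (intro mult_left_mono) auto
        then have "K1 \<le> \<mu> * h" using hh(3) by linarith
        then have "1 / h \<le> \<mu> / K1" using hh K by (simp add: field_simps)
        then have "\<bar>v h\<bar> * (1 / h) \<le> (A * exp (- (c * (K1 * real p)))) * (\<mu> / K1)"
          using hb hh by (intro mult_mono) auto
        then show ?thesis using hh by (simp add: abs_divide mult_ac)
      qed
      \<comment> \<open>the slope \<open>v h / h\<close> is of order \<open>\<mu> exp (- c K1 p)\<close>, since \<open>1 / h \<le> \<mu> / (K1 p)\<close>\<close>
      define Q1 where "Q1 = Q + [:0, - v h / h:]"
      define k where "k = v 1 / (1 - h)"
      define Q2 where "Q2 = [:- k * h, k:]"
      have Q1x: "poly Q1 x = poly Q x - v h / h * x" "poly (pderiv Q1) x = poly (pderiv Q) x - v h / h" for x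
        by (simp_all add: Q1_def pderiv_add pderiv_pCons)
      have Q2x: "poly Q2 x = k * (x - h)" "poly (pderiv Q2) x = k" for x
        by (simp_all add: Q2_def pderiv_pCons algebra_simps)
      have deg: "degree Q1 \<le> p" "degree Q2 \<le> p"
        unfolding Q1_def Q2_def using Q(1) p by (auto intro!: degree_add_le)
      define Z where "Z x = (if x \<le> h then poly Q1 x else poly Q2 x)" for x
      have Q1h: "poly Q1 h = 0" using Q hh by (simp add: Q1x)
      have Q2h: "poly Q2 h = 0" by (simp add: Q2x)
      have Z1: "Z x = poly Q1 x" if "x \<in> {0..h}" for x using that by (simp add: Z_def)
      have Z2: "Z x = poly Q2 x" if "x \<in> {h..1}" for x using that Q1h Q2h by (cases "x = h") (auto simp: Z_def)
      have cont: "continuous_on {0..1} Z" unfolding Z_def[abs_def]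
        by (intro continuous_glue) (use hh Q1h Q2h in \<open>auto intro!: continuous_intros\<close>)
      have Z01: "Z 0 = v 0" "Z 1 = v 1" using Z1[of 0] Z2[of 1] hh Q by (auto simp: Q1x Q2x k_def)
      have err: "\<bar>deriv v x - deriv Z x\<bar> \<le> C * \<mu> * X x \<and> \<bar>v x - Z x\<bar> \<le> C * X x" if x: "x \<in> I01 - {h}" for x
      proof (cases "x < h")
        case True
        then have x': "x \<in> {0..h}" "x \<in> {0<..<h}" using x by auto
        have dZ: "deriv Z x = poly (pderiv Q1) x"
          by (rule DERIV_imp_deriv, rule local_poly_derivative[OF _ x'(2)]) (use Z1 in auto)
        have "\<bar>v h / h * x\<bar> \<le> A * X x"
        proof -
          have "\<bar>v h / h * x\<bar> = \<bar>v h\<bar> * (x / h)" using x' hh by (simp add: abs_mult)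
          also have "\<dots> \<le> \<bar>v h\<bar> * 1" using x' hh by (intro mult_left_mono) auto
          also have "\<dots> \<le> A * X x" using hb mult_left_mono[OF near(2)[OF x'(1)] less_imp_le[OF A0]] by linarith
          finally show ?thesis .
        qed
        then have a: "\<bar>v x - Z x\<bar> \<le> (C0 + A) * X x" using Qe(2)[OF x'(1)] unfolding Z1[OF x'(1)] Q1x distrib_right by linarith
        have "\<bar>v h / h\<bar> \<le> A / K1 * \<mu> * X x"
          using hd mult_left_mono[OF near(2)[OF x'(1)], of "A / K1 * \<mu>"] A0 K \<mu>0 by simp
        then have b: "\<bar>deriv v x - deriv Z x\<bar> \<le> (C0 + A / K1) * \<mu> * X x" using Qe(1)[OF x'(1)] unfolding dZ Q1x distrib_right by linarith
        have "(C0 + A / K1) * \<mu> * X x \<le> C * \<mu> * X x" "(C0 + A) * X x \<le> C * X x"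
          using Cp X0[of x] \<mu>0 by (auto intro!: mult_right_mono)
        then show ?thesis using a b by linarith
      next
        case False
        then have x': "x \<in> {h..1}" "x \<in> {h<..<1}" "x \<in> {0..1}" using x hh by auto
        have dZ: "deriv Z x = k"
          unfolding Q2x(2)[of x, symmetric]
          by (rule DERIV_imp_deriv, rule local_poly_derivative[OF _ x'(2)]) (use Z2 in auto)
        have Xx: "exp (- (c * \<mu> * x)) \<le> X x"
        proof -
          have "\<sigma> * real p \<le> c / 2 * (K1 * real p)" using mult_right_mono[OF s(3), of "real p"] by simp
          also have "\<dots> \<le> c / 2 * (\<mu> * x)"
          proof (rule mult_left_mono)
            have "\<mu> * h \<le> \<mu> * x" using x' \<mu>0 by simp
            then show "K1 * real p \<le> \<mu> * x" using hh(3) by linarith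
          qed (use cA in simp)
          finally have 1: "\<sigma> * real p \<le> c / 2 * (\<mu> * x)" .
          have "\<omega> * (\<mu> * x) \<le> c / 2 * (\<mu> * x)" using o \<mu>0 x' by (intro mult_right_mono) auto
          then have "\<sigma> * real p + \<omega> * \<mu> * x \<le> c * \<mu> * x" using 1 by (simp add: mult.assoc)
          then show ?thesis unfolding X_def exp_add[symmetric] by simp
        qed
        have v1: "\<bar>v 1\<bar> \<le> A * X x"
        proof -
          have "c * \<mu> * x \<le> c * \<mu> * 1" using x' c\<mu> by (intro mult_left_mono) auto
          then have "exp (- (c * \<mu> * 1)) \<le> exp (- (c * \<mu> * x))" by simp
          then have "A * exp (- (c * \<mu> * 1)) \<le> A * X x" using order_trans[OF _ Xx] A0 by (intro mult_left_mono) (simp_all only: less_imp_le)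
          moreover have "\<bar>v 1\<bar> \<le> A * exp (- (c * \<mu> * 1))" by (rule vb) simp
          ultimately show ?thesis by linarith
        qed
        have Zx: "\<bar>Z x\<bar> \<le> A * X x"
        proof -
          have "\<bar>Z x\<bar> = \<bar>v 1\<bar> * ((x - h) / (1 - h))" unfolding Z2[OF x'(1)] Q2x k_def using x' hh by (simp add: abs_mult abs_divide)
          also have "\<dots> \<le> \<bar>v 1\<bar> * 1" using x' hh by (intro mult_left_mono) auto
          finally show ?thesis using v1 by simp
        qed
        have vx: "\<bar>v x\<bar> \<le> A * X x" using vb[OF x'(3)] mult_left_mono[OF Xx less_imp_le[OF A0]] by linarith
        have a: "\<bar>v x - Z x\<bar> \<le> (A + A) * X x" using Zx vx unfolding distrib_right by linarith
        have kb: "\<bar>k\<bar> \<le> 4 * A * \<mu> * X x"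
        proof -
          have "\<bar>k\<bar> = \<bar>v 1\<bar> * (1 / (1 - h))" using hh by (simp add: k_def abs_divide)
          also have "\<dots> \<le> (A * X x) * 2" using v1 hh A0 X0[of x] by (intro mult_mono) (auto simp: divide_le_eq)
          also have "\<dots> \<le> (A * X x) * (4 * \<mu>)" using \<mu> A0 X0[of x] by (intro mult_left_mono) auto
          finally show ?thesis by (simp add: mult_ac)
        qed
        have "\<bar>deriv v x\<bar> \<le> A * A * \<mu> * X x"         proof -
          have "A * A * \<mu> * exp (- (c * \<mu> * x)) \<le> A * A * \<mu> * X x" using Xx A0 \<mu>0 by (intro mult_left_mono) auto
          then show ?thesis using vd[OF x'(3)] by linarith
        qed
        then have b: "\<bar>deriv v x - deriv Z x\<bar> \<le> (A * A + 4 * A) * \<mu> * X x" using kb unfolding dZ distrib_right by linarith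
        have "(A * A + 4 * A) * \<mu> * X x \<le> C * \<mu> * X x" "(A + A) * X x \<le> C * X x"
          using Cp X0[of x] \<mu>0 by (auto intro!: mult_right_mono)
        then show ?thesis using a b by linarith
      qed
      show ?thesis using cont Z01 Z1 Z2 deg err by blast
    qed
    then show ?thesis by (simp add: X_def mult.assoc)
  qed
  show ?thesis
    by (intro exI[of _ C] exI[of _ \<sigma>] exI[of _ \<omega>] conjI Cp s o allI impI) (use main[OF _ _ _ _ _ _ refl] in simp)
qed

section \<open>The weak form and the error bound\<close>

context holomorphic_coefficients
begin

lemma real_trace:
  assumes H: "H holomorphic_on W"
  shows "x \<in> {0..1} \<Longrightarrow> ((\<lambda>x. Re (H (of_real x))) has_real_derivative Re (deriv H (of_real x))) (at x)"
    and "continuous_on {0..1} (\<lambda>x. Re (H (of_real x)))"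
proof -
  show d: "((\<lambda>x. Re (H (of_real x))) has_real_derivative Re (deriv H (of_real x))) (at x)" if "x \<in> {0..1}" for x
    by (rule cx_deriv_real, rule holomorphic_derivI[OF H open_rhombus real_in_W[OF that]])
  show "continuous_on {0..1} (\<lambda>x. Re (H (of_real x)))"
    by (intro continuous_at_imp_continuous_on ballI) (rule DERIV_isCont, erule d)
qed

lemma deriv_hol: "H holomorphic_on W \<Longrightarrow> deriv H holomorphic_on W"
  by (rule holomorphic_deriv[OF _ open_rhombus])

lemma real_trace_piecewise_C1:
  assumes H: "H holomorphic_on W"
  shows "piecewise_C1 (\<lambda>x. Re (H (of_real x)))"
proof (rule piecewise_C1I[of "{}" _ "\<lambda>x. Re (deriv H (of_real x))"])
  have c: "continuous_on {0..1} (\<lambda>x. Re (deriv H (of_real x)))" by (rule real_trace(2)[OF deriv_hol[OF H]])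
  then show "continuous_on (I01 - {}) (\<lambda>x. Re (deriv H (of_real x)))" by (rule continuous_on_subset) auto
  have "bounded ((\<lambda>x. Re (deriv H (of_real x))) ` {0..1})"
    by (intro compact_imp_bounded compact_continuous_image c) auto
  then show "bounded ((\<lambda>x. Re (deriv H (of_real x))) ` (I01 - {}))" by (rule bounded_subset) auto
qed (use real_trace[OF H] in auto)

lemma coefficients_continuous: "continuous_on {0..1} b" "continuous_on {0..1} c" "continuous_on {0..1} f"
proof -
  have *: "continuous_on {0..1} g" if "G holomorphic_on U" "\<And>x. x \<in> {0..1} \<Longrightarrow> G (of_real x) = of_real (g x)" for G g
    by (rule continuous_on_eq[OF real_trace(2)[OF holomorphic_on_subset[OF that(1) W_U']]]) (simp add: that(2))
  show "continuous_on {0..1} b" "continuous_on {0..1} c" "continuous_on {0..1} f"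
    by (rule *[OF hol(1) real(1)] *[OF hol(2) real(2)] *[OF hol(3) real(3)]; assumption)+
qed

text \<open>The decomposition extends \<open>u\<close> holomorphically beyond the end points, so its derivatives are bounded up to the
  boundary and the equation may be tested.\<close>

lemma BVP_solution_regular:
  assumes u: "is_BVP_solution \<epsilon>1 \<epsilon>2 b c f u" and H: "H holomorphic_on W" "\<And>x. x \<in> {0..1} \<Longrightarrow> u x = Re (H (of_real x))"
  shows "piecewise_C1 u" and "\<And>v. piecewise_C1 v \<Longrightarrow> v 0 = 0 \<Longrightarrow> v 1 = 0 \<Longrightarrow>
    integral\<^sup>L M01 (\<lambda>x. \<epsilon>1 * (deriv u x * deriv v x) + \<epsilon>2 * (b x * deriv u x * v x) + c x * u x * v x)
      = integral\<^sup>L M01 (\<lambda>x. f x * v x)"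
proof -
  define w1 where "w1 = (\<lambda>x. Re (deriv H (of_real x)))"
  define w2 where "w2 = (\<lambda>x. Re (deriv (deriv H) (of_real x)))"
  have I: "x \<in> {0..1}" if "x \<in> I01" for x :: real using that by auto
  have ud: "(u has_real_derivative w1 x) (at x)" if x: "x \<in> I01" for x
    unfolding w1_def
    by (rule has_field_derivative_transform_within_open[OF real_trace(1)[OF H(1) I[OF x]], of I01]) (use x H(2) in auto)
  then have du: "deriv u x = w1 x" if "x \<in> I01" for x using that by (intro DERIV_imp_deriv)
  have w1d: "(w1 has_real_derivative w2 x) (at x)" if "x \<in> {0..1}" for x
    unfolding w1_def w2_def by (rule real_trace(1)[OF deriv_hol[OF H(1)] that])
  have c1: "continuous_on {0..1} w1" unfolding w1_def by (rule real_trace(2)[OF deriv_hol[OF H(1)]])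
  have c2: "continuous_on {0..1} w2" unfolding w2_def by (rule real_trace(2)[OF deriv_hol[OF deriv_hol[OF H(1)]]])
  have uc: "continuous_on {0..1} u" using u by (simp add: is_BVP_solution_def)
  have ddu: "deriv (deriv u) x = w2 x" if x: "x \<in> I01" for x
  proof (rule DERIV_imp_deriv)
    show "(deriv u has_real_derivative w2 x) (at x)"
      by (rule has_field_derivative_transform_within_open[OF w1d[OF I[OF x]], of I01]) (use x du in auto)
  qed
  show pu: "piecewise_C1 u"
  proof (rule piecewise_C1I[of "{}" _ w1])
    show "continuous_on (I01 - {}) w1" using c1 by (rule continuous_on_subset) auto
    have "bounded (w1 ` {0..1})" by (intro compact_imp_bounded compact_continuous_image c1) auto
    then show "bounded (w1 ` (I01 - {}))" by (rule bounded_subset) auto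
  qed (use uc ud in auto)
  fix v assume v: "piecewise_C1 v" "v 0 = 0" "v 1 = 0"
  obtain S where S: "finite S" "\<And>x. x \<in> I01 - S \<Longrightarrow> (v has_real_derivative deriv v x) (at x)"
    using piecewise_C1_deriv[OF v(1)] by blast
  note bms = bm_intros bm_continuous[OF c1] bm_continuous[OF c2] piecewise_C1_bm[OF v(1)] piecewise_C1_deriv_bm[OF v(1)]
  have "integral\<^sup>L M01 (\<lambda>x. w2 x * v x + w1 x * deriv v x) = w1 1 * v 1 - w1 0 * v 0"
  proof (rule integral_derivative_M01[OF S(1)])
    show "bounded_measurable (\<lambda>x. w2 x * v x + w1 x * deriv v x)" by (intro bms)
  next
    fix x assume x: "x \<in> I01 - S"
    have "(w1 has_real_derivative w2 x) (at x)" using w1d x by auto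
    from DERIV_mult[OF this S(2)[OF x]]
    show "((\<lambda>x. w1 x * v x) has_real_derivative w2 x * v x + w1 x * deriv v x) (at x)" by (simp add: mult.commute)
  qed (auto intro!: continuous_intros c1 piecewise_C1_continuous[OF v(1)] bms)
  then have 0: "integral\<^sup>L M01 (\<lambda>x. \<epsilon>1 * (w2 x * v x + w1 x * deriv v x)) = 0" using v by simp
  have ode: "- \<epsilon>1 * w2 x + \<epsilon>2 * b x * w1 x + c x * u x = f x" if "x \<in> I01" for x
    using u that du ddu unfolding is_BVP_solution_def by force
  note bc = coefficients_continuous[THEN bm_continuous] bm_continuous[OF uc]
  have "integral\<^sup>L M01 (\<lambda>x. \<epsilon>1 * (deriv u x * deriv v x) + \<epsilon>2 * (b x * deriv u x * v x) + c x * u x * v x)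
      = integral\<^sup>L M01 (\<lambda>x. f x * v x + \<epsilon>1 * (w2 x * v x + w1 x * deriv v x))"
  proof (rule Bochner_Integration.integral_cong[OF refl])
    fix x assume "x \<in> space M01"
    then have x: "x \<in> I01" by simp
    have "f x * v x = (- \<epsilon>1 * w2 x + \<epsilon>2 * b x * w1 x + c x * u x) * v x" by (simp only: ode[OF x])
    then show "\<epsilon>1 * (deriv u x * deriv v x) + \<epsilon>2 * (b x * deriv u x * v x) + c x * u x * v x
      = f x * v x + \<epsilon>1 * (w2 x * v x + w1 x * deriv v x)" unfolding du[OF x] by (simp add: algebra_simps)
  qed
  also have "\<dots> = integral\<^sup>L M01 (\<lambda>x. f x * v x) + integral\<^sup>L M01 (\<lambda>x. \<epsilon>1 * (w2 x * v x + w1 x * deriv v x))"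
    by (rule Bochner_Integration.integral_add) (intro bm_integrable bms bc)+
  finally show "integral\<^sup>L M01 (\<lambda>x. \<epsilon>1 * (deriv u x * deriv v x) + \<epsilon>2 * (b x * deriv u x * v x) + c x * u x * v x)
      = integral\<^sup>L M01 (\<lambda>x. f x * v x)" using 0 by simp
qed

lemma b_deriv:
  shows "x \<in> I01 \<Longrightarrow> (b has_real_derivative deriv01 b x) (at x)" and "bounded_measurable (deriv01 b)"
    and "x \<in> I01 \<Longrightarrow> \<bar>deriv01 b x\<bar> \<le> K / \<omega>"
proof -
  have BW: "B holomorphic_on W" using hol(1) W_U' by (rule holomorphic_on_subset)
  have d: "(b has_real_derivative Re (deriv B (of_real x))) (at x)" if x: "x \<in> I01" for x
  proof (rule has_field_derivative_transform_within_open[OF real_trace(1)[OF BW], of _ I01])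
    fix y :: real assume "y \<in> I01"
    then show "Re (B (of_real y)) = b y" using real(1)[of y] by auto
  qed (use x in auto)
  have e: "deriv01 b x = Re (deriv B (of_real x))" if x: "x \<in> I01" for x
    unfolding deriv01_def
    by (rule vector_derivative_at_within_ivl) (use d[OF x] x in \<open>auto simp: has_real_derivative_iff_has_vector_derivative\<close>)
  show "(b has_real_derivative deriv01 b x) (at x)" if "x \<in> I01" using d[OF that] e[OF that] by simp
  show "\<bar>deriv01 b x\<bar> \<le> K / \<omega>" if x: "x \<in> I01"
  proof -
    have "of_real x \<in> W" using x by (intro real_in_W) auto
    then have "cmod (deriv B (of_real x)) \<le> K / \<omega>" by (intro deriv_bound_W[OF hol(1)] bnd)
    then show ?thesis unfolding e[OF x] using abs_Re_le_cmod[of "deriv B (of_real x)"] by linarith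
  qed
  have c: "continuous_on {0..1} (\<lambda>x. Re (deriv B (of_real x)))" by (rule real_trace(2)[OF deriv_hol[OF BW]])
  show "bounded_measurable (deriv01 b)"
  proof (rule bm_continuous_off_finite[of "{}"])
    have "continuous_on (I01 - {}) (\<lambda>x. Re (deriv B (of_real x)))" using c by (rule continuous_on_subset) auto
    then show "continuous_on (I01 - {}) (deriv01 b)" by (rule iffD2[OF continuous_on_cong[OF refl], rotated]) (use e in auto)
    have "bounded ((\<lambda>x. Re (deriv B (of_real x))) ` {0..1})"
      by (intro compact_imp_bounded compact_continuous_image c) auto
    then show "bounded (deriv01 b ` (I01 - {}))" by (rule bounded_subset) (use e in auto)
  qed auto
qed

end

lemma mesh_poly_left:
  assumes h: "mesh_widths h0 h1" and c: "continuous_on {0..1} Z"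
    and q: "\<exists>q. degree q \<le> p \<and> (\<forall>x\<in>{0..h0}. Z x = poly q x)" "\<exists>q. degree q \<le> p \<and> (\<forall>x\<in>{h0..1}. Z x = poly q x)"
  shows "mesh_poly h0 h1 p Z"
proof -
  obtain q1 q2 where q1: "degree q1 \<le> p" "\<And>x. x \<in> {0..h0} \<Longrightarrow> Z x = poly q1 x"
    and q2: "degree q2 \<le> p" "\<And>x. x \<in> {h0..1} \<Longrightarrow> Z x = poly q2 x" using q by blast
  show ?thesis unfolding mesh_poly_def
  proof (intro conjI c)
    show "\<exists>q. degree q \<le> p \<and> (\<forall>x\<in>{0..h0}. Z x = poly q x)" by (rule q)
    show "\<exists>q. degree q \<le> p \<and> (\<forall>x\<in>{h0..1 - h1}. Z x = poly q x)"
      using q2 h by (intro exI[of _ q2]) (auto simp: mesh_widths_def)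
    show "\<exists>q. degree q \<le> p \<and> (\<forall>x\<in>{1 - h1..1}. Z x = poly q x)"
    proof (cases "h0 = 1")
      case True
      then have "h1 = 1" using h by (auto simp: mesh_widths_def)
      then show ?thesis using q1 True by (intro exI[of _ q1]) auto
    next
      case False
      then show ?thesis using q2 h by (intro exI[of _ q2]) (auto simp: mesh_widths_def)
    qed
  qed
qed

lemma mesh_poly_reflect:
  assumes "mesh_poly h1 h0 p Z" and h: "mesh_widths h0 h1"
  shows "mesh_poly h0 h1 p (\<lambda>x. Z (1 - x))"
proof -
  have r: "\<exists>q. degree q \<le> p \<and> (\<forall>x\<in>J. Z (1 - x) = poly q x)"
    if q: "\<exists>q. degree q \<le> p \<and> (\<forall>x\<in>K. Z x = poly q x)" and K: "\<And>x. x \<in> J \<Longrightarrow> 1 - x \<in> K" for J K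
  proof -
    obtain q where q: "degree q \<le> p" "\<And>x. x \<in> K \<Longrightarrow> Z x = poly q x" using q by blast
    have "degree (pcompose q [:1, -1:]) \<le> p" using q(1) by (simp add: degree_pcompose)
    then show ?thesis using q(2) K by (intro exI[of _ "pcompose q [:1, -1:]"]) (simp add: poly_pcompose)
  qed
  have "continuous_on {0..1} (\<lambda>x. Z (1 - x))"
    by (rule continuous_on_compose2[of "{0..1}" Z]) (use assms in \<open>auto simp: mesh_poly_def intro!: continuous_intros\<close>)
  then show ?thesis using assms(1) unfolding mesh_poly_def
    by (intro conjI r[of "{1 - h0..1}"] r[of "{h1..1 - h0}"] r[of "{0..h1}"]) auto
qed

text \<open>Galerkin orthogonality makes \<open>\<eta> = z - w\<close> a discrete function with
  \<open>B(\<eta>, \<eta>) = - B(ea + eb, \<eta>)\<close>, to which \<open>energy_estimate\<close> applies; the triangle inequality does the rest.\<close>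

theorem FEM_error_by_approximation:
  fixes \<epsilon>1 \<epsilon>2 K \<rho> :: real
  defines "Q \<equiv> 2 + 2 * (1 + 1 / \<rho>) * (2 * (1 + K\<^sup>2 + 8 * K\<^sup>2 / \<rho>))"
  assumes eps: "0 < \<epsilon>1" "\<epsilon>1 \<le> 1" "0 < \<epsilon>2" "\<epsilon>2 \<le> 1" and \<rho>: "\<rho> > 0"
    and b: "continuous_on {0..1} b" "\<And>x. x \<in> I01 \<Longrightarrow> (b has_real_derivative b' x) (at x)" "bounded_measurable b'"
    and c: "continuous_on {0..1} c"
    and K: "\<And>x. x \<in> I01 \<Longrightarrow> \<bar>b x\<bar> \<le> K \<and> \<bar>b' x\<bar> \<le> K \<and> \<bar>c x\<bar> \<le> K"
    and coer: "\<And>x. x \<in> I01 \<Longrightarrow> c x - \<epsilon>2 / 2 * b' x \<ge> \<rho>"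
    and u: "piecewise_C1 u"
    and weak: "\<And>v. piecewise_C1 v \<Longrightarrow> v 0 = 0 \<Longrightarrow> v 1 = 0 \<Longrightarrow>
      integral\<^sup>L M01 (\<lambda>x. \<epsilon>1 * (deriv u x * deriv v x) + \<epsilon>2 * (b x * deriv u x * v x) + c x * u x * v x)
        = integral\<^sup>L M01 (\<lambda>x. f x * v x)"
    and h: "mesh_widths h0 h1" and w: "is_FE_approx \<epsilon>1 \<epsilon>2 b c f {0, h0, 1 - h1, 1} p w"
    and z: "mesh_poly h0 h1 p z" "z 0 = 0" "z 1 = 0"
    and ea: "piecewise_C1 ea" and eb: "piecewise_C1 eb" and split: "\<And>x. x \<in> {0..1} \<Longrightarrow> u x = z x + ea x + eb x"
  shows "energy_norm \<epsilon>1 (\<lambda>x. u x - w x) \<le> sqrt (Q * integral\<^sup>L M01 (\<lambda>x. \<epsilon>1 * (deriv ea x + deriv eb x)\<^sup>2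
      + (ea x + eb x)\<^sup>2 + \<epsilon>2\<^sup>2 * (deriv ea x)\<^sup>2 + \<epsilon>2\<^sup>2 / \<epsilon>1 * (eb x)\<^sup>2))"
proof -
  have wF: "w \<in> FE_space {0, h0, 1 - h1, 1} p"
    and wG: "\<And>v. v \<in> FE_space {0, h0, 1 - h1, 1} p \<Longrightarrow> bilinear_form \<epsilon>1 \<epsilon>2 b c w v = L2_inner f v"
    using w by (auto simp: is_FE_approx_def)
  note wm = FE_space_mesh_poly[OF h wF]
  have wz: "piecewise_C1 w" "piecewise_C1 z" using mesh_poly_piecewise_C1[OF _ h] wm(1) z(1) by auto
  define \<eta> where "\<eta> = (\<lambda>x. z x + (-1) * w x)"
  define e where "e = (\<lambda>x. u x + (-1) * w x)"
  have \<eta>m: "mesh_poly h0 h1 p \<eta>" unfolding \<eta>_def by (rule mesh_poly_lincomb[OF z(1) wm(1)])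
  have \<eta>: "piecewise_C1 \<eta>" "\<eta> 0 = 0" "\<eta> 1 = 0" using mesh_poly_piecewise_C1[OF \<eta>m h] z wm by (auto simp: \<eta>_def)
  have e: "piecewise_C1 e" unfolding e_def by (rule piecewise_C1_lincomb(1)[OF u wz(1)])
  obtain Sz where Sz: "finite Sz" "\<And>x. x \<in> I01 - Sz \<Longrightarrow> (z has_real_derivative deriv z x) (at x)"
    using piecewise_C1_deriv[OF wz(2)] by blast
  obtain Sw where Sw: "finite Sw" "\<And>x. x \<in> I01 - Sw \<Longrightarrow> (w has_real_derivative deriv w x) (at x)"
    using piecewise_C1_deriv[OF wz(1)] by blast
  obtain Sa where Sa: "finite Sa" "\<And>x. x \<in> I01 - Sa \<Longrightarrow> (ea has_real_derivative deriv ea x) (at x)"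
    using piecewise_C1_deriv[OF ea] by blast
  obtain Sb where Sb: "finite Sb" "\<And>x. x \<in> I01 - Sb \<Longrightarrow> (eb has_real_derivative deriv eb x) (at x)"
    using piecewise_C1_deriv[OF eb] by blast
  define T where "T = Sz \<union> Sw \<union> Sa \<union> Sb"
  have D: "deriv u x = deriv z x + deriv ea x + deriv eb x \<and> deriv \<eta> x = deriv z x - deriv w x
      \<and> deriv e x = deriv ea x + deriv eb x + deriv \<eta> x" if x: "x \<in> I01 - T" for x
  proof -
    note d = Sz(2)[of x] Sw(2)[of x] Sa(2)[of x] Sb(2)[of x]
    have du: "(u has_real_derivative deriv z x + deriv ea x + deriv eb x) (at x)"
    proof (rule has_field_derivative_transform_within_open[of "\<lambda>x. z x + ea x + eb x" _ _ I01])
      show "((\<lambda>x. z x + ea x + eb x) has_real_derivative deriv z x + deriv ea x + deriv eb x) (at x)"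
        by (intro DERIV_add d) (use x in \<open>auto simp: T_def\<close>)
    qed (use x split in auto)
    have "(\<eta> has_real_derivative deriv z x + (-1) * deriv w x) (at x)"
      unfolding \<eta>_def by (intro DERIV_add DERIV_cmult d) (use x in \<open>auto simp: T_def\<close>)
    moreover have "(e has_real_derivative deriv z x + deriv ea x + deriv eb x + (-1) * deriv w x) (at x)"
      unfolding e_def by (intro DERIV_add[OF du] DERIV_cmult d) (use x in \<open>auto simp: T_def\<close>)
    ultimately show ?thesis using du by (simp add: DERIV_imp_deriv)
  qed
  have "finite T" using Sz Sw Sa Sb by (simp add: T_def)
  then have AD: "AE x in M01. x \<in> I01 - T"
    using AE_M01_off_finite[of T] AE_space[of M01] by (auto elim: eventually_elim2)
  note bms = bm_intros bm_continuous[OF b(1)] bm_continuous[OF c] b(3) ea[THEN piecewise_C1_bm] eb[THEN piecewise_C1_bm]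
    ea[THEN piecewise_C1_deriv_bm] eb[THEN piecewise_C1_deriv_bm] \<eta>(1)[THEN piecewise_C1_bm] \<eta>(1)[THEN piecewise_C1_deriv_bm]
    u[THEN piecewise_C1_bm] u[THEN piecewise_C1_deriv_bm] wz(1)[THEN piecewise_C1_bm] wz(1)[THEN piecewise_C1_deriv_bm]
    e[THEN piecewise_C1_bm] e[THEN piecewise_C1_deriv_bm]
  have ms: "g \<in> borel_measurable M01" if "bounded_measurable g" for g using that by (simp add: bounded_measurable_def)
  let ?A = "\<lambda>g g' x. \<epsilon>1 * (g' x * deriv \<eta> x) + \<epsilon>2 * (b x * g' x * \<eta> x) + c x * g x * \<eta> x"
  let ?d = "\<lambda>x. ea x + eb x" and ?d' = "\<lambda>x. deriv ea x + deriv eb x"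
  have orth: "integral\<^sup>L M01 (?A \<eta> (deriv \<eta>)) = - integral\<^sup>L M01 (?A ?d ?d')"
  proof -
    have "integral\<^sup>L M01 (?A \<eta> (deriv \<eta>)) = integral\<^sup>L M01 (\<lambda>x. (?A u (deriv u) x - ?A w (deriv w) x) - ?A ?d ?d' x)"
    proof (rule integral_cong_AE)
      show "AE x in M01. ?A \<eta> (deriv \<eta>) x = (?A u (deriv u) x - ?A w (deriv w) x) - ?A ?d ?d' x"
        using AD
      proof eventually_elim
        case (elim x)
        have eq: "u x - w x - (ea x + eb x) = \<eta> x" "deriv u x - deriv w x - (deriv ea x + deriv eb x) = deriv \<eta> x"
          using split[of x] elim D[OF elim] by (auto simp: \<eta>_def)
        have "\<epsilon>1 * ((p1 - p2 - p3) * t) + \<epsilon>2 * (b x * (p1 - p2 - p3) * y) + c x * (q1 - q2 - q3) * y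
          = ((\<epsilon>1 * (p1 * t) + \<epsilon>2 * (b x * p1 * y) + c x * q1 * y) - (\<epsilon>1 * (p2 * t) + \<epsilon>2 * (b x * p2 * y) + c x * q2 * y))
            - (\<epsilon>1 * (p3 * t) + \<epsilon>2 * (b x * p3 * y) + c x * q3 * y)" for p1 p2 p3 q1 q2 q3 t y
          by (simp add: algebra_simps)
        from this[of "deriv u x" "deriv w x" "deriv ea x + deriv eb x" "deriv \<eta> x" "\<eta> x" "u x" "w x" "ea x + eb x"]
        show ?case unfolding eq .
      qed
    qed (intro ms bms)+
    also have "\<dots> = (integral\<^sup>L M01 (?A u (deriv u)) - integral\<^sup>L M01 (?A w (deriv w))) - integral\<^sup>L M01 (?A ?d ?d')"
    proof -
      have i: "integrable M01 (?A u (deriv u))" "integrable M01 (?A w (deriv w))" "integrable M01 (?A ?d ?d')"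
        by (intro bm_integrable bms)+
      show ?thesis
        by (simp only: Bochner_Integration.integral_diff[OF Bochner_Integration.integrable_diff[OF i(1,2)] i(3)]
            Bochner_Integration.integral_diff[OF i(1,2)])
    qed
    also have "integral\<^sup>L M01 (?A u (deriv u)) = integral\<^sup>L M01 (\<lambda>x. f x * \<eta> x)" by (rule weak[OF \<eta>])
    also have "integral\<^sup>L M01 (?A w (deriv w)) = bilinear_form \<epsilon>1 \<epsilon>2 b c w \<eta>"
      by (rule bilinear_form_piecewise_C1[OF wz(1) \<eta>(1), symmetric]) (intro bms)+
    also have "\<dots> = integral\<^sup>L M01 (\<lambda>x. f x * \<eta> x)"
      using wG[OF mesh_poly_FE_space[OF h \<eta>m \<eta>(2,3)]] by (simp add: L2_inner_def)
    finally show ?thesis by simp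
  qed
  let ?G = "\<lambda>x. \<epsilon>1 * (deriv ea x + deriv eb x)\<^sup>2 + (ea x + eb x)\<^sup>2 + \<epsilon>2\<^sup>2 * (deriv ea x)\<^sup>2 + \<epsilon>2\<^sup>2 / \<epsilon>1 * (eb x)\<^sup>2"
  let ?E = "\<lambda>x. \<epsilon>1 * (deriv \<eta> x)\<^sup>2 + \<rho> * (\<eta> x)\<^sup>2"
  have est: "integral\<^sup>L M01 ?E \<le> 2 * (1 + K\<^sup>2 + 8 * K\<^sup>2 / \<rho>) * integral\<^sup>L M01 ?G"
    by (rule energy_estimate[OF eps \<rho> b c K coer ea eb \<eta> orth])
  have "integral\<^sup>L M01 (\<lambda>x. \<epsilon>1 * (deriv e x)\<^sup>2 + (e x)\<^sup>2) \<le> integral\<^sup>L M01 (\<lambda>x. 2 * ?G x + 2 * (1 + 1 / \<rho>) * ?E x)"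
  proof (rule integral_mono_AE)
    show "AE x in M01. \<epsilon>1 * (deriv e x)\<^sup>2 + (e x)\<^sup>2 \<le> 2 * ?G x + 2 * (1 + 1 / \<rho>) * ?E x"
      using AD
    proof eventually_elim
      case (elim x)
      have sq: "(s + t)\<^sup>2 \<le> 2 * s\<^sup>2 + 2 * t\<^sup>2" for s t :: real
        using zero_le_power2[of "s - t"] by (simp add: power2_eq_square algebra_simps)
      have ex: "e x = (ea x + eb x) + \<eta> x" using split[of x] elim by (simp add: e_def \<eta>_def)
      define g1 g2 g3 g4 where "g1 = \<epsilon>1 * (deriv ea x + deriv eb x)\<^sup>2" and "g2 = (ea x + eb x)\<^sup>2"
        and "g3 = \<epsilon>2\<^sup>2 * (deriv ea x)\<^sup>2" and "g4 = \<epsilon>2\<^sup>2 / \<epsilon>1 * (eb x)\<^sup>2"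
      define y1 y2 where "y1 = \<epsilon>1 * (deriv \<eta> x)\<^sup>2" and "y2 = (\<eta> x)\<^sup>2"
      have "\<epsilon>1 * (deriv e x)\<^sup>2 \<le> \<epsilon>1 * (2 * (deriv ea x + deriv eb x)\<^sup>2 + 2 * (deriv \<eta> x)\<^sup>2)"
        using D[OF elim] sq[of "deriv ea x + deriv eb x" "deriv \<eta> x"] eps by (intro mult_left_mono) auto
      also have "\<dots> = 2 * g1 + 2 * y1" by (simp add: g1_def y1_def distrib_left)
      finally have 1: "\<epsilon>1 * (deriv e x)\<^sup>2 \<le> 2 * g1 + 2 * y1" .
      have 2: "(e x)\<^sup>2 \<le> 2 * g2 + 2 * y2" unfolding ex g2_def y2_def by (rule sq)
      have 3: "0 \<le> g3" "0 \<le> g4" using eps by (auto simp: g3_def g4_def)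
      have 4: "y1 + y2 \<le> (1 + 1 / \<rho>) * (y1 + \<rho> * y2)"
      proof -
        have "(1 + 1 / \<rho>) * (y1 + \<rho> * y2) = y1 + y2 + (y1 / \<rho> + \<rho> * y2)"
          using \<rho> by (simp add: field_simps)
        moreover have "0 \<le> y1 / \<rho> + \<rho> * y2" using \<rho> eps by (simp add: y1_def y2_def)
        ultimately show ?thesis by linarith
      qed
      have "\<epsilon>1 * (deriv e x)\<^sup>2 + (e x)\<^sup>2 \<le> 2 * (g1 + g2 + g3 + g4) + 2 * (y1 + y2)" using 1 2 3 by simp
      also have "2 * (y1 + y2) \<le> 2 * ((1 + 1 / \<rho>) * (y1 + \<rho> * y2))" using 4 by (intro mult_left_mono) auto
      finally show ?case unfolding g1_def g2_def g3_def g4_def y1_def y2_def by (simp only: mult.assoc)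
    qed
  qed (intro bm_integrable bms)+
  also have "\<dots> = 2 * integral\<^sup>L M01 ?G + 2 * (1 + 1 / \<rho>) * integral\<^sup>L M01 ?E"
    by (subst Bochner_Integration.integral_add) (intro bm_integrable bms integral_mult_right_zero arg_cong2[where f="(+)"])+
  also have "\<dots> \<le> 2 * integral\<^sup>L M01 ?G + 2 * (1 + 1 / \<rho>) * (2 * (1 + K\<^sup>2 + 8 * K\<^sup>2 / \<rho>) * integral\<^sup>L M01 ?G)"
    using est \<rho> by (intro add_left_mono mult_left_mono) auto
  also have "\<dots> = Q * integral\<^sup>L M01 ?G" unfolding Q_def by (simp only: distrib_right mult.assoc)
  finally have *: "integral\<^sup>L M01 (\<lambda>x. \<epsilon>1 * (deriv e x)\<^sup>2 + (e x)\<^sup>2) \<le> Q * integral\<^sup>L M01 ?G" .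
  have "integral\<^sup>L M01 (\<lambda>x. \<epsilon>1 * (deriv e x)\<^sup>2 + (e x)\<^sup>2)
      = \<epsilon>1 * integral\<^sup>L M01 (\<lambda>x. (deriv e x)\<^sup>2) + integral\<^sup>L M01 (\<lambda>x. (e x)\<^sup>2)"
    by (subst Bochner_Integration.integral_add) (intro bm_integrable bms integral_mult_right_zero arg_cong2[where f="(+)"] refl)+
  then have "energy_norm \<epsilon>1 e \<le> sqrt (Q * integral\<^sup>L M01 ?G)"
    unfolding energy_norm_piecewise_C1[OF e] using * by simp
  then show ?thesis by (simp add: e_def)
qed

text \<open>The critical terms are \<open>\<epsilon>1 eb'\<^sup>2\<close> and \<open>\<epsilon>2\<^sup>2 / \<epsilon>1 * eb\<^sup>2\<close>. Both are of order \<open>X\<^sup>2 \<Lambda>\<close> times the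
  squared weight with \<open>\<Lambda> = s / \<epsilon>1\<close>, and the integral of the squared weight is of order \<open>1 / \<Lambda>\<close>.\<close>

lemma weighted_error_integral:
  fixes \<epsilon>1 \<epsilon>2 s \<omega> X :: real
  assumes eps: "0 < \<epsilon>1" "0 < s" "s \<le> 2" "\<epsilon>1 \<le> s\<^sup>2" "\<epsilon>2\<^sup>2 \<le> s\<^sup>2" and \<omega>: "0 < \<omega>"
    and ea: "piecewise_C1 ea" and eb: "piecewise_C1 eb" and S: "finite S"
    and bnd: "\<And>x. x \<in> I01 - S \<Longrightarrow> \<bar>ea x\<bar> \<le> X \<and> \<bar>deriv ea x\<bar> \<le> X / s \<and>
        \<bar>eb x\<bar> \<le> X * exp (- (\<omega> * (s / \<epsilon>1) * (1 - x))) \<and> \<bar>deriv eb x\<bar> \<le> X * (s / \<epsilon>1) * exp (- (\<omega> * (s / \<epsilon>1) * (1 - x)))"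
  shows "integral\<^sup>L M01 (\<lambda>x. \<epsilon>1 * (deriv ea x + deriv eb x)\<^sup>2
      + (ea x + eb x)\<^sup>2 + \<epsilon>2\<^sup>2 * (deriv ea x)\<^sup>2 + \<epsilon>2\<^sup>2 / \<epsilon>1 * (eb x)\<^sup>2) \<le> X\<^sup>2 * (7 + 3 / \<omega>)"
proof -
  define \<Lambda> where "\<Lambda> = s / \<epsilon>1"
  have \<Lambda>: "0 < \<Lambda>" using eps by (simp add: \<Lambda>_def)
  define k where "k = 2 * \<omega> * \<Lambda>"
  have k: "0 < k" using \<Lambda> \<omega> by (simp add: k_def)
  define q where "q x = exp (- (k * (1 - x)))" for x
  have qb: "bounded_measurable q" unfolding q_def by (intro bm_continuous continuous_intros)
  have qi: "integral\<^sup>L M01 q \<le> 1 / k"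
  proof -
    have "integral\<^sup>L M01 q = exp (- (k * (1 - 1))) / k - exp (- (k * (1 - 0))) / k"
    proof (rule integral_derivative_M01[of "{}" "\<lambda>x. exp (- (k * (1 - x))) / k"])
      show "continuous_on {0..1} (\<lambda>x. exp (- (k * (1 - x))) / k)" using k by (intro continuous_intros) auto
      show "((\<lambda>x. exp (- (k * (1 - x))) / k) has_real_derivative q x) (at x)" for x
        unfolding q_def using k by (auto intro!: derivative_eq_intros)
    qed (use qb in auto)
    also have "\<dots> \<le> exp (- (k * (1 - 1))) / k" using k by simp
    finally show ?thesis by simp
  qed
  have "integral\<^sup>L M01 (\<lambda>x. \<epsilon>1 * (deriv ea x + deriv eb x)\<^sup>2
      + (ea x + eb x)\<^sup>2 + \<epsilon>2\<^sup>2 * (deriv ea x)\<^sup>2 + \<epsilon>2\<^sup>2 / \<epsilon>1 * (eb x)\<^sup>2) \<le> integral\<^sup>L M01 (\<lambda>x. 7 * X\<^sup>2 + 6 * \<Lambda> * X\<^sup>2 * q x)"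
  proof (rule integral_mono_AE)
    note bms = bm_intros qb ea[THEN piecewise_C1_bm] eb[THEN piecewise_C1_bm] ea[THEN piecewise_C1_deriv_bm] eb[THEN piecewise_C1_deriv_bm]
    show "integrable M01 (\<lambda>x. \<epsilon>1 * (deriv ea x + deriv eb x)\<^sup>2
      + (ea x + eb x)\<^sup>2 + \<epsilon>2\<^sup>2 * (deriv ea x)\<^sup>2 + \<epsilon>2\<^sup>2 / \<epsilon>1 * (eb x)\<^sup>2)" "integrable M01 (\<lambda>x. 7 * X\<^sup>2 + 6 * \<Lambda> * X\<^sup>2 * q x)"
      by (intro bm_integrable bms)+
    show "AE x in M01. \<epsilon>1 * (deriv ea x + deriv eb x)\<^sup>2
      + (ea x + eb x)\<^sup>2 + \<epsilon>2\<^sup>2 * (deriv ea x)\<^sup>2 + \<epsilon>2\<^sup>2 / \<epsilon>1 * (eb x)\<^sup>2 \<le> 7 * X\<^sup>2 + 6 * \<Lambda> * X\<^sup>2 * q x"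
      using AE_M01_off_finite[OF S] AE_space[of M01]
    proof eventually_elim
      case (elim x)
      then have x: "x \<in> I01" "x \<in> I01 - S" by auto
      have q: "(exp (- (\<omega> * \<Lambda> * (1 - x))))\<^sup>2 = q x" unfolding q_def k_def by (simp add: exp_double[symmetric])
      have q01: "0 < q x" "q x \<le> 1" using x k by (auto simp: q_def)
      have sqle: "y\<^sup>2 \<le> t\<^sup>2" if "\<bar>y\<bar> \<le> t" for y t :: real using that by (simp add: abs_le_square_iff[symmetric])
      have 1: "(ea x)\<^sup>2 \<le> X\<^sup>2" using bnd[OF x(2)] by (intro sqle) auto
      have 2: "(deriv ea x)\<^sup>2 \<le> X\<^sup>2 / s\<^sup>2" using sqle[of "deriv ea x" "X / s"] bnd[OF x(2)] by (simp add: power_divide)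
      have 3: "(eb x)\<^sup>2 \<le> X\<^sup>2 * q x"
        using sqle[of "eb x" "X * exp (- (\<omega> * \<Lambda> * (1 - x)))"] bnd[OF x(2)] by (simp add: \<Lambda>_def[symmetric] power_mult_distrib q)
      have 4: "(deriv eb x)\<^sup>2 \<le> X\<^sup>2 * \<Lambda>\<^sup>2 * q x"
        using sqle[of "deriv eb x" "X * \<Lambda> * exp (- (\<omega> * \<Lambda> * (1 - x)))"] bnd[OF x(2)] by (simp add: \<Lambda>_def[symmetric] power_mult_distrib q)
      have sq: "(s + t)\<^sup>2 \<le> 2 * s\<^sup>2 + 2 * t\<^sup>2" for s t :: real
        using zero_le_power2[of "s - t"] by (simp add: power2_eq_square algebra_simps)
      have ss: "s\<^sup>2 / \<epsilon>1 \<le> 2 * \<Lambda>" "\<epsilon>1 * \<Lambda>\<^sup>2 = s\<^sup>2 / \<epsilon>1"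
        using eps by (auto simp: \<Lambda>_def power2_eq_square field_simps)
      have a: "\<epsilon>1 * (deriv ea x)\<^sup>2 \<le> X\<^sup>2" "\<epsilon>2\<^sup>2 * (deriv ea x)\<^sup>2 \<le> X\<^sup>2"
      proof -
        have *: "t * (deriv ea x)\<^sup>2 \<le> X\<^sup>2" if "t \<le> s\<^sup>2" for t
        proof -
          have "t * (deriv ea x)\<^sup>2 \<le> s\<^sup>2 * (X\<^sup>2 / s\<^sup>2)" using that 2 by (intro mult_mono) auto
          then show ?thesis using eps by simp
        qed
        show "\<epsilon>1 * (deriv ea x)\<^sup>2 \<le> X\<^sup>2" "\<epsilon>2\<^sup>2 * (deriv ea x)\<^sup>2 \<le> X\<^sup>2" by (rule *[OF eps(4)] *[OF eps(5)])+
      qed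
      have bb: "\<epsilon>1 * (deriv eb x)\<^sup>2 \<le> 2 * \<Lambda> * X\<^sup>2 * q x" "\<epsilon>2\<^sup>2 / \<epsilon>1 * (eb x)\<^sup>2 \<le> 2 * \<Lambda> * X\<^sup>2 * q x"
      proof -
        have "\<epsilon>1 * (deriv eb x)\<^sup>2 \<le> \<epsilon>1 * (X\<^sup>2 * \<Lambda>\<^sup>2 * q x)" using 4 eps by (intro mult_left_mono) auto
        also have "\<dots> = (s\<^sup>2 / \<epsilon>1) * (X\<^sup>2 * q x)" unfolding ss(2)[symmetric] by (simp only: mult_ac)
        also have "\<dots> \<le> 2 * \<Lambda> * (X\<^sup>2 * q x)" using ss(1) q01 by (intro mult_right_mono) auto
        finally show "\<epsilon>1 * (deriv eb x)\<^sup>2 \<le> 2 * \<Lambda> * X\<^sup>2 * q x" by (simp only: mult.assoc)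
        have "\<epsilon>2\<^sup>2 / \<epsilon>1 \<le> s\<^sup>2 / \<epsilon>1" using eps by (intro divide_right_mono) auto
        then have "\<epsilon>2\<^sup>2 / \<epsilon>1 * (eb x)\<^sup>2 \<le> 2 * \<Lambda> * (X\<^sup>2 * q x)" using ss(1) 3 eps \<Lambda> by (intro mult_mono) auto
        then show "\<epsilon>2\<^sup>2 / \<epsilon>1 * (eb x)\<^sup>2 \<le> 2 * \<Lambda> * X\<^sup>2 * q x" by (simp only: mult.assoc)
      qed
      have "X\<^sup>2 * q x \<le> X\<^sup>2 * 1" using q01 by (intro mult_left_mono) auto
      then have 5: "(ea x + eb x)\<^sup>2 \<le> 4 * X\<^sup>2" using sq[of "ea x" "eb x"] 1 3 by linarith
      have "\<epsilon>1 * (deriv ea x + deriv eb x)\<^sup>2 \<le> \<epsilon>1 * (2 * (deriv ea x)\<^sup>2 + 2 * (deriv eb x)\<^sup>2)"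
        using sq eps by (intro mult_left_mono) auto
      also have "\<dots> = 2 * (\<epsilon>1 * (deriv ea x)\<^sup>2) + 2 * (\<epsilon>1 * (deriv eb x)\<^sup>2)" by (simp add: algebra_simps)
      also have "\<dots> \<le> 2 * X\<^sup>2 + 2 * (2 * \<Lambda> * X\<^sup>2 * q x)" using a bb by linarith
      finally show ?case using 5 a(2) bb(2) by linarith
    qed
  qed
  also have "\<dots> = 7 * X\<^sup>2 + 6 * \<Lambda> * X\<^sup>2 * integral\<^sup>L M01 q"
  proof -
    have i: "integrable M01 (\<lambda>x. 7 * X\<^sup>2)" "integrable M01 (\<lambda>x. 6 * \<Lambda> * X\<^sup>2 * q x)" by (intro bm_integrable bm_intros qb)+
    have "integral\<^sup>L M01 (\<lambda>x. 7 * X\<^sup>2) = 7 * X\<^sup>2" by (simp add: measure_restrict_space)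
    then show ?thesis by (simp only: Bochner_Integration.integral_add[OF i] integral_mult_right_zero)
  qed
  also have "\<dots> \<le> 7 * X\<^sup>2 + 6 * \<Lambda> * X\<^sup>2 * (1 / k)" using qi \<Lambda> by (intro add_left_mono mult_left_mono) auto
  also have "\<dots> = X\<^sup>2 * (7 + 3 / \<omega>)" unfolding k_def using \<Lambda> \<omega> by (simp add: field_simps)
  finally show ?thesis .
qed

lemma layer_phase_mono:
  assumes M: "layer_phase W c A \<mu> M" and "A \<le> A'" "0 \<le> \<mu>"
  shows "layer_phase W c A' \<mu> M"
proof -
  obtain m where "M 0 = 0" and m: "\<And>z. z \<in> W \<Longrightarrow> (M has_field_derivative m z) (at z) \<and> c * \<mu> \<le> Re (m z) \<and> cmod (m z) \<le> A * \<mu>"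
    using M unfolding layer_phase_def by blast
  have "A * \<mu> \<le> A' * \<mu>" using assms by (intro mult_right_mono)
  then show ?thesis unfolding layer_phase_def using \<open>M 0 = 0\<close> m by (intro conjI exI[of _ m]) (auto intro: order_trans)
qed

context holomorphic_coefficients
begin

lemma layer_holomorphic:
  assumes M: "layer_phase W c' A \<mu> M"
  shows "(\<lambda>z. \<alpha> * exp (- M z)) holomorphic_on W" "(\<lambda>z. \<alpha> * exp (- M (1 - z))) holomorphic_on W"
proof -
  obtain m where m: "\<And>z. z \<in> W \<Longrightarrow> (M has_field_derivative m z) (at z)"
    using M unfolding layer_phase_def by blast
  have h: "M holomorphic_on W" unfolding holomorphic_on_def field_differentiable_def
    using m by (blast intro: has_field_derivative_at_within)
  show "(\<lambda>z. \<alpha> * exp (- M z)) holomorphic_on W" by (intro holomorphic_intros h)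
  have "(M \<circ> (\<lambda>z. 1 - z)) holomorphic_on W"
    by (rule holomorphic_on_compose_gen[of _ _ _ W]) (auto intro!: holomorphic_intros h simp: rhombus_reflect)
  then show "(\<lambda>z. \<alpha> * exp (- M (1 - z))) holomorphic_on W"
    by (intro holomorphic_intros) (simp add: o_def)
qed

text \<open>The left layer joins the smooth part: both have derivative errors of order \<open>1 / s\<close>. The right layer is
  approximated as a left layer and reflected. Nodal exactness makes \<open>z\<close> vanish at the end points.\<close>

theorem quasi_interpolant:
  assumes \<kappa>: "0 < \<kappa>"
  shows "\<exists>C \<sigma> \<omega>'. 0 < C \<and> 0 < \<sigma> \<and> 0 < \<omega>' \<and> (\<forall>\<epsilon>1 \<epsilon>2 p \<Delta> u. 0 < \<epsilon>1 \<and> \<epsilon>1 < \<epsilon>2 \<and> \<epsilon>2 \<le> 1 \<and> 1 \<le> p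
      \<and> SBL_mesh \<epsilon>1 \<epsilon>2 b c \<kappa> p = Some \<Delta> \<and> is_BVP_solution \<epsilon>1 \<epsilon>2 b c f u \<longrightarrow>
     (\<exists>h0 h1 z ea eb S. mesh_widths h0 h1 \<and> \<Delta> = {0, h0, 1 - h1, 1} \<and> mesh_poly h0 h1 p z \<and> z 0 = 0 \<and> z 1 = 0 \<and>
       piecewise_C1 ea \<and> piecewise_C1 eb \<and> (\<forall>x\<in>{0..1}. u x = z x + ea x + eb x) \<and> finite S \<and>
       (\<forall>x\<in>I01 - S. \<bar>ea x\<bar> \<le> C * exp (- \<sigma> * real p) \<and> \<bar>deriv ea x\<bar> \<le> C * exp (- \<sigma> * real p) / scale \<epsilon>1 \<epsilon>2 \<and>
         \<bar>eb x\<bar> \<le> C * exp (- \<sigma> * real p) * exp (- (\<omega>' * (scale \<epsilon>1 \<epsilon>2 / \<epsilon>1) * (1 - x))) \<and>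
         \<bar>deriv eb x\<bar> \<le> C * exp (- \<sigma> * real p) * (scale \<epsilon>1 \<epsilon>2 / \<epsilon>1) * exp (- (\<omega>' * (scale \<epsilon>1 \<epsilon>2 / \<epsilon>1) * (1 - x))))))"
proof -
  obtain A0 \<delta> where A0: "0 < A0" "0 < \<delta>" and dec: "\<forall>\<epsilon>1 \<epsilon>2 u. 0 < \<epsilon>1 \<and> \<epsilon>1 < \<epsilon>2 \<and> \<epsilon>2 \<le> 1 \<and> is_BVP_solution \<epsilon>1 \<epsilon>2 b c f u \<longrightarrow>
     (\<exists>S \<alpha>0 \<alpha>1 M0 M1. S holomorphic_on W \<and> (\<forall>z\<in>W. cmod (S z) \<le> A0) \<and> cmod \<alpha>0 \<le> A0 \<and> cmod \<alpha>1 \<le> A0 \<and>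
        layer_phase W \<delta> A0 (1 / scale \<epsilon>1 \<epsilon>2) M0 \<and> layer_phase W \<delta> A0 (scale \<epsilon>1 \<epsilon>2 / \<epsilon>1) M1 \<and>
        (\<forall>x\<in>{0..1}. u x = Re (S (of_real x) + \<alpha>0 * exp (- M0 (of_real x)) + \<alpha>1 * exp (- M1 (1 - of_real x)))))"
    using solution_decomposition by (elim exE conjE) (rule that)
  \<comment> \<open>enlarged so that the lower constant of the layer phases does not exceed the upper one\<close>
  define A where "A = A0 + \<delta>"
  have A: "0 < A" "A0 \<le> A" "\<delta> \<le> A" using A0 by (auto simp: A_def)
  obtain K1 K2 where K12: "0 < K1" "0 < K2" and widths: "\<forall>\<epsilon>1 \<epsilon>2 p \<Delta>. 0 < \<epsilon>1 \<and> \<epsilon>1 < \<epsilon>2 \<and> \<epsilon>2 \<le> 1 \<and> 1 \<le> p \<and> SBL_mesh \<epsilon>1 \<epsilon>2 b c \<kappa> p = Some \<Delta> \<longrightarrow>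
    (\<exists>h0 h1. mesh_widths h0 h1 \<and> \<Delta> = {0, h0, 1 - h1, 1} \<and>
       1 / scale \<epsilon>1 \<epsilon>2 * h0 \<le> K2 * real p \<and> scale \<epsilon>1 \<epsilon>2 / \<epsilon>1 * h1 \<le> K2 * real p \<and>
       (h0 = 1 \<or> K1 * real p \<le> 1 / scale \<epsilon>1 \<epsilon>2 * h0) \<and> (h1 = 1 \<or> K1 * real p \<le> scale \<epsilon>1 \<epsilon>2 / \<epsilon>1 * h1))"
    using SBL_mesh_widths[OF \<kappa>] by (elim exE conjE) (rule that)
  obtain Cs \<sigma>s where Cs: "0 < Cs" "0 < \<sigma>s" and smooth: "\<forall>S h0 h1 p. S holomorphic_on W \<and> (\<forall>z\<in>W. cmod (S z) \<le> A) \<and> mesh_widths h0 h1 \<and> 1 \<le> p \<longrightarrow>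
     (\<exists>Z. mesh_poly h0 h1 p Z \<and> Z 0 = Re (S 0) \<and> Z 1 = Re (S 1) \<and>
       (\<forall>x\<in>I01 - {h0, 1 - h1}. \<bar>deriv (\<lambda>x. Re (S (of_real x))) x - deriv Z x\<bar> \<le> Cs * exp (- \<sigma>s * real p)
          \<and> \<bar>Re (S (of_real x)) - Z x\<bar> \<le> Cs * exp (- \<sigma>s * real p)))"
    using smooth_approximation[OF ok A(1)] by (elim exE conjE) (rule that)
  obtain Cl \<sigma>l \<omega>l where Cl: "0 < Cl" "0 < \<sigma>l" "0 < \<omega>l" and layer: "\<forall>M \<mu> h p \<alpha>. layer_phase W \<delta> A \<mu> M \<and> 1/2 \<le> \<mu> \<and> \<mu> * h \<le> K2 * real p
      \<and> 1 \<le> p \<and> cmod \<alpha> \<le> A \<and> (h = 1 \<or> 0 < h \<and> h \<le> 1/2 \<and> K1 * real p \<le> \<mu> * h) \<longrightarrow>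
     (\<exists>Z. continuous_on {0..1} Z \<and> Z 0 = Re (\<alpha> * exp (- M 0)) \<and> Z 1 = Re (\<alpha> * exp (- M 1)) \<and>
       (\<exists>q. degree q \<le> p \<and> (\<forall>x\<in>{0..h}. Z x = poly q x)) \<and> (\<exists>q. degree q \<le> p \<and> (\<forall>x\<in>{h..1}. Z x = poly q x)) \<and>
       (\<forall>x\<in>I01 - {h}. \<bar>deriv (\<lambda>x. Re (\<alpha> * exp (- M (of_real x)))) x - deriv Z x\<bar> \<le> Cl * \<mu> * exp (- \<sigma>l * real p) * exp (- \<omega>l * \<mu> * x)
          \<and> \<bar>Re (\<alpha> * exp (- M (of_real x))) - Z x\<bar> \<le> Cl * exp (- \<sigma>l * real p) * exp (- \<omega>l * \<mu> * x)))"
    using layer_approximation[OF ok A0(2) A(3) K12] by (elim exE conjE) (rule that)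
  define C' \<sigma> where "C' = 2 * Cs + Cl" and "\<sigma> = min \<sigma>s \<sigma>l"
  have C': "0 < C'" "0 < \<sigma>" using Cs Cl by (auto simp: C'_def \<sigma>_def)
  have main: "\<exists>h0 h1 z ea eb S. mesh_widths h0 h1 \<and> \<Delta> = {0, h0, 1 - h1, 1} \<and> mesh_poly h0 h1 p z \<and> z 0 = 0 \<and> z 1 = 0 \<and>
       piecewise_C1 ea \<and> piecewise_C1 eb \<and> (\<forall>x\<in>{0..1}. u x = z x + ea x + eb x) \<and> finite S \<and>
       (\<forall>x\<in>I01 - S. \<bar>ea x\<bar> \<le> C' * exp (- \<sigma> * real p) \<and> \<bar>deriv ea x\<bar> \<le> C' * exp (- \<sigma> * real p) / scale \<epsilon>1 \<epsilon>2 \<and>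
         \<bar>eb x\<bar> \<le> C' * exp (- \<sigma> * real p) * exp (- (\<omega>l * (scale \<epsilon>1 \<epsilon>2 / \<epsilon>1) * (1 - x))) \<and>
         \<bar>deriv eb x\<bar> \<le> C' * exp (- \<sigma> * real p) * (scale \<epsilon>1 \<epsilon>2 / \<epsilon>1) * exp (- (\<omega>l * (scale \<epsilon>1 \<epsilon>2 / \<epsilon>1) * (1 - x))))"
    if eps: "0 < \<epsilon>1" "\<epsilon>1 < \<epsilon>2" "\<epsilon>2 \<le> 1" and p: "1 \<le> p" and mesh: "SBL_mesh \<epsilon>1 \<epsilon>2 b c \<kappa> p = Some \<Delta>"
      and u: "is_BVP_solution \<epsilon>1 \<epsilon>2 b c f u" for \<epsilon>1 \<epsilon>2 p \<Delta> u
  proof -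
    define s where "s = scale \<epsilon>1 \<epsilon>2"
    define \<Lambda> where "\<Lambda> = s / \<epsilon>1"
    note sb = scale_bounds[OF eps, folded s_def]
    have \<mu>: "1/2 \<le> 1 / s" "1/2 \<le> \<Lambda>" "0 < \<Lambda>"
    proof -
      show "1/2 \<le> 1 / s" "0 < \<Lambda>" using sb eps by (auto simp: \<Lambda>_def field_simps)
      have "1 \<le> \<Lambda>" using sb(5) eps by (simp add: \<Lambda>_def)
      then show "1/2 \<le> \<Lambda>" by simp
    qed
    obtain S0 \<alpha>0 \<alpha>1 M0 M1 where S0: "S0 holomorphic_on W" "\<forall>z\<in>W. cmod (S0 z) \<le> A0" and \<alpha>: "cmod \<alpha>0 \<le> A0" "cmod \<alpha>1 \<le> A0"
      and M: "layer_phase W \<delta> A0 (1 / s) M0" "layer_phase W \<delta> A0 \<Lambda> M1"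
      and ux: "\<forall>x\<in>{0..1}. u x = Re (S0 (of_real x) + \<alpha>0 * exp (- M0 (of_real x)) + \<alpha>1 * exp (- M1 (1 - of_real x)))"
      using dec[rule_format, OF conjI[OF eps(1) conjI[OF eps(2) conjI[OF eps(3) u]]], folded s_def, folded \<Lambda>_def]
      by (elim exE conjE) (rule that)
    obtain h0 h1 where h: "mesh_widths h0 h1" and \<Delta>: "\<Delta> = {0, h0, 1 - h1, 1}"
      and hK: "1 / s * h0 \<le> K2 * real p" "\<Lambda> * h1 \<le> K2 * real p" "h0 = 1 \<or> K1 * real p \<le> 1 / s * h0" "h1 = 1 \<or> K1 * real p \<le> \<Lambda> * h1"
      using widths[rule_format, OF conjI[OF eps(1) conjI[OF eps(2) conjI[OF eps(3) conjI[OF p mesh]]]], folded s_def, folded \<Lambda>_def]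
      by (elim exE conjE) (rule that)
    have h': "mesh_widths h1 h0" using h by (auto simp: mesh_widths_def)
    have A': "\<forall>z\<in>W. cmod (S0 z) \<le> A" "cmod \<alpha>0 \<le> A" "cmod \<alpha>1 \<le> A" using S0 \<alpha> A by force+
    have M': "layer_phase W \<delta> A (1 / s) M0" "layer_phase W \<delta> A \<Lambda> M1"
      by (rule layer_phase_mono[OF M(1) A(2)] layer_phase_mono[OF M(2) A(2)], use \<mu> in linarith)+
    have cond: "h0 = 1 \<or> 0 < h0 \<and> h0 \<le> 1/2 \<and> K1 * real p \<le> 1 / s * h0" "h1 = 1 \<or> 0 < h1 \<and> h1 \<le> 1/2 \<and> K1 * real p \<le> \<Lambda> * h1"
      using h hK unfolding mesh_widths_def by auto
    obtain Zs where Zs: "mesh_poly h0 h1 p Zs" "Zs 0 = Re (S0 0)" "Zs 1 = Re (S0 1)"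
      and Zse: "\<forall>x\<in>I01 - {h0, 1 - h1}. \<bar>deriv (\<lambda>x. Re (S0 (of_real x))) x - deriv Zs x\<bar> \<le> Cs * exp (- \<sigma>s * real p)
          \<and> \<bar>Re (S0 (of_real x)) - Zs x\<bar> \<le> Cs * exp (- \<sigma>s * real p)"
      using smooth[rule_format, OF conjI[OF S0(1) conjI[OF A'(1) conjI[OF h p]]]] by (elim exE conjE) (rule that)
    define vs where "vs = (\<lambda>x. Re (S0 (complex_of_real x)))"
    define v0 where "v0 = (\<lambda>x. Re (\<alpha>0 * exp (- M0 (complex_of_real x))))"
    define v1 where "v1 = (\<lambda>x. Re (\<alpha>1 * exp (- M1 (complex_of_real x))))"
    obtain Z0 where "continuous_on {0..1} Z0 \<and> Z0 0 = Re (\<alpha>0 * exp (- M0 0)) \<and> Z0 1 = Re (\<alpha>0 * exp (- M0 1)) \<and>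
       (\<exists>q. degree q \<le> p \<and> (\<forall>x\<in>{0..h0}. Z0 x = poly q x)) \<and> (\<exists>q. degree q \<le> p \<and> (\<forall>x\<in>{h0..1}. Z0 x = poly q x)) \<and>
       (\<forall>x\<in>I01 - {h0}. \<bar>deriv v0 x - deriv Z0 x\<bar> \<le> Cl * (1 / s) * exp (- \<sigma>l * real p) * exp (- \<omega>l * (1 / s) * x)
          \<and> \<bar>v0 x - Z0 x\<bar> \<le> Cl * exp (- \<sigma>l * real p) * exp (- \<omega>l * (1 / s) * x))"
      using layer[rule_format, OF conjI[OF M'(1) conjI[OF \<mu>(1) conjI[OF hK(1) conjI[OF p conjI[OF A'(2) cond(1)]]]]]]
      by (elim exE) (rule that[unfolded v0_def])
    then have Z0: "continuous_on {0..1} Z0" "Z0 0 = Re (\<alpha>0 * exp (- M0 0))" "Z0 1 = Re (\<alpha>0 * exp (- M0 1))"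
       "\<exists>q. degree q \<le> p \<and> (\<forall>x\<in>{0..h0}. Z0 x = poly q x)" "\<exists>q. degree q \<le> p \<and> (\<forall>x\<in>{h0..1}. Z0 x = poly q x)"
      and Z0e: "\<forall>x\<in>I01 - {h0}. \<bar>deriv v0 x - deriv Z0 x\<bar> \<le> Cl * (1 / s) * exp (- \<sigma>l * real p) * exp (- \<omega>l * (1 / s) * x)
          \<and> \<bar>v0 x - Z0 x\<bar> \<le> Cl * exp (- \<sigma>l * real p) * exp (- \<omega>l * (1 / s) * x)"
      by - (elim conjE; assumption)+
    obtain Z1 where "continuous_on {0..1} Z1 \<and> Z1 0 = Re (\<alpha>1 * exp (- M1 0)) \<and> Z1 1 = Re (\<alpha>1 * exp (- M1 1)) \<and>
       (\<exists>q. degree q \<le> p \<and> (\<forall>x\<in>{0..h1}. Z1 x = poly q x)) \<and> (\<exists>q. degree q \<le> p \<and> (\<forall>x\<in>{h1..1}. Z1 x = poly q x)) \<and>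
       (\<forall>x\<in>I01 - {h1}. \<bar>deriv v1 x - deriv Z1 x\<bar> \<le> Cl * \<Lambda> * exp (- \<sigma>l * real p) * exp (- \<omega>l * \<Lambda> * x)
          \<and> \<bar>v1 x - Z1 x\<bar> \<le> Cl * exp (- \<sigma>l * real p) * exp (- \<omega>l * \<Lambda> * x))"
      using layer[rule_format, OF conjI[OF M'(2) conjI[OF \<mu>(2) conjI[OF hK(2) conjI[OF p conjI[OF A'(3) cond(2)]]]]]]
      by (elim exE) (rule that[unfolded v1_def])
    then have Z1: "continuous_on {0..1} Z1" "Z1 0 = Re (\<alpha>1 * exp (- M1 0))" "Z1 1 = Re (\<alpha>1 * exp (- M1 1))"
       "\<exists>q. degree q \<le> p \<and> (\<forall>x\<in>{0..h1}. Z1 x = poly q x)" "\<exists>q. degree q \<le> p \<and> (\<forall>x\<in>{h1..1}. Z1 x = poly q x)"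
      and Z1e: "\<forall>x\<in>I01 - {h1}. \<bar>deriv v1 x - deriv Z1 x\<bar> \<le> Cl * \<Lambda> * exp (- \<sigma>l * real p) * exp (- \<omega>l * \<Lambda> * x)
          \<and> \<bar>v1 x - Z1 x\<bar> \<le> Cl * exp (- \<sigma>l * real p) * exp (- \<omega>l * \<Lambda> * x)"
      by - (elim conjE; assumption)+
    have m0: "mesh_poly h0 h1 p Z0" by (rule mesh_poly_left[OF h Z0(1,4,5)])
    have m1: "mesh_poly h1 h0 p Z1" by (rule mesh_poly_left[OF h' Z1(1,4,5)])
    have m1': "mesh_poly h0 h1 p (\<lambda>x. Z1 (1 - x))" by (rule mesh_poly_reflect[OF m1 h])
    note pZ = mesh_poly_piecewise_C1[OF Zs(1) h] mesh_poly_piecewise_C1[OF m0 h] mesh_poly_piecewise_C1[OF m1 h'] mesh_poly_piecewise_C1[OF m1' h]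
    have pv: "piecewise_C1 vs" "piecewise_C1 v0" "piecewise_C1 v1" "piecewise_C1 (\<lambda>x. v1 (1 - x))"
      using real_trace_piecewise_C1[OF S0(1)] real_trace_piecewise_C1[OF layer_holomorphic(1)[OF M(1), of \<alpha>0]]
        real_trace_piecewise_C1[OF layer_holomorphic(1)[OF M(2), of \<alpha>1]] real_trace_piecewise_C1[OF layer_holomorphic(2)[OF M(2), of \<alpha>1]]
      by (simp_all add: vs_def v0_def v1_def)
    define z where "z = (\<lambda>x. (Zs x + 1 * Z0 x) + 1 * Z1 (1 - x))"
    define ea where "ea = (\<lambda>x. (vs x + (-1) * Zs x) + 1 * (v0 x + (-1) * Z0 x))"
    define eb where "eb = (\<lambda>x. v1 (1 - x) + (-1) * Z1 (1 - x))"
    have zm: "mesh_poly h0 h1 p z" unfolding z_def by (intro mesh_poly_lincomb Zs m0 m1')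
    have ea: "piecewise_C1 ea" unfolding ea_def by (intro piecewise_C1_lincomb pv pZ)
    have eb: "piecewise_C1 eb" unfolding eb_def by (intro piecewise_C1_lincomb(1) pv pZ)
    have usplit: "u x = vs x + v0 x + v1 (1 - x)" if "x \<in> {0..1}" for x
      using ux that by (simp add: vs_def v0_def v1_def)
    then have split: "\<forall>x\<in>{0..1}. u x = z x + ea x + eb x" by (simp add: z_def ea_def eb_def)
    have uend: "u 0 = 0" "u 1 = 0" using u by (auto simp: is_BVP_solution_def)
    have zend: "z 0 = 0" "z 1 = 0"
      using usplit[of 0] usplit[of 1] uend Zs(2,3) Z0(2,3) Z1(2,3) by (simp_all add: z_def vs_def v0_def v1_def)
    obtain S1 where S1: "finite S1" "\<And>x. x \<in> I01 - S1 \<Longrightarrow> (vs has_real_derivative deriv vs x) (at x)"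
      using piecewise_C1_deriv[OF pv(1)] by blast
    obtain S2 where S2: "finite S2" "\<And>x. x \<in> I01 - S2 \<Longrightarrow> (v0 has_real_derivative deriv v0 x) (at x)"
      using piecewise_C1_deriv[OF pv(2)] by blast
    obtain S3 where S3: "finite S3" "\<And>x. x \<in> I01 - S3 \<Longrightarrow> (v1 has_real_derivative deriv v1 x) (at x)"
      using piecewise_C1_deriv[OF pv(3)] by blast
    obtain S4 where S4: "finite S4" "\<And>x. x \<in> I01 - S4 \<Longrightarrow> (Zs has_real_derivative deriv Zs x) (at x)"
      using piecewise_C1_deriv[OF pZ(1)] by blast
    obtain S5 where S5: "finite S5" "\<And>x. x \<in> I01 - S5 \<Longrightarrow> (Z0 has_real_derivative deriv Z0 x) (at x)"
      using piecewise_C1_deriv[OF pZ(2)] by blast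
    obtain S6 where S6: "finite S6" "\<And>x. x \<in> I01 - S6 \<Longrightarrow> (Z1 has_real_derivative deriv Z1 x) (at x)"
      using piecewise_C1_deriv[OF pZ(3)] by blast
    define S where "S = S1 \<union> S2 \<union> S4 \<union> S5 \<union> {h0, 1 - h1} \<union> (\<lambda>x. 1 - x) ` (S3 \<union> S6 \<union> {h1})"
    have S: "finite S" using S1 S2 S3 S4 S5 S6 by (simp add: S_def)
    define E where "E = exp (- \<sigma> * real p)"
    have Es: "exp (- \<sigma>s * real p) \<le> E" "exp (- \<sigma>l * real p) \<le> E" "0 < E"
      unfolding E_def by (auto simp: \<sigma>_def intro!: mult_right_mono)
    have err: "\<bar>ea x\<bar> \<le> C' * E \<and> \<bar>deriv ea x\<bar> \<le> C' * E / s \<and> \<bar>eb x\<bar> \<le> C' * E * exp (- (\<omega>l * \<Lambda> * (1 - x))) \<and>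
         \<bar>deriv eb x\<bar> \<le> C' * E * \<Lambda> * exp (- (\<omega>l * \<Lambda> * (1 - x)))" if x: "x \<in> I01 - S" for x
    proof -
      define y where "y = 1 - x"
      have "y \<notin> S3 \<union> S6 \<union> {h1}"
      proof
        assume "y \<in> S3 \<union> S6 \<union> {h1}"
        then have "1 - y \<in> (\<lambda>x. 1 - x) ` (S3 \<union> S6 \<union> {h1})" by (rule imageI)
        then show False using x unfolding S_def y_def by simp
      qed
      then have xx: "x \<in> I01" "x \<notin> S1" "x \<notin> S2" "x \<notin> S4" "x \<notin> S5" "x \<notin> {h0, 1 - h1}" and yy: "y \<in> I01" "y \<notin> S3" "y \<notin> S6" "y \<noteq> h1"
        using x unfolding S_def by (auto simp: y_def)
      have dea: "deriv ea x = (deriv vs x + (-1) * deriv Zs x) + 1 * (deriv v0 x + (-1) * deriv Z0 x)"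
        unfolding ea_def by (rule DERIV_imp_deriv, intro DERIV_add DERIV_cmult S1(2) S2(2) S4(2) S5(2)) (use xx in auto)
      have rf: "((\<lambda>x. g (1 - x)) has_real_derivative - g') (at x)" if "(g has_real_derivative g') (at y)" for g g'
      proof -
        have "((\<lambda>x. 1 - x) has_real_derivative -1) (at x)" by (auto intro!: derivative_eq_intros)
        from DERIV_chain2[OF that[unfolded y_def] this] show ?thesis by simp
      qed
      have deb: "deriv eb x = - deriv v1 y + (-1) * (- deriv Z1 y)"
        unfolding eb_def by (rule DERIV_imp_deriv, intro DERIV_add DERIV_cmult rf S3(2) S6(2)) (use yy in auto)
      have w: "exp (- \<omega>l * (1 / s) * x) \<le> 1" using Cl sb xx by simp
      have es: "\<bar>deriv vs x - deriv Zs x\<bar> \<le> Cs * E" "\<bar>vs x - Zs x\<bar> \<le> Cs * E"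
      proof -
        have "Cs * exp (- \<sigma>s * real p) \<le> Cs * E" using Cs Es by (intro mult_left_mono) auto
        then show "\<bar>deriv vs x - deriv Zs x\<bar> \<le> Cs * E" "\<bar>vs x - Zs x\<bar> \<le> Cs * E"
          using Zse[folded vs_def] xx(1,6) by (auto simp: vs_def intro: order_trans)
      qed
      have e0: "\<bar>deriv v0 x - deriv Z0 x\<bar> \<le> Cl * E / s" "\<bar>v0 x - Z0 x\<bar> \<le> Cl * E"
      proof -
        have a: "exp (- \<sigma>l * real p) * exp (- \<omega>l * (1 / s) * x) \<le> E * 1" using w Es by (intro mult_mono) auto
        have "Cl * (1 / s) * (exp (- \<sigma>l * real p) * exp (- \<omega>l * (1 / s) * x)) \<le> Cl * (1 / s) * (E * 1)"
          "Cl * (exp (- \<sigma>l * real p) * exp (- \<omega>l * (1 / s) * x)) \<le> Cl * (E * 1)"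
          using a Cl sb by (intro mult_left_mono; simp)+
        moreover have "\<bar>deriv v0 x - deriv Z0 x\<bar> \<le> Cl * (1 / s) * exp (- \<sigma>l * real p) * exp (- \<omega>l * (1 / s) * x)"
          "\<bar>v0 x - Z0 x\<bar> \<le> Cl * exp (- \<sigma>l * real p) * exp (- \<omega>l * (1 / s) * x)" using Z0e xx(1,6) by auto
        ultimately show "\<bar>deriv v0 x - deriv Z0 x\<bar> \<le> Cl * E / s" "\<bar>v0 x - Z0 x\<bar> \<le> Cl * E"
          by (simp_all add: mult.assoc)
      qed
      have e1: "\<bar>deriv v1 y - deriv Z1 y\<bar> \<le> C' * E * \<Lambda> * exp (- (\<omega>l * \<Lambda> * y))" "\<bar>v1 y - Z1 y\<bar> \<le> C' * E * exp (- (\<omega>l * \<Lambda> * y))"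
      proof -
        have eq: "Cl * \<Lambda> * t * g = Cl * t * (\<Lambda> * g)" "C' * E * \<Lambda> * g = C' * E * (\<Lambda> * g)" "- \<omega>l * \<Lambda> * y = - (\<omega>l * \<Lambda> * y)" for t g
          by simp_all
        have a: "Cl * exp (- \<sigma>l * real p) \<le> C' * E" using Es Cs Cl by (intro mult_mono) (auto simp: C'_def)
        have "Cl * exp (- \<sigma>l * real p) * (\<Lambda> * exp (- (\<omega>l * \<Lambda> * y))) \<le> C' * E * (\<Lambda> * exp (- (\<omega>l * \<Lambda> * y)))"
          "Cl * exp (- \<sigma>l * real p) * exp (- (\<omega>l * \<Lambda> * y)) \<le> C' * E * exp (- (\<omega>l * \<Lambda> * y))"
          using a \<mu> by (intro mult_right_mono; simp)+
        moreover have "\<bar>deriv v1 y - deriv Z1 y\<bar> \<le> Cl * \<Lambda> * exp (- \<sigma>l * real p) * exp (- \<omega>l * \<Lambda> * y)"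
          "\<bar>v1 y - Z1 y\<bar> \<le> Cl * exp (- \<sigma>l * real p) * exp (- \<omega>l * \<Lambda> * y)" using Z1e yy(1,4) by auto
        ultimately show "\<bar>deriv v1 y - deriv Z1 y\<bar> \<le> C' * E * \<Lambda> * exp (- (\<omega>l * \<Lambda> * y))" "\<bar>v1 y - Z1 y\<bar> \<le> C' * E * exp (- (\<omega>l * \<Lambda> * y))"
          unfolding eq by linarith+
      qed
      have tri: "\<bar>(t1 + (-1) * t2) + 1 * (t3 + (-1) * t4)\<bar> \<le> k1 + k2" if "\<bar>t1 - t2\<bar> \<le> k1" "\<bar>t3 - t4\<bar> \<le> k2" for t1 t2 t3 t4 k1 k2 :: real
        using that abs_triangle_ineq[of "t1 - t2" "t3 - t4"] by simp
      have "Cs * E \<le> 2 * Cs * E / s"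
      proof -
        have "Cs * E * s \<le> Cs * E * 2" using sb Cs Es by (intro mult_left_mono) auto
        then show ?thesis using sb by (simp add: field_simps)
      qed
      then have "\<bar>deriv ea x\<bar> \<le> 2 * Cs * E / s + Cl * E / s" unfolding dea
        by (rule tri[OF order_trans[OF es(1)] e0(1)])
      moreover have "2 * Cs * E / s + Cl * E / s = C' * E / s" by (simp add: C'_def add_divide_distrib distrib_right)
      moreover have "\<bar>ea x\<bar> \<le> C' * E"
      proof -
        have "0 \<le> Cs * E" using Cs Es by simp
        have "\<bar>ea x\<bar> \<le> Cs * E + Cl * E" unfolding ea_def by (rule tri[OF es(2) e0(2)])
        then show ?thesis using \<open>0 \<le> Cs * E\<close> unfolding C'_def distrib_right mult.assoc by linarith
      qed
      moreover have "\<bar>eb x\<bar> = \<bar>v1 y - Z1 y\<bar>" by (simp add: eb_def y_def)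
      moreover have "\<bar>deriv eb x\<bar> = \<bar>deriv v1 y - deriv Z1 y\<bar>" unfolding deb by simp
      ultimately show ?thesis using e1 unfolding y_def by simp
    qed
    show ?thesis unfolding s_def[symmetric] \<Lambda>_def[symmetric] E_def[symmetric]
      by (rule exI[of _ h0], rule exI[of _ h1], rule exI[of _ z], rule exI[of _ ea], rule exI[of _ eb], rule exI[of _ S])
        (use h \<Delta> zm zend ea eb split S err in \<open>auto simp only:\<close>)
  qed
  show ?thesis
    by (rule exI[of _ C'], rule exI[of _ \<sigma>], rule exI[of _ \<omega>l]) (use main C' Cl in simp)
qed

end

lemma FE_space_degree_zero:
  assumes v: "v \<in> FE_space {0, 1} 0" and x: "x \<in> {0..1}"
  shows "v x = 0"
proof -
  have h: "mesh_widths 1 1" by (simp add: mesh_widths_def)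
  have "v \<in> FE_space {0, 1, 1 - 1, 1} 0" using v by (simp add: insert_commute)
  note m = FE_space_mesh_poly[OF h this]
  obtain q where q: "degree q \<le> 0" "\<And>x. x \<in> {0..1} \<Longrightarrow> v x = poly q x" using m(1) unfolding mesh_poly_def by blast
  obtain a where "q = [:a:]" using q(1) by (metis degree_eq_zeroE le_zero_eq)
  then show ?thesis using q(2)[OF x] q(2)[of 0] m(2) by simp
qed

text \<open>Even the choice of the weak derivative is the same, since the defining property of \<open>is_weak_deriv\<close> only involves integrals over
  the open unit interval.\<close>

lemma energy_norm_cong:
  assumes "\<And>x. x \<in> I01 \<Longrightarrow> v x = w x"
  shows "energy_norm \<epsilon> v = energy_norm \<epsilon> w"
proof -
  have *: "L2_inner v g = L2_inner w g'" if "\<And>x. x \<in> I01 \<Longrightarrow> g x = g' x" for g g'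
    unfolding L2_inner_def by (rule Bochner_Integration.integral_cong) (simp_all add: assms that)
  have "weak_deriv v = weak_deriv w" unfolding weak_deriv_def is_weak_deriv_def by (simp only: *[OF refl])
  moreover have "L2_norm v = L2_norm w" unfolding L2_norm_def by (simp only: *[OF assms])
  ultimately show ?thesis by (simp add: energy_norm_def)
qed

context holomorphic_coefficients
begin

lemma BVP_solution_holomorphic:
  assumes "0 < \<epsilon>1" "\<epsilon>1 < \<epsilon>2" "\<epsilon>2 \<le> 1" "is_BVP_solution \<epsilon>1 \<epsilon>2 b c f u"
  obtains H where "H holomorphic_on W" "\<And>x. x \<in> {0..1} \<Longrightarrow> u x = Re (H (of_real x))"
proof -
  obtain A \<delta> where dec: "\<forall>\<epsilon>1 \<epsilon>2 u. 0 < \<epsilon>1 \<and> \<epsilon>1 < \<epsilon>2 \<and> \<epsilon>2 \<le> 1 \<and> is_BVP_solution \<epsilon>1 \<epsilon>2 b c f u \<longrightarrow>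
     (\<exists>S \<alpha>0 \<alpha>1 M0 M1. S holomorphic_on W \<and> (\<forall>z\<in>W. cmod (S z) \<le> A) \<and> cmod \<alpha>0 \<le> A \<and> cmod \<alpha>1 \<le> A \<and>
        layer_phase W \<delta> A (1 / scale \<epsilon>1 \<epsilon>2) M0 \<and> layer_phase W \<delta> A (scale \<epsilon>1 \<epsilon>2 / \<epsilon>1) M1 \<and>
        (\<forall>x\<in>{0..1}. u x = Re (S (of_real x) + \<alpha>0 * exp (- M0 (of_real x)) + \<alpha>1 * exp (- M1 (1 - of_real x)))))"
    using solution_decomposition by (elim exE conjE) (rule that)
  obtain S \<alpha>0 \<alpha>1 M0 M1 where S: "S holomorphic_on W"
    and M: "layer_phase W \<delta> A (1 / scale \<epsilon>1 \<epsilon>2) M0" "layer_phase W \<delta> A (scale \<epsilon>1 \<epsilon>2 / \<epsilon>1) M1"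
    and u: "\<forall>x\<in>{0..1}. u x = Re (S (of_real x) + \<alpha>0 * exp (- M0 (of_real x)) + \<alpha>1 * exp (- M1 (1 - of_real x)))"
    using dec[rule_format, OF conjI[OF assms(1) conjI[OF assms(2) conjI[OF assms(3,4)]]]] by (elim exE conjE) (rule that)
  show thesis
  proof (rule that)
    show "(\<lambda>z. S z + \<alpha>0 * exp (- M0 z) + \<alpha>1 * exp (- M1 (1 - z))) holomorphic_on W"
      by (intro holomorphic_on_add S layer_holomorphic[OF M(1)] layer_holomorphic[OF M(2)])
  qed (use u in blast)
qed

lemma BVP_solution_weak:
  assumes "0 < \<epsilon>1" "\<epsilon>1 < \<epsilon>2" "\<epsilon>2 \<le> 1" and u: "is_BVP_solution \<epsilon>1 \<epsilon>2 b c f u"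
  shows "piecewise_C1 u" and "\<And>v. piecewise_C1 v \<Longrightarrow> v 0 = 0 \<Longrightarrow> v 1 = 0 \<Longrightarrow>
    integral\<^sup>L M01 (\<lambda>x. \<epsilon>1 * (deriv u x * deriv v x) + \<epsilon>2 * (b x * deriv u x * v x) + c x * u x * v x)
      = integral\<^sup>L M01 (\<lambda>x. f x * v x)"
proof -
  obtain H where H: "H holomorphic_on W" "\<And>x. x \<in> {0..1} \<Longrightarrow> u x = Re (H (of_real x))"
    using BVP_solution_holomorphic[OF assms] by blast
  show "piecewise_C1 u" by (rule BVP_solution_regular(1)[OF u H])
  show "integral\<^sup>L M01 (\<lambda>x. \<epsilon>1 * (deriv u x * deriv v x) + \<epsilon>2 * (b x * deriv u x * v x) + c x * u x * v x)
      = integral\<^sup>L M01 (\<lambda>x. f x * v x)" if "piecewise_C1 v" "v 0 = 0" "v 1 = 0" for v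
    by (rule BVP_solution_regular(2)[OF u H(1)]) (use H(2) that in auto)
qed

lemma real_coefficient_bounds:
  assumes "x \<in> {0..1}" shows "\<bar>b x\<bar> \<le> K" "\<bar>c x\<bar> \<le> K" "\<bar>f x\<bar> \<le> K"
  using bnd[OF W_U[OF real_in_W[OF assms]]] real[OF assms] by simp_all

text \<open>Test the equation with the solution itself.\<close>

lemma energy_stability:
  assumes \<rho>: "0 < \<rho>" and eps: "0 < \<epsilon>1" "\<epsilon>1 < \<epsilon>2" "\<epsilon>2 \<le> 1" and coer: "\<And>x. x \<in> {0..1} \<Longrightarrow> \<rho> \<le> c x - \<epsilon>2 / 2 * deriv01 b x"
    and u: "is_BVP_solution \<epsilon>1 \<epsilon>2 b c f u"
  shows "energy_norm \<epsilon>1 u \<le> sqrt ((1 + 1 / \<rho>) * (K\<^sup>2 / \<rho>))"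
proof -
  note pu = BVP_solution_weak[OF eps u]
  have u0: "u 0 = 0" "u 1 = 0" using u by (auto simp: is_BVP_solution_def)
  note bms = bm_intros coefficients_continuous[THEN bm_continuous] pu(1)[THEN piecewise_C1_bm] pu(1)[THEN piecewise_C1_deriv_bm]
  let ?E = "\<lambda>x. \<epsilon>1 * (deriv u x)\<^sup>2 + \<rho> * (u x)\<^sup>2"
  have "integral\<^sup>L M01 ?E \<le> integral\<^sup>L M01 (\<lambda>x. \<epsilon>1 * (deriv u x * deriv u x) + \<epsilon>2 * (b x * deriv u x * u x) + c x * u x * u x)"
    by (rule coercivity[OF eps(1) coefficients_continuous(1) b_deriv(1,2) coefficients_continuous(2) coer pu(1) u0]) auto
  also have "\<dots> = integral\<^sup>L M01 (\<lambda>x. f x * u x)" by (rule pu(2)[OF pu(1) u0])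
  also have "\<dots> \<le> integral\<^sup>L M01 (\<lambda>x. (1/2) * ?E x + K\<^sup>2 / (2 * \<rho>))"
  proof (rule bm_integral_mono)
    fix x assume x: "x \<in> I01"
    have "\<bar>f x\<bar> \<le> K" using real_coefficient_bounds(3)[of x] x by auto
    then have fK: "(f x)\<^sup>2 \<le> K\<^sup>2" by (simp add: abs_le_square_iff[symmetric])
    have "u x * f x \<le> (2 * \<rho>) * (u x)\<^sup>2 / 4 + (f x)\<^sup>2 / (2 * \<rho>)" using \<rho> by (intro young_product) simp
    also have "(f x)\<^sup>2 / (2 * \<rho>) \<le> K\<^sup>2 / (2 * \<rho>)" using fK \<rho> by (intro divide_right_mono) auto
    finally have "f x * u x \<le> \<rho> * (u x)\<^sup>2 / 2 + K\<^sup>2 / (2 * \<rho>)" by (simp add: mult.commute)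
    moreover have "0 \<le> \<epsilon>1 * (deriv u x)\<^sup>2" using eps by simp
    ultimately show "f x * u x \<le> (1/2) * ?E x + K\<^sup>2 / (2 * \<rho>)" by (simp add: field_simps)
  qed (intro bms)+
  also have "\<dots> = (1/2) * integral\<^sup>L M01 ?E + K\<^sup>2 / (2 * \<rho>)"
  proof -
    have i: "integrable M01 (\<lambda>x. (1/2) * ?E x)" "integrable M01 (\<lambda>x. K\<^sup>2 / (2 * \<rho>))" by (intro bm_integrable bms)+
    have "integral\<^sup>L M01 (\<lambda>x. K\<^sup>2 / (2 * \<rho>)) = K\<^sup>2 / (2 * \<rho>)" by (simp add: measure_restrict_space)
    then show ?thesis by (simp only: Bochner_Integration.integral_add[OF i] integral_mult_right_zero)
  qed
  finally have E: "integral\<^sup>L M01 ?E \<le> K\<^sup>2 / \<rho>" by (simp add: field_simps)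
  have i: "integrable M01 (\<lambda>x. \<epsilon>1 * (deriv u x)\<^sup>2)" "integrable M01 (\<lambda>x. (u x)\<^sup>2)" by (intro bm_integrable bms)+
  have "\<epsilon>1 * integral\<^sup>L M01 (\<lambda>x. (deriv u x)\<^sup>2) + integral\<^sup>L M01 (\<lambda>x. (u x)\<^sup>2)
      = integral\<^sup>L M01 (\<lambda>x. \<epsilon>1 * (deriv u x)\<^sup>2 + (u x)\<^sup>2)"
    by (simp only: Bochner_Integration.integral_add[OF i] integral_mult_right_zero)
  also have "\<dots> \<le> integral\<^sup>L M01 (\<lambda>x. (1 + 1 / \<rho>) * ?E x)"
  proof (rule bm_integral_mono)
    fix x
    have "(1 + 1 / \<rho>) * ?E x = \<epsilon>1 * (deriv u x)\<^sup>2 + (u x)\<^sup>2 + (\<epsilon>1 * (deriv u x)\<^sup>2 / \<rho> + \<rho> * (u x)\<^sup>2)"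
      using \<rho> by (simp add: field_simps)
    moreover have "0 \<le> \<epsilon>1 * (deriv u x)\<^sup>2 / \<rho> + \<rho> * (u x)\<^sup>2" using \<rho> eps by auto
    ultimately show "\<epsilon>1 * (deriv u x)\<^sup>2 + (u x)\<^sup>2 \<le> (1 + 1 / \<rho>) * ?E x" by linarith
  qed (intro bms)+
  also have "\<dots> = (1 + 1 / \<rho>) * integral\<^sup>L M01 ?E" by (rule integral_mult_right_zero)
  also have "\<dots> \<le> (1 + 1 / \<rho>) * (K\<^sup>2 / \<rho>)" using E \<rho> by (intro mult_left_mono) auto
  finally show ?thesis unfolding energy_norm_piecewise_C1[OF pu(1)] by (rule real_sqrt_le_mono)
qed

text \<open>For \<open>p = 0\<close> the mesh is \<open>{0, 1}\<close>, the discrete solution is zero and the claim is the stability of \<open>u\<close>.\<close>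

theorem FEM_error_bound:
  assumes \<kappa>: "0 < \<kappa>" and \<rho>: "0 < \<rho>"
  shows "\<exists>C \<sigma>. 0 < C \<and> 0 < \<sigma> \<and> (\<forall>p \<epsilon>1 \<epsilon>2 \<Delta> u w. 0 < \<epsilon>1 \<and> \<epsilon>1 < \<epsilon>2 \<and> \<epsilon>2 \<le> 1 \<and>
    (\<forall>x\<in>{0..1}. \<rho> \<le> c x - \<epsilon>2 / 2 * deriv01 b x) \<and> SBL_mesh \<epsilon>1 \<epsilon>2 b c \<kappa> p = Some \<Delta> \<and>
    is_BVP_solution \<epsilon>1 \<epsilon>2 b c f u \<and> is_FE_approx \<epsilon>1 \<epsilon>2 b c f \<Delta> p w
    \<longrightarrow> energy_norm \<epsilon>1 (\<lambda>x. u x - w x) \<le> C * exp (- \<sigma> * real p))"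
proof -
  obtain Ca \<sigma> \<omega>a where Ca: "0 < Ca" "0 < \<sigma>" "0 < \<omega>a" and approx: "\<forall>\<epsilon>1 \<epsilon>2 p \<Delta> u. 0 < \<epsilon>1 \<and> \<epsilon>1 < \<epsilon>2 \<and> \<epsilon>2 \<le> 1 \<and> 1 \<le> p
      \<and> SBL_mesh \<epsilon>1 \<epsilon>2 b c \<kappa> p = Some \<Delta> \<and> is_BVP_solution \<epsilon>1 \<epsilon>2 b c f u \<longrightarrow>
     (\<exists>h0 h1 z ea eb S. mesh_widths h0 h1 \<and> \<Delta> = {0, h0, 1 - h1, 1} \<and> mesh_poly h0 h1 p z \<and> z 0 = 0 \<and> z 1 = 0 \<and>
       piecewise_C1 ea \<and> piecewise_C1 eb \<and> (\<forall>x\<in>{0..1}. u x = z x + ea x + eb x) \<and> finite S \<and>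
       (\<forall>x\<in>I01 - S. \<bar>ea x\<bar> \<le> Ca * exp (- \<sigma> * real p) \<and> \<bar>deriv ea x\<bar> \<le> Ca * exp (- \<sigma> * real p) / scale \<epsilon>1 \<epsilon>2 \<and>
         \<bar>eb x\<bar> \<le> Ca * exp (- \<sigma> * real p) * exp (- (\<omega>a * (scale \<epsilon>1 \<epsilon>2 / \<epsilon>1) * (1 - x))) \<and>
         \<bar>deriv eb x\<bar> \<le> Ca * exp (- \<sigma> * real p) * (scale \<epsilon>1 \<epsilon>2 / \<epsilon>1) * exp (- (\<omega>a * (scale \<epsilon>1 \<epsilon>2 / \<epsilon>1) * (1 - x)))))"
    using quasi_interpolant[OF \<kappa>] by (elim exE conjE) (rule that)
  \<comment> \<open>the second term bounds the derivative of \<open>b\<close>, by Cauchy's estimate\<close>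
  define k where "k = K + K / \<omega>"
  define Q where "Q = 2 + 2 * (1 + 1 / \<rho>) * (2 * (1 + k\<^sup>2 + 8 * k\<^sup>2 / \<rho>))"
  have Q: "0 \<le> Q" using \<rho> unfolding Q_def by (intro add_nonneg_nonneg mult_nonneg_nonneg) auto
  define C1 where "C1 = Ca * sqrt (Q * (7 + 3 / \<omega>a))"
  define C2 where "C2 = sqrt ((1 + 1 / \<rho>) * (K\<^sup>2 / \<rho>))"
  have C12: "0 \<le> C1" "0 \<le> C2" using Ca Q \<rho> by (auto simp: C1_def C2_def)
  have bnds: "\<bar>b x\<bar> \<le> k \<and> \<bar>deriv01 b x\<bar> \<le> k \<and> \<bar>c x\<bar> \<le> k" if x: "x \<in> I01" for x
  proof -
    have "0 < K / \<omega>" using K \<omega> by simp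
    then show ?thesis using real_coefficient_bounds[of x] b_deriv(3)[OF x] x K unfolding k_def by fastforce
  qed
  have main: "energy_norm \<epsilon>1 (\<lambda>x. u x - w x) \<le> (C1 + C2 + 1) * exp (- \<sigma> * real p)"
    if eps: "0 < \<epsilon>1" "\<epsilon>1 < \<epsilon>2" "\<epsilon>2 \<le> 1" and coer: "\<forall>x\<in>{0..1}. \<rho> \<le> c x - \<epsilon>2 / 2 * deriv01 b x"
      and mesh: "SBL_mesh \<epsilon>1 \<epsilon>2 b c \<kappa> p = Some \<Delta>" and u: "is_BVP_solution \<epsilon>1 \<epsilon>2 b c f u"
      and w: "is_FE_approx \<epsilon>1 \<epsilon>2 b c f \<Delta> p w" for p \<epsilon>1 \<epsilon>2 \<Delta> u w
  proof (cases "p = 0")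
    case True
    then have \<Delta>: "\<Delta> = {0, 1}" using mesh by (auto simp: SBL_mesh_def)
    have w0: "w x = 0" if "x \<in> {0..1}" for x
      using FE_space_degree_zero[OF _ that] w True \<Delta> by (simp add: is_FE_approx_def)
    have "energy_norm \<epsilon>1 (\<lambda>x. u x - w x) = energy_norm \<epsilon>1 u" by (rule energy_norm_cong) (simp add: w0)
    also have "\<dots> \<le> C2" unfolding C2_def by (rule energy_stability[OF \<rho> eps _ u]) (use coer in blast)
    finally show ?thesis using True C12 by simp
  next
    case False
    then have p: "1 \<le> p" by simp
    obtain h0 h1 z ea eb S where h: "mesh_widths h0 h1" and \<Delta>: "\<Delta> = {0, h0, 1 - h1, 1}" and z: "mesh_poly h0 h1 p z" "z 0 = 0" "z 1 = 0"
      and e: "piecewise_C1 ea" "piecewise_C1 eb" and split: "\<forall>x\<in>{0..1}. u x = z x + ea x + eb x" and S: "finite S"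
      and err: "\<forall>x\<in>I01 - S. \<bar>ea x\<bar> \<le> Ca * exp (- \<sigma> * real p) \<and> \<bar>deriv ea x\<bar> \<le> Ca * exp (- \<sigma> * real p) / scale \<epsilon>1 \<epsilon>2 \<and>
         \<bar>eb x\<bar> \<le> Ca * exp (- \<sigma> * real p) * exp (- (\<omega>a * (scale \<epsilon>1 \<epsilon>2 / \<epsilon>1) * (1 - x))) \<and>
         \<bar>deriv eb x\<bar> \<le> Ca * exp (- \<sigma> * real p) * (scale \<epsilon>1 \<epsilon>2 / \<epsilon>1) * exp (- (\<omega>a * (scale \<epsilon>1 \<epsilon>2 / \<epsilon>1) * (1 - x)))"
      using approx[rule_format, OF conjI[OF eps(1) conjI[OF eps(2) conjI[OF eps(3) conjI[OF p conjI[OF mesh u]]]]]]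
      by (elim exE conjE) (rule that)
    define X where "X = Ca * exp (- \<sigma> * real p)"
    have X: "0 \<le> X" using Ca by (simp add: X_def)
    note pu = BVP_solution_weak[OF eps u]
    have eps': "\<epsilon>1 \<le> 1" "0 < \<epsilon>2" using eps by auto
    have coer': "\<And>x. x \<in> I01 \<Longrightarrow> \<rho> \<le> c x - \<epsilon>2 / 2 * deriv01 b x" using coer by auto
    have split': "\<And>x. x \<in> {0..1} \<Longrightarrow> u x = z x + ea x + eb x" using split by blast
    let ?I = "integral\<^sup>L M01 (\<lambda>x. \<epsilon>1 * (deriv ea x + deriv eb x)\<^sup>2
      + (ea x + eb x)\<^sup>2 + \<epsilon>2\<^sup>2 * (deriv ea x)\<^sup>2 + \<epsilon>2\<^sup>2 / \<epsilon>1 * (eb x)\<^sup>2)"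
    have I: "?I \<le> X\<^sup>2 * (7 + 3 / \<omega>a)"
      by (rule weighted_error_integral[OF eps(1) scale_bounds(1,2,3,7)[OF eps] Ca(3) e S]) (use err in \<open>simp add: X_def\<close>)
    have "energy_norm \<epsilon>1 (\<lambda>x. u x - w x) \<le> sqrt (Q * ?I)"
      unfolding Q_def
      by (rule FEM_error_by_approximation[OF eps(1) eps' eps(3) \<rho> coefficients_continuous(1) b_deriv(1,2) coefficients_continuous(2)
        bnds coer' pu h w[unfolded \<Delta>] z e split'])
    also have "\<dots> \<le> sqrt (Q * (X\<^sup>2 * (7 + 3 / \<omega>a)))" using I Q by (intro real_sqrt_le_mono mult_left_mono)
    also have "Q * (X\<^sup>2 * (7 + 3 / \<omega>a)) = X\<^sup>2 * (Q * (7 + 3 / \<omega>a))" by (simp only: mult_ac)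
    also have "sqrt \<dots> = X * sqrt (Q * (7 + 3 / \<omega>a))" using X by (simp only: real_sqrt_mult real_sqrt_abs abs_of_nonneg)
    also have "\<dots> = C1 * exp (- \<sigma> * real p)" by (simp add: X_def C1_def)
    also have "\<dots> \<le> (C1 + C2 + 1) * exp (- \<sigma> * real p)" using C12 by (intro mult_right_mono) auto
    finally show ?thesis .
  qed
  show ?thesis
  proof (intro exI conjI allI impI)
    show "0 < C1 + C2 + 1" using C12 by linarith
    show "0 < \<sigma>" by (rule Ca)
  qed (elim conjE, rule main)
qed

end

theorem theorem11:
  fixes b c f :: "real \<Rightarrow> real"
    and \<gamma>\<^sub>f \<gamma>\<^sub>c \<gamma>\<^sub>b C\<^sub>0 \<beta> \<gamma> \<rho> \<kappa> :: real
  assumes "real_analytic_on b {0..1}" "real_analytic_on c {0..1}" "real_analytic_on f {0..1}"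
    and "\<gamma>\<^sub>f > 0" "\<gamma>\<^sub>c > 0" "\<gamma>\<^sub>b > 0" "C\<^sub>0 > 0"
    and "\<And>n. Linf_norm ((deriv01 ^^ n) f) \<le> ereal (C\<^sub>0 * fact n * \<gamma>\<^sub>f ^ n)"
    and "\<And>n. Linf_norm ((deriv01 ^^ n) c) \<le> ereal (C\<^sub>0 * fact n * \<gamma>\<^sub>c ^ n)"
    and "\<And>n. Linf_norm ((deriv01 ^^ n) b) \<le> ereal (C\<^sub>0 * fact n * \<gamma>\<^sub>b ^ n)"
    and "\<beta> > 0" "\<gamma> > 0" "\<rho> > 0" "\<kappa> > 0"
  shows "\<exists>C>0. \<exists>\<sigma>>0. \<forall>(p::nat) \<epsilon>\<^sub>1 \<epsilon>\<^sub>2 \<Delta> u u\<^sub>F.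
    0 < \<epsilon>\<^sub>1 \<and> \<epsilon>\<^sub>1 < \<epsilon>\<^sub>2 \<and> \<epsilon>\<^sub>2 \<le> 1 \<and>
    (\<forall>x\<in>{0..1}. b x \<ge> \<beta> \<and> c x \<ge> \<gamma> \<and> c x - \<epsilon>\<^sub>2 / 2 * deriv01 b x \<ge> \<rho>) \<and>
    SBL_mesh \<epsilon>\<^sub>1 \<epsilon>\<^sub>2 b c \<kappa> p = Some \<Delta> \<and>
    is_BVP_solution \<epsilon>\<^sub>1 \<epsilon>\<^sub>2 b c f u \<and>
    is_FE_approx \<epsilon>\<^sub>1 \<epsilon>\<^sub>2 b c f \<Delta> p u\<^sub>F
    \<longrightarrow> energy_norm \<epsilon>\<^sub>1 (\<lambda>x. u x - u\<^sub>F x) \<le> C * exp (- \<sigma> * real p)"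
proof (cases "\<forall>x\<in>{0..1}. \<beta> \<le> b x \<and> \<gamma> \<le> c x")
  case True
  obtain B C F \<theta> r \<omega> K U where "holomorphic_coefficients b c f \<beta> \<gamma> B C F \<theta> r \<omega> K U"
    using analytic_coefficients_extend[OF assms(1-3) \<open>\<beta> > 0\<close> \<open>\<gamma> > 0\<close>] True by blast
  then interpret holomorphic_coefficients b c f \<beta> \<gamma> B C F \<theta> r \<omega> K U .
  obtain D \<sigma> where D: "0 < D" "0 < \<sigma>" and bound: "\<forall>p \<epsilon>1 \<epsilon>2 \<Delta> u w. 0 < \<epsilon>1 \<and> \<epsilon>1 < \<epsilon>2 \<and> \<epsilon>2 \<le> 1 \<and>
    (\<forall>x\<in>{0..1}. \<rho> \<le> c x - \<epsilon>2 / 2 * deriv01 b x) \<and> SBL_mesh \<epsilon>1 \<epsilon>2 b c \<kappa> p = Some \<Delta> \<and>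
    is_BVP_solution \<epsilon>1 \<epsilon>2 b c f u \<and> is_FE_approx \<epsilon>1 \<epsilon>2 b c f \<Delta> p w
    \<longrightarrow> energy_norm \<epsilon>1 (\<lambda>x. u x - w x) \<le> D * exp (- \<sigma> * real p)"
    using FEM_error_bound[OF \<open>\<kappa> > 0\<close> \<open>\<rho> > 0\<close>] by (elim exE conjE) (rule that)
  show ?thesis
    by (rule exI[of _ D], rule conjI[OF D(1)], rule exI[of _ \<sigma>], rule conjI[OF D(2)], intro allI impI, elim conjE,
      rule bound[rule_format]) auto
next
  case False
  \<comment> \<open>the condition on the coefficients then fails for every \<open>\<epsilon>\<^sub>2\<close>\<close>
  then show ?thesis by (intro exI[of _ 1] conjI) auto
qed

end
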